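(* Let $K$ be a field and let $f(x)=ax^d+b\in K[x]$ with $a\ne0$, where $d\ge2$ is coprime to $\operatorname{char}K$. Suppose $f$ is post-critically finite, i.e. the strict forward orbit $\{f^i(0):i\ge1\}$ is finite, with $n$ elements. Let $\gamma_1,\dots,\gamma_n,\gamma_\infty$, $\Lambda$ and $c_i:=\rho_\Lambda(\gamma_i)$ be as in the context, so that each $c_i$ is the image of an inertia generator over $f^i(0)$ and $\overline{\mathrm{Arb}}(f)=\langle\!\langle c_1,\dots,c_n\rangle\!\rangle\subseteq[C_d]^\infty$. If $c_1',\dots,c_n'\in[C_d]^\infty$ are elements such that $c_i'$ is conjugate to $c_i$ in $[C_d]^\infty$ for each $i$, then there exist an element $w\in[C_d]^\infty$ and elements $u_1,\dots,u_n\in\overline{\mathrm{Arb}}(f)$ such that $$wc_i'w^{-1}=u_ic_iu_i^{-1}\quad\text{for each } i,$$ and $$w\langle\!\langle c_1',\dots,c_n'\rangle\!\rangle w^{-1}=\overline{\mathrm{Arb}}(f).$$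
   Context: Let $t$ be transcendental over $K$, fix a separable closure $K(t)^{\mathrm{sep}}$, and let $K^{\mathrm{sep}}$ be the separable closure of $K$ in it. $f^{-\ell}(t)$ is the set of the $d^\ell$ roots of $f^\ell(x)=t$ in $K(t)^{\mathrm{sep}}$ ($f^\ell$ the $\ell$-fold composition), $K^{\mathrm{sep}}(f^{-\infty}(t))=\bigcup_\ell K^{\mathrm{sep}}(f^{-\ell}(t))$, and $\Gamma:=\operatorname{Gal}(K^{\mathrm{sep}}(f^{-\infty}(t))/K^{\mathrm{sep}}(t))$. Wreath products: $\sigma=(1\,2\cdots d)\in S_d$, $C_d=\langle\sigma\rangle$, and $[C_d]^\infty=C_d\ltimes([C_d]^\infty)^d$ is the profinite iterated wreath product acting on words in $\{1,\dots,d\}$, with $g(g_1,\dots,g_d)$ acting by $iw'\mapsto g(i)g_i(w')$. The standard odometer is the element $c_\infty\in[C_d]^\infty$ with $c_\infty=\sigma(1,\dots,1,c_\infty)$. $\langle\!\langle\cdots\rangle\!\rangle$ denotes topologically generated closed subgroup. Paths: a preimage labeling is a bijection $i\mapsto t_i$ from $\{1,\dots,d\}$ to $f^{-1}(t)$. A path from $t$ to $t_i$ is a $K^{\mathrm{sep}}$-isomorphism $\lambda_i:K(t)^{\mathrm{sep}}\to K(t_i)^{\mathrm{sep}}$ with $\lambda_i(t)=t_i$; it restricts to an isomorphism $K^{\mathrm{sep}}(f^{-\infty}(t))\to K^{\mathrm{sep}}(f^{-\infty}(t_i))$. A choice of paths $\Lambda$ is a collection of one path $\lambda_i$ from $t$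 to $t_i$ for each $i$. For $\gamma\in\Gamma$ let $\tilde\gamma\in S_d$ be the permutation with $\gamma(t_i)=t_{\tilde\gamma(i)}$, let $\gamma|_i$ be the restriction of $\gamma$ to $K^{\mathrm{sep}}(f^{-\infty}(t_i))$, and $\gamma_{\Lambda,i}=\lambda_{\tilde\gamma(i)}^{-1}\,\gamma|_i\,\lambda_i\in\Gamma$. The injective homomorphism $\rho_\Lambda$ is defined recursively by $\rho_\Lambda(\gamma)=\tilde\gamma(\rho_\Lambda(\gamma_{\Lambda,1}),\dots,\rho_\Lambda(\gamma_{\Lambda,d}))$, and $\overline{\mathrm{Arb}}(f):=\rho_\Lambda(\Gamma)$. Setup: let $\gamma_1,\dots,\gamma_n,\gamma_\infty\in\Gamma$ be such that $\gamma_i$ topologically generates an inertia group over the point $f^i(0)$, $\gamma_\infty$ topologically generates an inertia group over $\infty$, $\Gamma=\langle\!\langle\gamma_1,\dots,\gamma_n\rangle\!\rangle$, and $\gamma_\infty=\gamma_1\cdots\gamma_n$ (such elements exist). Let a preimage labeling and choice of paths $\Lambda$ be chosen so that $\rho_\Lambda(\gamma_\infty)=c_\infty$ (such choices exist; then $\overline{\mathrm{Arb}}(f)\subseteq[C_d]^\infty$). *)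

theory Defs
  imports "HOL-Computational_Algebra.Computational_Algebra" "HOL-Analysis.Function_Topology"
    "HOL-Combinatorics.Cycles" "HOL-Algebra.Sym_Groups"
begin

section \<open>Subfields, adjunction and separable closures\<close>

text \<open>
  A fixed separable closure of \<open>K(t)\<close> is modelled by a type \<open>'l\<close> of class \<open>field\<close>;
  all other fields that occur (\<open>K\<close>, its separable closure, \<open>K(t)\<close>, ...) are subsets of it.
\<close>

definition is_subfield :: "'l::field set \<Rightarrow> bool" where
  "is_subfield F \<longleftrightarrow> 1 \<in> F \<and> (\<forall>x\<in>F. \<forall>y\<in>F. x - y \<in> F \<and> x * y \<in> F) \<and> (\<forall>x\<in>F. inverse x \<in> F)"

definition adjoin :: "'l::field set \<Rightarrow> 'l set \<Rightarrow> 'l set" where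
  "adjoin F S = is_subfield hull (F \<union> S)"

definition poly_over :: "'l::field set \<Rightarrow> 'l poly \<Rightarrow> bool" where
  "poly_over F p \<longleftrightarrow> (\<forall>i. coeff p i \<in> F)"

definition transcendental_over :: "'l::field set \<Rightarrow> 'l \<Rightarrow> bool" where
  "transcendental_over F x \<longleftrightarrow> (\<forall>p. poly_over F p \<and> p \<noteq> 0 \<longrightarrow> poly p x \<noteq> 0)"

definition separable_poly :: "'l::field poly \<Rightarrow> bool" where
  "separable_poly p \<longleftrightarrow> coprime p (pderiv p)"

definition separable_over :: "'l::field set \<Rightarrow> 'l \<Rightarrow> bool" where
  "separable_over F x \<longleftrightarrow> (\<exists>p. poly_over F p \<and> separable_poly p \<and> poly p x = 0)"

definition sep_closure :: "'l::field set \<Rightarrow> 'l set" where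
  "sep_closure F = {x. separable_over F x}"

definition UNIV_is_separable_closure_of :: "'l::field set \<Rightarrow> bool" where
  "UNIV_is_separable_closure_of F \<longleftrightarrow>
     sep_closure F = UNIV \<and>
     (\<forall>p :: 'l poly. degree p > 0 \<and> separable_poly p \<longrightarrow> (\<exists>x. poly p x = 0))"

definition field_iso :: "'l::field set \<Rightarrow> 'l set \<Rightarrow> ('l \<Rightarrow> 'l) \<Rightarrow> bool" where
  "field_iso A B h \<longleftrightarrow>
     bij_betw h A B \<and> (\<forall>x\<in>A. \<forall>y\<in>A. h (x + y) = h x + h y \<and> h (x * y) = h x * h y)"


section \<open>Galois groups and topological generation\<close>

text \<open>
  As usual for permutations in HOL, an automorphism of \<open>M\<close> is a function on the ambient type that
  is the identity outside \<open>M\<close>.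
\<close>

definition gal_group :: "'l::field set \<Rightarrow> 'l set \<Rightarrow> ('l \<Rightarrow> 'l) monoid" where
  "gal_group M F =
     \<lparr>carrier = {g. g permutes M \<and> field_iso M M g \<and> (\<forall>x\<in>F. g x = x)}, mult = (\<circ>), one = id\<rparr>"

text \<open>
  The topology of pointwise convergence for discrete source and target. On a Galois group it
  induces the Krull topology, and on a group of automorphisms of a rooted tree the profinite
  topology whose basic neighbourhoods of the identity are the level stabilisers.
\<close>

definition pointwise_topology :: "('a \<Rightarrow> 'b) topology" where
  "pointwise_topology = product_topology (\<lambda>_. discrete_topology UNIV) UNIV"

definition top_generate :: "('a \<Rightarrow> 'b, 'm) monoid_scheme \<Rightarrow> ('a \<Rightarrow> 'b) set \<Rightarrow> ('a \<Rightarrow> 'b) set" where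
  "top_generate G S = Abstract_Topology.closure_of (subtopology pointwise_topology (carrier G)) (generate G S)"


section \<open>Inertia groups\<close>

text \<open>
  The places of an algebraic extension \<open>M\<close> of \<open>k(t)\<close> over a point of the projective line are given
  by the valuation rings of \<open>M\<close> lying over the local ring of that point.
\<close>

definition valuation_ring_of :: "'l::field set \<Rightarrow> 'l set \<Rightarrow> bool" where
  "valuation_ring_of M V \<longleftrightarrow>
     V \<subseteq> M \<and> 1 \<in> V \<and> (\<forall>x\<in>V. \<forall>y\<in>V. x - y \<in> V \<and> x * y \<in> V) \<and>
     (\<forall>x\<in>M. x \<in> V \<or> inverse x \<in> V)"

definition valuation_ideal :: "'l::field set \<Rightarrow> 'l set" where
  "valuation_ideal V = {x\<in>V. x = 0 \<or> inverse x \<notin> V}"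

definition inertia_group :: "'l::field set \<Rightarrow> 'l set \<Rightarrow> 'l set \<Rightarrow> ('l \<Rightarrow> 'l) set" where
  "inertia_group M F V =
     {g \<in> carrier (gal_group M F). g ` V = V \<and> (\<forall>x\<in>V. g x - x \<in> valuation_ideal V)}"

definition is_inertia_group_over ::
    "'l::field set \<Rightarrow> 'l set \<Rightarrow> 'l set \<Rightarrow> ('l \<Rightarrow> 'l) set \<Rightarrow> bool" where
  "is_inertia_group_over M F R I \<longleftrightarrow>
     (\<exists>V. valuation_ring_of M V \<and> V \<inter> F = R \<and> I = inertia_group M F V)"

text \<open>The local rings of the projective line over \<open>k\<close> with coordinate \<open>t\<close> at \<open>P \<in> k\<close> and at infinity.\<close>

definition local_ring_at :: "'l::field set \<Rightarrow> 'l \<Rightarrow> 'l \<Rightarrow> 'l set" where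
  "local_ring_at k t P =
     {poly p t / poly q t | p q. poly_over k p \<and> poly_over k q \<and> poly q P \<noteq> 0}"

definition local_ring_at_infinity :: "'l::field set \<Rightarrow> 'l \<Rightarrow> 'l set" where
  "local_ring_at_infinity k t =
     {poly p t / poly q t | p q. poly_over k p \<and> poly_over k q \<and> q \<noteq> 0 \<and> degree p \<le> degree q}"


section \<open>The iterated wreath product\<close>

text \<open>
  Elements of the automorphism group of the tree of words over \<open>{1..d}\<close> are permutations of
  \<open>lists {1..d}\<close>, again extended by the identity to all lists. \<open>node d s gs\<close> is the element
  \<open>s(gs 1, \<dots>, gs d)\<close>.
\<close>

fun node :: "nat \<Rightarrow> (nat \<Rightarrow> nat) \<Rightarrow> (nat \<Rightarrow> nat list \<Rightarrow> nat list) \<Rightarrow> nat list \<Rightarrow> nat list" where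
  "node d s gs [] = []"
| "node d s gs (i # w) = (if i # w \<in> lists {1..d} then s i # gs i w else i # w)"

definition std_cycle :: "nat \<Rightarrow> nat \<Rightarrow> nat" where
  "std_cycle d = cycle_of_list [1..<Suc d]"

lemma std_cycle_eq:
  assumes "i \<in> {1..d}"
  shows "std_cycle d i = (if i = d then 1 else Suc i)"
proof -
  have gen: "cycle_of_list [m..<m + Suc k] i = (if i = m + k then m else Suc i)"
    if "i \<in> {m..m + k}" for m k i :: nat
    using that
  proof (induction k arbitrary: m i)
    case 0
    then show ?case by simp
  next
    case (Suc k)
    have e: "[m..<m + Suc (Suc k)] = m # Suc m # [Suc (Suc m)..<Suc m + Suc k]"
      by (simp add: upt_rec)
    have e': "Suc m # [Suc (Suc m)..<Suc m + Suc k] = [Suc m..<Suc m + Suc k]"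
      by (simp add: upt_rec)
    have *: "cycle_of_list [m..<m + Suc (Suc k)] i
        = transpose m (Suc m) (cycle_of_list [Suc m..<Suc m + Suc k] i)"
      unfolding e unfolding cycle_of_list.simps(1) unfolding e' comp_apply by (rule refl)
    show ?case
    proof (cases "i = m")
      case True
      then have "cycle_of_list [Suc m..<Suc m + Suc k] i = i"
        by (intro id_outside_supp) auto
      then show ?thesis using * True by simp
    next
      case False
      then have "i \<in> {Suc m..Suc m + k}" using Suc.prems by auto
      from Suc.IH[OF this] * show ?thesis
        using \<open>i \<in> {Suc m..Suc m + k}\<close> by (auto simp: transpose_def)
    qed
  qed
  have "Suc d = 1 + Suc (d - 1)"
    using assms by auto
  then show ?thesis
    using gen[of i 1 "d - 1"] assms by (simp add: std_cycle_def del: upt_Suc)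
qed

definition cyclic_perms :: "nat \<Rightarrow> (nat \<Rightarrow> nat) set" where
  "cyclic_perms d = generate (sym_group d) {std_cycle d}"

coinductive_set wreath_perms :: "nat \<Rightarrow> (nat list \<Rightarrow> nat list) set" for d :: nat where
  node: "\<lbrakk>s \<in> cyclic_perms d; \<forall>i\<in>{1..d}. gs i \<in> wreath_perms d\<rbrakk> \<Longrightarrow> node d s gs \<in> wreath_perms d"

definition iter_wreath :: "nat \<Rightarrow> (nat list \<Rightarrow> nat list) monoid" where
  "iter_wreath d = \<lparr>carrier = wreath_perms d, mult = (\<circ>), one = id\<rparr>"

primrec odometer :: "nat \<Rightarrow> nat list \<Rightarrow> nat list" where
  "odometer d [] = []"
| "odometer d (i # w) =
     (if i # w \<in> lists {1..d} then std_cycle d i # (if i = d then odometer d w else w) else i # w)"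

lemma odometer_eq_node:
  "odometer d = node d (std_cycle d) (\<lambda>i. if i = d then odometer d else id)"
proof
  show "odometer d w = node d (std_cycle d) (\<lambda>i. if i = d then odometer d else id) w" for w
    by (cases w) auto
qed


section \<open>Iterated preimages and the arboreal representation\<close>

definition preimage_field :: "'l::field set \<Rightarrow> 'l poly \<Rightarrow> 'l \<Rightarrow> 'l set" where
  "preimage_field K f t = (\<Union>l. adjoin (sep_closure K) {x. (poly f ^^ l) x = t})"

definition geom_group :: "'l::field set \<Rightarrow> 'l poly \<Rightarrow> 'l \<Rightarrow> ('l \<Rightarrow> 'l) monoid" where
  "geom_group K f t = gal_group (preimage_field K f t) (adjoin (sep_closure K) {t})"

definition is_inertia_over_point ::
    "'l::field set \<Rightarrow> 'l poly \<Rightarrow> 'l \<Rightarrow> 'l \<Rightarrow> ('l \<Rightarrow> 'l) set \<Rightarrow> bool" where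
  "is_inertia_over_point K f t P I \<longleftrightarrow>
     is_inertia_group_over (preimage_field K f t) (adjoin (sep_closure K) {t})
       (local_ring_at (sep_closure K) t P) I"

definition is_inertia_over_infinity ::
    "'l::field set \<Rightarrow> 'l poly \<Rightarrow> 'l \<Rightarrow> ('l \<Rightarrow> 'l) set \<Rightarrow> bool" where
  "is_inertia_over_infinity K f t I \<longleftrightarrow>
     is_inertia_group_over (preimage_field K f t) (adjoin (sep_closure K) {t})
       (local_ring_at_infinity (sep_closure K) t) I"

definition preimage_labeling :: "nat \<Rightarrow> 'l::field poly \<Rightarrow> 'l \<Rightarrow> (nat \<Rightarrow> 'l) \<Rightarrow> bool" where
  "preimage_labeling d f t tt \<longleftrightarrow> bij_betw tt {1..d} {x. poly f x = t}"

definition is_path :: "'l::field set \<Rightarrow> 'l \<Rightarrow> 'l \<Rightarrow> ('l \<Rightarrow> 'l) \<Rightarrow> bool" where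
  "is_path K t s l \<longleftrightarrow>
     field_iso (sep_closure (adjoin K {t})) (sep_closure (adjoin K {s})) l \<and>
     (\<forall>x\<in>sep_closure K. l x = x) \<and> l t = s"

definition choice_of_paths ::
    "nat \<Rightarrow> 'l::field set \<Rightarrow> 'l \<Rightarrow> (nat \<Rightarrow> 'l) \<Rightarrow> (nat \<Rightarrow> 'l \<Rightarrow> 'l) \<Rightarrow> bool" where
  "choice_of_paths d K t tt L \<longleftrightarrow> (\<forall>i\<in>{1..d}. is_path K t (tt i) (L i))"

text \<open>
  \<open>root_perm d tt g i\<close> is the label \<open>j\<close> with \<open>g (tt i) = tt j\<close>, and \<open>section_at\<close> is the map
  \<open>L\<^sub>j\<inverse> \<circ> g \<circ> L\<^sub>i\<close> on the preimage field \<open>M\<close>. Since each path is bijective onto its codomain, which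
  contains the argument, \<open>inv_into (sep_closure (adjoin K {t}))\<close> is its inverse.
\<close>

definition root_perm :: "nat \<Rightarrow> (nat \<Rightarrow> 'l) \<Rightarrow> ('l \<Rightarrow> 'l) \<Rightarrow> nat \<Rightarrow> nat" where
  "root_perm d tt g i = (THE j. j \<in> {1..d} \<and> g (tt i) = tt j)"

definition section_at ::
    "nat \<Rightarrow> 'l::field set \<Rightarrow> 'l poly \<Rightarrow> 'l \<Rightarrow> (nat \<Rightarrow> 'l) \<Rightarrow> (nat \<Rightarrow> 'l \<Rightarrow> 'l) \<Rightarrow> ('l \<Rightarrow> 'l) \<Rightarrow> nat \<Rightarrow> 'l \<Rightarrow> 'l"
where
  "section_at d K f t tt L g i =
     (\<lambda>x. if x \<in> preimage_field K f t
          then inv_into (sep_closure (adjoin K {t})) (L (root_perm d tt g i)) (g (L i x))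
          else x)"

primrec arboreal_rep ::
    "nat \<Rightarrow> 'l::field set \<Rightarrow> 'l poly \<Rightarrow> 'l \<Rightarrow> (nat \<Rightarrow> 'l) \<Rightarrow> (nat \<Rightarrow> 'l \<Rightarrow> 'l) \<Rightarrow> ('l \<Rightarrow> 'l)
      \<Rightarrow> nat list \<Rightarrow> nat list"
where
  "arboreal_rep d K f t tt L g [] = []"
| "arboreal_rep d K f t tt L g (i # w) =
     (if i # w \<in> lists {1..d}
      then root_perm d tt g i # arboreal_rep d K f t tt L (section_at d K f t tt L g i) w
      else i # w)"

lemma arboreal_rep_eq_node:
  "arboreal_rep d K f t tt L g =
     node d (root_perm d tt g) (\<lambda>i. arboreal_rep d K f t tt L (section_at d K f t tt L g i))"
proof
  show "arboreal_rep d K f t tt L g w =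
     node d (root_perm d tt g) (\<lambda>i. arboreal_rep d K f t tt L (section_at d K f t tt L g i)) w" for w
    by (cases w) auto
qed

definition arb_image ::
    "nat \<Rightarrow> 'l::field set \<Rightarrow> 'l poly \<Rightarrow> 'l \<Rightarrow> (nat \<Rightarrow> 'l) \<Rightarrow> (nat \<Rightarrow> 'l \<Rightarrow> 'l) \<Rightarrow> (nat list \<Rightarrow> nat list) set"
where
  "arb_image d K f t tt L = arboreal_rep d K f t tt L ` carrier (geom_group K f t)"

end

theory Submission
  imports Defs
begin

text \<open>
  The product \<open>Y\<close> over the nodes \<open>w\<close> of level \<open>i - 1\<close> of one chosen preimage of each \<open>w\<close> satisfies
  \<open>Y\<^sup>d = const * (t - f\<^sup>i(0))\<close>. Since \<open>\<gamma>_inf\<close> acts as the odometer it multiplies \<open>Y\<close> by a fixed primitive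
  \<open>d\<close>-th root of unity \<open>\<xi>\<close>; as \<open>\<gamma>_inf\<close> is the product of the \<open>\<gamma>\<^sub>j\<close> and only \<open>\<gamma>\<^sub>i\<close> ramifies there, so does
  \<open>\<gamma>\<^sub>i\<close>. Hence each \<open>\<gamma>\<^sub>i\<close> is a tame inertia generator normalised by \<open>\<xi>\<close>. The class of such elements is
  stable under the wreath recursion: over \<open>f(0)\<close> the root permutation is \<open>\<sigma>\<close> and the product of the
  sections lies over \<open>0\<close>, and over the other points the root permutation is trivial and the non-trivial
  sections lie over the post-critical preimages. Therefore \<open>c\<^sub>i\<close> is conjugate at every level to the
  generator \<open>a\<^sub>i\<close> of a finite automaton, with \<open>a\<^sub>1 = \<sigma>(1, \<dots>, 1, a\<^sub>n)\<close>, \<open>a\<^sub>i = (1, \<dots>, 1, a\<^sub>i\<^sub>-\<^sub>1)\<close> if the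
  orbit is periodic, and with \<open>a\<^sub>1 = \<sigma>\<close> and one \<open>a\<^sub>m\<^sub>+\<^sub>1\<close> carrying both \<open>a\<^sub>m\<close> and \<open>a\<^sub>n\<close>, at distance \<open>r\<close>, if
  \<open>f\<^sup>n(0) = \<xi>\<^sup>r f\<^sup>m(0)\<close>.

  For the automaton two facts are proved by induction on the level: up to a common conjugation, any
  tuple of conjugates of the \<open>a\<^sub>i\<close> consists of conjugates by elements of the generated group, and any
  such tuple of inner conjugates generates the whole group. In the preperiodic case this takes place
  modulo the sections of the subgroup that the tuple generates, where the commutator \<open>z\<close> of \<open>a\<^sub>m\<close> and
  \<open>a\<^sub>n\<close> controls all the obstructions. Both facts transfer to the \<open>c\<^sub>i\<close> level by level, and a
  compactness argument yields the conjugators on the whole tree.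
\<close>


section \<open>Subgroups of additively written groups\<close>

text \<open>The obstacle in the preperiodic case is the branch generator: its two non-trivial
  sections are conjugated by sections of one and the same element, so conjugators for
  \<open>a m\<close> and \<open>a n\<close> cannot be chosen independently. Let \<open>B\<close>
  consist of the sections that a given subgroup realises at a single vertex. Modulo \<open>B\<close>
  only \<open>a m\<close> and \<open>a n\<close> survive. If \<open>2 * r\<close> differs from
  \<open>d\<close>, or if \<open>m > 1\<close> and \<open>d > 2\<close>, they commute modulo
  \<open>B\<close>, because suitable conjugates have almost disjoint supports. Otherwise the half
  turn exchanges the two branch positions, and conjugation by \<open>a m\<close> and
  \<open>a n\<close> acts on \<open>z\<close> through one sign \<open>e\<close> modulo
  \<open>B\<close>. Displacements by powers of \<open>z\<close> are then undone by the commutator of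
  the branch pair with its swap. This requires the exponent \<open>1 + 2 * j * (1 - e)\<close> to be
  invertible: for \<open>e = 1\<close> it is 1, and \<open>e = - 1\<close> forces
  \<open>d = 2\<close>, where it is odd while the order of \<open>z\<close> at each level is a power
  of 2. On the arithmetic side the factor \<xi> is tracked together with inertia, since it decides
  which power of the rotation the class over f(0) induces on the first level.\<close>

definition add_subgroup :: "'g::group_add set \<Rightarrow> bool" where
  "add_subgroup Y \<longleftrightarrow> 0 \<in> Y \<and> (\<forall>x\<in>Y. \<forall>y\<in>Y. x + y \<in> Y) \<and> (\<forall>x\<in>Y. - x \<in> Y)"

lemma add_subgroupI:
  "0 \<in> Y \<Longrightarrow> (\<And>x y. x \<in> Y \<Longrightarrow> y \<in> Y \<Longrightarrow> x + y \<in> Y) \<Longrightarrow> (\<And>x. x \<in> Y \<Longrightarrow> - x \<in> Y) \<Longrightarrow> add_subgroup Y"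
  by (auto simp: add_subgroup_def)

lemma add_subgroupD:
  assumes "add_subgroup Y"
  shows add_subgroup_zero: "0 \<in> Y"
    and add_subgroup_add: "x \<in> Y \<Longrightarrow> y \<in> Y \<Longrightarrow> x + y \<in> Y"
    and add_subgroup_minus: "x \<in> Y \<Longrightarrow> - x \<in> Y"
    and add_subgroup_diff: "x \<in> Y \<Longrightarrow> y \<in> Y \<Longrightarrow> x - y \<in> Y"
  using assms by (auto simp: add_subgroup_def diff_conv_add_uminus simp del: add_uminus_conv_diff)

lemmas grp = diff_conv_add_uminus add.assoc minus_add

lemma add_subgroup_hull: "add_subgroup (add_subgroup hull S)"
  by (rule hull_in) (fastforce simp: add_subgroup_def)

definition zmul :: "int \<Rightarrow> 'g::group_add \<Rightarrow> 'g" where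
  "zmul k x = (if 0 \<le> k then ((+) x ^^ nat k) 0 else - ((+) x ^^ nat (- k)) 0)"

lemma zmul_0 [simp]: "zmul 0 x = 0" by (simp add: zmul_def)
lemma zmul_1 [simp]: "zmul 1 x = x" by (simp add: zmul_def)
lemma zmul_minus_one [simp]: "zmul (- 1) x = - x" by (simp add: zmul_def)

lemma zmul_plus1: "zmul (k + 1) x = x + zmul k x"
proof (cases "0 \<le> k")
  case True
  then have "nat (k + 1) = Suc (nat k)" by simp
  then show ?thesis using True by (simp add: zmul_def)
next
  case False
  define j where "j = nat (- (k + 1))"
  \<comment> \<open>An element commutes with its own multiples; this is needed because negation
    reverses the order of a sum.\<close>
  have pw: "x + ((+) x ^^ j) 0 = ((+) x ^^ j) 0 + x" for j
    by (induction j) (simp, metis add.assoc funpow.simps(2) comp_apply)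
  have "nat (- k) = Suc j" using False by (auto simp: j_def)
  then have k: "zmul k x = - (x + ((+) x ^^ j) 0)" using False by (simp add: zmul_def)
  have k1: "zmul (k + 1) x = - ((+) x ^^ j) 0"
    using False by (cases "k = -1") (auto simp: zmul_def j_def)
  show ?thesis unfolding k k1 pw by (simp add: grp del: add_uminus_conv_diff)
qed

lemma zmul_minus1: "zmul (k - 1) x = - x + zmul k x"
  using zmul_plus1[of "k - 1" x] by (simp add: add.assoc[symmetric])

lemma zmul_add: "zmul (i + j) x = zmul i x + zmul j x"
proof (induction i rule: int_induct[where k = 0])
  case (step1 i)
  then show ?case using zmul_plus1[of "i + j" x] zmul_plus1[of i x] by (simp add: algebra_simps)
next
  case (step2 i)
  then show ?case using zmul_minus1[of "i + j" x] zmul_minus1[of i x] by (simp add: algebra_simps)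
qed simp

lemma zmul_uminus: "zmul (- i) x = - zmul i x"
  using zmul_add[of "-i" i x] by (simp add: eq_neg_iff_add_eq_0)

lemma zmul_hom:
  assumes "\<And>x y. F (x + y) = F x + F y"
  shows "zmul k (F x) = F (zmul k x)"
proof -
  have F0: "F 0 = 0" using assms[of 0 0] by (metis add_0_right add_left_cancel)
  have Fm: "F (- y) = - F y" for y using assms[of "-y" y] F0 by (simp add: eq_neg_iff_add_eq_0)
  show ?thesis
    by (induction k rule: int_induct[where k = 0]) (simp_all add: F0 assms Fm zmul_plus1 zmul_minus1)
qed

lemma zmul_conj: "zmul k (g + x - g) = g + zmul k x - g"
  by (rule zmul_hom[of "\<lambda>x. g + x - g"]) (simp add: grp del: add_uminus_conv_diff)

lemma zmul_zmul: "zmul i (zmul j x) = zmul (i * j) x"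
proof (induction i rule: int_induct[where k = 0])
  case (step1 i)
  have "(i + 1) * j = j + i * j" by (simp add: distrib_right)
  then show ?case using zmul_add[of j "i * j" x] step1 unfolding zmul_plus1 by simp
next
  case (step2 i)
  then show ?case using zmul_add[of "- j" "i * j" x] by (simp add: zmul_minus1 left_diff_distrib zmul_uminus)
qed simp

lemma zmul_neg: "zmul i (- x) = - zmul i x"
  using zmul_zmul[of i "-1" x] by (simp add: zmul_uminus)

lemma add_subgroup_zmul: "add_subgroup Y \<Longrightarrow> x \<in> Y \<Longrightarrow> zmul k x \<in> Y"
  by (induction k rule: int_induct[where k = 0])
    (auto simp: zmul_plus1 zmul_minus1 dest: add_subgroupD simp del: add_uminus_conv_diff)

text \<open>Writing [f, h] for f + h - f - h, one has [f, h + k] = [f, h] + (h + [f, k] - h), and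
  conjugation by \<open>h\<close> preserves \<open>T\<close>. This reduces statements about
  centrality modulo \<open>T\<close> to generators.\<close>

lemma add_subgroup_comm_set:
  assumes T: "add_subgroup T" and G: "add_subgroup G" and nrm: "\<And>g b. g \<in> G \<Longrightarrow> b \<in> T \<Longrightarrow> g + b - g \<in> T"
  shows "add_subgroup {h \<in> G. f + h - f - h \<in> T}"
proof (rule add_subgroupI)
  fix h k assume h: "h \<in> {h \<in> G. f + h - f - h \<in> T}" and k: "k \<in> {h \<in> G. f + h - f - h \<in> T}"
  have "(f + h - f - h) + (h + (f + k - f - k) - h) \<in> T"
    using h k nrm[of h "f + k - f - k"] add_subgroup_add[OF T] by blast
  also have "(f + h - f - h) + (h + (f + k - f - k) - h) = f + (h + k) - f - (h + k)"
    by (simp add: grp del: add_uminus_conv_diff)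
  finally show "h + k \<in> {h \<in> G. f + h - f - h \<in> T}" using h k add_subgroup_add[OF G] by blast
next
  fix h assume h: "h \<in> {h \<in> G. f + h - f - h \<in> T}"
  have "- h + - (f + h - f - h) - (- h) \<in> T"
    using h nrm[of "- h" "- (f + h - f - h)"] add_subgroup_minus[OF T] add_subgroup_minus[OF G] by blast
  also have "- h + - (f + h - f - h) - (- h) = f + (- h) - f - (- h)"
    by (simp add: grp del: add_uminus_conv_diff)
  finally show "- h \<in> {h \<in> G. f + h - f - h \<in> T}" using h add_subgroup_minus[OF G] by blast
qed (simp_all add: add_subgroup_zero[OF T] add_subgroup_zero[OF G])

text \<open>Membership of both sides in \<open>G\<close> is built in, so that chains of congruences
  carry along the side conditions under which \<open>N\<close> is normalised.\<close>

definition cong_mod :: "'g::group_add set \<Rightarrow> 'g set \<Rightarrow> 'g \<Rightarrow> 'g \<Rightarrow> bool" where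
  "cong_mod G N x y \<longleftrightarrow> x \<in> G \<and> y \<in> G \<and> x - y \<in> N"

lemma cong_mod_mem: "cong_mod G N x y \<Longrightarrow> add_subgroup Y \<Longrightarrow> N \<subseteq> Y \<Longrightarrow> y \<in> Y \<Longrightarrow> x \<in> Y"
  using add_subgroup_add[of Y "x - y" y] by (auto simp: cong_mod_def)

locale add_normal =
  fixes G N :: "'g::group_add set"
  assumes G: "add_subgroup G" and N: "add_subgroup N" and N_G: "N \<subseteq> G"
    and normal: "g \<in> G \<Longrightarrow> x \<in> N \<Longrightarrow> g + x - g \<in> N"
begin

lemma cong_refl: "x \<in> G \<Longrightarrow> cong_mod G N x x" by (simp add: cong_mod_def add_subgroup_zero[OF N])

lemma cong_sym: "cong_mod G N x y \<Longrightarrow> cong_mod G N y x"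
  using add_subgroup_minus[OF N, of "x - y"] by (auto simp: cong_mod_def)

lemma cong_trans [trans]: assumes "cong_mod G N x y" "cong_mod G N y z" shows "cong_mod G N x z"
proof -
  have "(x - y) + (y - z) \<in> N" using assms add_subgroup_add[OF N] by (simp add: cong_mod_def)
  also have "(x - y) + (y - z) = x - z" by (simp add: grp del: add_uminus_conv_diff)
  finally show ?thesis using assms by (simp add: cong_mod_def)
qed

lemma cong_add: assumes "cong_mod G N x y" "cong_mod G N x' y'" shows "cong_mod G N (x + x') (y + y')"
proof -
  have "(x + (x' - y') - x) + (x - y) \<in> N" using assms normal add_subgroup_add[OF N] by (simp add: cong_mod_def)
  also have "(x + (x' - y') - x) + (x - y) = (x + x') - (y + y')" by (simp add: grp del: add_uminus_conv_diff)
  finally show ?thesis using assms add_subgroup_add[OF G] by (simp add: cong_mod_def)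
qed

lemma cong_minus: assumes "cong_mod G N x y" shows "cong_mod G N (- x) (- y)"
proof -
  have "- x + - (x - y) - (- x) \<in> N"
    using assms normal add_subgroup_minus[OF N] add_subgroup_minus[OF G] by (meson cong_mod_def)
  also have "- x + - (x - y) - (- x) = - x - (- y)" by (simp add: grp del: add_uminus_conv_diff)
  finally show ?thesis using assms add_subgroup_minus[OF G] by (simp add: cong_mod_def)
qed

lemma cong_diff: "cong_mod G N x y \<Longrightarrow> cong_mod G N x' y' \<Longrightarrow> cong_mod G N (x - x') (y - y')"
  using cong_add[of x y "- x'" "- y'"] cong_minus by simp

lemma cong_conj: "cong_mod G N x y \<Longrightarrow> cong_mod G N x' y' \<Longrightarrow> cong_mod G N (x + x' - x) (y + y' - y)"
  by (intro cong_diff cong_add)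

lemma cong_zmul: "cong_mod G N x y \<Longrightarrow> cong_mod G N (zmul k x) (zmul k y)"
  by (induction k rule: int_induct[where k = 0])
    (auto simp: zmul_plus1 zmul_minus1 add_subgroup_zero[OF G]
      intro!: cong_add cong_minus cong_refl simp del: add_uminus_conv_diff)

lemma cong_iff_mem: "x \<in> G \<Longrightarrow> cong_mod G N x 0 \<longleftrightarrow> x \<in> N"
  by (simp add: cong_mod_def add_subgroup_zero[OF G])

end

section \<open>Groups with a wreath recursion\<close>

text \<open>
  The non-commutative groups are written additively, which makes the class \<open>group_add\<close> available. Here
  \<open>W\<close> stands for the iterated wreath product, \<open>rot k\<close> for \<open>\<sigma>\<^sup>k\<close>, \<open>tup h\<close> for the element acting by
  \<open>h i\<close> below the \<open>i\<close>-th vertex, with the vertices indexed by residues modulo \<open>d\<close>, and \<open>K l\<close> for the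
  stabiliser of level \<open>l\<close>.
\<close>

locale wreath_tower =
  fixes d :: nat and W :: "'g::group_add set" and rot :: "int \<Rightarrow> 'g" and tup :: "(int \<Rightarrow> 'g) \<Rightarrow> 'g"
    and K :: "nat \<Rightarrow> 'g set"
  assumes d2: "d \<ge> 2"
    and W: "add_subgroup W"
    and rot_W: "rot k \<in> W" and rot_add: "rot (i + j) = rot i + rot j" and rot_d: "rot (int d) = 0"
    and tup_cong: "(\<And>i. 0 \<le> i \<Longrightarrow> i < int d \<Longrightarrow> h i = h' i) \<Longrightarrow> tup h = tup h'"
    and tup_add: "tup (\<lambda>i. h i + h' i) = tup h + tup h'"
    and tup_W: "(\<And>i. h i \<in> W) \<Longrightarrow> tup h \<in> W"
    and rot_tup: "rot k + tup h - rot k = tup (\<lambda>i. h ((i - k) mod int d))"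
    and W_cases: "g \<in> W \<Longrightarrow> \<exists>k h. (\<forall>i. h i \<in> W) \<and> g = rot k + tup h"
    and K0: "K 0 = W" and K_subgroup: "add_subgroup (K l)" and K_W: "K l \<subseteq> W"
    and K_normal: "g \<in> W \<Longrightarrow> x \<in> K l \<Longrightarrow> g + x - g \<in> K l"
    and K_tup: "(\<And>i. h i \<in> K l) \<Longrightarrow> tup h \<in> K (Suc l)"
begin

lemmas W_zero = add_subgroup_zero[OF W]
lemmas W_add = add_subgroup_add[OF W]
lemmas W_minus = add_subgroup_minus[OF W]
lemmas W_diff = add_subgroup_diff[OF W]
lemmas K_zero = add_subgroup_zero[OF K_subgroup]
lemmas K_add = add_subgroup_add[OF K_subgroup]

lemma d_pos: "0 < int d" using d2 by simp

lemma rot_0 [simp]: "rot 0 = 0" using rot_add[of 0 0] by (metis add_0_right add_left_cancel)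
lemma rot_minus: "rot (- k) = - rot k" using rot_add[of "-k" k] by (simp add: eq_neg_iff_add_eq_0)

lemma rot_zmul: "rot k = zmul k (rot 1)"
proof (induction k rule: int_induct[where k = 0])
  case (step1 k)
  then show ?case using rot_add[of 1 k] unfolding zmul_plus1 by (simp add: add.commute)
next
  case (step2 k)
  then show ?case using rot_add[of "-1" k] by (simp add: zmul_minus1 rot_minus)
qed simp

lemma rot_mult_d: "rot (j * int d) = 0"
proof -
  have "zmul (j * int d) (rot 1) = zmul j (rot (int d))"
    by (simp add: rot_zmul[of "int d"] zmul_zmul)
  also have "\<dots> = 0" by (simp add: rot_d, induction j rule: int_induct[where k = 0]) (auto simp: zmul_plus1 zmul_minus1)
  finally show ?thesis by (simp add: rot_zmul[of "j * int d"])
qed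

lemma tup_0 [simp]: "tup (\<lambda>_. 0) = 0" using tup_add[of "\<lambda>_. 0" "\<lambda>_. 0"] by (metis add_0_right add_left_cancel)

lemma tup_minus: "tup (\<lambda>i. - h i) = - tup h"
  using tup_add[of "\<lambda>i. - h i" h] by (simp add: eq_neg_iff_add_eq_0)

lemma tup_diff: "tup (\<lambda>i. h i - h' i) = tup h - tup h'"
  using tup_add[of h "\<lambda>i. - h' i"] by (simp add: tup_minus)

lemma tup_conj: "tup h + tup h' - tup h = tup (\<lambda>i. h i + h' i - h i)"
  by (simp add: tup_diff tup_add)

lemma tup_zmul: "tup (\<lambda>i. zmul k (h i)) = zmul k (tup h)"
  by (induction k rule: int_induct[where k = 0])
    (simp_all add: zmul_plus1 zmul_minus1 tup_add tup_minus del: add_uminus_conv_diff)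

lemma tup_rot: "tup h + rot k = rot k + tup (\<lambda>i. h ((i + k) mod int d))"
proof -
  have "rot (- k) + tup h - rot (- k) = tup (\<lambda>i. h ((i + k) mod int d))"
    by (simp only: rot_tup) simp
  then have "rot k + (rot (- k) + tup h - rot (- k)) = rot k + tup (\<lambda>i. h ((i + k) mod int d))" by simp
  then show ?thesis by (simp add: rot_minus grp del: add_uminus_conv_diff)
qed

text \<open>Serves to prove self-similarity: if the sections of some generators lie in
  \<open>S\<close>, then so do those of everything they generate.\<close>

lemma wr_subgroup:
  assumes S: "add_subgroup S"
  shows "add_subgroup {rot k + tup h | k h. \<forall>i. h i \<in> S}"
proof (rule add_subgroupI)
  have "0 = rot 0 + tup (\<lambda>_. 0)" by simp
  then show "0 \<in> {rot k + tup h |k h. \<forall>i. h i \<in> S}" using add_subgroup_zero[OF S] by blast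
next
  fix x y assume "x \<in> {rot k + tup h |k h. \<forall>i. h i \<in> S}" "y \<in> {rot k + tup h |k h. \<forall>i. h i \<in> S}"
  then obtain k h k' h' where x: "x = rot k + tup h" "\<forall>i. h i \<in> S" and y: "y = rot k' + tup h'" "\<forall>i. h' i \<in> S" by blast
  have "x + y = rot k + (tup h + rot k') + tup h'" by (simp add: x y add.assoc)
  also have "\<dots> = rot (k + k') + tup (\<lambda>i. h ((i + k') mod int d) + h' i)"
    by (simp add: tup_rot rot_add tup_add add.assoc)
  finally show "x + y \<in> {rot k + tup h |k h. \<forall>i. h i \<in> S}" using x y add_subgroup_add[OF S] by blast
next
  fix x assume "x \<in> {rot k + tup h |k h. \<forall>i. h i \<in> S}"
  then obtain k h where x: "x = rot k + tup h" "\<forall>i. h i \<in> S" by blast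
  have "- x = tup (\<lambda>i. - h i) + rot (- k)" by (simp add: x minus_add tup_minus rot_minus)
  also have "\<dots> = rot (- k) + tup (\<lambda>i. - h ((i - k) mod int d))" by (simp add: tup_rot)
  finally show "- x \<in> {rot k + tup h |k h. \<forall>i. h i \<in> S}" using x add_subgroup_minus[OF S] by blast
qed

definition pos :: "int \<Rightarrow> 'g \<Rightarrow> int \<Rightarrow> 'g" where
  "pos j g i = (if i = j mod int d then g else 0)"

definition emb :: "int \<Rightarrow> 'g \<Rightarrow> 'g" where
  "emb j g = tup (pos j g)"

lemma emb_add: "emb j (g + h) = emb j g + emb j h"
  unfolding emb_def by (subst tup_add[symmetric]) (rule tup_cong, simp add: pos_def)

lemma emb_0 [simp]: "emb j 0 = 0" using emb_add[of j 0 0] by (metis add_0_right add_left_cancel)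

lemma emb_minus: "emb j (- g) = - emb j g"
  using emb_add[of j "-g" g] by (simp add: eq_neg_iff_add_eq_0)

lemma rot_emb: "rot k + emb j g - rot k = emb (j + k) g"
  unfolding emb_def rot_tup
proof (rule tup_cong)
  fix i assume i: "0 \<le> i" "i < int d"
  have "(i - k) mod int d = j mod int d \<longleftrightarrow> i = (j + k) mod int d"
  proof
    assume "(i - k) mod int d = j mod int d"
    then have "(i - k + k) mod int d = (j + k) mod int d" by (metis mod_add_left_eq)
    then show "i = (j + k) mod int d" using i by simp
  next
    assume "i = (j + k) mod int d"
    then have "(i - k) mod int d = (j + k - k) mod int d" by (metis mod_diff_left_eq)
    then show "(i - k) mod int d = j mod int d" by simp
  qed
  then show "pos j g ((i - k) mod int d) = pos (j + k) g i" by (simp add: pos_def)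
qed

lemma emb_W: "g \<in> W \<Longrightarrow> emb j g \<in> W"
  unfolding emb_def by (rule tup_W) (simp add: pos_def W_zero)

lemma emb_K: "g \<in> K l \<Longrightarrow> emb j g \<in> K (Suc l)"
  unfolding emb_def by (rule K_tup) (simp add: pos_def K_zero)

lemma tup_emb_conj: "tup h + emb j g - tup h = emb j (h (j mod int d) + g - h (j mod int d))"
  unfolding emb_def tup_conj by (rule tup_cong) (simp add: pos_def)

abbreviation eqm :: "nat \<Rightarrow> 'g \<Rightarrow> 'g \<Rightarrow> bool" where
  "eqm l \<equiv> cong_mod W (K l)"

lemma W_K_normal: "add_normal W (K l)"
  using W K_subgroup K_W K_normal by unfold_locales auto

lemmas eqm_def = cong_mod_def[of W "K l" for l]
lemmas eqm_refl = add_normal.cong_refl[OF W_K_normal]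
lemmas eqm_sym = add_normal.cong_sym[OF W_K_normal]
lemmas eqm_trans [trans] = add_normal.cong_trans[OF W_K_normal]
lemmas eqm_add = add_normal.cong_add[OF W_K_normal]
lemmas eqm_minus = add_normal.cong_minus[OF W_K_normal]
lemmas eqm_conj = add_normal.cong_conj[OF W_K_normal]

lemma eqm_tup: assumes "\<And>i. eqm l (h i) (h' i)" shows "eqm (Suc l) (tup h) (tup h')"
proof -
  have "tup (\<lambda>i. h i - h' i) \<in> K (Suc l)" using assms by (intro K_tup) (simp add: eqm_def)
  then show ?thesis using assms tup_W by (simp add: eqm_def tup_diff)
qed

lemma eqm_emb: "eqm l x y \<Longrightarrow> eqm (Suc l) (emb j x) (emb j y)"
  unfolding emb_def by (rule eqm_tup) (simp add: pos_def eqm_refl W_zero)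

lemma eqm_0: "x \<in> W \<Longrightarrow> y \<in> W \<Longrightarrow> eqm 0 x y" by (simp add: cong_mod_def K0 W_diff)

lemmas eqm_mem = cong_mod_mem[of W "K l" for l]

lemma mod_subgroup:
  assumes H: "add_subgroup H" "H \<subseteq> W" shows "add_subgroup {g \<in> W. \<exists>v\<in>H. eqm l g v}"
proof (rule add_subgroupI)
  let ?H = "{g \<in> W. \<exists>v\<in>H. eqm l g v}"
  show "0 \<in> ?H" using W_zero add_subgroup_zero[OF H(1)] eqm_refl by auto
  show "g + h \<in> ?H" if "g \<in> ?H" "h \<in> ?H" for g h
    using that W_add add_subgroup_add[OF H(1)] eqm_add by simp meson
  show "- g \<in> ?H" if "g \<in> ?H" for g
    using that W_minus add_subgroup_minus[OF H(1)] eqm_minus by simp meson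
qed

text \<open>The bridge between consecutive levels: a subgroup \<open>Y\<close> containing
  \<open>K (Suc l)\<close> is studied through this group of sections, to which the induction
  hypothesis at level \<open>l\<close> applies.\<close>

definition sections_at_0 :: "'g set \<Rightarrow> 'g set \<Rightarrow> 'g set" where
  "sections_at_0 Y S = (\<lambda>h. h 0) ` {h. tup h \<in> Y \<and> (\<forall>i. h i \<in> S)}"

lemma sections_at_0I: "tup h \<in> Y \<Longrightarrow> (\<And>i. h i \<in> S) \<Longrightarrow> x = h 0 \<Longrightarrow> x \<in> sections_at_0 Y S"
  unfolding sections_at_0_def by (rule image_eqI[of _ _ h]) auto

lemma sections_at_0E:
  assumes "x \<in> sections_at_0 Y S"
  obtains h where "x = h 0" "tup h \<in> Y" "\<forall>i. h i \<in> S"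
proof -
  from assms obtain h where h: "x = h 0" "h \<in> {h. tup h \<in> Y \<and> (\<forall>i. h i \<in> S)}"
    unfolding sections_at_0_def by (rule imageE)
  show ?thesis by (rule that[of h]) (use h in auto)
qed

lemma sections_at_0_subgroup:
  assumes Y: "add_subgroup Y" and S: "add_subgroup S"
  shows "add_subgroup (sections_at_0 Y S)"
proof (rule add_subgroupI)
  show "0 \<in> sections_at_0 Y S"
    by (rule sections_at_0I[of "\<lambda>_. 0"]) (simp_all add: add_subgroup_zero[OF Y] add_subgroup_zero[OF S])
next
  fix x y assume "x \<in> sections_at_0 Y S"
  then obtain h where h: "x = h 0" "tup h \<in> Y" "\<forall>i. h i \<in> S" by (rule sections_at_0E)
  assume "y \<in> sections_at_0 Y S"
  then obtain h' where h': "y = h' 0" "tup h' \<in> Y" "\<forall>i. h' i \<in> S" by (rule sections_at_0E)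
  show "x + y \<in> sections_at_0 Y S"
    by (rule sections_at_0I[of "\<lambda>i. h i + h' i"])
      (simp_all add: tup_add h h' add_subgroup_add[OF Y] add_subgroup_add[OF S])
next
  fix x assume "x \<in> sections_at_0 Y S"
  then obtain h where h: "x = h 0" "tup h \<in> Y" "\<forall>i. h i \<in> S" by (rule sections_at_0E)
  show "- x \<in> sections_at_0 Y S"
    by (rule sections_at_0I[of "\<lambda>i. - h i"])
      (simp_all add: tup_minus h add_subgroup_minus[OF Y] add_subgroup_minus[OF S])
qed

lemma emb_sections_at_0: "emb 0 g \<in> Y \<Longrightarrow> g \<in> S \<Longrightarrow> 0 \<in> S \<Longrightarrow> g \<in> sections_at_0 Y S"
  by (rule sections_at_0I[of "pos 0 g"]) (simp_all add: emb_def pos_def)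

text \<open>The \<open>d\<close>-th power of an element fixes the first level, and its sections are
  handled by the previous level. For \<open>d = 2\<close> this bounds orders by powers of 2.\<close>

lemma exponent_K: "g \<in> W \<Longrightarrow> zmul (int d ^ l) g \<in> K l"
proof (induction l arbitrary: g)
  case 0 then show ?case by (simp add: K0)
next
  case (Suc l)
  obtain k h where h: "\<forall>i. h i \<in> W" "g = rot k + tup h" using W_cases Suc.prems by blast
  have "\<exists>h'. (\<forall>i. h' i \<in> W) \<and> zmul (int j) g = rot (int j * k) + tup h'" for j
  proof (induction j)
    case 0
    show ?case by (rule exI[of _ "\<lambda>_. 0"]) (simp add: W_zero)
  next
    case (Suc j)
    then obtain h' where h': "\<forall>i. h' i \<in> W" "zmul (int j) g = rot (int j * k) + tup h'" by blast
    have "zmul (int (Suc j)) g = g + zmul (int j) g" using zmul_plus1[of "int j" g] by (simp add: add.commute)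
    also have "\<dots> = rot k + (tup h + rot (int j * k)) + tup h'" by (simp only: h'(2), simp only: h(2) add.assoc)
    also have "\<dots> = rot (int (Suc j) * k) + tup (\<lambda>i. h ((i + int j * k) mod int d) + h' i)"
      by (simp add: tup_rot tup_add rot_add add.assoc distrib_right)
    finally show ?case
      by (intro exI[of _ "\<lambda>i. h ((i + int j * k) mod int d) + h' i"]) (simp add: h(1) h'(1) W_add)
  qed
  then obtain h' where h': "\<forall>i. h' i \<in> W" "zmul (int d) g = rot (int d * k) + tup h'" by blast
  have "zmul (int d) g = tup h'" using h' rot_mult_d[of k] by (metis add_0 mult.commute)
  moreover have "zmul (int d ^ Suc l) g = zmul (int d ^ l) (zmul (int d) g)"
    by (simp add: zmul_zmul mult.commute)
  ultimately have "zmul (int d ^ Suc l) g = tup (\<lambda>i. zmul (int d ^ l) (h' i))" by (simp add: tup_zmul)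
  then show ?case using K_tup[of "\<lambda>i. zmul (int d ^ l) (h' i)" l] Suc.IH h' by simp
qed

end

section \<open>Inner conjugators and generation by conjugates\<close>

locale wreath_model = wreath_tower +
  fixes n :: nat and a :: "nat \<Rightarrow> 'a"
  assumes n: "n \<ge> 1" and a_W: "i \<in> {1..n} \<Longrightarrow> a i \<in> W"
begin

definition A :: "'a set" where
  "A = add_subgroup hull (a ` {1..n})"

text \<open>Generation of \<open>A\<close> modulo \<open>K l\<close>, expressed through all
  subgroups above \<open>K l\<close> so that no quotient group has to be formed.\<close>

definition generating :: "nat \<Rightarrow> (nat \<Rightarrow> 'a) \<Rightarrow> bool" where
  "generating l x \<longleftrightarrow>
     (\<forall>Y. add_subgroup Y \<and> Y \<subseteq> W \<and> K l \<subseteq> Y \<and> x ` {1..n} \<subseteq> Y \<longrightarrow> A \<subseteq> Y)"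

definition conjugates_inner :: "nat \<Rightarrow> bool" where
  "conjugates_inner l \<longleftrightarrow>
     (\<forall>g. (\<forall>i\<in>{1..n}. g i \<in> W) \<longrightarrow>
       (\<exists>w\<in>W. \<exists>v. \<forall>i\<in>{1..n}. v i \<in> A \<and> eqm l (w + (g i + a i - g i) - w) (v i + a i - v i)))"

definition conjugates_generate :: "nat \<Rightarrow> bool" where
  "conjugates_generate l \<longleftrightarrow>
     (\<forall>u. (\<forall>i\<in>{1..n}. u i \<in> A) \<longrightarrow> generating l (\<lambda>i. u i + a i - u i))"

lemma A: "add_subgroup A" unfolding A_def by (rule add_subgroup_hull)
lemma a_A: "i \<in> {1..n} \<Longrightarrow> a i \<in> A" unfolding A_def by (simp add: hull_inc)

lemma A_subset: "add_subgroup Y \<Longrightarrow> (\<And>i. i \<in> {1..n} \<Longrightarrow> a i \<in> Y) \<Longrightarrow> A \<subseteq> Y"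
  unfolding A_def by (rule hull_minimal) auto

lemma A_W: "A \<subseteq> W" by (rule A_subset[OF W a_W])

lemmas A_zero = add_subgroup_zero[OF A]
lemmas A_add = add_subgroup_add[OF A]
lemmas A_minus = add_subgroup_minus[OF A]
lemmas A_diff = add_subgroup_diff[OF A]

definition A_mod :: "nat \<Rightarrow> 'a set" where
  "A_mod l = {g \<in> W. \<exists>v\<in>A. eqm l g v}"

lemma A_mod: "add_subgroup (A_mod l)"
  unfolding A_mod_def by (rule mod_subgroup[OF A A_W])

lemma A_mod_W: "A_mod l \<subseteq> W" by (auto simp: A_mod_def)
lemma A_A_mod: "A \<subseteq> A_mod l" using A_W eqm_refl by (auto simp: A_mod_def)
lemma K_A_mod: "K l \<subseteq> A_mod l"
  using K_W A_zero W_zero by (auto simp: A_mod_def cong_mod_def intro!: bexI[of _ 0])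

lemma conjugates_inner_0: "conjugates_inner 0"
  unfolding conjugates_inner_def
proof (intro allI impI)
  fix g :: "nat \<Rightarrow> 'a" assume g: "\<forall>i\<in>{1..n}. g i \<in> W"
  show "\<exists>w\<in>W. \<exists>v. \<forall>i\<in>{1..n}. v i \<in> A \<and> eqm 0 (w + (g i + a i - g i) - w) (v i + a i - v i)"
    by (rule bexI[of _ 0], rule exI[of _ "\<lambda>_. 0"])
      (use g in \<open>auto simp: A_zero W_zero intro!: eqm_0 W_add W_diff a_W\<close>)
qed

lemma conjugates_generate_0: "conjugates_generate 0"
  using A_W by (auto simp: conjugates_generate_def generating_def K0)

text \<open>Conjugating the whole tuple by \<open>- g 1\<close> makes the first conjugator trivial,
  and the common conjugator \<open>w\<close> absorbs the change.\<close>

lemma conjugates_innerI: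
  assumes "\<And>g. (\<And>i. i \<in> {1..n} \<Longrightarrow> g i \<in> W) \<Longrightarrow> g 1 = 0 \<Longrightarrow>
     \<exists>w\<in>W. \<exists>v. \<forall>i\<in>{1..n}. v i \<in> A \<and> eqm l (w + (g i + a i - g i) - w) (v i + a i - v i)"
  shows "conjugates_inner l"
  unfolding conjugates_inner_def
proof (intro allI impI)
  fix g :: "nat \<Rightarrow> 'a" assume g: "\<forall>i\<in>{1..n}. g i \<in> W"
  have g1: "g 1 \<in> W" using g n by auto
  obtain w v where w: "w \<in> W"
    and v: "\<forall>i\<in>{1..n}. v i \<in> A \<and> eqm l (w + ((- g 1 + g i) + a i - (- g 1 + g i)) - w) (v i + a i - v i)"
    using assms[of "\<lambda>i. - g 1 + g i"] g g1 W_add W_minus by auto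
  have "(w - g 1) + (g i + a i - g i) - (w - g 1) = w + ((- g 1 + g i) + a i - (- g 1 + g i)) - w" for i
    by (simp add: grp del: add_uminus_conv_diff)
  then show "\<exists>w\<in>W. \<exists>v. \<forall>i\<in>{1..n}. v i \<in> A \<and> eqm l (w + (g i + a i - g i) - w) (v i + a i - v i)"
    using v w g1 W_diff by (intro bexI[of _ "w - g 1"] exI[of _ v]) auto
qed

lemma conjugates_innerE:
  assumes "conjugates_inner l" "\<forall>i\<in>{1..n}. g i \<in> W"
  obtains w v where "w \<in> W" "\<forall>i\<in>{1..n}. v i \<in> A \<and> eqm l (w + (g i + a i - g i) - w) (v i + a i - v i)"
proof -
  have "\<exists>w\<in>W. \<exists>v. \<forall>i\<in>{1..n}. v i \<in> A \<and> eqm l (w + (g i + a i - g i) - w) (v i + a i - v i)"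
    using assms(1)[unfolded conjugates_inner_def, THEN spec, THEN mp, OF assms(2)] .
  then show ?thesis using that by (elim bexE exE)
qed

text \<open>Replaces \<open>Y\<close> by its preimage under conjugation by \<open>u 1\<close>. This
  is harmless because \<open>u 1\<close> lies in \<open>A\<close>, which is therefore stable under
  that conjugation.\<close>

lemma conjugates_generateI:
  assumes "\<And>u Y. (\<And>i. i \<in> {1..n} \<Longrightarrow> u i \<in> A) \<Longrightarrow> u 1 = 0 \<Longrightarrow> add_subgroup Y \<Longrightarrow> Y \<subseteq> W \<Longrightarrow> K l \<subseteq> Y \<Longrightarrow>
     (\<And>i. i \<in> {1..n} \<Longrightarrow> u i + a i - u i \<in> Y) \<Longrightarrow> A \<subseteq> Y"
  shows "conjugates_generate l"
  unfolding conjugates_generate_def generating_def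
proof (intro allI impI)
  fix u Y assume u: "\<forall>i\<in>{1..n}. u i \<in> A"
    and Y: "add_subgroup Y \<and> Y \<subseteq> W \<and> K l \<subseteq> Y \<and> (\<lambda>i. u i + a i - u i) ` {1..n} \<subseteq> Y"
  have u1: "u 1 \<in> A" using u n by auto
  then have u1W: "u 1 \<in> W" using A_W by auto
  define Y' where "Y' = {y \<in> W. u 1 + y - u 1 \<in> Y}"
  have "A \<subseteq> Y'"
  proof (rule assms[of "\<lambda>i. - u 1 + u i"])
    show "add_subgroup Y'"
    proof (rule add_subgroupI)
      fix x y assume xy: "x \<in> Y'" "y \<in> Y'"
      then have "(u 1 + x - u 1) + (u 1 + y - u 1) \<in> Y" using Y add_subgroup_add by (auto simp: Y'_def)
      also have "(u 1 + x - u 1) + (u 1 + y - u 1) = u 1 + (x + y) - u 1" by (simp add: grp del: add_uminus_conv_diff)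
      finally show "x + y \<in> Y'" using xy W_add by (auto simp: Y'_def)
    next
      fix x assume x: "x \<in> Y'"
      then have "- (u 1 + x - u 1) \<in> Y" using Y add_subgroup_minus by (auto simp: Y'_def simp del: minus_diff_eq)
      also have "- (u 1 + x - u 1) = u 1 + (- x) - u 1" by (simp add: grp del: add_uminus_conv_diff)
      finally show "- x \<in> Y'" using x W_minus by (auto simp: Y'_def)
    qed (use Y add_subgroup_zero W_zero in \<open>auto simp: Y'_def\<close>)
    show "Y' \<subseteq> W" by (auto simp: Y'_def)
    show "K l \<subseteq> Y'" using K_normal[OF u1W] K_W Y by (auto simp: Y'_def)
    show "- u 1 + u i \<in> A" if "i \<in> {1..n}" for i using that u u1 A_add A_minus by auto
    show "(- u 1 + u i) + a i - (- u 1 + u i) \<in> Y'" if "i \<in> {1..n}" for i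
    proof -
      have e: "u 1 + ((- u 1 + u i) + a i - (- u 1 + u i)) - u 1 = u i + a i - u i"
        by (simp add: grp del: add_uminus_conv_diff)
      have "u 1 + ((- u 1 + u i) + a i - (- u 1 + u i)) - u 1 \<in> Y" unfolding e using Y that by auto
      moreover have "- u 1 + u i + a i - (- u 1 + u i) \<in> W"
        using u u1W that A_W a_W W_add W_diff W_minus by (meson subset_iff)
      ultimately show ?thesis unfolding Y'_def by simp
    qed
  qed simp
  show "A \<subseteq> Y"
  proof
    fix x assume "x \<in> A"
    then have "- u 1 + x + u 1 \<in> Y'" using \<open>A \<subseteq> Y'\<close> u1 A_add A_minus by auto
    then show "x \<in> Y" by (simp add: Y'_def grp del: add_uminus_conv_diff)
  qed
qed

lemma A_wr:
  assumes "\<And>i. i \<in> {1..n} \<Longrightarrow> \<exists>k h. (\<forall>j. h j \<in> A) \<and> a i = rot k + tup h" and "v \<in> A"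
  shows "\<exists>k h. (\<forall>j. h j \<in> A) \<and> v = rot k + tup h"
proof -
  have "A \<subseteq> {rot k + tup h | k h. \<forall>j. h j \<in> A}"
    using assms(1) by (intro A_subset wr_subgroup A) blast
  then show ?thesis using assms(2) by blast
qed

end

section \<open>The periodic model\<close>

locale periodic_model = wreath_model +
  assumes a_1: "a 1 = rot 1 + emb 0 (a n)"
    and a_step: "i \<in> {2..n} \<Longrightarrow> a i = emb 0 (a (i - 1))"
begin

lemma a_1_tup: "a 1 = rot 1 + tup (pos 0 (a n))"
  using a_1 by (simp only: emb_def)

text \<open>Rotations themselves need not belong to \<open>A\<close> here. Powers of
  \<open>a 1\<close> take their place, and the discrepancy has its sections in
  \<open>S\<close>.\<close>

lemma a_1_power:
  assumes "add_subgroup S" "a n \<in> S"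
  shows "\<exists>h. (\<forall>j. h j \<in> S) \<and> zmul k (a 1) = rot k + tup h"
proof -
  note a1 = a_1_tup[simplified]
  have "\<exists>h. (\<forall>j. h j \<in> S) \<and> zmul (int k) (a 1) = rot (int k) + tup h" for k
  proof (induction k)
    case 0
    show ?case using add_subgroup_zero[OF assms(1)] by (intro exI[of _ "\<lambda>_. 0"]) simp
  next
    case (Suc k)
    then obtain h where h: "\<forall>j. h j \<in> S" "zmul (int k) (a 1) = rot (int k) + tup h" by blast
    have "zmul (int (Suc k)) (a 1) = rot 1 + (tup (pos 0 (a n)) + rot (int k)) + tup h"
      using zmul_plus1[of "int k" "a 1"] by (simp only: h(2)) (simp add: a1 add.assoc add.commute)
    also have "\<dots> = rot (int (Suc k)) + tup (\<lambda>i. pos 0 (a n) ((i + int k) mod int d) + h i)"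
      by (simp add: tup_rot tup_add rot_add add.assoc)
    finally show ?case using h(1) assms add_subgroup_add[OF assms(1)] add_subgroup_zero[OF assms(1)]
      by (intro exI[of _ "\<lambda>i. pos 0 (a n) ((i + int k) mod int d) + h i"]) (simp add: pos_def)
  qed note nonneg = this
  show ?thesis
  proof (cases "0 \<le> k")
    case True then show ?thesis using nonneg[of "nat k"] by simp
  next
    case False
    then obtain h where h: "\<forall>j. h j \<in> S" "zmul (- k) (a 1) = rot (- k) + tup h" using nonneg[of "nat (- k)"] by auto
    have "zmul k (a 1) = - zmul (- k) (a 1)" by (simp add: zmul_uminus)
    also have "\<dots> = tup (\<lambda>i. - h i) + rot k" by (simp only: h(2)) (simp add: minus_add tup_minus rot_minus)
    also have "\<dots> = rot k + tup (\<lambda>i. - h ((i + k) mod int d))" by (simp add: tup_rot)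
    finally show ?thesis using h(1) add_subgroup_minus[OF assms(1)]
      by (intro exI[of _ "\<lambda>i. - h ((i + k) mod int d)"]) simp
  qed
qed

text \<open>In the first \<open>d\<close> steps of the cycle each vertex passes through 0 exactly
  once. For the vertex 0 this happens at the first step, and the bound \<open>k \<le> d\<close> in
  the induction excludes a second passage.\<close>

lemma a_1_power_d: "\<exists>h. (\<forall>j. h j \<in> A) \<and> zmul (int d) (a 1) = tup h \<and> h 0 = a n"
proof -
  note a1 = a_1_tup[simplified]
  have nA: "a n \<in> A" using n a_A by auto
  have "k \<le> d \<Longrightarrow> \<exists>h. (\<forall>j. h j \<in> A) \<and> zmul (int k) (a 1) = rot (int k) + tup h \<and> h 0 = (if k = 0 then 0 else a n)" for k
  proof (induction k)
    case 0
    show ?case using A_zero by (intro exI[of _ "\<lambda>_. 0"]) simp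
  next
    case (Suc k)
    then obtain h where h: "\<forall>j. h j \<in> A" "zmul (int k) (a 1) = rot (int k) + tup h" "h 0 = (if k = 0 then 0 else a n)"
      by auto
    have "zmul (int (Suc k)) (a 1) = rot 1 + (tup (pos 0 (a n)) + rot (int k)) + tup h"
      using zmul_plus1[of "int k" "a 1"] by (simp only: h(2)) (simp add: a1 add.assoc add.commute)
    also have "\<dots> = rot (int (Suc k)) + tup (\<lambda>i. pos 0 (a n) ((i + int k) mod int d) + h i)"
      by (simp add: tup_rot tup_add rot_add add.assoc)
    finally show ?case using h(1,3) nA A_add A_zero Suc.prems
      by (intro exI[of _ "\<lambda>i. pos 0 (a n) ((i + int k) mod int d) + h i"]) (auto simp: pos_def)
  qed
  from this[of d] show ?thesis using d2 by (auto simp: rot_d)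
qed

lemma a_wr: "i \<in> {1..n} \<Longrightarrow> \<exists>k h. (\<forall>j. h j \<in> A) \<and> a i = rot k + tup h"
proof (cases "i = 1")
  case True
  then show ?thesis using a_A[of n] n A_zero
    by (intro exI[of _ 1] exI[of _ "pos 0 (a n)"]) (use a_1_tup in \<open>simp add: pos_def\<close>)
next
  case False
  assume "i \<in> {1..n}"
  with False have i: "i \<in> {2..n}" and "i - 1 \<in> {1..n}" by auto
  then have "a (i - 1) \<in> A" using a_A by blast
  with i show ?thesis using A_zero
    by (intro exI[of _ 0] exI[of _ "pos 0 (a (i - 1))"]) (simp add: a_step[of i] emb_def, simp add: pos_def)
qed

lemma A_split:
  assumes "v \<in> A"
  shows "\<exists>k h. (\<forall>j. h j \<in> A) \<and> tup h \<in> A \<and> v = zmul k (a 1) + tup h"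
proof -
  obtain k h where h: "\<forall>j. h j \<in> A" "v = rot k + tup h" using A_wr[OF a_wr assms] by blast
  obtain h' where h': "\<forall>j. h' j \<in> A" "zmul k (a 1) = rot k + tup h'" using a_1_power[OF A a_A[of n]] n by auto
  have "- zmul k (a 1) + v = tup (\<lambda>i. - h' i + h i)"
    by (simp only: h(2) h'(2)) (simp add: tup_add tup_minus grp del: add_uminus_conv_diff)
  moreover have "- zmul k (a 1) + v \<in> A" using assms a_A[of 1] n by (intro A_add A_minus add_subgroup_zmul[OF A]) auto
  moreover have "v = zmul k (a 1) + (- zmul k (a 1) + v)" by (simp add: grp del: add_uminus_conv_diff)
  ultimately show ?thesis using h(1) h'(1) A_add A_minus
    by (intro exI[of _ k] exI[of _ "\<lambda>i. - h' i + h i"]) simp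
qed

text \<open>For i < n the element \<open>a i\<close> is the section of \<open>a (Suc i)\<close> at
  0, while \<open>a n\<close> is the section of the \<open>d\<close>-th power of \<open>a 1\<close>;
  so every generator occurs.\<close>

lemma sections_onto:
  assumes "v \<in> A" shows "\<exists>h. tup h \<in> A \<and> (\<forall>i. h i \<in> A) \<and> h 0 = v"
proof -
  let ?P = "sections_at_0 A A"
  have "add_subgroup ?P" by (rule sections_at_0_subgroup[OF A A])
  moreover have "a i \<in> ?P" if i: "i \<in> {1..n}" for i
  proof (cases "i = n")
    case True
    obtain h where h: "\<forall>j. h j \<in> A" "zmul (int d) (a 1) = tup h" "h 0 = a n" using a_1_power_d by blast
    have "tup h \<in> A" using add_subgroup_zmul[OF A a_A[of 1], of "int d"] n h(2) by simp
    then show ?thesis using True h by (intro sections_at_0I[of h]) auto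
  next
    case False
    then have "Suc i \<in> {2..n}" using i by auto
    then have "emb 0 (a i) = a (Suc i)" "a (Suc i) \<in> A" using a_step[of "Suc i"] a_A[of "Suc i"] by auto
    then show ?thesis using a_A[OF i] A_zero by (intro emb_sections_at_0) auto
  qed
  ultimately have "A \<subseteq> ?P" by (rule A_subset)
  with assms have "v \<in> ?P" by blast
  then obtain h where "v = h 0" "tup h \<in> A" "\<forall>i. h i \<in> A" by (rule sections_at_0E)
  then show ?thesis by (intro exI[of _ h]) auto
qed

text \<open>As \<open>u 1 = 0\<close>, the element \<open>a 1\<close> lies in \<open>Y\<close>.
  Stripping powers of \<open>a 1\<close> from the other conjugators leaves conjugates of
  \<open>a (i - 1)\<close> placed at vertex 0. These sections generate by the induction hypothesis,
  and the group they generate supplies what is needed to undo the conjugations.\<close>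

lemma conjugates_generate_step:
  assumes IH: "conjugates_generate l" shows "conjugates_generate (Suc l)"
proof (rule conjugates_generateI)
  fix u Y assume u: "\<And>i. i \<in> {1..n} \<Longrightarrow> u i \<in> A" "u 1 = 0" and Y: "add_subgroup Y" "Y \<subseteq> W" "K (Suc l) \<subseteq> Y"
    and uY: "\<And>i. i \<in> {1..n} \<Longrightarrow> u i + a i - u i \<in> Y"
  note Y_zero = add_subgroup_zero[OF Y(1)] and Y_add = add_subgroup_add[OF Y(1)] and Y_minus = add_subgroup_minus[OF Y(1)]
  have a1Y: "a 1 \<in> Y" using uY[of 1] u(2) n by simp
  have "\<exists>h :: int \<Rightarrow> 'a. (\<forall>j. h j \<in> A) \<and> emb 0 (h 0 + a (i - 1) - h 0) \<in> Y" if i: "i \<in> {2..n}" for i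
  proof -
    obtain k h where h: "\<forall>j. h j \<in> A" "u i = zmul k (a 1) + tup h" using A_split[of "u i"] u(1)[of i] i by auto
    have "- zmul k (a 1) + (u i + a i - u i) + zmul k (a 1) \<in> Y"
      using uY[of i] i add_subgroup_zmul[OF Y(1) a1Y] by (intro Y_add Y_minus) auto
    also have "- zmul k (a 1) + (u i + a i - u i) + zmul k (a 1) = tup h + a i - tup h"
      by (simp add: h(2) grp del: add_uminus_conv_diff)
    also have "\<dots> = emb 0 (h 0 + a (i - 1) - h 0)" by (simp add: a_step[OF i] tup_emb_conj)
    finally show ?thesis using h(1) by blast
  qed
  then have "\<forall>i\<in>{2..n}. \<exists>h :: int \<Rightarrow> 'a. (\<forall>j. h j \<in> A) \<and> emb 0 (h 0 + a (i - 1) - h 0) \<in> Y" ..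
  from bchoice[OF this] obtain H :: "nat \<Rightarrow> int \<Rightarrow> 'a"
    where H': "\<forall>i\<in>{2..n}. (\<forall>j. H i j \<in> A) \<and> emb 0 (H i 0 + a (i - 1) - H i 0) \<in> Y" ..
  note H = bspec[OF H']
  \<comment> \<open>The conjugator for \<open>a n\<close> is 0 because the \<open>d\<close>-th power
    of \<open>a 1\<close>, which lies in \<open>Y\<close>, has exactly \<open>a n\<close> as its
    section.\<close>
  define v where "v i = (if i = n then 0 else H (Suc i) 0)" for i
  have vA: "v i \<in> A" if "i \<in> {1..n}" for i using that H[of "Suc i"] A_zero by (auto simp: v_def)
  then have gen: "generating l (\<lambda>i. v i + a i - v i)" using IH unfolding conjugates_generate_def by blast
  define P where "P = sections_at_0 Y W"
  have P: "add_subgroup P" unfolding P_def by (rule sections_at_0_subgroup[OF Y(1) W])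
  have embP: "g \<in> P" if "emb 0 g \<in> Y" "g \<in> W" for g
    unfolding P_def using that W_zero by (intro emb_sections_at_0)
  have KP: "K l \<subseteq> P" using embP emb_K Y(3) K_W by blast
  have PW: "P \<subseteq> W" by (auto simp: P_def elim: sections_at_0E)
  have "v i + a i - v i \<in> P" if i: "i \<in> {1..n}" for i
  proof (cases "i = n")
    case True
    obtain h where h: "\<forall>j. h j \<in> A" "zmul (int d) (a 1) = tup h" "h 0 = a n" using a_1_power_d by blast
    have "tup h \<in> Y" using add_subgroup_zmul[OF Y(1) a1Y, of "int d"] h(2) by simp
    then show ?thesis using True A_W h unfolding P_def by (intro sections_at_0I[of h]) (auto simp: v_def)
  next
    case False
    then show ?thesis using H[of "Suc i"] i A_W a_W
      by (intro embP W_diff W_add) (auto simp: v_def)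
  qed
  then have AP: "A \<subseteq> P" using gen P PW KP unfolding generating_def by blast
  show "A \<subseteq> Y"
  proof (rule A_subset[OF Y(1)])
    fix i assume i: "i \<in> {1..n}"
    show "a i \<in> Y"
    proof (cases "i = 1")
      case False
      then have i2: "i \<in> {2..n}" using i by auto
      \<comment> \<open>Some element of \<open>Y\<close> that fixes the first level has the section
        \<open>- H i 0\<close> at 0; conjugation by it removes the unwanted conjugator.\<close>
      have "- H i 0 \<in> P" using H[OF i2] AP A_minus by blast
      then obtain h where h: "- H i 0 = h 0" "tup h \<in> Y" unfolding P_def by (rule sections_at_0E)
      have "tup h + emb 0 (H i 0 + a (i - 1) - H i 0) - tup h \<in> Y" using h H[OF i2] Y_add add_subgroup_diff[OF Y(1)] by blast
      also have "tup h + emb 0 (H i 0 + a (i - 1) - H i 0) - tup h = a i"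
        by (simp add: tup_emb_conj flip: h(1)) (simp add: grp a_step[OF i2] del: add_uminus_conv_diff)
      finally show ?thesis .
    qed (use a1Y in simp)
  qed
qed

text \<open>The conjugator is a constant tuple, which commutes with all rotations. If its entry also
  centralises \<open>a n\<close> modulo \<open>K l\<close>, it centralises \<open>a 1\<close> modulo
  \<open>K (Suc l)\<close>, and so the powers of \<open>a 1\<close> split off from the
  \<open>g i\<close> do no harm.\<close>

lemma conjugates_inner_step:
  assumes IH: "conjugates_inner l" shows "conjugates_inner (Suc l)"
proof (rule conjugates_innerI)
  fix g :: "nat \<Rightarrow> 'a" assume g: "\<And>i. i \<in> {1..n} \<Longrightarrow> g i \<in> W" "g 1 = 0"
  have a1W: "a 1 \<in> W" using a_W n by auto
  have "\<forall>i\<in>{1..n}. \<exists>p. (\<forall>j. snd p j \<in> W) \<and> g i = zmul (fst p) (a 1) + tup (snd p)"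
  proof
    fix i assume i: "i \<in> {1..n}"
    obtain k h where h: "\<forall>j. h j \<in> W" "g i = rot k + tup h" using W_cases g(1) i by blast
    obtain h' where h': "\<forall>j. h' j \<in> A" "zmul k (a 1) = rot k + tup h'" using a_1_power[OF A a_A[of n]] n by auto
    have "g i = zmul k (a 1) + tup (\<lambda>i. - h' i + h i)"
      by (simp only: h(2) h'(2)) (simp add: tup_add tup_minus grp del: add_uminus_conv_diff)
    moreover have "\<forall>j. - h' j + h j \<in> W" using h(1) h'(1) A_W W_add W_minus by blast
    ultimately show "\<exists>p. (\<forall>j. snd p j \<in> W) \<and> g i = zmul (fst p) (a 1) + tup (snd p)"
      by (intro exI[of _ "(k, \<lambda>i. - h' i + h i)"]) simp
  qed
  from bchoice[OF this] obtain p
    where p: "\<forall>i\<in>{1..n}. (\<forall>j. snd (p i) j \<in> W) \<and> g i = zmul (fst (p i)) (a 1) + tup (snd (p i))" ..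
  define k h where "k i = fst (p i)" and "h i = snd (p i)" for i
  have h: "(\<forall>j. h i j \<in> W) \<and> g i = zmul (k i) (a 1) + tup (h i)" if "i \<in> {1..n}" for i
    using bspec[OF p that] unfolding k_def h_def .
  define G where "G i = (if i = n then 0 else h (Suc i) 0)" for i
  have "\<forall>i\<in>{1..n}. G i \<in> W" using h W_zero by (auto simp: G_def)
  with IH obtain w v where w: "w \<in> W" and v: "\<forall>i\<in>{1..n}. v i \<in> A \<and> eqm l (w + (G i + a i - G i) - w) (v i + a i - v i)"
    by (rule conjugates_innerE)
  have vn: "v n \<in> A" using v n by auto
  \<comment> \<open>Since \<open>G n = 0\<close>, this shift gives \<open>v' n = 0\<close>, so that
    \<open>w'\<close> centralises \<open>a n\<close> modulo \<open>K l\<close>.\<close>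
  define w' where "w' = - v n + w"
  define v' where "v' i = - v n + v i" for i
  have v'A: "v' i \<in> A" if "i \<in> {1..n}" for i using that v vn A_add A_minus by (auto simp: v'_def)
  have w': "w' \<in> W" using w vn A_W W_add W_minus by (auto simp: w'_def)
  have vnW: "- v n \<in> W" using vn A_W W_minus by auto
  have v': "eqm l (w' + (G i + a i - G i) - w') (v' i + a i - v' i)" if i: "i \<in> {1..n}" for i
  proof -
    have "eqm l (- v n + (w + (G i + a i - G i) - w) - (- v n)) (- v n + (v i + a i - v i) - (- v n))"
      using bspec[OF v i] eqm_conj[OF eqm_refl[OF vnW]] by blast
    also have "- v n + (w + (G i + a i - G i) - w) - (- v n) = w' + (G i + a i - G i) - w'"
      by (simp add: w'_def grp del: add_uminus_conv_diff)
    also have "- v n + (v i + a i - v i) - (- v n) = v' i + a i - v' i"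
      by (simp add: v'_def grp del: add_uminus_conv_diff)
    finally show ?thesis .
  qed
  define w1 where "w1 = tup (\<lambda>_. w')"
  have w1W: "w1 \<in> W" unfolding w1_def using w' by (intro tup_W)
  have w1_emb: "w1 + emb 0 x - w1 = emb 0 (w' + x - w')" for x by (simp add: w1_def tup_emb_conj)
  have w1_rot: "w1 + rot k - w1 = rot k" for k by (simp add: w1_def tup_rot)
  have w1_a1: "eqm (Suc l) (w1 + a 1 - w1) (a 1)"
  proof -
    have "w1 + a 1 - w1 = (w1 + rot 1 - w1) + (w1 + emb 0 (a n) - w1)"
      by (simp only: a_1) (simp add: grp del: add_uminus_conv_diff)
    also have "\<dots> = rot 1 + emb 0 (w' + a n - w')" by (simp only: w1_rot w1_emb)
    finally have e: "w1 + a 1 - w1 = rot 1 + emb 0 (w' + a n - w')" .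
    have "eqm l (w' + a n - w') (a n)" using v'[of n] n by (simp add: G_def v'_def)
    then show ?thesis unfolding e unfolding a_1 by (simp add: eqm_add eqm_refl rot_W eqm_emb)
  qed
  have w1_zmul: "eqm (Suc l) (w1 + zmul k (a 1) - w1) (zmul k (a 1))" for k
    unfolding zmul_conj[symmetric]
    by (induction k rule: int_induct[where k = 0])
      (use w1_a1 in \<open>auto simp: zmul_plus1 zmul_minus1 intro!: eqm_add eqm_minus eqm_refl W_zero simp del: add_uminus_conv_diff minus_diff_eq\<close>)
  have "\<exists>x. x \<in> A \<and> eqm (Suc l) (w1 + (g i + a i - g i) - w1) (x + a i - x)" if i: "i \<in> {1..n}" for i
  proof (cases "i = 1")
    case True
    then show ?thesis using w1_a1 A_zero g(2) by (intro exI[of _ 0]) simp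
  next
    case False
    then have i2: "i \<in> {2..n}" and i1: "i - 1 \<in> {1..n}" using i by auto
    obtain h' where h': "tup h' \<in> A" "\<forall>i. h' i \<in> A" "h' 0 = v' (i - 1)" using sections_onto[OF v'A[OF i1]] by blast
    let ?z = "zmul (k i) (a 1)"
    have zA: "?z \<in> A" using add_subgroup_zmul[OF A a_A[of 1]] n by auto
    have Gi: "G (i - 1) = h i 0" using i2 by (auto simp: G_def)
    have "g i + a i - g i = ?z + emb 0 (h i 0 + a (i - 1) - h i 0) - ?z"
    proof -
      have "g i + a i - g i = ?z + (tup (h i) + emb 0 (a (i - 1)) - tup (h i)) - ?z"
        using h[OF i] by (simp add: a_step[OF i2] grp del: add_uminus_conv_diff)
      then show ?thesis by (simp only: tup_emb_conj mod_0)
    qed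
    then have "w1 + (g i + a i - g i) - w1 =
        (w1 + ?z - w1) + (w1 + emb 0 (h i 0 + a (i - 1) - h i 0) - w1) - (w1 + ?z - w1)"
      by (simp add: grp del: add_uminus_conv_diff)
    also have "\<dots> = (w1 + ?z - w1) + emb 0 (w' + (G (i - 1) + a (i - 1) - G (i - 1)) - w') - (w1 + ?z - w1)"
      by (simp only: w1_emb Gi)
    also have "eqm (Suc l) \<dots> (?z + emb 0 (v' (i - 1) + a (i - 1) - v' (i - 1)) - ?z)"
      by (intro eqm_conj w1_zmul eqm_emb v' i1)
    also have "?z + emb 0 (v' (i - 1) + a (i - 1) - v' (i - 1)) - ?z = ?z + (tup h' + emb 0 (a (i - 1)) - tup h') - ?z"
      by (simp only: tup_emb_conj mod_0 h'(3))
    also have "\<dots> = (?z + tup h') + a i - (?z + tup h')"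
      by (simp add: a_step[OF i2] grp del: add_uminus_conv_diff)
    finally show ?thesis using zA h'(1) A_add by blast
  qed
  then show "\<exists>w\<in>W. \<exists>v. \<forall>i\<in>{1..n}. v i \<in> A \<and> eqm (Suc l) (w + (g i + a i - g i) - w) (v i + a i - v i)"
    using w1W by metis
qed

theorem rigid: "conjugates_inner l \<and> conjugates_generate l"
  by (induction l) (auto simp: conjugates_inner_0 conjugates_generate_0 conjugates_inner_step conjugates_generate_step)

end

section \<open>The preperiodic model\<close>

locale preperiodic_model = wreath_model +
  fixes m :: nat and r :: int
  assumes m: "1 \<le> m" "m < n" and r: "0 < r" "r < int d"
    and a_1: "a 1 = rot 1"
    and a_step: "i \<in> {2..n} \<Longrightarrow> i \<noteq> Suc m \<Longrightarrow> a i = emb 0 (a (i - 1))"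
    and a_branch: "a (Suc m) = tup (\<lambda>i. if i = 0 then a m else if i = r then a n else 0)"
begin

definition pr :: "'a \<Rightarrow> 'a \<Rightarrow> int \<Rightarrow> 'a" where
  "pr p q i = (if i = 0 then p else if i = r then q else 0)"

definition pair :: "'a \<Rightarrow> 'a \<Rightarrow> 'a" where
  "pair p q = tup (pr p q)"

lemma a_branch': "a (Suc m) = pair (a m) (a n)"
  unfolding a_branch pair_def by (rule tup_cong) (simp add: pr_def)

lemma pair_add: "pair (p + p') (q + q') = pair p q + pair p' q'"
  unfolding pair_def tup_add[symmetric] by (rule tup_cong) (simp add: pr_def)

lemma pair_minus: "pair (- p) (- q) = - pair p q"
  unfolding pair_def tup_minus[symmetric] by (rule tup_cong) (simp add: pr_def)

lemma pair_zmul: "zmul k (pair p q) = pair (zmul k p) (zmul k q)"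
  unfolding pair_def tup_zmul[symmetric]
proof (rule tup_cong)
  have "zmul k (0::'a) = 0" by (induction k rule: int_induct[where k = 0]) (auto simp: zmul_plus1 zmul_minus1)
  then show "zmul k (pr p q i) = pr (zmul k p) (zmul k q) i" for i by (simp add: pr_def)
qed

lemma pair_eq_emb: "pair p q = emb 0 p + emb r q"
  unfolding pair_def emb_def tup_add[symmetric] using r by (intro tup_cong) (simp add: pr_def pos_def)

lemma tup_pair_conj: "tup h + pair p q - tup h = pair (h 0 + p - h 0) (h r + q - h r)"
  unfolding pair_def tup_conj by (rule tup_cong) (simp add: pr_def)

lemma eqm_pair: "eqm l x x' \<Longrightarrow> eqm l y y' \<Longrightarrow> eqm (Suc l) (pair x y) (pair x' y')"
  unfolding pair_eq_emb by (intro eqm_add eqm_emb)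

lemma a_wr: "i \<in> {1..n} \<Longrightarrow> \<exists>k h. (\<forall>j. h j \<in> A) \<and> a i = rot k + tup h"
proof -
  assume i: "i \<in> {1..n}"
  consider "i = 1" | "i \<in> {2..n}" "i \<noteq> Suc m" "i - 1 \<in> {1..n}" | "i = Suc m" using i by force
  then show ?thesis
  proof cases
    case 1
    then show ?thesis using a_1 A_zero by (intro exI[of _ 1] exI[of _ "\<lambda>_. 0"]) simp
  next
    case 2
    then have "a (i - 1) \<in> A" using a_A by blast
    with 2 show ?thesis using A_zero
      by (intro exI[of _ 0] exI[of _ "pos 0 (a (i - 1))"]) (simp add: a_step[of i] emb_def, simp add: pos_def)
  next
    case 3
    then show ?thesis using a_A[of m] a_A[of n] A_zero m n
      by (intro exI[of _ 0] exI[of _ "pr (a m) (a n)"]) (simp add: a_branch' pair_def, simp add: pr_def)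
  qed
qed

lemma rot_A: "rot k \<in> A"
  using add_subgroup_zmul[OF A a_A[of 1], of k] n unfolding a_1 by (simp flip: rot_zmul)

lemma A_split: "v \<in> A \<Longrightarrow> \<exists>k h. (\<forall>j. h j \<in> A) \<and> tup h \<in> A \<and> v = rot k + tup h"
proof -
  assume v: "v \<in> A"
  obtain k h where h: "\<forall>j. h j \<in> A" "v = rot k + tup h" using A_wr[OF a_wr v] by blast
  moreover have "- rot k + v \<in> A" using v rot_A A_add A_minus by blast
  moreover have "- rot k + v = tup h" by (simp add: h(2) grp del: add_uminus_conv_diff)
  ultimately show ?thesis by (intro exI[of _ k] exI[of _ h]) simp
qed

text \<open>The rotation has order two when \<open>d = 2\<close>, and the recursion hands this
  property on to the other generators one level at a time.\<close>

lemma involutions: assumes "d = 2" "i \<in> {1..n}" shows "a i + a i \<in> K l"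
  using assms(2)
proof (induction l arbitrary: i)
  case 0 then show ?case using a_W W_add by (simp add: K0)
next
  case (Suc l)
  consider "i = 1" | "i \<in> {2..n}" "i \<noteq> Suc m" "i - 1 \<in> {1..n}" | "i = Suc m" using Suc.prems by force
  then show ?case
  proof cases
    case 1
    have "rot 1 + rot 1 = rot (int d)" using assms(1) by (simp flip: rot_add)
    then show ?thesis using 1 a_1 by (simp add: rot_d K_zero)
  next
    case 2
    then show ?thesis using Suc.IH[of "i - 1"] emb_K by (simp add: a_step[of i] flip: emb_add)
  next
    case 3
    have "a m + a m \<in> K l" "a n + a n \<in> K l" using Suc.IH m n by auto
    then show ?thesis unfolding 3 a_branch' pair_add[symmetric] by (simp add: pair_eq_emb K_add emb_K)
  qed
qed

end

text \<open>\<open>Y\<close> is used in two ways: as a subgroup containing given conjugates, when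
  generation is proved, and as \<open>A\<close> modulo \<open>K (Suc l)\<close>, when conjugators
  are sought. The difficulty is that \<open>x m\<close> and \<open>x n\<close> are available only
  jointly, as a pair.\<close>

locale branch_context = preperiodic_model +
  fixes l :: nat and Y :: "'a set" and x :: "nat \<Rightarrow> 'a"
  assumes Y: "add_subgroup Y" and Y_W: "Y \<subseteq> W" and K_Y: "K (Suc l) \<subseteq> Y" and rot_1_Y: "rot 1 \<in> Y"
    and x_conj: "i \<in> {1..n} \<Longrightarrow> \<exists>\<phi>\<in>A. x i = \<phi> + a i - \<phi>"
    and x_emb: "i \<in> {1..n} - {m, n} \<Longrightarrow> emb 0 (x i) \<in> Y"
    and x_pair: "pair (x m) (x n) \<in> Y"
    and x_gen: "generating l x"
begin

lemmas Y_zero = add_subgroup_zero[OF Y]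
lemmas Y_add = add_subgroup_add[OF Y]
lemmas Y_minus = add_subgroup_minus[OF Y]
lemmas Y_diff = add_subgroup_diff[OF Y]

lemma rot_Y: "rot k \<in> Y"
  using add_subgroup_zmul[OF Y rot_1_Y, of k] by (simp flip: rot_zmul)

lemma emb_Y: "emb 0 g \<in> Y \<Longrightarrow> emb j g \<in> Y"
  using Y_diff[OF Y_add[OF rot_Y[of j]] rot_Y[of j], of "emb 0 g"] rot_emb[of j 0 g] by simp

lemma rot_pair: "rot r + pair p q - rot r = tup (\<lambda>i. if i = r then p else if i = (2 * r) mod int d then q else 0)"
  unfolding pair_def rot_tup
proof (rule tup_cong)
  fix i assume i: "0 \<le> i" "i < int d"
  have 1: "(i - r) mod int d = 0 \<longleftrightarrow> i = r"
    using i r by (smt (verit, best) mod_pos_pos_trivial mod_add_self2 diff_add_cancel)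
  have "(i - r) mod int d = r \<longleftrightarrow> i = (2 * r) mod int d"
  proof
    assume "(i - r) mod int d = r"
    then have "(i - r + r) mod int d = (r + r) mod int d" by (metis mod_add_left_eq)
    then show "i = (2 * r) mod int d" using i by simp
  next
    assume "i = (2 * r) mod int d"
    then have "(i - r) mod int d = (2 * r - r) mod int d" by (metis mod_diff_left_eq)
    then show "(i - r) mod int d = r" using r by simp
  qed
  with 1 show "pr p q ((i - r) mod int d) = (if i = r then p else if i = (2 * r) mod int d then q else 0)"
    by (simp add: pr_def)
qed

definition P where "P = sections_at_0 Y W"

lemma P: "add_subgroup P" unfolding P_def by (rule sections_at_0_subgroup[OF Y W])
lemma P_W: "P \<subseteq> W" by (auto simp: P_def elim: sections_at_0E)
lemma emb_P: "emb 0 g \<in> Y \<Longrightarrow> g \<in> W \<Longrightarrow> g \<in> P" unfolding P_def using W_zero by (intro emb_sections_at_0)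
lemma K_P: "K l \<subseteq> P" using emb_P emb_K K_Y K_W by blast

lemma x_A: "i \<in> {1..n} \<Longrightarrow> x i \<in> A"
  using x_conj[of i] a_A[of i] A_add A_diff by auto

lemma x_P: assumes "i \<in> {1..n}" shows "x i \<in> P"
proof -
  have xW: "x i \<in> W" if "i \<in> {1..n}" for i using x_A[OF that] A_W by auto
  have mn: "m \<in> {1..n}" "n \<in> {1..n}" using m n by auto
  consider "i = m" | "i = n" | "i \<in> {1..n} - {m, n}" using assms by auto
  then show ?thesis
  proof cases
    case 1
    have "pr (x m) (x n) j \<in> W" for j using xW mn W_zero by (simp add: pr_def)
    then show ?thesis unfolding P_def using x_pair
      by (intro sections_at_0I[of "pr (x m) (x n)"]) (auto simp: 1 pair_def, simp add: pr_def)
  next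
    case 2
    \<comment> \<open>The rotation by \<open>- r\<close> brings the second component of the pair to
      vertex 0.\<close>
    have "rot (- r) + pair (x m) (x n) - rot (- r) \<in> Y" by (intro Y_diff Y_add rot_Y x_pair)
    then have "tup (\<lambda>i. pr (x m) (x n) ((i + r) mod int d)) \<in> Y" by (simp only: pair_def rot_tup) simp
    moreover have "pr (x m) (x n) j \<in> W" for j using xW mn W_zero by (simp add: pr_def)
    ultimately show ?thesis unfolding P_def using r
      by (intro sections_at_0I[of "\<lambda>i. pr (x m) (x n) ((i + r) mod int d)"]) (auto simp: 2, simp add: pr_def)
  next
    case 3
    then show ?thesis using emb_P x_emb xW by auto
  qed
qed

abbreviation Ah where "Ah \<equiv> A_mod l"

lemmas Ah = A_mod[of l]
lemmas Ah_zero = add_subgroup_zero[OF Ah]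
lemmas Ah_add = add_subgroup_add[OF Ah]
lemmas Ah_minus = add_subgroup_minus[OF Ah]
lemmas Ah_diff = add_subgroup_diff[OF Ah]
lemmas Ah_W = A_mod_W[of l]
lemmas A_Ah = A_A_mod[of l]
lemmas K_Ah = K_A_mod[of l]

text \<open>Induction principle for \<open>Ah\<close>: a property that defines a subgroup above
  \<open>K l\<close> is checked on any tuple generating modulo \<open>K l\<close>, be it
  \<open>a\<close> or \<open>x\<close>.\<close>

lemma Ah_subset:
  assumes T: "add_subgroup T" "T \<subseteq> W" "K l \<subseteq> T" and y: "generating l y" "\<And>i. i \<in> {1..n} \<Longrightarrow> y i \<in> T"
  shows "Ah \<subseteq> T"
proof
  fix g assume "g \<in> Ah"
  then obtain v where v: "v \<in> A" "eqm l g v" by (auto simp: A_mod_def)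
  have "A \<subseteq> T" using y(1) T y(2) unfolding generating_def by blast
  then show "g \<in> T" using eqm_mem[OF v(2) T(1,3)] v(1) by blast
qed

lemma a_gen: "generating l a"
  unfolding generating_def using A_subset by blast

lemma Ah_P: "Ah \<subseteq> P"
  by (rule Ah_subset[OF P P_W K_P x_gen x_P])

text \<open>The sections that \<open>Y\<close> realises at one vertex with nothing elsewhere. As
  \<open>Y\<close> contains the rotations, the choice of vertex 0 is immaterial.\<close>

definition B where "B = {g \<in> Ah. emb 0 g \<in> Y}"

lemma B: "add_subgroup B"
  by (rule add_subgroupI) (auto simp: B_def Ah_zero Ah_add Ah_minus emb_add emb_minus Y_zero Y_add Y_minus)

lemma B_Ah: "B \<subseteq> Ah" by (auto simp: B_def)
lemma K_B: "K l \<subseteq> B" using K_Ah emb_K K_Y by (auto simp: B_def)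

text \<open>Every element of \<open>Ah\<close> is the section at 0 of an element of
  \<open>Y\<close>, and conjugating by that element keeps \<open>emb 0 b\<close> inside
  \<open>Y\<close> and at vertex 0.\<close>

lemma B_normal: assumes "g \<in> Ah" "b \<in> B" shows "g + b - g \<in> B"
proof -
  have "g \<in> P" using assms Ah_P by auto
  then obtain h where h: "g = h 0" "tup h \<in> Y" unfolding P_def by (rule sections_at_0E)
  have "tup h + emb 0 b - tup h \<in> Y" using h assms Y_add Y_diff by (simp add: B_def)
  then show ?thesis using assms Ah_add Ah_diff by (simp add: B_def tup_emb_conj h)
qed

sublocale AB: add_normal Ah B
  using Ah B B_Ah B_normal by unfold_locales

abbreviation eqB where "eqB \<equiv> cong_mod Ah B"

lemma x_Ah: "i \<in> {1..n} \<Longrightarrow> x i \<in> Ah" using x_A A_Ah by blast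
lemma a_Ah: "i \<in> {1..n} \<Longrightarrow> a i \<in> Ah" using a_A A_Ah by blast
lemma am_Ah: "a m \<in> Ah" and an_Ah: "a n \<in> Ah" and xm_Ah: "x m \<in> Ah" and xn_Ah: "x n \<in> Ah"
  using a_Ah x_Ah m n by auto

lemma x_B: "i \<in> {1..n} - {m, n} \<Longrightarrow> x i \<in> B" using x_Ah x_emb by (auto simp: B_def)

lemma a_B: assumes "i \<in> {1..n} - {m, n}" shows "a i \<in> B"
proof -
  obtain \<phi> where "\<phi> \<in> A" "x i = \<phi> + a i - \<phi>" using x_conj assms by auto
  then have "- \<phi> + x i - (- \<phi>) \<in> B" "- \<phi> + x i - (- \<phi>) = a i"
    using B_normal[of "- \<phi>" "x i"] x_B[OF assms] A_Ah A_minus by (auto simp: grp simp del: add_uminus_conv_diff)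
  then show ?thesis by simp
qed

lemma pair_B: assumes "b \<in> B" "b' \<in> B" shows "pair b b' \<in> Y"
  using assms Y_add emb_Y by (auto simp: pair_eq_emb B_def)

lemma pair_eqB: assumes "eqB p p'" "eqB q q'" "pair p' q' \<in> Y" shows "pair p q \<in> Y"
proof -
  have "pair (p - p') (q - q') + pair p' q' \<in> Y" using assms pair_B Y_add by (simp add: cong_mod_def)
  then show ?thesis by (simp flip: pair_add)
qed

text \<open>Modulo \<open>T\<close> the group \<open>Ah\<close> is generated by \<open>y m\<close>
  and \<open>y n\<close>, so it is abelian as soon as these two commute. The argument spreads
  commutation first from \<open>y m\<close>, then from \<open>y n\<close>, then from an arbitrary
  element.\<close>

lemma commutators_in:
  assumes T: "add_subgroup T" "B \<subseteq> T" "T \<subseteq> Ah" and nrm: "\<And>g t. g \<in> Ah \<Longrightarrow> t \<in> T \<Longrightarrow> g + t - g \<in> T"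
    and y: "generating l y" "\<And>i. i \<in> {1..n} \<Longrightarrow> y i \<in> Ah" "\<And>i. i \<in> {1..n} - {m, n} \<Longrightarrow> y i \<in> T"
    and ymn: "y m + y n - y m - y n \<in> T"
    and gh: "g \<in> Ah" "h \<in> Ah"
  shows "g + h - g - h \<in> T"
proof -
  note T_zero = add_subgroup_zero[OF T(1)] and T_diff = add_subgroup_diff[OF T(1)] and T_minus = add_subgroup_minus[OF T(1)]
  have KT: "K l \<subseteq> T" using K_B T by blast
  have mn: "m \<in> {1..n}" "n \<in> {1..n}" using m n by auto
  have *: "\<forall>h\<in>Ah. f + h - f - h \<in> T" if f: "f \<in> Ah" and fy: "\<And>i. i \<in> {1..n} \<Longrightarrow> f + y i - f - y i \<in> T" for f
  proof -
    have "Ah \<subseteq> {h \<in> Ah. f + h - f - h \<in> T}"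
    proof (rule Ah_subset[OF _ _ _ y(1)])
      show "add_subgroup {h \<in> Ah. f + h - f - h \<in> T}" by (rule add_subgroup_comm_set[OF T(1) Ah nrm])
      show "K l \<subseteq> {h \<in> Ah. f + h - f - h \<in> T}" using KT K_Ah nrm[OF f] T_diff by blast
    qed (use Ah_W y(2) fy in auto)
    then show ?thesis by blast
  qed
  have inv: "h + f - h - f \<in> T" if "f + h - f - h \<in> T" for f h
    using T_minus[OF that] by (simp add: grp del: add_uminus_conv_diff)
  have other: "f + y i - f - y i \<in> T" if "f \<in> Ah" "i \<in> {1..n} - {m, n}" for f i
    using nrm[OF that(1)] y(3)[OF that(2)] T_diff by blast
  have "\<forall>h\<in>Ah. y m + h - y m - h \<in> T"
  proof (rule *[OF y(2)[OF mn(1)]])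
    fix i assume "i \<in> {1..n}"
    then consider "i = m" | "i = n" | "i \<in> {1..n} - {m, n}" by auto
    then show "y m + y i - y m - y i \<in> T" using ymn other[OF y(2)[OF mn(1)]] T_zero by cases auto
  qed note m1 = this
  have "\<forall>h\<in>Ah. y n + h - y n - h \<in> T"
  proof (rule *[OF y(2)[OF mn(2)]])
    fix i assume "i \<in> {1..n}"
    then consider "i = m" | "i = n" | "i \<in> {1..n} - {m, n}" by auto
    then show "y n + y i - y n - y i \<in> T" using inv[OF ymn] other[OF y(2)[OF mn(2)]] T_zero by cases auto
  qed note n1 = this
  have "\<forall>h\<in>Ah. g + h - g - h \<in> T"
  proof (rule *[OF gh(1)])
    fix i assume "i \<in> {1..n}"
    then consider "i = m" | "i = n" | "i \<in> {1..n} - {m, n}" by auto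
    then show "g + y i - g - y i \<in> T" using inv m1 n1 other[OF gh(1)] gh(1) by cases auto
  qed
  then show ?thesis using gh by blast
qed

definition z where "z = a m + a n - a m - a n"

lemma z_Ah: "z \<in> Ah" unfolding z_def using am_Ah an_Ah Ah_add Ah_diff by simp

text \<open>The branch pair occupies 0 and \<open>r\<close>, its rotation by \<open>r\<close>
  occupies \<open>r\<close> and \<open>2 * r\<close>. They meet only at \<open>r\<close>, so their
  commutator is concentrated at one vertex and puts the commutator of \<open>x n\<close> and
  \<open>x m\<close> into \<open>B\<close>.\<close>

lemma z_generic:
  assumes "2 * r \<noteq> int d" shows "z \<in> B"
proof -
  have 2: "(2 * r) mod int d \<noteq> 0" "(2 * r) mod int d \<noteq> r"
  proof -
    have "(2 * r) mod int d = (if 2 * r < int d then 2 * r else 2 * r - int d)"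
      using r d_pos by (auto simp: mod_pos_pos_trivial) (smt (verit) mod_pos_pos_trivial mod_add_self2 minus_mod_self2)
    then show "(2 * r) mod int d \<noteq> 0" "(2 * r) mod int d \<noteq> r" using assms r by (auto split: if_splits)
  qed
  let ?h = "\<lambda>i. if i = r then x m else if i = (2 * r) mod int d then x n else 0"
  have "tup ?h \<in> Y" unfolding rot_pair[symmetric] by (intro Y_diff Y_add rot_Y x_pair)
  then have "pair (x m) (x n) + tup ?h - pair (x m) (x n) - tup ?h \<in> Y" by (intro Y_diff Y_add x_pair)
  also have "pair (x m) (x n) + tup ?h - pair (x m) (x n) - tup ?h = emb r (x n + x m - x n - x m)"
    unfolding pair_def emb_def tup_add[symmetric] tup_diff[symmetric] using 2 r
    by (intro tup_cong) (simp add: pr_def pos_def)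
  finally have "rot (- r) + emb r (x n + x m - x n - x m) - rot (- r) \<in> Y" by (intro Y_diff Y_add rot_Y)
  then have "emb 0 (x n + x m - x n - x m) \<in> Y" by (simp only: rot_emb) simp
  then have "x n + x m - x n - x m \<in> B" using xm_Ah xn_Ah Ah_add Ah_diff by (simp add: B_def)
  then have "- (x n + x m - x n - x m) \<in> B" by (rule add_subgroup_minus[OF B])
  then have "x m + x n - x m - x n \<in> B" by (simp add: grp del: add_uminus_conv_diff)
  then show ?thesis unfolding z_def
    by (intro commutators_in[OF B _ B_Ah B_normal x_gen x_Ah x_B _ am_Ah an_Ah]) auto
qed


lemma emb_commute_tup: "h 0 = 0 \<Longrightarrow> emb 0 g + tup h = tup h + emb 0 g"
  using tup_emb_conj[of h 0 g] by (simp add: diff_eq_eq)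

lemma a_n_tup: "\<exists>h. a n = tup h \<and> (\<forall>i. i \<noteq> 0 \<longrightarrow> i \<noteq> r \<longrightarrow> h i = 0) \<and> (n \<noteq> Suc m \<longrightarrow> h r = 0)"
proof (cases "n = Suc m")
  case True
  then show ?thesis using a_branch' by (intro exI[of _ "pr (a m) (a n)"]) (auto simp: pair_def pr_def)
next
  case False
  then have "a n = emb 0 (a (n - 1))" using a_step[of n] m by auto
  then show ?thesis using r by (intro exI[of _ "pos 0 (a (n - 1))"]) (auto simp: emb_def pos_def)
qed

text \<open>For \<open>m > 1\<close> the rotations lie in \<open>B\<close>, so \<open>a n\<close>
  may be rotated without changing it modulo \<open>B\<close>. A suitable rotation frees vertex 0,
  which is where \<open>a m\<close> acts, and the two then commute exactly.\<close>

lemma z_disjoint: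
  assumes "m > 1" "d > 2" shows "z \<in> B"
proof -
  have "rot 1 \<in> B" using a_B[of 1] a_1 assms m by auto
  then have rot_B: "rot k \<in> B" for k using add_subgroup_zmul[OF B, of "rot 1" k] by (simp flip: rot_zmul)
  obtain h where h: "a n = tup h" "\<And>i. i \<noteq> 0 \<Longrightarrow> i \<noteq> r \<Longrightarrow> h i = 0" using a_n_tup by blast
  \<comment> \<open>The rotated element has the section of \<open>a n\<close> from vertex
    \<open>int d - k\<close> at 0. This vertex must avoid 0 and \<open>r\<close>, which is possible
    as \<open>d > 2\<close>.\<close>
  define k where "k = (if r = int d - 1 then 2 else 1 :: int)"
  have k: "0 < k" "k < int d" "k + r \<noteq> int d" using assms r by (auto simp: k_def)
  have "(- k) mod int d = int d - k" using k(1,2) by (simp add: zmod_zminus1_eq_if)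
  then have h0: "h ((0 - k) mod int d) = 0" using k h(2) by simp
  define a' where "a' = rot k + a n - rot k"
  have a'_tup: "a' = tup (\<lambda>i. h ((i - k) mod int d))" unfolding a'_def h(1) rot_tup ..
  have "a m = emb 0 (a (m - 1))" using a_step[of m] assms m by auto
  then have comm: "a m + a' = a' + a m" unfolding a'_tup using emb_commute_tup[of "\<lambda>i. h ((i - k) mod int d)"] h0 by simp
  have a': "a' \<in> Ah" unfolding a'_def using rot_B B_Ah an_Ah Ah_add Ah_diff by blast
  have "rot k + (a n - rot k - a n) \<in> B"
    using B_normal[OF an_Ah add_subgroup_minus[OF B rot_B[of k]]] rot_B add_subgroup_add[OF B] by simp
  then have "eqB a' (a n)" using a' an_Ah by (simp add: cong_mod_def a'_def grp del: add_uminus_conv_diff)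
  then have "eqB (a m + a n - a m - a n) (a m + a' - a m - a')"
    by (intro AB.cong_diff AB.cong_add AB.cong_refl am_Ah) (auto intro: AB.cong_sym)
  moreover have "a m + a' - a m - a' = 0" by (simp add: comm)
  ultimately show ?thesis using z_Ah by (simp add: z_def AB.cong_iff_mem)
qed

lemma swap_pair: "2 * r = int d \<Longrightarrow> rot r + pair p q - rot r = pair q p"
  unfolding rot_pair unfolding pair_def using r by (intro tup_cong) (auto simp: pr_def)

lemma swap_Y: "2 * r = int d \<Longrightarrow> pair p q \<in> Y \<Longrightarrow> pair q p \<in> Y"
  using swap_pair[of p q] Y_add Y_diff rot_Y by metis

text \<open>
  Here \<open>x n\<close> commutes with its conjugate by \<open>x 1\<close> because their supports are disjoint. Since
  \<open>pair (x 1) (x n)\<close> and \<open>pair (x n) (x 1)\<close> both lie in \<open>Y\<close>, the roles of \<open>x 1\<close> and \<open>x n\<close> may be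
  exchanged modulo \<open>B\<close>.
\<close>

lemma z_central:
  assumes "m = 1" "d > 2" "2 * r = int d" "g \<in> Ah" shows "z + g - z - g \<in> B"
proof -
  have r2: "r \<ge> 2" using assms by simp
  obtain h where h: "a n = tup h" "\<And>i. i \<noteq> 0 \<Longrightarrow> i \<noteq> r \<Longrightarrow> h i = 0" using a_n_tup by blast
  obtain \<phi> \<psi> where \<phi>: "\<phi> \<in> A" "x 1 = \<phi> + a 1 - \<phi>" and \<psi>: "\<psi> \<in> A" "x n = \<psi> + a n - \<psi>"
    using x_conj[of 1] x_conj[of n] n by auto
  \<comment> \<open>This is \<open>x 1\<close> conjugated by \<open>- \<psi>\<close>, which at the
    same time turns \<open>x n\<close> into \<open>a n\<close>.\<close>
  define y where "y = (- \<psi> + \<phi>) + rot 1 - (- \<psi> + \<phi>)"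
  obtain k h' where h': "- \<psi> + \<phi> = rot k + tup h'" using A_split[of "- \<psi> + \<phi>"] \<phi> \<psi> A_add A_minus by blast
  have "y = rot k + (tup h' + rot 1) - tup h' - rot k" unfolding y_def h' by (simp add: grp del: add_uminus_conv_diff)
  also have "tup h' + rot 1 = rot 1 + tup (\<lambda>i. h' ((i + 1) mod int d))" by (rule tup_rot)
  also have "rot k + (rot 1 + tup (\<lambda>i. h' ((i + 1) mod int d))) - tup h' - rot k
      = rot (k + 1) + tup (\<lambda>i. h' ((i + 1) mod int d) - h' i) + rot (- k)"
    by (simp only: rot_add rot_minus tup_diff) (simp add: grp del: add_uminus_conv_diff)
  also have "\<dots> = rot 1 + tup (\<lambda>i. h' (((i - k) mod int d + 1) mod int d) - h' ((i - k) mod int d))"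
    by (simp add: tup_rot add.assoc) (simp flip: rot_add add.assoc)
  finally obtain q where y: "y = rot 1 + tup q" by blast
  have y_an: "y + a n - y = tup (\<lambda>i. q ((i - 1) mod int d) + h ((i - 1) mod int d) - q ((i - 1) mod int d))"
  proof -
    have "y + a n - y = rot 1 + (tup q + tup h - tup q) - rot 1" by (simp add: y h(1) grp del: add_uminus_conv_diff)
    then show ?thesis by (simp only: tup_conj rot_tup)
  qed
  have "a n + (y + a n - y) = (y + a n - y) + a n"
    unfolding y_an unfolding h(1) tup_add[symmetric]
  proof (rule tup_cong)
    fix i assume i: "0 \<le> i" "i < int d"
    \<comment> \<open>The sections of \<open>a n\<close> sit at 0 and \<open>r\<close>, those of its
      conjugate at 1 and \<open>r + 1\<close>. With \<open>2 * r = int d\<close> and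
      \<open>r \<ge> 2\<close> these positions are disjoint.\<close>
    have "h i = 0 \<or> h ((i - 1) mod int d) = 0"
    proof (rule ccontr)
      assume "\<not> ?thesis"
      then have "i = 0 \<or> i = r" "(i - 1) mod int d = 0 \<or> (i - 1) mod int d = r" using h(2) by blast+
      moreover have "i = 0 \<Longrightarrow> (i - 1) mod int d = int d - 1" using d2 by (simp add: zmod_minus1)
      moreover have "i = r \<Longrightarrow> (i - 1) mod int d = r - 1" using r by simp
      ultimately show False using r2 r assms(2,3) by linarith
    qed
    then show "h i + (q ((i - 1) mod int d) + h ((i - 1) mod int d) - q ((i - 1) mod int d)) =
        q ((i - 1) mod int d) + h ((i - 1) mod int d) - q ((i - 1) mod int d) + h i" by auto
  qed
  then have "\<psi> + (a n + (y + a n - y)) - \<psi> = \<psi> + ((y + a n - y) + a n) - \<psi>" by simp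
  then have comm: "x n + (x 1 + x n - x 1) = (x 1 + x n - x 1) + x n"
    unfolding \<phi>(2) \<psi>(2) y_def a_1 by (simp add: grp del: add_uminus_conv_diff)
  let ?p = "pair (x 1) (x n)" and ?p' = "pair (x n) (x 1)"
  have pY: "?p \<in> Y" "?p' \<in> Y" using x_pair swap_Y assms by auto
  \<comment> \<open>The first component of this commutator vanishes by \<open>comm\<close>; the
    second then stands alone and, after a swap, gives an element of \<open>B\<close>.\<close>
  have "?p' + (?p + ?p' - ?p) - ?p' - (?p + ?p' - ?p) \<in> Y" by (intro Y_diff Y_add pY)
  also have "?p' + (?p + ?p' - ?p) - ?p' - (?p + ?p' - ?p) =
     pair (x n + (x 1 + x n - x 1) - x n - (x 1 + x n - x 1)) (x 1 + (x n + x 1 - x n) - x 1 - (x n + x 1 - x n))"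
    by (simp only: diff_conv_add_uminus pair_minus[symmetric] pair_add[symmetric])
  also have "x n + (x 1 + x n - x 1) - x n - (x 1 + x n - x 1) = 0" unfolding comm by simp
  finally have "pair 0 (x 1 + (x n + x 1 - x n) - x 1 - (x n + x 1 - x n)) \<in> Y" .
  then have "emb 0 (x 1 + (x n + x 1 - x n) - x 1 - (x n + x 1 - x n)) \<in> Y"
    using swap_Y[OF assms(3)] by (fastforce simp: pair_eq_emb)
  moreover have x1: "x 1 \<in> Ah" using x_Ah[of 1] n by auto
  ultimately have e: "x 1 + (x n + x 1 - x n) - x 1 - (x n + x 1 - x n) \<in> B"
    using xn_Ah Ah_add Ah_diff by (simp add: B_def)
  \<comment> \<open>The centre of \<open>Ah\<close> modulo \<open>B\<close>. It is enough to put the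
    commutator of \<open>x m\<close> and \<open>x n\<close> into it: then all commutators of
    \<open>Ah\<close>, in particular \<open>z\<close>, lie in \<open>Z\<close>.\<close>
  define Z where "Z = {c \<in> Ah. \<forall>g\<in>Ah. c + g - c - g \<in> B}"
  have inv: "g + c - g - c \<in> B" if "c + g - c - g \<in> B" for c g
    using add_subgroup_minus[OF B that] by (simp add: grp del: add_uminus_conv_diff)
  have Z_eq: "Z = {c \<in> Ah. \<forall>g\<in>Ah. g + c - g - c \<in> B}" unfolding Z_def using inv by blast
  have Z: "add_subgroup Z"
  proof -
    have "Z = Ah \<inter> (\<Inter>g\<in>Ah. {c \<in> Ah. g + c - g - c \<in> B})" unfolding Z_eq by blast
    moreover have "add_subgroup {c \<in> Ah. g + c - g - c \<in> B}" for g
      by (rule add_subgroup_comm_set[OF B Ah B_normal])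
    ultimately show ?thesis using Ah by (auto simp: add_subgroup_def)
  qed
  have Z_B: "B \<subseteq> Z" unfolding Z_eq using B_Ah B_normal add_subgroup_diff[OF B] by blast
  have Z_normal: "g + c - g \<in> Z" if g: "g \<in> Ah" and c: "c \<in> Z" for g c
  proof -
    have "g + c - g - c \<in> B" using g c unfolding Z_eq by blast
    then have "(g + c - g - c) + c \<in> Z" using Z_B c add_subgroup_add[OF Z] by blast
    then show ?thesis by simp
  qed
  define f where "f = x 1 + x n - x 1 - x n"
  have f: "f \<in> Ah" unfolding f_def using x1 xn_Ah Ah_add Ah_diff by simp
  have "Ah \<subseteq> {h \<in> Ah. f + h - f - h \<in> B}"
  proof (rule Ah_subset[OF _ _ _ x_gen])
    show "add_subgroup {h \<in> Ah. f + h - f - h \<in> B}" by (rule add_subgroup_comm_set[OF B Ah B_normal])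
    show "K l \<subseteq> {h \<in> Ah. f + h - f - h \<in> B}" using K_B K_Ah B_normal[OF f] add_subgroup_diff[OF B] by blast
    fix i assume i: "i \<in> {1..n}"
    then consider "i = 1" | "i = n" | "i \<in> {1..n} - {m, n}" using assms by auto
    then show "x i \<in> {h \<in> Ah. f + h - f - h \<in> B}"
    proof cases
      case 1
      let ?w = "x n + x 1 - x n"
      have "x 1 + (- ?w + (x 1 + ?w - x 1 - ?w) - (- ?w)) - x 1 \<in> B"
        using e x1 xn_Ah by (intro B_normal Ah_add Ah_diff Ah_minus)
      also have "x 1 + (- ?w + (x 1 + ?w - x 1 - ?w) - (- ?w)) - x 1 = f + x 1 - f - x 1"
        by (simp add: f_def grp del: add_uminus_conv_diff)
      finally show ?thesis using 1 x1 by simp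
    next
      case 2
      have "f + x n - f - x n = (x 1 + x n - x 1) + x n - (x 1 + x n - x 1) - x n"
        unfolding f_def by (simp add: grp del: add_uminus_conv_diff)
      also have "\<dots> = 0" unfolding comm[symmetric] by simp
      finally show ?thesis using 2 xn_Ah add_subgroup_zero[OF B] by simp
    next
      case 3
      then show ?thesis using x_B[OF 3] x_Ah[OF i] B_normal[OF f] add_subgroup_diff[OF B] by blast
    qed
  qed (use Ah_W in auto)
  then have "f \<in> Z" using f unfolding Z_def by blast
  then have "z \<in> Z" unfolding z_def f_def using x_B Z_B assms(1) Z_eq
    by (intro commutators_in[OF Z Z_B _ Z_normal x_gen x_Ah _ _ am_Ah an_Ah]) auto
  then show ?thesis using assms(4) unfolding Z_def by blast
qed

text \<open>Modulo \<open>B\<close> both \<open>a m\<close> and \<open>a n\<close> are involutions,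
  so they generate a dihedral group and each of them inverts their commutator.\<close>

lemma z_dihedral:
  assumes "d = 2"
  shows "eqB (a m + z - a m) (- z)" "eqB (a n + z - a n) (- z)"
proof -
  have k: "a m + a m \<in> B" "a n + a n \<in> B" using involutions[OF assms, of _ l] K_B m n by auto
  have "(a m + a m) + (a n + - (a m + a m) - a n) \<in> B"
    using k B_normal[OF an_Ah add_subgroup_minus[OF B k(1)]] add_subgroup_add[OF B] by blast
  also have "(a m + a m) + (a n + - (a m + a m) - a n) = (a m + z - a m) - (- z)"
    by (simp add: z_def grp del: add_uminus_conv_diff)
  finally show "eqB (a m + z - a m) (- z)" using z_Ah am_Ah Ah_add Ah_diff Ah_minus by (simp add: cong_mod_def)
  let ?g = "a n + a m + a n - a m"
  have "?g \<in> Ah" "a n + a m \<in> Ah" by (intro Ah_add Ah_diff am_Ah an_Ah)+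
  then have "(?g + - (a n + a n) - ?g) + ((a n + a m) + (a n + a n) - (a n + a m)) \<in> B"
    using add_subgroup_add[OF B] B_normal add_subgroup_minus[OF B k(2)] k(2) by blast
  also have "(?g + - (a n + a n) - ?g) + ((a n + a m) + (a n + a n) - (a n + a m)) = (a n + z - a n) - (- z)"
    by (simp add: z_def grp del: add_uminus_conv_diff)
  finally show "eqB (a n + z - a n) (- z)" using z_Ah an_Ah Ah_add Ah_diff Ah_minus by (simp add: cong_mod_def)
qed

text \<open>Both generators act through the same sign. The link between \<open>e = - 1\<close> and
  \<open>d = 2\<close> is recorded because the order of \<open>z\<close> is then a power of 2 at
  each level.\<close>

definition z_action :: "int \<Rightarrow> bool" where
  "z_action e \<longleftrightarrow> (e = 1 \<or> e = - 1 \<and> d = 2) \<and> eqB (a m + z - a m) (zmul e z) \<and> eqB (a n + z - a n) (zmul e z)"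

text \<open>What remains besides \<open>2 * r \<noteq> int d\<close> and the case
  \<open>m > 1\<close>, \<open>d > 2\<close> is a half turn with \<open>m = 1\<close> and
  \<open>d > 2\<close>, where \<open>z\<close> is central modulo \<open>B\<close>, or with
  \<open>d = 2\<close>, where the dihedral relation holds.\<close>

lemma z_cases: "z \<in> B \<or> 2 * r = int d \<and> (\<exists>e. z_action e)"
proof -
  consider "2 * r \<noteq> int d" | "m > 1" "d > 2" | "2 * r = int d" "m = 1" "d > 2" | "2 * r = int d" "d = 2"
    using m d2 by fastforce
  then show ?thesis
  proof cases
    case 3
    have "eqB (g + z - g) z" if "g \<in> Ah" for g
    proof -
      have "- (z + g - z - g) \<in> B" using z_central[OF 3(2,3,1) that] add_subgroup_minus[OF B] by blast
      then show ?thesis using that z_Ah Ah_add Ah_diff by (simp add: cong_mod_def grp del: add_uminus_conv_diff)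
    qed
    then have "z_action 1" using am_Ah an_Ah by (simp add: z_action_def)
    then show ?thesis using 3 by blast
  next
    case 4
    have "z_action (- 1)" unfolding z_action_def zmul_minus_one using z_dihedral[OF 4(2)] 4(2) by blast
    then show ?thesis using 4 by blast
  qed (use z_generic z_disjoint in auto)
qed

end

section \<open>The normal subgroup generated by \<open>z\<close> and the abelian quotient\<close>

context branch_context
begin

text \<open>The elements acting on \<open>z\<close> by a sign modulo \<open>B\<close> form a
  subgroup, and it contains all generators: those in \<open>B\<close> act trivially, the other two
  by \<open>z_action\<close>.\<close>

lemma z_conj: assumes "g \<in> Ah" shows "\<exists>e. (e = 1 \<or> e = - 1) \<and> eqB (g + z - g) (zmul e z)"
proof (cases "z \<in> B")
  case True
  then have "g + z - g - z \<in> B" using B_normal assms add_subgroup_diff[OF B] by blast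
  then show ?thesis using assms z_Ah Ah_add Ah_diff by (intro exI[of _ 1]) (simp add: cong_mod_def)
next
  case False
  then obtain e where e: "z_action e" using z_cases by blast
  let ?M = "{g \<in> Ah. \<exists>e. (e = 1 \<or> e = - 1) \<and> eqB (g + z - g) (zmul e z)}"
  have "Ah \<subseteq> ?M"
  proof (rule Ah_subset[OF _ _ _ a_gen])
    have triv: "g \<in> ?M" if "g \<in> B" for g
    proof -
      have "g + (z - g - z) \<in> B"
        using B_normal[OF z_Ah add_subgroup_minus[OF B that]] that add_subgroup_add[OF B] by simp
      then have "eqB (g + z - g) (zmul 1 z)" using that B_Ah z_Ah Ah_add Ah_diff
        by (simp add: cong_mod_def subset_iff grp del: add_uminus_conv_diff)
      then show ?thesis using that B_Ah by blast
    qed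
    show "add_subgroup ?M"
    proof (rule add_subgroupI)
      show "0 \<in> ?M" by (rule triv) (rule add_subgroup_zero[OF B])
    next
      fix g h assume "g \<in> ?M" "h \<in> ?M"
      then obtain e e' where g: "g \<in> Ah" "e = 1 \<or> e = - 1" "eqB (g + z - g) (zmul e z)"
        and h: "h \<in> Ah" "e' = 1 \<or> e' = - 1" "eqB (h + z - h) (zmul e' z)" by blast
      have "(g + h) + z - (g + h) = g + (h + z - h) - g" by (simp add: grp del: add_uminus_conv_diff)
      also have "eqB \<dots> (g + zmul e' z - g)" by (intro AB.cong_conj AB.cong_refl g h)
      also have "g + zmul e' z - g = zmul e' (g + z - g)" by (simp add: zmul_conj)
      also have "eqB \<dots> (zmul e' (zmul e z))" by (intro AB.cong_zmul g)
      finally have "eqB ((g + h) + z - (g + h)) (zmul (e' * e) z)" by (simp add: zmul_zmul)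
      moreover have "e' * e = 1 \<or> e' * e = - 1" using g(2) h(2) by auto
      ultimately show "g + h \<in> ?M" using g(1) h(1) Ah_add by blast
    next
      fix g assume "g \<in> ?M"
      then obtain e where g: "g \<in> Ah" "e = 1 \<or> e = - 1" "eqB (g + z - g) (zmul e z)" by blast
      have ee: "e * e = 1" using g(2) by auto
      have "eqB (zmul e (g + z - g)) (zmul (e * e) z)" using AB.cong_zmul[OF g(3), of e] by (simp add: zmul_zmul)
      then have "eqB (g + zmul e z - g) z" by (simp add: zmul_conj ee)
      then have "eqB (- g + (g + zmul e z - g) - (- g)) (- g + z - (- g))" by (intro AB.cong_conj AB.cong_refl Ah_minus g)
      moreover have "- g + (g + zmul e z - g) - (- g) = zmul e z" by (simp add: grp del: add_uminus_conv_diff)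
      ultimately have "eqB (- g + z - (- g)) (zmul e z)" using AB.cong_sym by simp
      then show "- g \<in> ?M" using g Ah_minus by blast
    qed
    show "K l \<subseteq> ?M" using K_B triv by blast
    fix i assume "i \<in> {1..n}"
    then consider "i = m" | "i = n" | "i \<in> {1..n} - {m, n}" by auto
    then show "a i \<in> ?M" using e am_Ah an_Ah a_B triv unfolding z_action_def by cases blast+
  qed (use Ah_W in auto)
  then show ?thesis using assms by blast
qed

text \<open>The subgroup generated by \<open>z\<close> and \<open>B\<close>; it is normal in
  \<open>Ah\<close> because conjugation changes \<open>z\<close> only by a sign modulo
  \<open>B\<close>.\<close>

definition N where "N = {zmul q z + b | q b. b \<in> B}"

lemma N_Ah: "N \<subseteq> Ah"
  using add_subgroup_zmul[OF Ah z_Ah] Ah_add B_Ah by (auto simp: N_def)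

lemma N_eqB: "y \<in> N \<longleftrightarrow> (\<exists>q. eqB y (zmul q z))"
proof
  assume "y \<in> N"
  then obtain q b where y: "y = zmul q z + b" "b \<in> B" by (auto simp: N_def)
  have q: "zmul q z \<in> Ah" by (rule add_subgroup_zmul[OF Ah z_Ah])
  have "y - zmul q z \<in> B" using B_normal[OF q y(2)] by (simp add: y)
  then show "\<exists>q. eqB y (zmul q z)" using q \<open>y \<in> N\<close> N_Ah by (auto simp: cong_mod_def)
next
  assume "\<exists>q. eqB y (zmul q z)"
  then obtain q where y: "eqB y (zmul q z)" ..
  then have "- zmul q z + (y - zmul q z) - (- zmul q z) \<in> B"
    by (intro B_normal Ah_minus) (auto simp: cong_mod_def)
  then have "- zmul q z + y \<in> B" by (simp add: grp del: add_uminus_conv_diff)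
  moreover have "y = zmul q z + (- zmul q z + y)" by (simp add: grp del: add_uminus_conv_diff)
  ultimately show "y \<in> N" unfolding N_def by blast
qed

lemma N: "add_subgroup N"
proof (rule add_subgroupI)
  show "0 \<in> N" unfolding N_eqB by (intro exI[of _ 0]) (simp add: AB.cong_refl Ah_zero)
next
  fix x y assume "x \<in> N" "y \<in> N"
  then obtain q q' where "eqB x (zmul q z)" "eqB y (zmul q' z)" unfolding N_eqB by blast
  then have "eqB (x + y) (zmul (q + q') z)" unfolding zmul_add by (rule AB.cong_add)
  then show "x + y \<in> N" unfolding N_eqB by blast
next
  fix x assume "x \<in> N"
  then obtain q where "eqB x (zmul q z)" unfolding N_eqB by blast
  then have "eqB (- x) (zmul (- q) z)" unfolding zmul_uminus by (rule AB.cong_minus)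
  then show "- x \<in> N" unfolding N_eqB by blast
qed

lemma N_normal: assumes "g \<in> Ah" "y \<in> N" shows "g + y - g \<in> N"
proof -
  obtain q where q: "eqB y (zmul q z)" using assms N_eqB by blast
  obtain e where e: "eqB (g + z - g) (zmul e z)" using z_conj assms by blast
  have "eqB (g + y - g) (g + zmul q z - g)" by (intro AB.cong_conj AB.cong_refl assms q)
  also have "g + zmul q z - g = zmul q (g + z - g)" by (simp add: zmul_conj)
  also have "eqB \<dots> (zmul q (zmul e z))" by (intro AB.cong_zmul e)
  finally show ?thesis unfolding N_eqB zmul_zmul by blast
qed

lemma B_N: "B \<subseteq> N"
proof
  fix b assume "b \<in> B"
  then have "b = zmul 0 z + b" "b \<in> B" by simp_all
  then show "b \<in> N" unfolding N_def by blast
qed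

sublocale AN: add_normal Ah N
  using Ah N N_Ah N_normal by unfold_locales

lemma z_N: "z \<in> N" unfolding N_eqB by (intro exI[of _ 1]) (simp add: AB.cong_refl z_Ah)

lemma commutator_N: "g \<in> Ah \<Longrightarrow> h \<in> Ah \<Longrightarrow> g + h - g - h \<in> N"
  by (rule commutators_in[OF N B_N N_Ah N_normal a_gen a_Ah])
    (use a_B B_N z_N in \<open>auto simp flip: z_def\<close>)

lemma commute_N: assumes "g \<in> Ah" "h \<in> Ah" shows "cong_mod Ah N (g + h) (h + g)"
  using commutator_N[OF assms] assms Ah_add by (simp add: cong_mod_def grp del: add_uminus_conv_diff)

text \<open>The quotient of \<open>Ah\<close> by \<open>N\<close> is abelian, and of the generators
  only \<open>a m\<close> and \<open>a n\<close> are non-trivial in it.\<close>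

lemma normal_form:
  assumes "v \<in> Ah" shows "\<exists>i j. cong_mod Ah N v (zmul i (a m) + zmul j (a n))"
proof -
  let ?F = "{g \<in> Ah. \<exists>i j. cong_mod Ah N g (zmul i (a m) + zmul j (a n))}"
  have zm: "zmul i (a m) \<in> Ah" "zmul i (a n) \<in> Ah" for i using add_subgroup_zmul[OF Ah] am_Ah an_Ah by auto
  have triv: "g \<in> ?F" if "g \<in> N" for g
    using that N_Ah by (auto simp: AN.cong_iff_mem intro!: exI[of _ 0])
  have "Ah \<subseteq> ?F"
  proof (rule Ah_subset[OF _ _ _ a_gen])
    show "add_subgroup ?F"
    proof (rule add_subgroupI)
      show "0 \<in> ?F" by (rule triv) (rule add_subgroup_zero[OF N])
    next
      fix g h assume "g \<in> ?F" "h \<in> ?F"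
      then obtain i j i' j' where g: "g \<in> Ah" "cong_mod Ah N g (zmul i (a m) + zmul j (a n))"
        and h: "h \<in> Ah" "cong_mod Ah N h (zmul i' (a m) + zmul j' (a n))" by blast
      have "cong_mod Ah N (g + h) ((zmul i (a m) + zmul j (a n)) + (zmul i' (a m) + zmul j' (a n)))"
        by (intro AN.cong_add g h)
      also have "(zmul i (a m) + zmul j (a n)) + (zmul i' (a m) + zmul j' (a n)) =
          zmul i (a m) + (zmul j (a n) + zmul i' (a m)) + zmul j' (a n)" by (simp add: add.assoc)
      also have "cong_mod Ah N \<dots> (zmul i (a m) + (zmul i' (a m) + zmul j (a n)) + zmul j' (a n))"
        by (intro AN.cong_add AN.cong_refl commute_N zm)
      also have "\<dots> = zmul (i + i') (a m) + zmul (j + j') (a n)" by (simp add: zmul_add add.assoc)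
      finally show "g + h \<in> ?F" using g h Ah_add by blast
    next
      fix g assume "g \<in> ?F"
      then obtain i j where g: "g \<in> Ah" "cong_mod Ah N g (zmul i (a m) + zmul j (a n))" by blast
      have "cong_mod Ah N (- g) (- (zmul i (a m) + zmul j (a n)))" by (intro AN.cong_minus g)
      also have "- (zmul i (a m) + zmul j (a n)) = zmul (- j) (a n) + zmul (- i) (a m)" by (simp add: minus_add zmul_uminus)
      also have "cong_mod Ah N \<dots> (zmul (- i) (a m) + zmul (- j) (a n))" by (intro commute_N zm)
      finally show "- g \<in> ?F" using g Ah_minus by blast
    qed
    show "K l \<subseteq> ?F" using K_B B_N triv by blast
    fix i assume "i \<in> {1..n}"
    then consider "i = m" | "i = n" | "i \<in> {1..n} - {m, n}" by auto
    then show "a i \<in> ?F"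
    proof cases
      case 1
      then have "cong_mod Ah N (a i) (zmul 1 (a m) + zmul 0 (a n))" using am_Ah by (simp add: AN.cong_refl)
      then show ?thesis using am_Ah 1 by blast
    next
      case 2
      then have "cong_mod Ah N (a i) (zmul 0 (a m) + zmul 1 (a n))" using an_Ah by (simp add: AN.cong_refl)
      then show ?thesis using an_Ah 2 by blast
    next
      case 3
      then show ?thesis using triv a_B B_N by blast
    qed
  qed (use Ah_W in auto)
  then show ?thesis using assms by blast
qed

section \<open>Conjugating a pair of generators\<close>

text \<open>An element \<open>tup h\<close> of \<open>Y\<close> conjugates \<open>a m\<close> by
  \<open>h 0\<close> and \<open>a n\<close> by \<open>h r\<close>. Writing
  \<open>h r = h 0 + v\<close> shows that \<open>V\<close> consists of the relative conjugators that
  \<open>Y\<close> can realise.\<close>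

definition V where "V = {- h 0 + h r | h. tup h \<in> Y \<and> (\<forall>i. h i \<in> Ah)}"

lemma V_I: "tup h \<in> Y \<Longrightarrow> (\<And>i. h i \<in> Ah) \<Longrightarrow> v = - h 0 + h r \<Longrightarrow> v \<in> V"
  unfolding V_def by blast

lemma V_step: assumes "v \<in> V" "pair p q \<in> Y" "p \<in> Ah" "q \<in> Ah" shows "- p + v + q \<in> V"
proof -
  obtain h where h: "v = - h 0 + h r" "tup h \<in> Y" "\<forall>i. h i \<in> Ah" using assms(1) unfolding V_def by blast
  show ?thesis
  proof (rule V_I[of "\<lambda>i. h i + pr p q i"])
    show "tup (\<lambda>i. h i + pr p q i) \<in> Y" using h assms Y_add by (simp add: tup_add flip: pair_def)
    show "h i + pr p q i \<in> Ah" for i using h(3) assms Ah_add Ah_zero by (simp add: pr_def)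
    show "- p + v + q = - (h 0 + pr p q 0) + (h r + pr p q r)"
      using r by (simp add: h(1) pr_def grp del: add_uminus_conv_diff)
  qed
qed

lemma V_0: "0 \<in> V"
  by (rule V_I[of "\<lambda>_. 0"]) (simp_all add: Y_zero Ah_zero)

lemma V_B: "v \<in> V \<Longrightarrow> b \<in> B \<Longrightarrow> v + b \<in> V"
  using V_step[of v 0 b] pair_B[of 0 b] add_subgroup_zero[OF B] Ah_zero B_Ah by auto

context
  assumes branch_Y: "pair (a m) (a n) \<in> Y"
begin

lemma pair_z: assumes "2 * r = int d" shows "pair z (- z) \<in> Y"
proof -
  let ?p = "pair (a m) (a n)" and ?p' = "pair (a n) (a m)"
  have "?p + ?p' - ?p - ?p' \<in> Y" by (intro Y_diff Y_add branch_Y swap_Y[OF assms branch_Y])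
  also have "?p + ?p' - ?p - ?p' = pair z (a n + a m - a n - a m)"
    by (simp only: diff_conv_add_uminus pair_minus[symmetric] pair_add[symmetric] z_def)
  also have "a n + a m - a n - a m = - z" by (simp add: z_def grp del: add_uminus_conv_diff)
  finally show ?thesis .
qed

text \<open>The pair of \<open>z\<close> and \<open>- z\<close> shifts the exponent by 2 in either
  direction. The negated branch pair followed by its swap produces the exponent -1, so both parities
  are reached.\<close>

lemma V_zmul: "zmul q z \<in> V"
proof (cases "z \<in> B")
  case True
  then show ?thesis using V_B[OF V_0, of "zmul q z"] add_subgroup_zmul[OF B] by simp
next
  case False
  then have r2: "2 * r = int d" using z_cases by blast
  have pz: "pair z (- z) \<in> Y" "pair (- z) z \<in> Y"
    using pair_z[OF r2] Y_minus[OF pair_z[OF r2]] by (auto simp flip: pair_minus)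
  have up: "zmul (q + 2) z \<in> V" if "zmul q z \<in> V" for q
  proof -
    have "- (- z) + zmul q z + z \<in> V" by (rule V_step[OF that pz(2)]) (auto intro: z_Ah Ah_minus)
    also have "- (- z) + zmul q z + z = zmul (1 + q + 1) z" by (simp only: zmul_add zmul_1 minus_minus)
    finally show ?thesis by (simp add: algebra_simps)
  qed
  have down: "zmul (q - 2) z \<in> V" if "zmul q z \<in> V" for q
  proof -
    have "- z + zmul q z + - z \<in> V" by (rule V_step[OF that pz(1)]) (auto intro: z_Ah Ah_minus)
    also have "- z + zmul q z + - z = zmul (- 1 + q + - 1) z" by (simp only: zmul_add zmul_minus_one)
    finally show ?thesis by (simp add: algebra_simps)
  qed
  have "pair (- a m) (- a n) \<in> Y" "pair (- a n) (- a m) \<in> Y"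
    using Y_minus[OF branch_Y] Y_minus[OF swap_Y[OF r2 branch_Y]] by (simp_all add: pair_minus)
  then have "- (- a n) + (- (- a m) + 0 + - a n) + - a m \<in> V"
    using V_step[OF V_step[OF V_0, of "- a m" "- a n"], of "- a n" "- a m"] am_Ah an_Ah Ah_minus by blast
  also have "- (- a n) + (- (- a m) + 0 + - a n) + - a m = zmul (- 1) z" by (simp add: z_def grp del: add_uminus_conv_diff)
  finally have odd: "zmul (- 1) z \<in> V" .
  have even: "zmul (2 * k) z \<in> V" for k
  proof (induction k rule: int_induct[where k = 0])
    case (step1 k) then show ?case using up[of "2 * k"] by (simp add: algebra_simps)
  next
    case (step2 k) then show ?case using down[of "2 * k"] by (simp add: algebra_simps)
  qed (simp add: V_0)
  have odd: "zmul (2 * k - 1) z \<in> V" for k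
  proof (induction k rule: int_induct[where k = 0])
    case base show ?case using odd by simp
  next
    case (step1 k) then show ?case using up[of "2 * k - 1"] by (simp add: algebra_simps)
  next
    case (step2 k) then show ?case using down[of "2 * k - 1"] by (simp add: algebra_simps)
  qed
  show ?thesis using even[of "q div 2"] odd[of "q div 2 + 1"] by (cases "even q") (auto elim!: evenE oddE simp: add.commute)
qed

text \<open>Up to \<open>B\<close>, \<open>v\<close> is a power of \<open>a m\<close>, then a power
  of \<open>z\<close>, then a power of \<open>a n\<close>. A power of the branch pair supplies the
  left factor at the cost of another power of \<open>a n\<close>, \<open>V_zmul\<close> supplies the
  middle one, and powers of \<open>a n\<close> on the right do not affect the conjugate of
  \<open>a n\<close>.\<close>

lemma conj_pair:
  assumes v: "v \<in> Ah"
  shows "\<exists>h. tup h \<in> Y \<and> (\<forall>i. h i \<in> Ah) \<and>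
    tup h + pair (a m) (a n) - tup h = pair (h 0 + a m - h 0) (h 0 + (v + a n - v) - h 0)"
proof -
  obtain i j where ij: "cong_mod Ah N v (zmul i (a m) + zmul j (a n))" using normal_form v by blast
  have zm: "zmul k (a m) \<in> Ah" "zmul k (a n) \<in> Ah" for k using add_subgroup_zmul[OF Ah] am_Ah an_Ah by auto
  let ?i = "zmul i (a m)" and ?j = "zmul j (a n)"
  have "v - (?i + ?j) \<in> N" using ij by (simp add: cong_mod_def)
  then have "- ?i + (v - (?i + ?j)) - (- ?i) \<in> N" by (intro N_normal Ah_minus zm)
  then obtain q b where qb: "- ?i + (v - (?i + ?j)) - (- ?i) = zmul q z + b" "b \<in> B" unfolding N_def by blast
  then have "zmul q z + b \<in> V" using V_B V_zmul by blast
  moreover have "pair (zmul (- i) (a m)) (zmul (- i) (a n)) \<in> Y"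
    using add_subgroup_zmul[OF Y branch_Y, of "- i"] by (simp add: pair_zmul)
  ultimately have "- zmul (- i) (a m) + (zmul q z + b) + zmul (- i) (a n) \<in> V" by (rule V_step[OF _ _ zm])
  then obtain h where h: "- zmul (- i) (a m) + (zmul q z + b) + zmul (- i) (a n) = - h 0 + h r"
    "tup h \<in> Y" "\<forall>i. h i \<in> Ah" unfolding V_def by blast
  have "v = - h 0 + h r + zmul (i + j) (a n)"
    unfolding h(1)[symmetric] qb(1)[symmetric] by (simp add: zmul_uminus zmul_add grp del: add_uminus_conv_diff)
  moreover have "zmul k (a n) + a n - zmul k (a n) = a n" for k
    using zmul_add[of k 1 "a n"] zmul_add[of 1 k "a n"] by (simp add: add.commute[of 1 k] diff_eq_eq)
  ultimately have "v + a n - v = (- h 0 + h r) + a n - (- h 0 + h r)"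
    by (simp add: grp del: add_uminus_conv_diff) (metis add.assoc diff_conv_add_uminus)
  then have "h 0 + (v + a n - v) - h 0 = h r + a n - h r" by (simp add: grp del: add_uminus_conv_diff)
  then show ?thesis using h(2,3) by (intro exI[of _ h]) (simp add: tup_pair_conj)
qed

end

end

section \<open>Displacement of the branch pair by elements of \<open>A\<close>\<close>

context branch_context
begin

lemma conj_z_minus:
  assumes "g \<in> Ah" "e = 1 \<or> e = - 1" "eqB (g + z - g) (zmul e z)"
  shows "eqB (- g + z - (- g)) (zmul e z)"
proof -
  have ee: "e * e = 1" using assms(2) by auto
  have "eqB (zmul e (g + z - g)) (zmul (e * e) z)" using AB.cong_zmul[OF assms(3), of e] by (simp add: zmul_zmul)
  then have "eqB (g + zmul e z - g) z" by (simp add: zmul_conj ee)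
  then have "eqB (- g + (g + zmul e z - g) - (- g)) (- g + z - (- g))" by (intro AB.cong_conj AB.cong_refl Ah_minus assms)
  moreover have "- g + (g + zmul e z - g) - (- g) = zmul e z" by (simp add: grp del: add_uminus_conv_diff)
  ultimately show ?thesis using AB.cong_sym by simp
qed

lemma conj_z_zmul:
  assumes "eqB (g + z - g) (zmul e z)" shows "eqB (g + zmul k z - g) (zmul (k * e) z)"
  using AB.cong_zmul[OF assms, of k] by (simp add: zmul_conj zmul_zmul)

lemma push_z:
  assumes "g \<in> Ah" "eqB (g + z - g) (zmul e z)" shows "eqB (g + zmul k z) (zmul (k * e) z + g)"
  using AB.cong_add[OF conj_z_zmul[OF assms(2), of k] AB.cong_refl[OF assms(1)]] by simp

lemma zmul_z_Ah: "zmul k z \<in> Ah" by (rule add_subgroup_zmul[OF Ah z_Ah])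

text \<open>
  How a pair of sections at the positions \<open>s\<close> and \<open>s + r\<close> moves the pair \<open>(a m, a n)\<close>: the two
  displacements are inverse powers of \<open>z\<close>.
\<close>

definition acts :: "'a \<Rightarrow> 'a \<Rightarrow> bool" where
  "acts g g' \<longleftrightarrow> g \<in> Ah \<and> g' \<in> Ah \<and> (\<exists>j e. (e = 1 \<or> e = - 1) \<and>
     eqB (g + z - g) (zmul e z) \<and> eqB (g' + z - g') (zmul e z) \<and>
     eqB (g + a m - g) (zmul j z + a m) \<and> eqB (g' + a n - g') (zmul (- j) z + a n))"

lemma actsI:
  "g \<in> Ah \<Longrightarrow> g' \<in> Ah \<Longrightarrow> e = 1 \<or> e = - 1 \<Longrightarrow> eqB (g + z - g) (zmul e z) \<Longrightarrow> eqB (g' + z - g') (zmul e z) \<Longrightarrow>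
   eqB (g + a m - g) (zmul j z + a m) \<Longrightarrow> eqB (g' + a n - g') (zmul (- j) z + a n) \<Longrightarrow> acts g g'"
  unfolding acts_def by blast

lemma conj_add_z:
  assumes g: "g \<in> Ah" and gz: "eqB (g + z - g) (zmul e z)" and gx: "eqB (g + y - g) (zmul j z + y)"
    and hx: "eqB (h + y - h) (zmul j' z + y)"
  shows "eqB ((g + h) + y - (g + h)) (zmul (j' * e + j) z + y)"
proof -
  have "(g + h) + y - (g + h) = g + (h + y - h) - g" by (simp add: grp del: add_uminus_conv_diff)
  also have "eqB \<dots> (g + (zmul j' z + y) - g)" by (intro AB.cong_conj AB.cong_refl g hx)
  also have "g + (zmul j' z + y) - g = (g + zmul j' z - g) + (g + y - g)" by (simp add: grp del: add_uminus_conv_diff)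
  also have "eqB \<dots> (zmul (j' * e) z + (zmul j z + y))" by (intro AB.cong_add conj_z_zmul gz gx)
  finally show ?thesis by (simp add: zmul_add add.assoc)
qed

lemma conj_minus_z:
  assumes g: "g \<in> Ah" and e: "e = 1 \<or> e = - 1" and gz: "eqB (g + z - g) (zmul e z)" and gx: "eqB (g + y - g) (zmul j z + y)"
    and y: "y \<in> Ah"
  shows "eqB (- g + y - (- g)) (zmul (- (j * e)) z + y)"
proof -
  have "eqB (- g + (g + y - g) - (- g)) (- g + (zmul j z + y) - (- g))" by (intro AB.cong_conj AB.cong_refl Ah_minus g gx)
  also have "- g + (zmul j z + y) - (- g) = (- g + zmul j z - (- g)) + (- g + y - (- g))"
    by (simp add: grp del: add_uminus_conv_diff)
  also have "eqB \<dots> (zmul (j * e) z + (- g + y - (- g)))"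
    by (intro AB.cong_add conj_z_zmul conj_z_minus g e gz AB.cong_refl Ah_add Ah_diff Ah_minus y)
  finally have "eqB y (zmul (j * e) z + (- g + y - (- g)))" by (simp add: grp del: add_uminus_conv_diff)
  then have "eqB (- zmul (j * e) z + y) (- zmul (j * e) z + (zmul (j * e) z + (- g + y - (- g))))"
    by (intro AB.cong_add AB.cong_refl Ah_minus zmul_z_Ah)
  then have "eqB (- zmul (j * e) z + y) (- g + y - (- g))" by (simp add: grp del: add_uminus_conv_diff)
  then show ?thesis unfolding zmul_uminus by (rule AB.cong_sym)
qed

lemma acts_add: assumes "acts g g'" "acts h h'" shows "acts (g + h) (g' + h')"
proof -
  obtain j e where g: "g \<in> Ah" "g' \<in> Ah" "e = 1 \<or> e = - 1" "eqB (g + z - g) (zmul e z)" "eqB (g' + z - g') (zmul e z)"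
    "eqB (g + a m - g) (zmul j z + a m)" "eqB (g' + a n - g') (zmul (- j) z + a n)" using assms(1) unfolding acts_def by blast
  obtain j' e' where h: "h \<in> Ah" "h' \<in> Ah" "e' = 1 \<or> e' = - 1" "eqB (h + z - h) (zmul e' z)" "eqB (h' + z - h') (zmul e' z)"
    "eqB (h + a m - h) (zmul j' z + a m)" "eqB (h' + a n - h') (zmul (- j') z + a n)" using assms(2) unfolding acts_def by blast
  have hz: "eqB ((g + h) + z - (g + h)) (zmul (e' * e) z)"
    if "g \<in> Ah" "eqB (g + z - g) (zmul e z)" "eqB (h + z - h) (zmul e' z)" for g h
  proof -
    have "(g + h) + z - (g + h) = g + (h + z - h) - g" by (simp add: grp del: add_uminus_conv_diff)
    also have "eqB \<dots> (g + zmul e' z - g)" by (intro AB.cong_conj AB.cong_refl that)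
    also have "eqB \<dots> (zmul (e' * e) z)" by (rule conj_z_zmul[OF that(2)])
    finally show ?thesis .
  qed
  have "eqB ((g' + h') + a n - (g' + h')) (zmul (- (j' * e + j)) z + a n)"
    using conj_add_z[OF g(2) g(5) g(7) h(7)] by (simp add: algebra_simps)
  moreover have "e' * e = 1 \<or> e' * e = - 1" using g(3) h(3) by auto
  ultimately show ?thesis unfolding acts_def
    using Ah_add g(1,2) h(1,2) hz[OF g(1,4) h(4)] hz[OF g(2,5) h(5)] conj_add_z[OF g(1) g(4) g(6) h(6)] by blast
qed

lemma acts_minus: assumes "acts g g'" shows "acts (- g) (- g')"
proof -
  obtain j e where g: "g \<in> Ah" "g' \<in> Ah" "e = 1 \<or> e = - 1" "eqB (g + z - g) (zmul e z)" "eqB (g' + z - g') (zmul e z)"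
    "eqB (g + a m - g) (zmul j z + a m)" "eqB (g' + a n - g') (zmul (- j) z + a n)" using assms unfolding acts_def by blast
  have "eqB (- g' + a n - (- g')) (zmul (- (- (j * e))) z + a n)"
    using conj_minus_z[OF g(2,3,5,7) an_Ah] by simp
  then show ?thesis unfolding acts_def
    using Ah_minus[OF g(1)] Ah_minus[OF g(2)] g(3) conj_z_minus[OF g(1,3,4)] conj_z_minus[OF g(2,3,5)] conj_minus_z[OF g(1,3,4,6) am_Ah] by blast
qed

lemma B_conj: assumes "b \<in> B" "g \<in> Ah" shows "eqB (b + g - b) g"
proof -
  have "b + (g - b - g) \<in> B"
    using B_normal[OF assms(2) add_subgroup_minus[OF B assms(1)]] assms(1) add_subgroup_add[OF B] by simp
  then show ?thesis using assms B_Ah Ah_add Ah_diff by (simp add: cong_mod_def subset_iff grp del: add_uminus_conv_diff)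
qed

lemma acts_B: assumes "b \<in> B" "b' \<in> B" shows "acts b b'"
  by (rule actsI[of _ _ 1 0]) (use assms B_Ah B_conj z_Ah am_Ah an_Ah in auto)

lemma acts_pair:
  assumes "z_action e" shows "acts (a m) (a n)" "acts (a n) (a m)"
proof -
  have e: "e = 1 \<or> e = - 1" "eqB (a m + z - a m) (zmul e z)" "eqB (a n + z - a n) (zmul e z)"
    using assms unfolding z_action_def by blast+
  show "acts (a m) (a n)"
    by (rule actsI[OF am_Ah an_Ah e, of 0]) (simp_all add: AB.cong_refl am_Ah an_Ah)
  have c: "a n + a m - a n = zmul (- 1) z + a m" "a m + a n - a m = zmul (- (- 1)) z + a n"
    by (simp_all add: z_def grp del: add_uminus_conv_diff)
  show "acts (a n) (a m)"
    by (rule actsI[OF an_Ah am_Ah e(1,3,2), of "- 1"]; unfold c; intro AB.cong_refl Ah_add zmul_z_Ah am_Ah an_Ah)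
qed

text \<open>The condition is imposed at every vertex, not only at the branch positions, so that it
  survives the rotations that occur when elements are multiplied.\<close>

definition balanced :: "(int \<Rightarrow> 'a) \<Rightarrow> bool" where
  "balanced h \<longleftrightarrow> (\<forall>s. acts (h (s mod int d)) (h ((s + r) mod int d)))"

text \<open>Balance passes from the generators to \<open>A\<close>: sections in \<open>B\<close> act
  trivially modulo \<open>B\<close>, and the branch generator carries \<open>a m\<close> and
  \<open>a n\<close> at opposite vertices, where both orders of the pair are admissible.\<close>

lemma A_balanced:
  assumes e: "z_action e" and r2: "2 * r = int d" and v: "v \<in> A"
  shows "\<exists>k h. balanced h \<and> v = rot k + tup h"
proof -
  let ?R = "{v. \<exists>k h. balanced h \<and> v = rot k + tup h}"
  have "A \<subseteq> ?R"
  proof (rule A_subset)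
    show "add_subgroup ?R"
    proof (rule add_subgroupI)
      have "balanced (\<lambda>_. 0)" unfolding balanced_def using acts_B add_subgroup_zero[OF B] by blast
      then show "0 \<in> ?R" by (auto intro!: exI[of _ 0] exI[of _ "\<lambda>_. 0"])
    next
      fix x y assume "x \<in> ?R" "y \<in> ?R"
      then obtain k h k' h' where x: "x = rot k + tup h" "balanced h" and y: "y = rot k' + tup h'" "balanced h'" by blast
      have "x + y = rot k + (tup h + rot k') + tup h'" by (simp add: x y add.assoc)
      also have "\<dots> = rot (k + k') + tup (\<lambda>i. h ((i + k') mod int d) + h' i)"
        by (simp add: tup_rot rot_add tup_add add.assoc)
      finally have "x + y = rot (k + k') + tup (\<lambda>i. h ((i + k') mod int d) + h' i)" .
      moreover have "balanced (\<lambda>i. h ((i + k') mod int d) + h' i)"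
        unfolding balanced_def
      proof
        fix s
        have "acts (h ((s + k') mod int d)) (h ((s + k' + r) mod int d))" "acts (h' (s mod int d)) (h' ((s + r) mod int d))"
          using x(2) y(2) unfolding balanced_def by blast+
        moreover have "((s + r) mod int d + k') mod int d = (s + k' + r) mod int d"
          unfolding mod_add_left_eq by (simp only: ac_simps)
        ultimately show "acts (h ((s mod int d + k') mod int d) + h' (s mod int d))
            (h (((s + r) mod int d + k') mod int d) + h' ((s + r) mod int d))"
          by (simp add: acts_add mod_add_left_eq)
      qed
      ultimately show "x + y \<in> ?R" by blast
    next
      fix x assume "x \<in> ?R"
      then obtain k h where x: "x = rot k + tup h" "balanced h" by blast
      have "- x = tup (\<lambda>i. - h i) + rot (- k)" by (simp add: x minus_add tup_minus rot_minus)
      also have "\<dots> = rot (- k) + tup (\<lambda>i. - h ((i + - k) mod int d))" by (simp only: tup_rot)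
      finally have "- x = rot (- k) + tup (\<lambda>i. - h ((i + - k) mod int d))" .
      moreover have "balanced (\<lambda>i. - h ((i + - k) mod int d))"
        unfolding balanced_def
      proof
        fix s
        have "acts (h ((s + - k) mod int d)) (h ((s + - k + r) mod int d))" using x(2) unfolding balanced_def by blast
        moreover have "((s + r) mod int d + - k) mod int d = (s + - k + r) mod int d"
          unfolding mod_add_left_eq by (simp only: ac_simps)
        moreover have "(s mod int d + - k) mod int d = (s + - k) mod int d" by (simp only: mod_add_left_eq)
        ultimately show "acts (- h ((s mod int d + - k) mod int d)) (- h (((s + r) mod int d + - k) mod int d))"
          by (simp only: acts_minus)
      qed
      ultimately show "- x \<in> ?R" by blast
    qed
    fix i assume i: "i \<in> {1..n}"
    have acts0: "acts 0 0" using acts_B add_subgroup_zero[OF B] by blast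
    consider "i = 1" | "i \<in> {2..n}" "i \<noteq> Suc m" "i - 1 \<in> {1..n} - {m, n}" | "i = Suc m" using i by force
    then show "a i \<in> ?R"
    proof cases
      case 1
      have "balanced (\<lambda>_. 0)" unfolding balanced_def using acts0 by blast
      then show ?thesis using 1 a_1 by (auto intro!: exI[of _ 1] exI[of _ "\<lambda>_. 0"])
    next
      case 2
      have "pos 0 (a (i - 1)) s \<in> B" for s using a_B[OF 2(3)] add_subgroup_zero[OF B] by (simp add: pos_def)
      then have "balanced (pos 0 (a (i - 1)))" unfolding balanced_def using acts_B by blast
      moreover have "a i = rot 0 + tup (pos 0 (a (i - 1)))" using a_step[OF 2(1,2)] by (simp add: emb_def)
      ultimately show ?thesis by blast
    next
      case 3
      have "balanced (pr (a m) (a n))"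
        unfolding balanced_def
      proof
        fix s
        define s0 where "s0 = s mod int d"
        have s0: "0 \<le> s0" "s0 < int d" using d_pos by (auto simp: s0_def)
        have t: "(s + r) mod int d = (if s0 + r < int d then s0 + r else s0 + r - int d)"
        proof -
          have "(s + r) mod int d = (s0 + r) mod int d" by (simp add: s0_def mod_add_left_eq)
          also have "\<dots> = (if s0 + r < int d then s0 + r else s0 + r - int d)"
            using s0 r by (simp add: mod_pos_pos_trivial) (smt (verit) mod_pos_pos_trivial minus_mod_self2)
          finally show ?thesis .
        qed
        have "acts (pr (a m) (a n) s0) (pr (a m) (a n) ((s + r) mod int d))"
          unfolding t using s0 r r2 acts_pair[OF e] acts0 by (auto simp: pr_def)
        then show "acts (pr (a m) (a n) (s mod int d)) (pr (a m) (a n) ((s + r) mod int d))" by (simp add: s0_def)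
      qed
      then show ?thesis using a_branch' by (auto simp: 3 pair_def intro!: exI[of _ 0])
    qed
  qed
  then show ?thesis using v by blast
qed

text \<open>If \<open>z\<close> is in \<open>B\<close>, conjugation is trivial modulo
  \<open>B\<close>. Otherwise balance leaves a pair displaced by inverse powers of \<open>z\<close>;
  its commutator with its own swap gives a power of the pair of \<open>z\<close> and
  \<open>- z\<close>, and a multiple of that removes the displacement.\<close>

lemma branch_in_Y:
  assumes u: "u \<in> A" and uY: "u + pair (a m) (a n) - u \<in> Y"
  shows "pair (a m) (a n) \<in> Y"
proof (cases "z \<in> B")
  case True
  obtain k h where h: "\<forall>j. h j \<in> A" "u = rot k + tup h" using A_split[OF u] by blast
  have "- rot k + (u + pair (a m) (a n) - u) + rot k \<in> Y" using uY rot_Y Y_add Y_minus by blast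
  also have "- rot k + (u + pair (a m) (a n) - u) + rot k = tup h + pair (a m) (a n) - tup h"
    by (simp add: h(2) grp del: add_uminus_conv_diff)
  finally have hY: "pair (h 0 + a m - h 0) (h r + a n - h r) \<in> Y" by (simp add: tup_pair_conj)
  have "eqB y (g + y - g)" if "g \<in> Ah" "y \<in> Ah" for g y
  proof -
    have "y + g - y - g \<in> B"
      by (rule commutators_in[OF B order_refl B_Ah B_normal a_gen a_Ah]) (use that True a_B in \<open>auto simp flip: z_def\<close>)
    then show ?thesis using that Ah_add Ah_diff by (simp add: cong_mod_def grp del: add_uminus_conv_diff)
  qed
  then show ?thesis using pair_eqB[OF _ _ hY] h(1) A_Ah am_Ah an_Ah by blast
next
  case False
  then obtain e where e: "z_action e" and r2: "2 * r = int d" using z_cases by blast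
  obtain k h where h: "balanced h" "u = rot k + tup h" using A_balanced[OF e r2 u] by blast
  have "- rot k + (u + pair (a m) (a n) - u) + rot k \<in> Y" using uY rot_Y Y_add Y_minus by blast
  also have "- rot k + (u + pair (a m) (a n) - u) + rot k = tup h + pair (a m) (a n) - tup h"
    by (simp add: h(2) grp del: add_uminus_conv_diff)
  finally have hY: "pair (h 0 + a m - h 0) (h r + a n - h r) \<in> Y" by (simp add: tup_pair_conj)
  have "acts (h 0) (h r)" using h(1)[unfolded balanced_def, rule_format, of 0] r by simp
  then obtain j where j: "eqB (h 0 + a m - h 0) (zmul j z + a m)" "eqB (h r + a n - h r) (zmul (- j) z + a n)"
    unfolding acts_def by blast
  let ?p = "zmul j z + a m" and ?q = "zmul (- j) z + a n"
  have pq: "pair ?p ?q \<in> Y" by (rule pair_eqB[OF _ _ hY]) (use j AB.cong_sym in auto)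
  have e1: "e = 1 \<or> e = - 1" "e * e = 1" using e by (auto simp: z_action_def)
  have em: "eqB (a m + z - a m) (zmul e z)" "eqB (- a m + z - (- a m)) (zmul e z)"
    and en: "eqB (a n + z - a n) (zmul e z)" "eqB (- a n + z - (- a n)) (zmul e z)"
    using e conj_z_minus[OF am_Ah e1(1)] conj_z_minus[OF an_Ah e1(1)] unfolding z_action_def by blast+
  \<comment> \<open>The exponent of \<open>z\<close> in the commutator of the two displaced
    generators. It equals 1 for \<open>e = 1\<close> and \<open>1 + 4 * j\<close> for
    \<open>e = - 1\<close>.\<close>
  define c where "c = 1 + 2 * j * (1 - e)"
  let ?\<kappa> = "?p + ?q - ?p - ?q"
  have \<kappa>: "eqB ?\<kappa> (zmul c z)"
  proof -
    let ?m = "a m" and ?n = "a n" and ?z = "\<lambda>k. zmul k z"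
    note Ahs = am_Ah an_Ah Ah_minus[OF am_Ah] Ah_minus[OF an_Ah] zmul_z_Ah
    \<comment> \<open>The calculation collects the powers of \<open>z\<close> on the left. Each
      passage across \<open>a m\<close>, \<open>a n\<close> or one of their inverses multiplies the
      exponent by \<open>e\<close>.\<close>
    have "?\<kappa> = ?z j + (?m + ?z (- j)) + ?n + - ?m + (?z (- j) + - ?n + ?z j)"
      by (simp add: zmul_uminus grp del: add_uminus_conv_diff)
    also have "eqB \<dots> (?z j + (?z (- j * e) + ?m) + ?n + - ?m + (?z (- j) + (?z (j * e) + - ?n)))"
      unfolding add.assoc[of "?z (- j)" "- ?n" "?z j"]
      by (intro AB.cong_add AB.cong_refl push_z Ahs em en)
    also have "\<dots> = ?z (j - j * e) + ?m + ?n + (- ?m + ?z (j * e - j)) + - ?n"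
    proof -
      have "?z (j * e - j) = ?z (- j) + ?z (j * e)" "?z (j - j * e) = ?z j + ?z (- j * e)" by (simp_all flip: zmul_add)
      then show ?thesis by (simp only: add.assoc)
    qed
    also have "eqB \<dots> (?z (j - j * e) + ?m + ?n + (?z ((j * e - j) * e) + - ?m) + - ?n)"
      by (intro AB.cong_add AB.cong_refl push_z Ahs em en)
    also have "\<dots> = ?z (j - j * e) + ?m + (?n + ?z (j - j * e)) + - ?m + - ?n"
      using e1(2) by (simp add: add.assoc left_diff_distrib mult.assoc del: add_uminus_conv_diff)
    also have "eqB \<dots> (?z (j - j * e) + ?m + (?z ((j - j * e) * e) + ?n) + - ?m + - ?n)"
      by (intro AB.cong_add AB.cong_refl push_z Ahs em en)
    also have "\<dots> = ?z (j - j * e) + (?m + ?z ((j - j * e) * e)) + ?n + - ?m + - ?n" by (simp only: add.assoc)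
    also have "eqB \<dots> (?z (j - j * e) + (?z ((j - j * e) * e * e) + ?m) + ?n + - ?m + - ?n)"
      by (intro AB.cong_add AB.cong_refl push_z Ahs em en)
    also have "\<dots> = ?z (j - j * e) + ?z (j - j * e) + ?z 1"
      using e1(2) by (simp add: mult.assoc z_def grp del: add_uminus_conv_diff)
    also have "\<dots> = ?z ((j - j * e) + (j - j * e) + 1)" by (simp only: zmul_add)
    also have "(j - j * e) + (j - j * e) + 1 = c" by (simp add: c_def algebra_simps)
    finally show ?thesis .
  qed
  have "pair ?p ?q + pair ?q ?p - pair ?p ?q - pair ?q ?p \<in> Y" using pq swap_Y[OF r2 pq] by (intro Y_diff Y_add)
  also have "pair ?p ?q + pair ?q ?p - pair ?p ?q - pair ?q ?p = pair ?\<kappa> (?q + ?p - ?q - ?p)"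
    by (simp only: diff_conv_add_uminus pair_minus[symmetric] pair_add[symmetric])
  also have "?q + ?p - ?q - ?p = - ?\<kappa>" by (simp add: grp del: add_uminus_conv_diff)
  finally have "pair (zmul c z) (- zmul c z) \<in> Y"
    by (rule pair_eqB[rotated 2]) (use \<kappa> AB.cong_sym AB.cong_minus in blast)+
  then have cY: "pair (zmul (k * c) z) (zmul (- (k * c)) z) \<in> Y" for k
    using add_subgroup_zmul[OF Y, of _ k] by (fastforce simp: pair_zmul zmul_neg zmul_zmul zmul_uminus)
  have "\<exists>k. eqB (zmul j z) (zmul (k * c) z)"
  proof (cases "e = 1")
    case True
    then show ?thesis by (intro exI[of _ j]) (simp add: c_def AB.cong_refl zmul_z_Ah)
  next
    case False
    then have "e = - 1" "d = 2" using e by (auto simp: z_action_def)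
    then have c: "c = 1 + 4 * j" and exp: "zmul (2 ^ l) z \<in> B" using exponent_K[of z l] z_Ah Ah_W K_B by (auto simp: c_def)
    \<comment> \<open>The exponent is odd and \<open>2 ^ l\<close> annihilates \<open>z\<close>
      modulo \<open>B\<close>, so a Bezout relation expresses \<open>zmul j z\<close> as a multiple
      of \<open>zmul c z\<close>.\<close>
    have "coprime (1 + 2 * (2 * j)) (2 ^ l)" by (intro coprime_power_right_iff[THEN iffD2] disjI1) (simp add: coprime_commute)
    then have "coprime c (2 ^ l)" by (simp add: c)
    then obtain s t where st: "s * c + t * 2 ^ l = 1" using bezout_int[of c "2 ^ l"] by (auto simp: coprime_iff_gcd_eq_1)
    have "zmul (j * t) (zmul (2 ^ l) z) \<in> B" by (rule add_subgroup_zmul[OF B exp])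
    then have "eqB (zmul (j * s * c) z + zmul (j * t * 2 ^ l) z) (zmul (j * s * c) z + 0)"
      by (intro AB.cong_add AB.cong_refl zmul_z_Ah) (simp add: AB.cong_iff_mem zmul_z_Ah zmul_zmul)
    moreover have "j * s * c + j * t * 2 ^ l = j" using st by (metis mult.assoc mult.right_neutral distrib_left)
    ultimately show ?thesis by (intro exI[of _ "j * s"]) (simp flip: zmul_add)
  qed
  then obtain k' where k': "eqB (zmul j z) (zmul (k' * c) z)" ..
  then have "pair (zmul j z) (zmul (- j) z) \<in> Y"
    using AB.cong_minus[OF k'] by (intro pair_eqB[OF _ _ cY[of k']]) (simp_all add: zmul_uminus)
  then have "- pair (zmul j z) (zmul (- j) z) + pair ?p ?q \<in> Y" using pq Y_add Y_minus by blast
  also have "- pair (zmul j z) (zmul (- j) z) + pair ?p ?q = pair (a m) (a n)"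
    by (simp add: grp flip: pair_minus pair_add del: add_uminus_conv_diff)
  finally show ?thesis .
qed

end

section \<open>Induction on the level in the preperiodic model\<close>

context preperiodic_model
begin

text \<open>With \<open>u 1 = 0\<close> all rotations lie in \<open>Y\<close>, so each conjugator
  may be taken to fix the first level. Its sections conjugate the generators one level down, and the
  induction hypothesis opens the branch context. There the simple generators come from
  \<open>B\<close> and the branch generator from \<open>branch_in_Y\<close>.\<close>

lemma conjugates_generate_step:
  assumes IH: "conjugates_generate l" shows "conjugates_generate (Suc l)"
proof (rule conjugates_generateI)
  fix u Y assume u: "\<And>i. i \<in> {1..n} \<Longrightarrow> u i \<in> A" "u 1 = 0" and Y: "add_subgroup Y" "Y \<subseteq> W" "K (Suc l) \<subseteq> Y"
    and uY: "\<And>i. i \<in> {1..n} \<Longrightarrow> u i + a i - u i \<in> Y"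
  have rot_1: "rot 1 \<in> Y" using uY[of 1] u(2) n a_1 by simp
  have rot_Y: "rot k \<in> Y" for k using add_subgroup_zmul[OF Y(1) rot_1, of k] by (simp flip: rot_zmul)
  have "\<forall>i\<in>{1..n}. \<exists>h. (\<forall>j. h j \<in> A) \<and> tup h + a i - tup h \<in> Y"
  proof
    fix i assume i: "i \<in> {1..n}"
    obtain k h where h: "\<forall>j. h j \<in> A" "u i = rot k + tup h" using A_split u(1) i by blast
    have "- rot k + (u i + a i - u i) + rot k \<in> Y"
      using uY[OF i] rot_Y add_subgroup_add[OF Y(1)] add_subgroup_minus[OF Y(1)] by blast
    also have "- rot k + (u i + a i - u i) + rot k = tup h + a i - tup h"
      by (simp add: h(2) grp del: add_uminus_conv_diff)
    finally show "\<exists>h. (\<forall>j. h j \<in> A) \<and> tup h + a i - tup h \<in> Y" using h(1) by blast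
  qed
  from bchoice[OF this] obtain H where H: "\<forall>i\<in>{1..n}. (\<forall>j. H i j \<in> A) \<and> tup (H i) + a i - tup (H i) \<in> Y" ..
  \<comment> \<open>The generator \<open>a i\<close> is found below \<open>a (Suc i)\<close> at
    vertex 0; only \<open>a n\<close> is found below the branch generator, at position
    \<open>r\<close>.\<close>
  define v where "v i = (if i = n then H (Suc m) r else H (Suc i) 0)" for i
  define x where "x i = v i + a i - v i" for i
  have vA: "v i \<in> A" if "i \<in> {1..n}" for i using that H m by (auto simp: v_def)
  have gen: "generating l x" using IH vA unfolding conjugates_generate_def x_def by blast
  have emb_x: "emb 0 (x i) \<in> Y" if "i \<in> {1..n} - {m, n}" for i
  proof -
    have i: "Suc i \<in> {2..n}" "Suc i \<noteq> Suc m" "i \<noteq> n" using that by auto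
    then show ?thesis using H[THEN bspec, of "Suc i"] a_step[OF i(1,2)] by (simp add: tup_emb_conj x_def v_def)
  qed
  have pair_x: "pair (x m) (x n) \<in> Y"
    using H[THEN bspec, of "Suc m"] m by (simp add: a_branch' tup_pair_conj x_def v_def)
  interpret branch_context d W rot tup K n a m r l Y x
    by unfold_locales (use Y rot_1 vA emb_x pair_x gen in \<open>auto simp: x_def\<close>)
  have "u (Suc m) + pair (a m) (a n) - u (Suc m) \<in> Y" using uY[of "Suc m"] m by (simp add: a_branch')
  then have branch: "a (Suc m) \<in> Y" using branch_in_Y[of "u (Suc m)"] u(1)[of "Suc m"] m by (simp add: a_branch')
  show "A \<subseteq> Y"
  proof (rule A_subset[OF Y(1)])
    fix i assume "i \<in> {1..n}"
    then consider "i = 1" | "i \<in> {2..n}" "i \<noteq> Suc m" "i - 1 \<in> {1..n} - {m, n}" | "i = Suc m" by force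
    then show "a i \<in> Y"
    proof cases
      case 1 then show ?thesis using rot_1 a_1 by simp
    next
      case 2 then show ?thesis using a_B[OF 2(3)] by (simp add: a_step[OF 2(1,2)] B_def)
    next
      case 3 then show ?thesis using branch by simp
    qed
  qed
qed

text \<open>A constant tuple fixes the rotations. Its entry is adjusted so that the conjugators
  required at the two branch positions come from a single element of \<open>Y\<close>; at the other
  generators any element of \<open>Ah\<close> is a section of \<open>Y\<close>.\<close>

lemma conjugates_inner_step:
  assumes IH: "conjugates_inner l" shows "conjugates_inner (Suc l)"
proof (rule conjugates_innerI)
  fix g :: "nat \<Rightarrow> 'a" assume g: "\<And>i. i \<in> {1..n} \<Longrightarrow> g i \<in> W" "g 1 = 0"
  have mn: "m \<in> {1..n}" "n \<in> {1..n}" using m n by auto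
  have "\<forall>i\<in>{1..n}. \<exists>p. (\<forall>j. snd p j \<in> W) \<and> g i = rot (fst p) + tup (snd p)"
    using W_cases g(1) by fastforce
  from bchoice[OF this] obtain p where p: "\<forall>i\<in>{1..n}. (\<forall>j. snd (p i) j \<in> W) \<and> g i = rot (fst (p i)) + tup (snd (p i))" ..
  define k h where "k i = fst (p i)" and "h i = snd (p i)" for i
  have h: "(\<forall>j. h i j \<in> W) \<and> g i = rot (k i) + tup (h i)" if "i \<in> {1..n}" for i
    using bspec[OF p that] unfolding k_def h_def .
  define G where "G i = (if i = n then h (Suc m) r else h (Suc i) 0)" for i
  have "\<forall>i\<in>{1..n}. G i \<in> W" using h m by (auto simp: G_def)
  with IH obtain w v where w: "w \<in> W" and v: "\<forall>i\<in>{1..n}. v i \<in> A \<and> eqm l (w + (G i + a i - G i) - w) (v i + a i - v i)"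
    by (rule conjugates_innerE)
  have vm: "v m \<in> A" using v mn by auto
  define Y where "Y = A_mod (Suc l)"
  have aY: "a i \<in> Y" if "i \<in> {1..n}" for i using a_A[OF that] A_A_mod unfolding Y_def by blast
  have embY: "emb 0 (a i) \<in> Y" if "i \<in> {1..n} - {m, n}" for i
  proof -
    have i: "Suc i \<in> {2..n}" "Suc i \<noteq> Suc m" using that by auto
    then show ?thesis using aY[of "Suc i"] a_step[OF i] by simp
  qed
  have pairY: "pair (a m) (a n) \<in> Y" using aY[of "Suc m"] m by (simp add: a_branch')
  have triv: "\<exists>\<phi>\<in>A. a i = \<phi> + a i - \<phi>" for i by (rule bexI[of _ 0]) (simp_all add: A_zero)
  have gen: "generating l a" unfolding generating_def using A_subset by blast
  have rot_1: "rot 1 \<in> Y" using aY[of 1] a_1 n by simp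
  interpret branch_context d W rot tup K n a m r l Y a
    by unfold_locales
      (use A_mod A_mod_W K_A_mod rot_1 embY pairY gen triv in \<open>auto simp: Y_def simp del: diff_conv_add_uminus\<close>)
  have "- v m + v n \<in> Ah" using v mn A_Ah A_add A_minus by blast
  then obtain q where q: "tup q \<in> Y" "\<forall>i. q i \<in> Ah"
    "tup q + pair (a m) (a n) - tup q = pair (q 0 + a m - q 0) (q 0 + ((- v m + v n) + a n - (- v m + v n)) - q 0)"
    using conj_pair[OF pairY] by blast
  \<comment> \<open>This makes \<open>c + v m\<close> equal to \<open>q 0\<close>, and by the choice
    of \<open>q\<close> the elements \<open>c + v n\<close> and \<open>q r\<close> conjugate
    \<open>a n\<close> in the same way.\<close>
  define c where "c = q 0 - v m"
  have cA: "c \<in> Ah" unfolding c_def using q(2) vm A_Ah Ah_diff by blast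
  have cW: "c \<in> W" using cA Ah_W by blast
  have cv: "eqm l ((c + w) + (G i + a i - G i) - (c + w)) ((c + v i) + a i - (c + v i))" if i: "i \<in> {1..n}" for i
  proof -
    have "eqm l (c + (w + (G i + a i - G i) - w) - c) (c + (v i + a i - v i) - c)"
      using bspec[OF v i] eqm_conj[OF eqm_refl[OF cW]] by blast
    then show ?thesis by (simp add: grp del: add_uminus_conv_diff)
  qed
  define w1 where "w1 = tup (\<lambda>_. c + w)"
  have w1W: "w1 \<in> W" unfolding w1_def using cW w W_add by (intro tup_W)
  have w1_rot: "w1 + rot k - w1 = rot k" for k by (simp add: w1_def tup_rot)
  have "\<exists>y. y \<in> A \<and> eqm (Suc l) (w1 + (g i + a i - g i) - w1) (y + a i - y)" if i: "i \<in> {1..n}" for i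
  proof -
    have fin: ?thesis
      if "w1 + (g i + a i - g i) - w1 = rot (k i) + (w1 + (tup (h i) + a i - tup (h i)) - w1) - rot (k i)"
        and s: "s \<in> Y" "eqm (Suc l) (w1 + (tup (h i) + a i - tup (h i)) - w1) (s + a i - s)" for s
    proof -
      obtain y where y: "y \<in> A" "eqm (Suc l) s y" using s(1) unfolding Y_def A_mod_def by blast
      have aiW: "a i \<in> W" by (rule a_W[OF i])
      have "eqm (Suc l) (s + a i - s) (y + a i - y)" by (intro eqm_conj y eqm_refl aiW)
      with s(2) have "eqm (Suc l) (w1 + (tup (h i) + a i - tup (h i)) - w1) (y + a i - y)" by (rule eqm_trans)
      then have "eqm (Suc l) (rot (k i) + (w1 + (tup (h i) + a i - tup (h i)) - w1) - rot (k i))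
          (rot (k i) + (y + a i - y) - rot (k i))"
        by (rule eqm_conj[OF eqm_refl[OF rot_W]])
      moreover have "rot (k i) + (y + a i - y) - rot (k i) = (rot (k i) + y) + a i - (rot (k i) + y)"
        by (simp add: grp del: add_uminus_conv_diff)
      moreover have "rot (k i) + y \<in> A" using rot_A y A_add by blast
      ultimately show ?thesis using that(1) by (intro exI[of _ "rot (k i) + y"]) simp
    qed
    have pull: "w1 + (g i + a i - g i) - w1 = rot (k i) + (w1 + (tup (h i) + a i - tup (h i)) - w1) - rot (k i)"
    proof -
      have "w1 + (g i + a i - g i) - w1 =
          (w1 + rot (k i) - w1) + (w1 + (tup (h i) + a i - tup (h i)) - w1) - (w1 + rot (k i) - w1)"
        using h[OF i] by (simp add: grp del: add_uminus_conv_diff)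
      then show ?thesis by (simp only: w1_rot)
    qed
    consider "i = 1" | "i \<in> {2..n}" "i \<noteq> Suc m" "i - 1 \<in> {1..n} - {m, n}" | "i = Suc m" using i by force
    then show ?thesis
    proof cases
      case 1
      have "w1 + (g i + a i - g i) - w1 = 0 + a i - 0" using 1 g(2) a_1 w1_rot by simp
      then show ?thesis using A_zero eqm_refl a_W[OF i] by (intro exI[of _ 0]) auto
    next
      case 2
      have "c + v (i - 1) \<in> P" using 2 v cA A_Ah Ah_add Ah_P by blast
      then obtain s where s: "c + v (i - 1) = s 0" "tup s \<in> Y" unfolding P_def by (rule sections_at_0E)
      have "w1 + (tup (h i) + a i - tup (h i)) - w1 = emb 0 ((c + w) + (h i 0 + a (i - 1) - h i 0) - (c + w))"
        unfolding a_step[OF 2(1,2)] by (simp only: tup_emb_conj w1_def mod_0)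
      also have "\<dots> = emb 0 ((c + w) + (G (i - 1) + a (i - 1) - G (i - 1)) - (c + w))" using 2 by (simp add: G_def)
      also have "eqm (Suc l) \<dots> (emb 0 ((c + v (i - 1)) + a (i - 1) - (c + v (i - 1))))"
        using 2 by (intro eqm_emb cv) auto
      also have "emb 0 ((c + v (i - 1)) + a (i - 1) - (c + v (i - 1))) = tup s + a i - tup s"
        unfolding a_step[OF 2(1,2)] by (simp only: tup_emb_conj mod_0 s(1))
      finally show ?thesis by (rule fin[OF pull s(2)])
    next
      case 3
      have "w1 + (tup (h i) + a i - tup (h i)) - w1 =
          pair ((c + w) + (h i 0 + a m - h i 0) - (c + w)) ((c + w) + (h i r + a n - h i r) - (c + w))"
        unfolding 3 a_branch' by (simp only: tup_pair_conj w1_def)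
      also have "\<dots> = pair ((c + w) + (G m + a m - G m) - (c + w)) ((c + w) + (G n + a n - G n) - (c + w))"
        using 3 m by (simp add: G_def)
      also have "eqm (Suc l) \<dots> (pair ((c + v m) + a m - (c + v m)) ((c + v n) + a n - (c + v n)))"
        by (intro eqm_pair cv mn)
      also have "pair ((c + v m) + a m - (c + v m)) ((c + v n) + a n - (c + v n)) = tup q + a i - tup q"
        unfolding 3 a_branch' q(3) by (simp add: c_def grp del: add_uminus_conv_diff)
      finally show ?thesis by (rule fin[OF pull q(1)])
    qed
  qed
  then show "\<exists>w\<in>W. \<exists>v. \<forall>i\<in>{1..n}. v i \<in> A \<and> eqm (Suc l) (w + (g i + a i - g i) - w) (v i + a i - v i)"
    using w1W by metis
qed

theorem rigid: "conjugates_inner l \<and> conjugates_generate l"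
  by (induction l) (auto simp: conjugates_inner_0 conjugates_generate_0 conjugates_inner_step conjugates_generate_step)

end

section \<open>Transfer from the model to tuples of conjugates\<close>

context wreath_model
begin

text \<open>Both tuples are conjugate to the model tuple entry by entry modulo \<open>K l\<close>,
  so each is brought to inner form, \<open>c\<close> by \<open>w\<close> and \<open>c'\<close> by
  \<open>w'\<close>. The inner conjugators differ by elements of \<open>A\<close>. As the inner
  tuple obtained from \<open>c\<close> generates \<open>A\<close>, conjugation by \<open>- w\<close>
  carries these differences into the group generated by the \<open>c i\<close>, modulo
  \<open>K l\<close>.\<close>

theorem rigid_tuples:
  assumes rigid: "conjugates_inner l" "conjugates_generate l"
    and c: "\<And>i. i \<in> {1..n} \<Longrightarrow> c i \<in> W \<and> (\<exists>g\<in>W. eqm l (c i) (g + a i - g))"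
    and c': "\<And>i. i \<in> {1..n} \<Longrightarrow> \<exists>g\<in>W. c' i = g + c i - g"
  shows "\<exists>w\<in>W. \<exists>u. \<forall>i\<in>{1..n}. u i \<in> add_subgroup hull (c ` {1..n}) \<and> eqm l (w + c' i - w) (u i + c i - u i)" (is ?inner)
    and "\<And>u Y. (\<And>i. i \<in> {1..n} \<Longrightarrow> u i \<in> add_subgroup hull (c ` {1..n})) \<Longrightarrow> add_subgroup Y \<Longrightarrow> Y \<subseteq> W \<Longrightarrow>
       K l \<subseteq> Y \<Longrightarrow> (\<And>i. i \<in> {1..n} \<Longrightarrow> u i + c i - u i \<in> Y) \<Longrightarrow> add_subgroup hull (c ` {1..n}) \<subseteq> Y"
proof -
  define C where "C = add_subgroup hull (c ` {1..n})"
  have C: "add_subgroup C" unfolding C_def by (rule add_subgroup_hull)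
  have c_C: "c i \<in> C" if "i \<in> {1..n}" for i unfolding C_def using that by (simp add: hull_inc)
  have C_min: "C \<subseteq> T" if "add_subgroup T" "\<And>i. i \<in> {1..n} \<Longrightarrow> c i \<in> T" for T
    unfolding C_def by (rule hull_minimal) (use that in auto)
  have C_W: "C \<subseteq> W" by (rule C_min[OF W]) (use c in auto)
  have "\<forall>i\<in>{1..n}. \<exists>g. g \<in> W \<and> eqm l (c i) (g + a i - g)" using c by blast
  from bchoice[OF this] obtain g where g: "\<forall>i\<in>{1..n}. g i \<in> W \<and> eqm l (c i) (g i + a i - g i)" ..
  have "\<forall>i\<in>{1..n}. \<exists>g. g \<in> W \<and> c' i = g + c i - g" using c' by blast
  from bchoice[OF this] obtain f where f: "\<forall>i\<in>{1..n}. f i \<in> W \<and> c' i = f i + c i - f i" ..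
  have "\<forall>i\<in>{1..n}. g i \<in> W" using g by blast
  with rigid(1) obtain w v where w: "w \<in> W"
    and v: "\<forall>i\<in>{1..n}. v i \<in> A \<and> eqm l (w + (g i + a i - g i) - w) (v i + a i - v i)" by (rule conjugates_innerE)
  have "\<forall>i\<in>{1..n}. f i + g i \<in> W" using f g W_add by blast
  with rigid(1) obtain w' v' where w': "w' \<in> W"
    and v': "\<forall>i\<in>{1..n}. v' i \<in> A \<and> eqm l (w' + ((f i + g i) + a i - (f i + g i)) - w') (v' i + a i - v' i)"
    by (rule conjugates_innerE)
  have wc: "eqm l (w + c i - w) (v i + a i - v i)" if i: "i \<in> {1..n}" for i
  proof (rule eqm_trans)
    show "eqm l (w + c i - w) (w + (g i + a i - g i) - w)" using g i by (intro eqm_conj[OF eqm_refl[OF w]]) blast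
  qed (use v i in blast)
  have wc': "eqm l (w' + c' i - w') (v' i + a i - v' i)" if i: "i \<in> {1..n}" for i
  proof (rule eqm_trans)
    have "eqm l (c' i) (f i + (g i + a i - g i) - f i)"
      using f g i by (metis (no_types, lifting) eqm_conj eqm_refl)
    also have "f i + (g i + a i - g i) - f i = (f i + g i) + a i - (f i + g i)" by (simp add: grp del: add_uminus_conv_diff)
    finally show "eqm l (w' + c' i - w') (w' + ((f i + g i) + a i - (f i + g i)) - w')"
      by (rule eqm_conj[OF eqm_refl[OF w']])
  qed (use v' i in blast)
  have pull: "add_subgroup {y \<in> W. - w + y + w \<in> T}" if T: "add_subgroup T" for T
  proof (rule add_subgroupI)
    show "0 \<in> {y \<in> W. - w + y + w \<in> T}" using W_zero add_subgroup_zero[OF T] by simp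
  next
    fix x y assume "x \<in> {y \<in> W. - w + y + w \<in> T}" "y \<in> {y \<in> W. - w + y + w \<in> T}"
    then have "x + y \<in> W" "(- w + x + w) + (- w + y + w) \<in> T" using W_add add_subgroup_add[OF T] by auto
    then show "x + y \<in> {y \<in> W. - w + y + w \<in> T}" by (simp add: grp del: add_uminus_conv_diff)
  next
    fix x assume "x \<in> {y \<in> W. - w + y + w \<in> T}"
    then have "- x \<in> W" "- (- w + x + w) \<in> T" using W_minus add_subgroup_minus[OF T] by blast+
    then show "- x \<in> {y \<in> W. - w + y + w \<in> T}" by (simp add: grp del: add_uminus_conv_diff)
  qed
  have pull_K: "K l \<subseteq> {y \<in> W. - w + y + w \<in> T}" if "K l \<subseteq> T" for T
    using that K_W K_normal[OF W_minus[OF w], of _ l] by auto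
  have in_pull: "v i + a i - v i \<in> {y \<in> W. - w + y + w \<in> T}" if T: "add_subgroup T" "K l \<subseteq> T" "c i \<in> T" and i: "i \<in> {1..n}" for T i
  proof (rule eqm_mem[OF eqm_sym[OF wc[OF i]] pull[OF T(1)] pull_K[OF T(2)]])
    have "w + c i - w \<in> W" using w c[OF i] W_add W_diff by blast
    moreover have "- w + (w + c i - w) + w = c i" by (simp add: grp del: add_uminus_conv_diff)
    ultimately show "w + c i - w \<in> {y \<in> W. - w + y + w \<in> T}" using T(3) by simp
  qed
  define Cm where "Cm = {g \<in> W. \<exists>v\<in>C. eqm l g v}"
  have Cm: "add_subgroup Cm" unfolding Cm_def by (rule mod_subgroup[OF C C_W])
  have K_Cm: "K l \<subseteq> Cm" unfolding Cm_def using K_W add_subgroup_zero[OF C] W_zero by (auto simp: cong_mod_def intro!: bexI[of _ 0])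
  have c_Cm: "c i \<in> Cm" if "i \<in> {1..n}" for i unfolding Cm_def using c_C[OF that] c[OF that] eqm_refl by blast
  have gen: "generating l (\<lambda>i. v i + a i - v i)" using rigid(2) v unfolding conjugates_generate_def by blast
  have A_pull: "A \<subseteq> {y \<in> W. - w + y + w \<in> Cm}"
    using gen[unfolded generating_def, rule_format, of "{y \<in> W. - w + y + w \<in> Cm}"]
      pull[OF Cm] pull_K[OF K_Cm] in_pull[OF Cm K_Cm c_Cm] by blast
  have "\<exists>u. u \<in> C \<and> eqm l ((- w + w') + c' i - (- w + w')) (u + c i - u)" if i: "i \<in> {1..n}" for i
  proof -
    have "v' i - v i \<in> A" using v v' i A_diff by blast
    then have "- w + (v' i - v i) + w \<in> Cm" using A_pull by blast
    then obtain u where u: "u \<in> C" "eqm l (- w + (v' i - v i) + w) u" unfolding Cm_def by blast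
    have vW: "v i \<in> W" "v' i \<in> W" "a i \<in> W" using v v' i A_W a_W by auto
    have "eqm l (- w + (w' + c' i - w') - (- w)) (- w + (v' i + a i - v' i) - (- w))"
      by (rule eqm_conj[OF eqm_refl[OF W_minus[OF w]] wc'[OF i]])
    also have "- w + (w' + c' i - w') - (- w) = (- w + w') + c' i - (- w + w')" by (simp add: grp del: add_uminus_conv_diff)
    also have "- w + (v' i + a i - v' i) - (- w) = (- w + (v' i - v i)) + (v i + a i - v i) - (- w + (v' i - v i))"
      by (simp add: grp del: add_uminus_conv_diff)
    finally have "eqm l ((- w + w') + c' i - (- w + w')) ((- w + (v' i - v i)) + (v i + a i - v i) - (- w + (v' i - v i)))" .
    also have "eqm l \<dots> ((- w + (v' i - v i)) + (w + c i - w) - (- w + (v' i - v i)))"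
    proof (rule eqm_conj[OF eqm_refl eqm_sym[OF wc[OF i]]])
      show "- w + (v' i - v i) \<in> W" using vW w W_add W_minus W_diff by blast
    qed
    also have "(- w + (v' i - v i)) + (w + c i - w) - (- w + (v' i - v i)) = (- w + (v' i - v i) + w) + c i - (- w + (v' i - v i) + w)"
      by (simp add: grp del: add_uminus_conv_diff)
    also have "eqm l \<dots> (u + c i - u)" using c[OF i] by (intro eqm_conj u eqm_refl) blast
    finally show ?thesis using u(1) by blast
  qed
  then have "\<forall>i\<in>{1..n}. \<exists>u. u \<in> C \<and> eqm l ((- w + w') + c' i - (- w + w')) (u + c i - u)" ..
  from bchoice[OF this] show ?inner unfolding C_def[symmetric] using w w' W_add W_minus by blast
  fix u Y assume u: "\<And>i. i \<in> {1..n} \<Longrightarrow> u i \<in> add_subgroup hull (c ` {1..n})" and Y: "add_subgroup Y" "Y \<subseteq> W" "K l \<subseteq> Y"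
    and uY: "\<And>i. i \<in> {1..n} \<Longrightarrow> u i + c i - u i \<in> Y"
  let ?T = "{y \<in> W. - w + y + w \<in> Y}"
  have sub: "add_subgroup {y \<in> W. w + y - w \<in> A_mod l}"
  proof (rule add_subgroupI)
    show "0 \<in> {y \<in> W. w + y - w \<in> A_mod l}" using W_zero add_subgroup_zero[OF A_mod] by simp
  next
    fix x y assume "x \<in> {y \<in> W. w + y - w \<in> A_mod l}" "y \<in> {y \<in> W. w + y - w \<in> A_mod l}"
    then have "x + y \<in> W" "(w + x - w) + (w + y - w) \<in> A_mod l" using W_add add_subgroup_add[OF A_mod] by auto
    then show "x + y \<in> {y \<in> W. w + y - w \<in> A_mod l}" by (simp add: grp del: add_uminus_conv_diff)
  next
    fix x assume "x \<in> {y \<in> W. w + y - w \<in> A_mod l}"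
    then have "- x \<in> W" "- (w + x - w) \<in> A_mod l" using W_minus add_subgroup_minus[OF A_mod] by blast+
    then show "- x \<in> {y \<in> W. w + y - w \<in> A_mod l}" by (simp add: grp del: add_uminus_conv_diff)
  qed
  have C_A: "C \<subseteq> {y \<in> W. w + y - w \<in> A_mod l}"
  proof (rule C_min[OF sub])
    fix i assume i: "i \<in> {1..n}"
    have "v i + a i - v i \<in> A" using v i a_A A_add A_diff by blast
    then have "w + c i - w \<in> A_mod l" using wc[OF i] unfolding A_mod_def by (auto simp: cong_mod_def)
    then show "c i \<in> {y \<in> W. w + y - w \<in> A_mod l}" using c[OF i] by blast
  qed
  \<comment> \<open>Conjugated by \<open>w\<close>, the given elements become conjugates of the
    \<open>a i\<close> by elements of \<open>A\<close>, to which generation for the model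
    applies.\<close>
  have "\<forall>i\<in>{1..n}. \<exists>s. s \<in> A \<and> s + a i - s \<in> ?T"
  proof
    fix i assume i: "i \<in> {1..n}"
    have "w + u i - w \<in> A_mod l" using C_A u[OF i] unfolding C_def by blast
    then obtain s where s: "s \<in> A" "eqm l (w + u i - w) s" unfolding A_mod_def by blast
    have uW: "u i \<in> W" using u[OF i] C_W unfolding C_def by blast
    have e: "- w + (w + (u i + c i - u i) - w) + w = u i + c i - u i" by (simp add: grp del: add_uminus_conv_diff)
    have "c i \<in> W" using c[OF i] by blast
    then have "w + (u i + c i - u i) - w \<in> W" by (intro W_add W_diff w uW)
    then have 1: "w + (u i + c i - u i) - w \<in> ?T" using uY[OF i] by (simp only: mem_Collect_eq e)
    have "eqm l ((w + u i - w) + (w + c i - w) - (w + u i - w)) (s + (v i + a i - v i) - s)" by (intro eqm_conj s wc i)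
    also have "(w + u i - w) + (w + c i - w) - (w + u i - w) = w + (u i + c i - u i) - w" by (simp add: grp del: add_uminus_conv_diff)
    also have "s + (v i + a i - v i) - s = (s + v i) + a i - (s + v i)" by (simp add: grp del: add_uminus_conv_diff)
    finally have "(s + v i) + a i - (s + v i) \<in> ?T" using eqm_mem[OF eqm_sym pull[OF Y(1)] pull_K[OF Y(3)] 1] by blast
    then show "\<exists>s. s \<in> A \<and> s + a i - s \<in> ?T" using s v i A_add by blast
  qed
  from bchoice[OF this] obtain s where s: "\<forall>i\<in>{1..n}. s i \<in> A \<and> s i + a i - s i \<in> ?T" ..
  have "generating l (\<lambda>i. s i + a i - s i)" using rigid(2) s unfolding conjugates_generate_def by blast
  then have AT: "A \<subseteq> ?T"
    unfolding generating_def using pull[OF Y(1)] pull_K[OF Y(3)] s by blast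
  show "add_subgroup hull (c ` {1..n}) \<subseteq> Y"
  proof (rule C_min[unfolded C_def, OF Y(1)])
    fix i assume i: "i \<in> {1..n}"
    have "v i + a i - v i \<in> A" using v i a_A A_add A_diff by blast
    then have "w + c i - w \<in> ?T" using eqm_mem[OF wc[OF i] pull[OF Y(1)] pull_K[OF Y(3)]] AT by blast
    then have "- w + (w + c i - w) + w \<in> Y" by blast
    then show "c i \<in> Y" by (simp add: grp del: add_uminus_conv_diff)
  qed
qed

end

section \<open>Recognising conjugates of the model generators\<close>

context wreath_tower
begin

text \<open>Multiplies the sections met along the cycle 1, 2, ..., d - 1, 0, the latest on the left.
  Starting at 1 makes the cycle end at 0, where the model generator carries its section.\<close>

primrec partial_product :: "(int \<Rightarrow> 'g) \<Rightarrow> nat \<Rightarrow> 'g" where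
  "partial_product h 0 = 0"
| "partial_product h (Suc j) = h (int (Suc j) mod int d) + partial_product h j"

lemma partial_product_W: "(\<And>i. h i \<in> W) \<Longrightarrow> partial_product h j \<in> W"
  by (induction j) (auto simp: W_zero W_add)

text \<open>A telescoping tuple \<open>q\<close> cancels the section at every vertex except 0, where
  the product around the whole cycle accumulates.\<close>

lemma rot_1_tup_conj:
  assumes "\<And>i. h i \<in> W"
  shows "\<exists>q\<in>W. rot 1 + tup h = q + (rot 1 + emb 0 (partial_product h d)) - q"
proof -
  let ?S = "partial_product h"
  \<comment> \<open>Vertex 0 stands for \<open>d\<close>, the end of the cycle, hence the index
    \<open>d - 1\<close>.\<close>
  define q where "q i = - ?S (if i = 0 then d - 1 else nat i - 1)" for i
  have qW: "tup q \<in> W" using partial_product_W assms W_minus by (intro tup_W) (simp add: q_def)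
  have "tup q + (rot 1 + tup h) - tup q = rot 1 + tup (\<lambda>i. q ((i + 1) mod int d) + h i - q i)"
    by (simp add: tup_rot tup_add tup_minus grp flip: add.assoc del: add_uminus_conv_diff)
  also have "tup (\<lambda>i. q ((i + 1) mod int d) + h i - q i) = emb 0 (?S d)"
    unfolding emb_def
  proof (rule tup_cong)
    fix i assume i: "0 \<le> i" "i < int d"
    show "q ((i + 1) mod int d) + h i - q i = pos 0 (?S d) i"
    proof (cases "i = 0")
      case True
      have "?S (Suc (d - 1)) = h (int (Suc (d - 1)) mod int d) + ?S (d - 1)" by simp
      moreover have "Suc (d - 1) = d" using d2 by simp
      ultimately have "?S d = h 0 + ?S (d - 1)" by (simp only:) simp
      then show ?thesis using True d2 by (simp add: q_def pos_def)
    next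
      case False
      define k where "k = nat i - 1"
      have k: "i = int (Suc k)" using i False by (auto simp: k_def)
      have "(i + 1) mod int d = (if Suc (Suc k) = d then 0 else i + 1)" using i k by (auto simp: mod_pos_pos_trivial)
      then have "q ((i + 1) mod int d) = - ?S (Suc k)" using k by (auto simp: q_def nat_add_distrib simp del: partial_product.simps)
      moreover have "?S (Suc k) = h i + ?S k"
      proof -
        have "int (Suc k) mod int d = i" using i k by (simp add: mod_pos_pos_trivial)
        then show ?thesis by (simp only: partial_product.simps)
      qed
      moreover have "q i = - ?S k" using k by (simp add: q_def nat_add_distrib)
      ultimately show ?thesis using False k by (simp add: pos_def grp del: add_uminus_conv_diff)
    qed
  qed
  finally have "- tup q + (tup q + (rot 1 + tup h) - tup q) + tup q = - tup q + (rot 1 + emb 0 (?S d)) - (- tup q)" by simp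
  then have "rot 1 + tup h = - tup q + (rot 1 + emb 0 (?S d)) - (- tup q)" by (simp add: grp del: add_uminus_conv_diff)
  then show ?thesis using qW W_minus by blast
qed

lemma eqm_conj_trans:
  assumes "eqm l y (g + b - g)" "q \<in> W" "x = q + y - q" "g \<in> W"
  shows "\<exists>g\<in>W. eqm l x (g + b - g)"
proof -
  have "eqm l x (q + (g + b - g) - q)" unfolding assms(3) by (rule eqm_conj[OF eqm_refl[OF assms(2)] assms(1)])
  also have "q + (g + b - g) - q = (q + g) + b - (q + g)" by (simp add: grp del: add_uminus_conv_diff)
  finally show ?thesis using assms W_add by blast
qed

lemma single_section_conj:
  assumes h: "\<And>i. i \<in> {0..<int d} - {j} \<Longrightarrow> h i = 0" and j: "j \<in> {0..<int d}"
    and g: "g \<in> W" "eqm l (h j) (g + b - g)"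
  shows "\<exists>g\<in>W. eqm (Suc l) (tup h) (g + emb 0 b - g)"
proof -
  have "tup h = emb (0 + j) (h j)" unfolding emb_def using h j by (intro tup_cong) (auto simp: pos_def)
  also have "\<dots> = rot j + emb 0 (h j) - rot j" by (rule rot_emb[symmetric])
  finally have e: "tup h = rot j + emb 0 (h j) - rot j" .
  have "eqm (Suc l) (emb 0 (h j)) (emb 0 (g + b - g))" by (rule eqm_emb[OF g(2)])
  also have "emb 0 (g + b - g) = emb 0 g + emb 0 b - emb 0 g"
    by (simp only: diff_conv_add_uminus emb_add emb_minus)
  finally show ?thesis using eqm_conj_trans[OF _ rot_W e] emb_W[OF g(1)] by blast
qed

end

context periodic_model
begin

text \<open>\<open>D\<close> is any family of sets stable under the recursion of the model. The
  conjugator at level l + 1 is assembled from the conjugators of the sections at level l, which is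
  why the whole class and not a single element enters the induction.\<close>

lemma classes_conj:
  assumes D1: "\<And>x. x \<in> D 1 \<Longrightarrow> \<exists>h. (\<forall>i. h i \<in> W) \<and> x = rot 1 + tup h \<and> partial_product h d \<in> D n"
    and D: "\<And>i x. i \<in> {2..n} \<Longrightarrow> x \<in> D i \<Longrightarrow>
      \<exists>h. \<exists>j\<in>{0..<int d}. x = tup h \<and> h j \<in> D (i - 1) \<and> (\<forall>k\<in>{0..<int d} - {j}. h k = 0)"
    and DW: "\<And>i x. i \<in> {1..n} \<Longrightarrow> x \<in> D i \<Longrightarrow> x \<in> W"
    and i: "i \<in> {1..n}" "x \<in> D i"
  shows "\<exists>g\<in>W. eqm l x (g + a i - g)"
  using i
proof (induction l arbitrary: i x)
  case 0
  then show ?case using DW[OF 0] a_W[OF 0(1)] W_zero by (intro bexI[of _ 0] eqm_0) auto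
next
  case (Suc l)
  show ?case
  proof (cases "i = 1")
    case True
    then obtain h where h: "\<And>i. h i \<in> W" "x = rot 1 + tup h" "partial_product h d \<in> D n" using D1 Suc.prems by blast
    have "\<exists>q\<in>W. x = q + (rot 1 + emb 0 (partial_product h d)) - q"
      unfolding h(2) by (rule rot_1_tup_conj[OF h(1)])
    then obtain q where q: "q \<in> W" "x = q + (rot 1 + emb 0 (partial_product h d)) - q" by blast
    obtain g where g: "g \<in> W" "eqm l (partial_product h d) (g + a n - g)" using Suc.IH[OF _ h(3)] n by auto
    have "eqm (Suc l) (rot 1 + emb 0 (partial_product h d)) (rot 1 + emb 0 (g + a n - g))"
      by (intro eqm_add eqm_refl rot_W eqm_emb g)
    also have "rot 1 + emb 0 (g + a n - g) = tup (\<lambda>_. g) + a 1 - tup (\<lambda>_. g)"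
    proof -
      have "tup (\<lambda>_. g) + a 1 - tup (\<lambda>_. g) = (tup (\<lambda>_. g) + rot 1 - tup (\<lambda>_. g)) + (tup (\<lambda>_. g) + emb 0 (a n) - tup (\<lambda>_. g))"
        by (simp only: a_1) (simp add: grp del: add_uminus_conv_diff)
      also have "tup (\<lambda>_. g) + rot 1 - tup (\<lambda>_. g) = rot 1" by (simp add: tup_rot)
      finally show ?thesis by (simp add: tup_emb_conj)
    qed
    finally show ?thesis using eqm_conj_trans[OF _ q] tup_W[of "\<lambda>_. g"] g(1) True by blast
  next
    case False
    then have i: "i \<in> {2..n}" "i - 1 \<in> {1..n}" using Suc.prems by auto
    obtain h j where h: "j \<in> {0..<int d}" "x = tup h" "h j \<in> D (i - 1)" "\<forall>k\<in>{0..<int d} - {j}. h k = 0"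
      using D[OF i(1) Suc.prems(2)] by blast
    obtain g where "g \<in> W" "eqm l (h j) (g + a (i - 1) - g)" using Suc.IH[OF i(2) h(3)] by blast
    then show ?thesis using single_section_conj[of j h g l "a (i - 1)"] h by (simp add: a_step[OF i(1)])
  qed
qed

end

context preperiodic_model
begin

text \<open>At the branch the two sections receive independent conjugators \<open>g\<close> and
  \<open>g'\<close>, which are combined into \<open>pair g g'\<close>; no relation between them is
  required, since conjugation takes place in \<open>W\<close>.\<close>

lemma classes_conj:
  assumes D1: "\<And>x. x \<in> D 1 \<Longrightarrow> \<exists>h. (\<forall>i. h i \<in> W) \<and> x = rot 1 + tup h \<and> partial_product h d = 0"
    and D: "\<And>i x. i \<in> {2..n} \<Longrightarrow> i \<noteq> Suc m \<Longrightarrow> x \<in> D i \<Longrightarrow>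
      \<exists>h. \<exists>j\<in>{0..<int d}. x = tup h \<and> h j \<in> D (i - 1) \<and> (\<forall>k\<in>{0..<int d} - {j}. h k = 0)"
    and Db: "\<And>x. x \<in> D (Suc m) \<Longrightarrow> \<exists>h. \<exists>j\<in>{0..<int d}. x = tup h \<and>
      h j \<in> D m \<and> h ((j + r) mod int d) \<in> D n \<and> (\<forall>k\<in>{0..<int d} - {j, (j + r) mod int d}. h k = 0)"
    and DW: "\<And>i x. i \<in> {1..n} \<Longrightarrow> x \<in> D i \<Longrightarrow> x \<in> W"
    and i: "i \<in> {1..n}" "x \<in> D i"
  shows "\<exists>g\<in>W. eqm l x (g + a i - g)"
  using i
proof (induction l arbitrary: i x)
  case 0
  then show ?case using DW[OF 0] a_W[OF 0(1)] W_zero by (intro bexI[of _ 0] eqm_0) auto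
next
  case (Suc l)
  consider "i = 1" | "i \<in> {2..n}" "i \<noteq> Suc m" "i - 1 \<in> {1..n}" | "i = Suc m" using Suc.prems by force
  then show ?case
  proof cases
    case 1
    then obtain h where h: "\<And>i. h i \<in> W" "x = rot 1 + tup h" "partial_product h d = 0" using D1 Suc.prems by blast
    have "\<exists>q\<in>W. x = q + (rot 1 + emb 0 (partial_product h d)) - q"
      unfolding h(2) by (rule rot_1_tup_conj[OF h(1)])
    then obtain q where q: "q \<in> W" "x = q + (rot 1 + emb 0 (partial_product h d)) - q" by blast
    then have "x = q + a i - q" using h(3) 1 a_1 by simp
    then show ?thesis using q eqm_refl DW[OF Suc.prems] by metis
  next
    case 2
    obtain h j where h: "j \<in> {0..<int d}" "x = tup h" "h j \<in> D (i - 1)" "\<forall>k\<in>{0..<int d} - {j}. h k = 0"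
      using D[OF 2(1,2) Suc.prems(2)] by blast
    obtain g where "g \<in> W" "eqm l (h j) (g + a (i - 1) - g)" using Suc.IH[OF 2(3) h(3)] by blast
    then show ?thesis using single_section_conj[of j h g l "a (i - 1)"] h by (simp add: a_step[OF 2(1,2)])
  next
    case 3
    obtain h j where h: "j \<in> {0..<int d}" "x = tup h" "h j \<in> D m" "h ((j + r) mod int d) \<in> D n"
      "\<forall>k\<in>{0..<int d} - {j, (j + r) mod int d}. h k = 0" using Db Suc.prems(2) unfolding 3 by blast
    obtain g where g: "g \<in> W" "eqm l (h j) (g + a m - g)" using Suc.IH[OF _ h(3)] m by auto
    obtain g' where g': "g' \<in> W" "eqm l (h ((j + r) mod int d)) (g' + a n - g')" using Suc.IH[OF _ h(4)] m by auto
    have "tup h = emb (0 + j) (h j) + emb (r + j) (h ((j + r) mod int d))"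
      unfolding emb_def tup_add[symmetric]
    proof (rule tup_cong)
      fix i assume i: "0 \<le> i" "i < int d"
      have "(j + r) mod int d \<noteq> j"
      proof
        assume "(j + r) mod int d = j"
        then have "(j + r) mod int d = j mod int d" using h(1) by simp
        then have "int d dvd (j + r) - j" by (simp only: mod_eq_dvd_iff)
        then show False using r zdvd_imp_le[of "int d" r] by simp
      qed
      moreover have "(r + j) mod int d = (j + r) mod int d" by (simp add: add.commute)
      moreover have "j mod int d = j" using h(1) by simp
      ultimately show "h i = pos (0 + j) (h j) i + pos (r + j) (h ((j + r) mod int d)) i"
        using h(5) i by (auto simp: pos_def)
    qed
    also have "\<dots> = rot j + pair (h j) (h ((j + r) mod int d)) - rot j"
      unfolding rot_emb[symmetric] pair_eq_emb by (simp add: grp del: add_uminus_conv_diff)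
    finally have e: "tup h = rot j + pair (h j) (h ((j + r) mod int d)) - rot j" .
    have "eqm (Suc l) (pair (h j) (h ((j + r) mod int d))) (pair (g + a m - g) (g' + a n - g'))"
      by (intro eqm_pair g g')
    also have "pair (g + a m - g) (g' + a n - g') = pair g g' + a i - pair g g'"
      by (simp only: diff_conv_add_uminus pair_add pair_minus a_branch' 3)
    finally show ?thesis using eqm_conj_trans[OF _ rot_W e] emb_W g(1) g'(1) W_add unfolding h(2) pair_eq_emb by blast
  qed
qed

end

section \<open>Bijections as an additively written group\<close>

text \<open>Carries the \<open>group_add\<close> instance demanded by the abstract part, with
  composition written as addition.\<close>

typedef 'a bijection = "{f :: 'a \<Rightarrow> 'a. bij f}"
  morphisms app Bijection
  by (rule exI[of _ id]) simp

lemma bij_app: "bij (app f)" using app[of f] by simp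

lemma app_Bijection: "bij f \<Longrightarrow> app (Bijection f) = f" by (simp add: Bijection_inverse)

lemma bijection_eqI: "(\<And>x. app f x = app g x) \<Longrightarrow> f = g"
  using app_inject by blast

instantiation bijection :: (type) group_add
begin

definition "0 = Bijection id"
definition "f + g = Bijection (app f \<circ> app g)"
definition "- f = Bijection (inv' (app f))"
definition "f - g = f + - (g :: 'a bijection)"

instance
proof
  fix f g h :: "'a bijection"
  have app_plus: "app (f + g) = app f \<circ> app g" for f g :: "'a bijection"
    unfolding plus_bijection_def by (rule app_Bijection) (intro bij_comp bij_app)
  have app_zero: "app (0 :: 'a bijection) = id" unfolding zero_bijection_def by (rule app_Bijection) simp
  have app_minus: "app (- f) = inv' (app f)" for f :: "'a bijection"
    unfolding uminus_bijection_def by (rule app_Bijection) (intro bij_imp_bij_inv bij_app)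
  show "f + g + h = f + (g + h)" by (rule bijection_eqI) (simp add: app_plus)
  show "0 + f = f" "f + 0 = f" by (rule bijection_eqI; simp add: app_plus app_zero)+
  show "- f + f = 0"
    by (rule bijection_eqI) (simp add: app_plus app_zero app_minus inv_f_f bij_is_inj[OF bij_app])
  show "f + - g = f - g" by (simp add: minus_bijection_def)
qed

end

lemma app_plus: "app (f + g) = app f \<circ> app g"
  unfolding plus_bijection_def by (rule app_Bijection) (intro bij_comp bij_app)

lemma app_zero: "app 0 = id" unfolding zero_bijection_def by (rule app_Bijection) simp

lemma app_uminus: "app (- f) = inv' (app f)"
  unfolding uminus_bijection_def by (rule app_Bijection) (intro bij_imp_bij_inv bij_app)

section \<open>The iterated wreath product of a cyclic group\<close>

definition rotl :: "nat \<Rightarrow> int \<Rightarrow> nat \<Rightarrow> nat" where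
  "rotl d k i = (if i \<in> {1..d} then nat ((int i - 1 + k) mod int d) + 1 else i)"

text \<open>Residue 0 stands for the letter \<open>d\<close>, so that the last coordinate in the
  recursion of the odometer becomes vertex 0 of the abstract model.\<close>

definition letter :: "nat \<Rightarrow> int \<Rightarrow> nat" where
  "letter d j = (if j mod int d = 0 then d else nat (j mod int d))"

lemma rotl_range: assumes "i \<in> {1..d}" shows "rotl d k i \<in> {1..d}"
proof -
  have "0 \<le> (int i - 1 + k) mod int d" "(int i - 1 + k) mod int d < int d" using assms by auto
  then have "nat ((int i - 1 + k) mod int d) < d" by linarith
  then show ?thesis using assms by (simp add: rotl_def)
qed

lemma rotl_outside: "i \<notin> {1..d} \<Longrightarrow> rotl d k i = i" by (auto simp: rotl_def)

lemma rotl_add: "rotl d (j + k) i = rotl d j (rotl d k i)"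
proof (cases "i \<in> {1..d}")
  case True
  then have d: "int d > 0" by auto
  have "int (rotl d k i) = (int i - 1 + k) mod int d + 1" using True d by (simp add: rotl_def)
  then have "rotl d j (rotl d k i) = nat (((int i - 1 + k) mod int d + j) mod int d) + 1"
    using rotl_range[OF True, of k] by (simp add: rotl_def)
  also have "((int i - 1 + k) mod int d + j) mod int d = (int i - 1 + (j + k)) mod int d"
    unfolding mod_add_left_eq by (simp add: algebra_simps)
  finally have "rotl d j (rotl d k i) = nat ((int i - 1 + (j + k)) mod int d) + 1" .
  moreover have "rotl d (j + k) i = nat ((int i - 1 + (j + k)) mod int d) + 1" using True by (simp add: rotl_def)
  ultimately show ?thesis by simp
qed (simp add: rotl_outside)

lemma rotl_0: "rotl d 0 = id" by (rule ext) (auto simp: rotl_def)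

lemma rotl_d: "rotl d (int d) = id"
  by (rule ext) (auto simp: rotl_def)

lemma rotl_comp: "rotl d j \<circ> rotl d k = rotl d (j + k)" by (rule ext) (simp add: rotl_add)

lemma rotl_mod: "rotl d (k mod int d) = rotl d k"
  by (rule ext) (simp add: rotl_def mod_add_right_eq)

lemma rotl_inverse: "rotl d (- k) (rotl d k i) = i" "rotl d k (rotl d (- k) i) = i"
  using rotl_add[of d "-k" k i] rotl_add[of d k "-k" i] by (simp_all add: rotl_0)

lemma rotl_permutes: "rotl d k permutes {1..d}"
  by (rule bij_imp_permutes[OF bij_betwI[of _ _ _ "rotl d (- k)"]])
    (use rotl_range rotl_inverse rotl_outside in blast)+

lemma std_cycle_rotl: "std_cycle d = rotl d 1"
proof
  fix i show "std_cycle d i = rotl d 1 i"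
  proof (cases "i \<in> {1..d}")
    case True
    then show ?thesis by (auto simp: std_cycle_eq rotl_def)
  next
    case False
    then have "std_cycle d i = i" unfolding std_cycle_def by (intro id_outside_supp) auto
    then show ?thesis using False by (simp add: rotl_outside)
  qed
qed

lemma cyclic_perms_eq: assumes "d \<ge> 1" shows "cyclic_perms d = range (rotl d)"
proof
  have gen: "generate (sym_group d) {rotl d 1} \<subseteq> range (rotl d)"
  proof
    fix s assume "s \<in> generate (sym_group d) {rotl d 1}"
    then show "s \<in> range (rotl d)"
    proof (induction rule: generate.induct)
      case one
      show ?case using rotl_0[of d] by (metis rangeI sym_group_one)
    next
      case (inv h)
      have "inv' (rotl d 1) = rotl d (- 1)" by (rule inv_unique_comp) (auto simp: rotl_inverse)
      moreover have "rotl d 1 \<in> carrier (sym_group d)" using rotl_permutes by (simp add: sym_group_carrier)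
      ultimately show ?case using inv sym_group_inv_equality[of "rotl d 1" d] by auto
    next
      case (eng h1 h2)
      then obtain j k where "h1 = rotl d j" "h2 = rotl d k" by blast
      then have "h1 \<otimes>\<^bsub>sym_group d\<^esub> h2 = rotl d (j + k)" by (simp add: sym_group_mult rotl_comp flip: comp_def)
      then show ?case by simp
    qed auto
  qed
  then show "cyclic_perms d \<subseteq> range (rotl d)" by (simp add: cyclic_perms_def std_cycle_rotl)
  have nat: "rotl d (int k) \<in> generate (sym_group d) {rotl d 1}" for k
  proof (induction k)
    case 0
    show ?case using generate.one[of "sym_group d" "{rotl d 1}"] unfolding sym_group_one of_nat_0 rotl_0 .
  next
    case (Suc k)
    have "rotl d 1 \<in> generate (sym_group d) {rotl d 1}" by (rule generate.incl) simp
    then have "rotl d 1 \<otimes>\<^bsub>sym_group d\<^esub> rotl d (int k) \<in> generate (sym_group d) {rotl d 1}"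
      by (rule generate.eng[OF _ Suc])
    then show ?case by (simp add: sym_group_mult rotl_comp)
  qed
  have "rotl d k \<in> generate (sym_group d) {rotl d 1}" for k
    using nat[of "nat (k mod int d)"] assms by (simp add: rotl_mod)
  then show "range (rotl d) \<subseteq> cyclic_perms d" by (auto simp: cyclic_perms_def std_cycle_rotl)
qed

lemma letter_range: assumes "d \<ge> 1" shows "letter d j \<in> {1..d}"
proof -
  have "0 \<le> j mod int d" "j mod int d < int d" using assms by auto
  then have "j mod int d \<noteq> 0 \<Longrightarrow> 1 \<le> nat (j mod int d) \<and> nat (j mod int d) \<le> d" by linarith
  then show ?thesis using assms by (simp add: letter_def)
qed

lemma letter_residue: "i \<in> {1..d} \<Longrightarrow> letter d (int i mod int d) = i"
  by (cases "i = d") (auto simp: letter_def)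

lemma residue_letter: "d \<ge> 1 \<Longrightarrow> int (letter d j) mod int d = j mod int d"
  by (auto simp: letter_def)

lemma residue_rotl: "i \<in> {1..d} \<Longrightarrow> int (rotl d k i) mod int d = (int i + k) mod int d"
proof -
  assume i: "i \<in> {1..d}"
  then have "int (rotl d k i) = (int i - 1 + k) mod int d + 1" by (simp add: rotl_def)
  then show ?thesis by (simp add: mod_add_left_eq)
qed

context
  fixes d :: nat
  assumes d: "d \<ge> 1"
begin

lemma wreath_perms_cases:
  assumes "g \<in> wreath_perms d"
  obtains k gs where "g = node d (rotl d k) gs" "\<And>i. i \<in> {1..d} \<Longrightarrow> gs i \<in> wreath_perms d"
  using assms by (cases rule: wreath_perms.cases) (auto simp: cyclic_perms_eq[OF d])

lemma node_wreath_perms: "(\<And>i. i \<in> {1..d} \<Longrightarrow> gs i \<in> wreath_perms d) \<Longrightarrow> node d (rotl d k) gs \<in> wreath_perms d"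
  by (rule wreath_perms.node) (auto simp: cyclic_perms_eq[OF d])

lemma wreath_perms_coinduct:
  assumes "X g" and "\<And>g. X g \<Longrightarrow> \<exists>k gs. g = node d (rotl d k) gs \<and> (\<forall>i\<in>{1..d}. X (gs i) \<or> gs i \<in> wreath_perms d)"
  shows "g \<in> wreath_perms d"
  using assms(1)
proof (coinduction arbitrary: g rule: wreath_perms.coinduct)
  case wreath_perms
  then show ?case using assms(2)[OF wreath_perms] by (fastforce simp: cyclic_perms_eq[OF d])
qed

lemma wreath_perms_outside: "g \<in> wreath_perms d \<Longrightarrow> w \<notin> lists {1..d} \<Longrightarrow> g w = w"
  by (erule wreath_perms_cases) (cases w; auto)

lemma wreath_perms_lists: "g \<in> wreath_perms d \<Longrightarrow> w \<in> lists {1..d} \<Longrightarrow> g w \<in> lists {1..d} \<and> length (g w) = length w"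
proof (induction w arbitrary: g)
  case Nil
  then show ?case by (elim wreath_perms_cases) auto
next
  case (Cons i w)
  from Cons.prems(1) obtain k gs where g: "g = node d (rotl d k) gs" "\<And>i. i \<in> {1..d} \<Longrightarrow> gs i \<in> wreath_perms d"
    by (rule wreath_perms_cases) blast
  have "i \<in> {1..d}" "w \<in> lists {1..d}" using Cons.prems(2) by auto
  then show ?case using Cons.IH[OF g(2)] rotl_range[of i d k] g(1) by auto
qed

lemma wreath_perms_length: "g \<in> wreath_perms d \<Longrightarrow> length (g w) = length w"
  using wreath_perms_lists wreath_perms_outside by metis

lemma wreath_perms_lists_iff: "g \<in> wreath_perms d \<Longrightarrow> g w \<in> lists {1..d} \<longleftrightarrow> w \<in> lists {1..d}"
  using wreath_perms_lists wreath_perms_outside by metis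

lemma id_wreath_perms: "id \<in> wreath_perms d"
proof (rule wreath_perms_coinduct[of "\<lambda>g. g = id"])
  fix g :: "nat list \<Rightarrow> nat list" assume "g = id"
  moreover have "id w = node d (rotl d 0) (\<lambda>_. id) w" for w by (cases w) (auto simp: rotl_0)
  ultimately show "\<exists>k gs. g = node d (rotl d k) gs \<and> (\<forall>i\<in>{1..d}. gs i = id \<or> gs i \<in> wreath_perms d)" by fastforce
qed simp

lemma comp_node:
  assumes "\<And>i. i \<in> {1..d} \<Longrightarrow> gs' i \<in> wreath_perms d"
  shows "node d (rotl d k) gs \<circ> node d (rotl d k') gs' = node d (rotl d (k + k')) (\<lambda>i. gs (rotl d k' i) \<circ> gs' i)"
proof
  fix w show "(node d (rotl d k) gs \<circ> node d (rotl d k') gs') w = node d (rotl d (k + k')) (\<lambda>i. gs (rotl d k' i) \<circ> gs' i) w"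
  proof (cases w)
    case (Cons i v)
    then show ?thesis using assms[of i] wreath_perms_lists[of "gs' i" v] rotl_range[of i d k']
      by (auto simp: rotl_add simp del: atLeastAtMost_iff)
  qed simp
qed

lemma comp_wreath_perms: "g \<in> wreath_perms d \<Longrightarrow> h \<in> wreath_perms d \<Longrightarrow> g \<circ> h \<in> wreath_perms d"
proof (rule wreath_perms_coinduct[of "\<lambda>f. \<exists>g\<in>wreath_perms d. \<exists>h\<in>wreath_perms d. f = g \<circ> h"])
  fix f assume "\<exists>g\<in>wreath_perms d. \<exists>h\<in>wreath_perms d. f = g \<circ> h"
  then obtain g h where "g \<in> wreath_perms d" "h \<in> wreath_perms d" and f: "f = g \<circ> h" by blast
  then obtain k gs k' gs' where g: "g = node d (rotl d k) gs" "\<And>i. i \<in> {1..d} \<Longrightarrow> gs i \<in> wreath_perms d"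
    and h: "h = node d (rotl d k') gs'" "\<And>i. i \<in> {1..d} \<Longrightarrow> gs' i \<in> wreath_perms d"
    by (elim wreath_perms_cases) blast
  have "f = node d (rotl d (k + k')) (\<lambda>i. gs (rotl d k' i) \<circ> gs' i)" unfolding f g(1) h(1) by (rule comp_node[OF h(2)])
  moreover have "\<forall>i\<in>{1..d}. \<exists>g\<in>wreath_perms d. \<exists>h\<in>wreath_perms d. gs (rotl d k' i) \<circ> gs' i = g \<circ> h"
    using g(2) h(2) rotl_range by blast
  ultimately show "\<exists>k gs. f = node d (rotl d k) gs \<and> (\<forall>i\<in>{1..d}. (\<exists>g\<in>wreath_perms d. \<exists>h\<in>wreath_perms d. gs i = g \<circ> h) \<or> gs i \<in> wreath_perms d)"
    by (intro exI[of _ "k + k'"] exI[of _ "\<lambda>i. gs (rotl d k' i) \<circ> gs' i"]) blast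
qed blast

text \<open>Coinductive membership gives only the shape at the first level, so bijectivity is
  established by induction on the words.\<close>

lemma wreath_perms_inj: "g \<in> wreath_perms d \<Longrightarrow> g v = g w \<Longrightarrow> v = w"
proof (induction v arbitrary: g w)
  case Nil
  then show ?case using wreath_perms_length[OF Nil(1)] by (metis length_0_conv)
next
  case (Cons i v)
  have "length w = Suc (length v)" using wreath_perms_length[OF Cons.prems(1)] Cons.prems(2) by (metis length_Cons)
  then obtain j u where w: "w = j # u" by (cases w) auto
  show ?case
  proof (cases "i # v \<in> lists {1..d}")
    case True
    then have True': "j # u \<in> lists {1..d}" using Cons.prems wreath_perms_lists_iff w by metis
    obtain k gs where g: "g = node d (rotl d k) gs" "\<And>i. i \<in> {1..d} \<Longrightarrow> gs i \<in> wreath_perms d"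
      using Cons.prems(1) by (rule wreath_perms_cases) blast
    have "rotl d k i = rotl d k j" "gs i v = gs j u" using Cons.prems(2) True True' by (auto simp: g(1) w)
    then have "i = j" using rotl_inverse(1) by metis
    then show ?thesis using Cons.IH[OF g(2)] \<open>gs i v = gs j u\<close> True w by auto
  next
    case False
    then have "j # u \<notin> lists {1..d}" using Cons.prems wreath_perms_lists_iff w by metis
    then show ?thesis using False Cons.prems wreath_perms_outside w by metis
  qed
qed

lemma wreath_perms_surj: "g \<in> wreath_perms d \<Longrightarrow> \<exists>v. g v = w"
proof (induction w arbitrary: g)
  case Nil
  then show ?case using wreath_perms_length[OF Nil(1), of "[]"] by auto
next
  case (Cons i w)
  show ?case
  proof (cases "i # w \<in> lists {1..d}")
    case True
    obtain k gs where g: "g = node d (rotl d k) gs" "\<And>i. i \<in> {1..d} \<Longrightarrow> gs i \<in> wreath_perms d"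
      using Cons.prems(1) by (rule wreath_perms_cases) blast
    let ?j = "rotl d (- k) i"
    have j: "?j \<in> {1..d}" using True rotl_range by auto
    obtain v where v: "gs ?j v = w" using Cons.IH[OF g(2)[OF j]] by blast
    then have "v \<in> lists {1..d}" using True wreath_perms_lists_iff[OF g(2)[OF j]] by auto
    then have "g (?j # v) = i # w" using j v by (simp add: g(1) rotl_inverse del: atLeastAtMost_iff)
    then show ?thesis by blast
  next
    case False
    then show ?thesis using wreath_perms_outside[OF Cons.prems] by blast
  qed
qed

lemma wreath_perms_bij: "g \<in> wreath_perms d \<Longrightarrow> bij g"
  unfolding bij_def inj_def surj_def using wreath_perms_inj wreath_perms_surj by metis

lemma inv_wreath_perms: "g \<in> wreath_perms d \<Longrightarrow> inv' g \<in> wreath_perms d"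
proof (rule wreath_perms_coinduct[of "\<lambda>f. \<exists>g\<in>wreath_perms d. f = inv' g"])
  fix f assume "\<exists>g\<in>wreath_perms d. f = inv' g"
  then obtain g where gw: "g \<in> wreath_perms d" and f: "f = inv' g" by blast
  obtain k gs where g: "g = node d (rotl d k) gs" "\<And>i. i \<in> {1..d} \<Longrightarrow> gs i \<in> wreath_perms d"
    using gw by (rule wreath_perms_cases) blast
  \<comment> \<open>The section of the inverse at \<open>i\<close> inverts the section at the letter
    that is moved to \<open>i\<close>.\<close>
  let ?gs = "\<lambda>i. inv' (gs (rotl d (- k) i))"
  have "node d (rotl d (- k)) ?gs (g w) = w" for w
  proof (cases w)
    case (Cons i v)
    show ?thesis
    proof (cases "i # v \<in> lists {1..d}")
      case True
      then have "i \<in> {1..d}" "v \<in> lists {1..d}" by auto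
      then show ?thesis using wreath_perms_lists[OF g(2)[of i], of v] rotl_range[of i d k] inv_f_f[OF bij_is_inj[OF wreath_perms_bij[OF g(2)[of i]]]]
        by (auto simp: Cons g(1) rotl_inverse simp del: atLeastAtMost_iff)
    qed (auto simp: Cons g(1))
  qed (simp add: g(1))
  then have "node d (rotl d (- k)) ?gs \<circ> g = id" by auto
  then have "f = node d (rotl d (- k)) ?gs" unfolding f using wreath_perms_bij[OF gw]
    by (metis bij_is_surj comp_assoc comp_id id_comp surj_iff)
  moreover have "\<forall>i\<in>{1..d}. \<exists>g\<in>wreath_perms d. ?gs i = inv' g" using g(2) rotl_range by blast
  ultimately show "\<exists>k gs. f = node d (rotl d k) gs \<and> (\<forall>i\<in>{1..d}. (\<exists>g\<in>wreath_perms d. gs i = inv' g) \<or> gs i \<in> wreath_perms d)" by blast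
qed blast

lemma iter_wreath_group: "group (iter_wreath d)"
proof (rule groupI)
  fix x assume x: "x \<in> carrier (iter_wreath d)"
  show "\<exists>y\<in>carrier (iter_wreath d). y \<otimes>\<^bsub>iter_wreath d\<^esub> x = \<one>\<^bsub>iter_wreath d\<^esub>"
    using x inv_wreath_perms wreath_perms_bij by (intro bexI[of _ "inv' x"]) (auto simp: iter_wreath_def bij_is_inj)
qed (auto simp: iter_wreath_def id_wreath_perms comp_wreath_perms comp_assoc)

lemma iter_wreath_inv: "g \<in> wreath_perms d \<Longrightarrow> inv\<^bsub>iter_wreath d\<^esub> g = inv' g"
  by (rule group.inv_equality[OF iter_wreath_group])
    (auto simp: iter_wreath_def inv_wreath_perms bij_is_inj wreath_perms_bij)

end

section \<open>The wreath recursion on bijections of all words\<close>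

text \<open>
  To have a wreath recursion without side conditions, a tree automorphism is extended from words over
  \<open>{1..d}\<close> to all words by acting on the longest prefix with letters in \<open>{1..d}\<close>. The letter \<open>i\<close>
  corresponds to the residue of \<open>i\<close> modulo \<open>d\<close>.
\<close>

definition ext_word :: "nat \<Rightarrow> (nat list \<Rightarrow> nat list) \<Rightarrow> nat list \<Rightarrow> nat list" where
  "ext_word d g w = g (takeWhile (\<lambda>i. i \<in> {1..d}) w) @ dropWhile (\<lambda>i. i \<in> {1..d}) w"

definition tree_bij :: "nat \<Rightarrow> (nat list \<Rightarrow> nat list) \<Rightarrow> nat list bijection" where
  "tree_bij d g = Bijection (ext_word d g)"

definition tree_rot :: "nat \<Rightarrow> int \<Rightarrow> nat list bijection" where
  "tree_rot d k = Bijection (\<lambda>w. case w of [] \<Rightarrow> [] | i # v \<Rightarrow> rotl d k i # v)"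

definition tree_tup :: "nat \<Rightarrow> (int \<Rightarrow> nat list bijection) \<Rightarrow> nat list bijection" where
  "tree_tup d h = Bijection (\<lambda>w. case w of [] \<Rightarrow> [] | i # v \<Rightarrow> i # (if i \<in> {1..d} then app (h (int i mod int d)) v else v))"

definition tree_W :: "nat \<Rightarrow> nat list bijection set" where
  "tree_W d = tree_bij d ` wreath_perms d"

definition tree_K :: "nat \<Rightarrow> nat \<Rightarrow> nat list bijection set" where
  "tree_K d l = {g \<in> tree_W d. \<forall>w. length w \<le> l \<longrightarrow> app g w = w}"

lemma app_tree_rot: "app (tree_rot d k) = (\<lambda>w. case w of [] \<Rightarrow> [] | i # v \<Rightarrow> rotl d k i # v)"
  unfolding tree_rot_def
proof (rule app_Bijection, rule o_bij)
  let ?f = "\<lambda>k w. case w of [] \<Rightarrow> [] | i # v \<Rightarrow> rotl d k i # v"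
  show "?f (- k) \<circ> ?f k = id" "?f k \<circ> ?f (- k) = id" by (rule ext; simp add: rotl_inverse split: list.split)+
qed

lemma app_tree_tup:
  "app (tree_tup d h) = (\<lambda>w. case w of [] \<Rightarrow> [] | i # v \<Rightarrow> i # (if i \<in> {1..d} then app (h (int i mod int d)) v else v))"
  unfolding tree_tup_def
proof (rule app_Bijection, rule o_bij)
  let ?f = "\<lambda>h w. case w of [] \<Rightarrow> [] | i # v \<Rightarrow> i # (if i \<in> {1..d} then app (h (int i mod int d)) v else v)"
  have inv: "app (- g) (app g v) = v" "app g (app (- g) v) = v" for g :: "nat list bijection" and v
    by (simp_all add: app_uminus inv_f_f surj_f_inv_f bij_app bij_is_inj bij_is_surj)
  have "(?f (\<lambda>i. - h i) \<circ> ?f h) w = id w" "(?f h \<circ> ?f (\<lambda>i. - h i)) w = id w" for w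
    by (cases w; simp add: inv)+
  then show "?f (\<lambda>i. - h i) \<circ> ?f h = id" "?f h \<circ> ?f (\<lambda>i. - h i) = id" by blast+
qed

lemma app_tree_rot_Cons [simp]: "app (tree_rot d k) (i # v) = rotl d k i # v" "app (tree_rot d k) [] = []"
  by (simp_all add: app_tree_rot)

lemma app_tree_tup_Cons [simp]:
  "app (tree_tup d h) (i # v) = i # (if i \<in> {1..d} then app (h (int i mod int d)) v else v)" "app (tree_tup d h) [] = []"
  by (simp_all add: app_tree_tup)

context
  fixes d :: nat
  assumes d: "d \<ge> 1"
begin

lemma ext_word_lists: "w \<in> lists {1..d} \<Longrightarrow> ext_word d g w = g w"
proof -
  assume "w \<in> lists {1..d}"
  then have "\<forall>i\<in>set w. i \<in> {1..d}" by auto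
  then have "takeWhile (\<lambda>i. i \<in> {1..d}) w = w" "dropWhile (\<lambda>i. i \<in> {1..d}) w = []"
    by (auto simp: takeWhile_eq_all_conv dropWhile_eq_Nil_conv)
  then show ?thesis by (simp only: ext_word_def append_Nil2)
qed

lemma takeWhile_lists: "takeWhile (\<lambda>i. i \<in> {1..d}) w \<in> lists {1..d}"
  by (auto dest: set_takeWhileD)

lemma prefix_append:
  assumes "u \<in> lists {1..d}"
  shows "takeWhile (\<lambda>i. i \<in> {1..d}) (u @ dropWhile (\<lambda>i. i \<in> {1..d}) w) = u"
    "dropWhile (\<lambda>i. i \<in> {1..d}) (u @ dropWhile (\<lambda>i. i \<in> {1..d}) w) = dropWhile (\<lambda>i. i \<in> {1..d}) w"
proof -
  have u: "\<And>i. i \<in> set u \<Longrightarrow> i \<in> {1..d}" using assms by auto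
  have "takeWhile P (dropWhile P w) = []" for P :: "nat \<Rightarrow> bool" by (induction w) auto
  then show "takeWhile (\<lambda>i. i \<in> {1..d}) (u @ dropWhile (\<lambda>i. i \<in> {1..d}) w) = u"
    using u by (simp add: takeWhile_append2 del: atLeastAtMost_iff)
  show "dropWhile (\<lambda>i. i \<in> {1..d}) (u @ dropWhile (\<lambda>i. i \<in> {1..d}) w) = dropWhile (\<lambda>i. i \<in> {1..d}) w"
    using u by (simp add: dropWhile_append2 del: atLeastAtMost_iff)
qed

lemma ext_word_comp:
  assumes "h \<in> wreath_perms d" shows "ext_word d (g \<circ> h) = ext_word d g \<circ> ext_word d h"
proof
  fix w
  have "h (takeWhile (\<lambda>i. i \<in> {1..d}) w) \<in> lists {1..d}" using wreath_perms_lists[OF d assms takeWhile_lists] by blast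
  then show "ext_word d (g \<circ> h) w = (ext_word d g \<circ> ext_word d h) w"
    by (simp only: ext_word_def comp_apply prefix_append)
qed

lemma ext_word_id: "ext_word d id = id" by (rule ext) (simp add: ext_word_def)

lemma app_tree_bij: assumes "g \<in> wreath_perms d" shows "app (tree_bij d g) = ext_word d g"
  unfolding tree_bij_def
proof (rule app_Bijection, rule o_bij)
  show "ext_word d (inv' g) \<circ> ext_word d g = id"
    using ext_word_comp[OF assms, of "inv' g"] by (simp add: ext_word_id bij_is_inj wreath_perms_bij[OF d assms])
  have "g \<circ> inv' g = id" using wreath_perms_bij[OF d assms] by (simp add: bij_is_surj surj_iff[symmetric])
  then show "ext_word d g \<circ> ext_word d (inv' g) = id"
    using ext_word_comp[OF inv_wreath_perms[OF d assms], of g] by (simp add: ext_word_id)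
qed

lemma tree_bij_comp:
  "g \<in> wreath_perms d \<Longrightarrow> h \<in> wreath_perms d \<Longrightarrow> tree_bij d (g \<circ> h) = tree_bij d g + tree_bij d h"
  by (rule bijection_eqI) (simp add: app_plus app_tree_bij comp_wreath_perms[OF d] ext_word_comp del: comp_apply)

lemma tree_bij_id: "tree_bij d id = 0"
  by (rule bijection_eqI) (simp add: app_zero app_tree_bij id_wreath_perms[OF d] ext_word_id)

lemma tree_bij_inv: assumes "g \<in> wreath_perms d" shows "tree_bij d (inv' g) = - tree_bij d g"
proof -
  have "tree_bij d (inv' g) + tree_bij d g = 0"
    using assms by (simp add: tree_bij_id bij_is_inj wreath_perms_bij[OF d] inv_wreath_perms[OF d] flip: tree_bij_comp)
  then show ?thesis by (simp add: eq_neg_iff_add_eq_0)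
qed

lemma ext_word_length: "g \<in> wreath_perms d \<Longrightarrow> length (ext_word d g w) = length w"
  using wreath_perms_length[OF d, of g] arg_cong[OF takeWhile_dropWhile_id[of "\<lambda>i. i \<in> {1..d}" w], of length]
  by (simp add: ext_word_def del: atLeastAtMost_iff takeWhile_dropWhile_id)

lemma ext_word_agree:
  assumes "\<And>w. w \<in> lists {1..d} \<Longrightarrow> length w \<le> l \<Longrightarrow> g w = h w" "length w \<le> l"
  shows "ext_word d g w = ext_word d h w"
proof -
  have "length (takeWhile (\<lambda>i. i \<in> {1..d}) w) \<le> l" using assms(2) length_takeWhile_le order_trans by blast
  then show ?thesis using assms(1) takeWhile_lists unfolding ext_word_def by simp
qed

text \<open>An extended map acts only on the longest prefix over \<open>{1..d}\<close>, which is no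
  longer than the word, and elements of \<open>wreath_perms\<close> fix all words with other
  letters. So agreement on short words may be tested before or after the extension.\<close>

lemma tree_bij_mod:
  assumes g: "g \<in> wreath_perms d" and h: "h \<in> wreath_perms d"
  shows "cong_mod (tree_W d) (tree_K d l) (tree_bij d g) (tree_bij d h) \<longleftrightarrow> (\<forall>w. length w \<le> l \<longrightarrow> g w = h w)"
proof -
  have mem: "tree_bij d g - tree_bij d h \<in> tree_W d"
  proof -
    have "tree_bij d g - tree_bij d h = tree_bij d (g \<circ> inv' h)"
      using g h by (simp add: tree_bij_comp tree_bij_inv inv_wreath_perms[OF d])
    then show ?thesis using g h comp_wreath_perms[OF d] inv_wreath_perms[OF d] by (simp add: tree_W_def)
  qed
  have app_diff: "app (tree_bij d g - tree_bij d h) (ext_word d h v) = ext_word d g v" for v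
  proof -
    have "app (tree_bij d g - tree_bij d h) (app (tree_bij d h) v) = app ((tree_bij d g - tree_bij d h) + tree_bij d h) v"
      by (simp only: app_plus comp_apply)
    then show ?thesis by (simp add: app_tree_bij g h)
  qed
  have surj: "\<exists>v. length v = length w \<and> ext_word d h v = w" for w
  proof -
    define v where "v = inv' (app (tree_bij d h)) w"
    have "ext_word d h v = w"
      unfolding v_def app_tree_bij[OF h, symmetric] by (rule surj_f_inv_f[OF bij_is_surj[OF bij_app]])
    then show ?thesis using ext_word_length[OF h, of v] by auto
  qed
  have "(\<forall>w. length w \<le> l \<longrightarrow> app (tree_bij d g - tree_bij d h) w = w) \<longleftrightarrow> (\<forall>v. length v \<le> l \<longrightarrow> ext_word d g v = ext_word d h v)"
    using app_diff surj ext_word_length[OF h] by metis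
  also have "\<dots> \<longleftrightarrow> (\<forall>w. length w \<le> l \<longrightarrow> g w = h w)"
  proof
    assume *: "\<forall>v. length v \<le> l \<longrightarrow> ext_word d g v = ext_word d h v"
    show "\<forall>w. length w \<le> l \<longrightarrow> g w = h w"
    proof (intro allI impI)
      fix w :: "nat list" assume "length w \<le> l"
      then show "g w = h w" using * ext_word_lists[of w] wreath_perms_outside[OF d g] wreath_perms_outside[OF d h]
        by (cases "w \<in> lists {1..d}") auto
    qed
  next
    assume "\<forall>w. length w \<le> l \<longrightarrow> g w = h w"
    then show "\<forall>v. length v \<le> l \<longrightarrow> ext_word d g v = ext_word d h v" using ext_word_agree[of l g h] by blast
  qed
  finally show ?thesis using g h mem by (simp add: cong_mod_def tree_K_def tree_W_def)
qed

lemma tree_bij_node: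
  assumes "\<And>i. i \<in> {1..d} \<Longrightarrow> gs i \<in> wreath_perms d"
  shows "tree_bij d (node d (rotl d k) gs) = tree_rot d k + tree_tup d (\<lambda>j. tree_bij d (gs (letter d j)))"
proof (rule bijection_eqI)
  fix w
  have n: "node d (rotl d k) gs \<in> wreath_perms d" by (rule node_wreath_perms[OF d assms])
  show "app (tree_bij d (node d (rotl d k) gs)) w = app (tree_rot d k + tree_tup d (\<lambda>j. tree_bij d (gs (letter d j)))) w"
  proof (cases w)
    case Nil
    then show ?thesis by (simp add: app_tree_bij[OF n] app_plus ext_word_def)
  next
    case (Cons i v)
    show ?thesis
    proof (cases "i \<in> {1..d}")
      case True
      then show ?thesis using takeWhile_lists[of v] letter_residue[OF True] assms[OF True]
        by (auto simp: Cons app_tree_bij[OF n] app_plus ext_word_def app_tree_bij simp del: atLeastAtMost_iff)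
    next
      case False
      then show ?thesis by (simp add: Cons app_tree_bij[OF n] app_plus ext_word_def rotl_outside del: atLeastAtMost_iff)
    qed
  qed
qed

lemma tree_W_cases:
  assumes "g \<in> tree_W d"
  shows "\<exists>k h. (\<forall>i. h i \<in> tree_W d) \<and> g = tree_rot d k + tree_tup d h"
proof -
  obtain g' where g': "g = tree_bij d g'" "g' \<in> wreath_perms d" using assms by (auto simp: tree_W_def)
  obtain k gs where gs: "g' = node d (rotl d k) gs" "\<And>i. i \<in> {1..d} \<Longrightarrow> gs i \<in> wreath_perms d"
    using g'(2) by (rule wreath_perms_cases[OF d]) blast
  have "g = tree_rot d k + tree_tup d (\<lambda>j. tree_bij d (gs (letter d j)))" unfolding g'(1) gs(1) by (rule tree_bij_node[OF gs(2)])
  moreover have "\<forall>j. tree_bij d (gs (letter d j)) \<in> tree_W d" using gs(2) letter_range[OF d] by (simp add: tree_W_def del: atLeastAtMost_iff)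
  ultimately show ?thesis by (intro exI[of _ k] exI[of _ "\<lambda>j. tree_bij d (gs (letter d j))"]) simp
qed

end

lemma tree_rot_0: "tree_rot d 0 = 0"
  by (rule bijection_eqI) (simp add: app_tree_rot rotl_0 app_zero split: list.split)

lemma tree_tup_0: "tree_tup d (\<lambda>_. 0) = 0"
  by (rule bijection_eqI) (simp add: app_tree_tup app_zero split: list.split)

lemma tree_tower:
  assumes d2: "d \<ge> 2"
  shows "wreath_tower d (tree_W d) (tree_rot d) (tree_tup d) (tree_K d)"
proof -
  have d: "d \<ge> 1" using d2 by simp
  have W: "add_subgroup (tree_W d)"
  proof (rule add_subgroupI)
    show "0 \<in> tree_W d" using id_wreath_perms[OF d] tree_bij_id[OF d] unfolding tree_W_def by (metis imageI)
    show "x + y \<in> tree_W d" if "x \<in> tree_W d" "y \<in> tree_W d" for x y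
      using that comp_wreath_perms[OF d] unfolding tree_W_def by (auto simp flip: tree_bij_comp[OF d])
    show "- x \<in> tree_W d" if "x \<in> tree_W d" for x
      using that inv_wreath_perms[OF d] unfolding tree_W_def by (auto simp flip: tree_bij_inv[OF d])
  qed
  have tup_W: "tree_tup d h \<in> tree_W d" if h: "\<And>i. h i \<in> tree_W d" for h
  proof -
    have "\<forall>i. \<exists>g. g \<in> wreath_perms d \<and> h i = tree_bij d g" using h unfolding tree_W_def by blast
    from choice[OF this] obtain gs where gs: "\<And>i. gs i \<in> wreath_perms d" "\<And>i. h i = tree_bij d (gs i)" by blast
    have "tree_bij d (node d (rotl d 0) (\<lambda>i. gs (int i mod int d))) =
        tree_rot d 0 + tree_tup d (\<lambda>j. tree_bij d (gs (int (letter d j) mod int d)))"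
      by (rule tree_bij_node[OF d gs(1)])
    also have "\<dots> = tree_tup d h"
    proof (rule bijection_eqI)
      show "app (tree_rot d 0 + tree_tup d (\<lambda>j. tree_bij d (gs (int (letter d j) mod int d)))) w = app (tree_tup d h) w" for w
        by (cases w) (simp_all add: tree_rot_0 residue_letter[OF d] gs(2))
    qed
    finally show ?thesis using node_wreath_perms[OF d, of "\<lambda>i. gs (int i mod int d)" 0] gs(1)
      unfolding tree_W_def by (metis imageI)
  qed
  have W_length: "length (app g w) = length w" if "g \<in> tree_W d" for g w
    using that ext_word_length[OF d] by (auto simp: tree_W_def app_tree_bij[OF d])
  have app_diff: "app (g + x - g) w = app g (app x (app (- g) w))" for g x :: "nat list bijection" and w
    by (simp add: app_plus diff_conv_add_uminus del: add_uminus_conv_diff)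
  have app_minus: "app g (app (- g) w) = w" "app (- g) (app g w) = w" for g :: "nat list bijection" and w
    by (simp_all add: app_uminus inv_f_f surj_f_inv_f bij_app bij_is_inj bij_is_surj)
  show ?thesis
  proof
    show "2 \<le> d" by (rule d2)
    show "add_subgroup (tree_W d)" by (rule W)
    show "tree_rot d k \<in> tree_W d" for k
    proof -
      have "tree_bij d (node d (rotl d k) (\<lambda>_. id)) = tree_rot d k + tree_tup d (\<lambda>j. tree_bij d id)"
        by (rule tree_bij_node[OF d id_wreath_perms[OF d]])
      also have "\<dots> = tree_rot d k" by (simp add: tree_bij_id[OF d] tree_tup_0)
      finally show ?thesis using node_wreath_perms[OF d, of "\<lambda>_. id" k] id_wreath_perms[OF d] unfolding tree_W_def by (metis imageI)
    qed
    show "tree_rot d (i + j) = tree_rot d i + tree_rot d j" for i j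
      by (rule bijection_eqI) (simp add: app_plus app_tree_rot rotl_add split: list.split)
    show "tree_rot d (int d) = 0"
      by (rule bijection_eqI) (simp add: app_zero app_tree_rot rotl_d split: list.split)
    show "tree_tup d h = tree_tup d h'" if "\<And>i. 0 \<le> i \<Longrightarrow> i < int d \<Longrightarrow> h i = h' i" for h h'
    proof (rule bijection_eqI)
      show "app (tree_tup d h) w = app (tree_tup d h') w" for w
        using that d by (cases w) simp_all
    qed
    show "tree_tup d (\<lambda>i. h i + h' i) = tree_tup d h + tree_tup d h'" for h h'
    proof (rule bijection_eqI)
      show "app (tree_tup d (\<lambda>i. h i + h' i)) w = app (tree_tup d h + tree_tup d h') w" for w
        by (cases w) (simp_all add: app_plus)
    qed
    show "tree_tup d h \<in> tree_W d" if "\<And>i. h i \<in> tree_W d" for h by (rule tup_W[OF that])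
    show "tree_rot d k + tree_tup d h - tree_rot d k = tree_tup d (\<lambda>i. h ((i - k) mod int d))" for k h
    proof -
      have "tree_rot d k + tree_tup d h = tree_tup d (\<lambda>i. h ((i - k) mod int d)) + tree_rot d k"
      proof (rule bijection_eqI)
        fix w show "app (tree_rot d k + tree_tup d h) w = app (tree_tup d (\<lambda>i. h ((i - k) mod int d)) + tree_rot d k) w"
        proof (cases w)
          case (Cons i v)
          show ?thesis
          proof (cases "i \<in> {1..d}")
            case True
            have "(int (rotl d k i) mod int d - k) mod int d = int i mod int d"
              unfolding residue_rotl[OF True] by (simp add: mod_diff_left_eq)
            then show ?thesis using True rotl_range[OF True] by (simp add: Cons app_plus del: atLeastAtMost_iff)
          next
            case False
            then show ?thesis by (simp add: Cons app_plus rotl_outside del: atLeastAtMost_iff)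
          qed
        qed (simp add: app_plus)
      qed
      then show ?thesis by (simp add: diff_eq_eq)
    qed
    show "\<exists>k h. (\<forall>i. h i \<in> tree_W d) \<and> g = tree_rot d k + tree_tup d h" if "g \<in> tree_W d" for g
      by (rule tree_W_cases[OF d that])
    show "tree_K d 0 = tree_W d"
    proof -
      have "app g [] = []" if "g \<in> tree_W d" for g using W_length[OF that, of "[]"] by simp
      then show ?thesis by (auto simp: tree_K_def)
    qed
    show "tree_K d l \<subseteq> tree_W d" for l by (auto simp: tree_K_def)
    show "add_subgroup (tree_K d l)" for l
    proof (rule add_subgroupI)
      show "0 \<in> tree_K d l" using add_subgroup_zero[OF W] by (simp add: tree_K_def app_zero)
      show "x + y \<in> tree_K d l" if "x \<in> tree_K d l" "y \<in> tree_K d l" for x y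
        using that add_subgroup_add[OF W] by (simp add: tree_K_def app_plus)
      show "- x \<in> tree_K d l" if "x \<in> tree_K d l" for x
        using that add_subgroup_minus[OF W] app_minus(2)[of x] by (simp add: tree_K_def) metis
    qed
    show "g + x - g \<in> tree_K d l" if g: "g \<in> tree_W d" and x: "x \<in> tree_K d l" for g x l
    proof -
      have "g + x - g \<in> tree_W d" using g x add_subgroup_add[OF W] add_subgroup_diff[OF W] by (simp add: tree_K_def)
      moreover have "length (app (- g) w) = length w" for w using W_length add_subgroup_minus[OF W g] by blast
      ultimately show ?thesis using x by (simp add: tree_K_def app_diff app_minus)
    qed
    show "tree_tup d h \<in> tree_K d (Suc l)" if "\<And>i. h i \<in> tree_K d l" for h l
    proof -
      have "app (tree_tup d h) w = w" if "length w \<le> Suc l" for w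
        using that \<open>\<And>i. h i \<in> tree_K d l\<close> by (cases w) (simp_all add: tree_K_def)
      then show ?thesis using that tup_W[of h] by (simp add: tree_K_def)
    qed
  qed
qed

section \<open>Automata\<close>

text \<open>The exponent \<open>out q\<close> gives the rotation in state \<open>q\<close>, and
  \<open>nxt q i\<close> the state in which the rest of the word is read. The state comes last
  because the recursion is on the word while the state varies.\<close>

primrec automaton :: "nat \<Rightarrow> (nat \<Rightarrow> int) \<Rightarrow> (nat \<Rightarrow> nat \<Rightarrow> nat) \<Rightarrow> nat list \<Rightarrow> nat \<Rightarrow> nat list" where
  "automaton d out nxt [] q = []"
| "automaton d out nxt (i # w) q =
     (if i # w \<in> lists {1..d} then rotl d (out q) i # automaton d out nxt w (nxt q i) else i # w)"

lemma automaton_node: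
  "(\<lambda>w. automaton d out nxt w q) = node d (rotl d (out q)) (\<lambda>i w. automaton d out nxt w (nxt q i))"
proof
  show "automaton d out nxt w q = node d (rotl d (out q)) (\<lambda>i w. automaton d out nxt w (nxt q i)) w" for w
    by (cases w) auto
qed

lemma automaton_wreath_perms: "d \<ge> 1 \<Longrightarrow> (\<lambda>w. automaton d out nxt w q) \<in> wreath_perms d"
proof (rule wreath_perms_coinduct[where X = "\<lambda>g. \<exists>q. g = (\<lambda>w. automaton d out nxt w q)"])
  fix g assume "\<exists>q. g = (\<lambda>w. automaton d out nxt w q)"
  then obtain q where "g = (\<lambda>w. automaton d out nxt w q)" by blast
  then show "\<exists>k gs. g = node d (rotl d k) gs \<and> (\<forall>i\<in>{1..d}. (\<exists>q. gs i = (\<lambda>w. automaton d out nxt w q)) \<or> gs i \<in> wreath_perms d)"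
    unfolding automaton_node[of d out nxt q] by blast
qed blast+

lemma automaton_id: "out q = 0 \<Longrightarrow> (\<And>i. nxt q i = q) \<Longrightarrow> automaton d out nxt w q = w"
  by (induction w) (auto simp: rotl_0)

definition tree_automaton :: "nat \<Rightarrow> (nat \<Rightarrow> int) \<Rightarrow> (nat \<Rightarrow> nat \<Rightarrow> nat) \<Rightarrow> nat \<Rightarrow> nat list bijection" where
  "tree_automaton d out nxt q = tree_bij d (\<lambda>w. automaton d out nxt w q)"

lemma tree_automaton_W: "d \<ge> 1 \<Longrightarrow> tree_automaton d out nxt q \<in> tree_W d"
  unfolding tree_automaton_def tree_W_def by (intro imageI automaton_wreath_perms)

lemma tree_automaton_rec: "d \<ge> 1 \<Longrightarrow>
  tree_automaton d out nxt q = tree_rot d (out q) + tree_tup d (\<lambda>j. tree_automaton d out nxt (nxt q (letter d j)))"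
  unfolding tree_automaton_def
  by (subst automaton_node) (rule tree_bij_node, assumption, rule automaton_wreath_perms)

lemma tree_automaton_0:
  assumes "d \<ge> 1" "out q = 0" "\<And>i. nxt q i = q" shows "tree_automaton d out nxt q = 0"
proof -
  have "(\<lambda>w. automaton d out nxt w q) = id" using automaton_id[where out = out and nxt = nxt and q = q] assms(2,3) by (simp add: fun_eq_iff)
  then show ?thesis unfolding tree_automaton_def using tree_bij_id[OF assms(1)] by simp
qed

lemma periodic_tree_model:
  assumes "d \<ge> 2" "n \<ge> 1"
  shows "\<exists>a. periodic_model d (tree_W d) (tree_rot d) (tree_tup d) (tree_K d) n a"
proof -
  interpret wreath_tower d "tree_W d" "tree_rot d" "tree_tup d" "tree_K d" by (rule tree_tower[OF assms(1)])
  have d: "d \<ge> 1" using assms by simp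
  define out :: "nat \<Rightarrow> int" where "out q = (if q = 1 then 1 else 0)" for q
  \<comment> \<open>State 0 is the identity and is kept by truncated subtraction. Letter
    \<open>d\<close> is vertex 0 of the model, the only one with a non-trivial section.\<close>
  define nxt where "nxt q i = (if i = d then if q = 1 then n else q - 1 else 0)" for q i
  define a where "a = tree_automaton d out nxt"
  have a0: "a 0 = 0" unfolding a_def by (rule tree_automaton_0[OF d]) (auto simp: out_def nxt_def)
  have sec: "tree_tup d (\<lambda>j. a (nxt q (letter d j))) = emb 0 (a (if q = 1 then n else q - 1))" for q
    unfolding emb_def
  proof (rule tup_cong)
    fix i assume i: "0 \<le> i" "i < int d"
    then have "letter d i = d \<longleftrightarrow> i = 0" by (auto simp: letter_def)
    then show "a (nxt q (letter d i)) = pos 0 (a (if q = 1 then n else q - 1)) i" using a0 by (simp add: nxt_def pos_def)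
  qed
  have "periodic_model d (tree_W d) (tree_rot d) (tree_tup d) (tree_K d) n a"
  proof unfold_locales
    show "n \<ge> 1" by (rule assms)
    show "a i \<in> tree_W d" for i unfolding a_def by (rule tree_automaton_W[OF d])
    show "a 1 = tree_rot d 1 + emb 0 (a n)"
      using tree_automaton_rec[OF d, of out nxt 1] sec[of 1] by (simp add: a_def[symmetric] out_def)
    show "a i = emb 0 (a (i - 1))" if "i \<in> {2..n}" for i
      using tree_automaton_rec[OF d, of out nxt i] sec[of i] that by (simp add: a_def[symmetric] out_def)
  qed
  then show ?thesis by blast
qed

lemma preperiodic_tree_model:
  assumes "d \<ge> 2" "1 \<le> m" "m < n" "0 < r" "r < int d"
  shows "\<exists>a. preperiodic_model d (tree_W d) (tree_rot d) (tree_tup d) (tree_K d) n a m r"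
proof -
  interpret wreath_tower d "tree_W d" "tree_rot d" "tree_tup d" "tree_K d" by (rule tree_tower[OF assms(1)])
  have d: "d \<ge> 1" using assms by simp
  define out :: "nat \<Rightarrow> int" where "out q = (if q = 1 then 1 else 0)" for q
  \<comment> \<open>Truncated subtraction keeps the identity state 0. State 1 passes to 0, so that
    \<open>a 1\<close> is the bare rotation.\<close>
  define nxt where "nxt q i = (if i = d then q - 1 else if q = Suc m \<and> i = nat r then n else 0)" for q i
  define a where "a = tree_automaton d out nxt"
  have a0: "a 0 = 0" unfolding a_def by (rule tree_automaton_0[OF d]) (auto simp: out_def nxt_def)
  have letter: "letter d i = (if i = 0 then d else nat i)" if "0 \<le> i" "i < int d" for i
    using that by (auto simp: letter_def)
  have sec: "tree_tup d (\<lambda>j. a (nxt q (letter d j))) =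
      tree_tup d (\<lambda>i. if i = 0 then a (q - 1) else if q = Suc m \<and> i = r then a n else 0)" for q
    by (rule tup_cong) (use assms a0 in \<open>auto simp: letter nxt_def\<close>)
  have "preperiodic_model d (tree_W d) (tree_rot d) (tree_tup d) (tree_K d) n a m r"
  proof unfold_locales
    show "1 \<le> m" "m < n" "0 < r" "r < int d" by (rule assms)+
    show "n \<ge> 1" using assms by simp
    show "a i \<in> tree_W d" for i unfolding a_def by (rule tree_automaton_W[OF d])
    have "tree_tup d (\<lambda>i. if i = 0 then a (1 - 1) else if 1 = Suc m \<and> i = r then a n else 0) = tree_tup d (\<lambda>_. 0)"
      by (rule tup_cong) (use assms a0 in auto)
    then show "a 1 = tree_rot d 1"
      using tree_automaton_rec[OF d, of out nxt 1] sec[of 1] by (simp add: a_def[symmetric] out_def)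
    show "a i = emb 0 (a (i - 1))" if "i \<in> {2..n}" "i \<noteq> Suc m" for i
    proof -
      have "a i = tree_tup d (\<lambda>j. a (nxt i (letter d j)))"
        using tree_automaton_rec[OF d, of out nxt i] that by (simp add: a_def[symmetric] out_def)
      also have "\<dots> = emb 0 (a (i - 1))" unfolding sec emb_def by (rule tup_cong) (use that in \<open>simp add: pos_def\<close>)
      finally show ?thesis .
    qed
    show "a (Suc m) = tree_tup d (\<lambda>i. if i = 0 then a m else if i = r then a n else 0)"
      using tree_automaton_rec[OF d, of out nxt "Suc m"] sec[of "Suc m"] assms
      by (simp add: a_def[symmetric] out_def tree_rot_0 cong: if_cong)
  qed
  then show ?thesis by blast
qed

section \<open>Agreement up to a level, and rigidity for tree automorphisms\<close>

definition agree :: "nat \<Rightarrow> (nat list \<Rightarrow> nat list) \<Rightarrow> (nat list \<Rightarrow> nat list) \<Rightarrow> bool" where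
  "agree l g h \<longleftrightarrow> (\<forall>w. length w \<le> l \<longrightarrow> g w = h w)"

abbreviation conj_by :: "(nat list \<Rightarrow> nat list) \<Rightarrow> (nat list \<Rightarrow> nat list) \<Rightarrow> nat list \<Rightarrow> nat list" where
  "conj_by g x \<equiv> g \<circ> x \<circ> inv' g"

context
  fixes d :: nat
  assumes d1: "d \<ge> 1"
begin

lemma conj_by_wreath_perms: "g \<in> wreath_perms d \<Longrightarrow> x \<in> wreath_perms d \<Longrightarrow> conj_by g x \<in> wreath_perms d"
  using comp_wreath_perms[OF d1] inv_wreath_perms[OF d1] by blast

lemma tree_bij_conj_by:
  "g \<in> wreath_perms d \<Longrightarrow> x \<in> wreath_perms d \<Longrightarrow> tree_bij d (conj_by g x) = tree_bij d g + tree_bij d x - tree_bij d g"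
  by (simp add: tree_bij_comp[OF d1] tree_bij_inv[OF d1] comp_wreath_perms[OF d1] inv_wreath_perms[OF d1])

lemma generate_wreath_perms: "S \<subseteq> wreath_perms d \<Longrightarrow> generate (iter_wreath d) S \<subseteq> wreath_perms d"
  using group.generate_incl[OF iter_wreath_group[OF d1], of S] by (simp add: iter_wreath_def)

lemma add_subgroup_tree_bij_generate:
  assumes S: "S \<subseteq> wreath_perms d" shows "add_subgroup (tree_bij d ` generate (iter_wreath d) S)"
proof (rule add_subgroupI)
  note gen = generate_wreath_perms[OF S]
  have "tree_bij d id \<in> tree_bij d ` generate (iter_wreath d) S"
    using generate.one[of "iter_wreath d" S] by (simp add: iter_wreath_def)
  then show "0 \<in> tree_bij d ` generate (iter_wreath d) S" by (simp only: tree_bij_id[OF d1])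
next
  note gen = generate_wreath_perms[OF S]
  fix x y assume "x \<in> tree_bij d ` generate (iter_wreath d) S" "y \<in> tree_bij d ` generate (iter_wreath d) S"
  then obtain g h where g: "x = tree_bij d g" "g \<in> generate (iter_wreath d) S"
    and h: "y = tree_bij d h" "h \<in> generate (iter_wreath d) S" by blast
  have "x + y = tree_bij d (g \<circ> h)"
    unfolding g(1) h(1) using g(2) h(2) gen by (intro tree_bij_comp[OF d1, symmetric]) auto
  moreover have "g \<circ> h \<in> generate (iter_wreath d) S" using generate.eng[OF g(2) h(2)] by (simp add: iter_wreath_def)
  ultimately show "x + y \<in> tree_bij d ` generate (iter_wreath d) S" by blast
next
  note gen = generate_wreath_perms[OF S]
  fix x assume "x \<in> tree_bij d ` generate (iter_wreath d) S"
  then obtain g where g: "x = tree_bij d g" "g \<in> generate (iter_wreath d) S" by blast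
  have gW: "g \<in> wreath_perms d" using g gen by blast
  have "inv\<^bsub>iter_wreath d\<^esub> g \<in> generate (iter_wreath d) S"
    using group.generate_m_inv_closed[OF iter_wreath_group[OF d1] _ g(2)] S by (simp add: iter_wreath_def)
  then have "inv' g \<in> generate (iter_wreath d) S" by (simp add: iter_wreath_inv[OF d1 gW])
  moreover have "- x = tree_bij d (inv' g)" using gW by (simp add: g(1) tree_bij_inv[OF d1])
  ultimately show "- x \<in> tree_bij d ` generate (iter_wreath d) S" by blast
qed

lemma hull_tree_bij:
  assumes S: "S \<subseteq> wreath_perms d"
  shows "add_subgroup hull (tree_bij d ` S) = tree_bij d ` generate (iter_wreath d) S"
proof
  show "add_subgroup hull (tree_bij d ` S) \<subseteq> tree_bij d ` generate (iter_wreath d) S"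
    by (rule hull_minimal) (auto intro: generate.incl add_subgroup_tree_bij_generate[OF S])
  note gen = generate_wreath_perms[OF S]
  let ?H = "add_subgroup hull (tree_bij d ` S)"
  have H: "add_subgroup ?H" by (rule add_subgroup_hull)
  show "tree_bij d ` generate (iter_wreath d) S \<subseteq> ?H"
  proof
    fix x assume "x \<in> tree_bij d ` generate (iter_wreath d) S"
    then obtain g where g: "x = tree_bij d g" "g \<in> generate (iter_wreath d) S" by blast
    from g(2) have "g \<in> wreath_perms d \<and> tree_bij d g \<in> ?H"
    proof (induction rule: generate.induct)
      case one
      have e: "\<one>\<^bsub>iter_wreath d\<^esub> = id" by (simp add: iter_wreath_def)
      show ?case unfolding e tree_bij_id[OF d1] using id_wreath_perms[OF d1] add_subgroup_zero[OF H] ..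
    next
      case (incl h)
      then show ?case using S by (auto intro: hull_inc)
    next
      case (inv h)
      then have "h \<in> wreath_perms d" "tree_bij d h \<in> ?H" using S by (auto intro: hull_inc)
      then show ?case using add_subgroup_minus[OF H] inv_wreath_perms[OF d1]
        by (simp add: iter_wreath_inv[OF d1] tree_bij_inv[OF d1])
    next
      case (eng h1 h2)
      then show ?case using add_subgroup_add[OF H] comp_wreath_perms[OF d1]
        by (simp add: tree_bij_comp[OF d1] iter_wreath_def del: comp_apply)
    qed
    then show "x \<in> ?H" by (simp add: g(1))
  qed
qed

end

text \<open>Carries \<open>rigid_tuples\<close> over to tree automorphisms. For the second claim the
  subgroup \<open>Y\<close> is the group generated by \<open>Z\<close>, enlarged by the level
  stabiliser.\<close>

lemma rigid_level:
  assumes M: "wreath_model d (tree_W d) (tree_rot d) (tree_tup d) (tree_K d) n a"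
    and rigid: "wreath_model.conjugates_inner (tree_W d) (tree_K d) n a l"
      "wreath_model.conjugates_generate (tree_W d) (tree_K d) n a l"
    and c: "\<And>i. i \<in> {1..n} \<Longrightarrow> c i \<in> wreath_perms d"
      "\<And>i. i \<in> {1..n} \<Longrightarrow> \<exists>g\<in>tree_W d. cong_mod (tree_W d) (tree_K d l) (tree_bij d (c i)) (g + a i - g)"
    and c': "\<And>i. i \<in> {1..n} \<Longrightarrow> \<exists>g\<in>wreath_perms d. c' i = conj_by g (c i)"
  shows "\<exists>w\<in>wreath_perms d. \<exists>u. \<forall>i\<in>{1..n}. u i \<in> generate (iter_wreath d) (c ` {1..n}) \<and>
      agree l (conj_by w (c' i)) (conj_by (u i) (c i))"
    and "\<And>u Z x. (\<And>i. i \<in> {1..n} \<Longrightarrow> u i \<in> generate (iter_wreath d) (c ` {1..n})) \<Longrightarrow> Z \<subseteq> wreath_perms d \<Longrightarrow>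
      (\<And>i. i \<in> {1..n} \<Longrightarrow> \<exists>h\<in>generate (iter_wreath d) Z. agree l (conj_by (u i) (c i)) h) \<Longrightarrow>
      x \<in> generate (iter_wreath d) (c ` {1..n}) \<Longrightarrow> \<exists>h\<in>generate (iter_wreath d) Z. agree l x h"
proof -
  interpret wreath_model d "tree_W d" "tree_rot d" "tree_tup d" "tree_K d" n a by (rule M)
  have d: "d \<ge> 1" using d2 by simp
  have bW: "tree_bij d g \<in> tree_W d" if "g \<in> wreath_perms d" for g using that by (simp add: tree_W_def)
  let ?c = "\<lambda>i. tree_bij d (c i)" and ?c' = "\<lambda>i. tree_bij d (c' i)"
  have c'W: "c' i \<in> wreath_perms d" if i: "i \<in> {1..n}" for i
  proof -
    obtain g where g: "g \<in> wreath_perms d" "c' i = conj_by g (c i)" using c'[OF i] ..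
    show ?thesis unfolding g(2) by (rule conj_by_wreath_perms[OF d g(1) c(1)[OF i]])
  qed
  have 1: "\<exists>g\<in>tree_W d. ?c' i = g + ?c i - g" if i: "i \<in> {1..n}" for i
  proof -
    obtain g where g: "g \<in> wreath_perms d" "c' i = conj_by g (c i)" using c'[OF i] ..
    then show ?thesis using tree_bij_conj_by[OF d g(1) c(1)[OF i]] bW[OF g(1)] by (intro bexI[of _ "tree_bij d g"]) simp_all
  qed
  have 2: "?c i \<in> tree_W d \<and> (\<exists>g\<in>tree_W d. eqm l (?c i) (g + a i - g))" if "i \<in> {1..n}" for i
    using c(2)[OF that] bW[OF c(1)[OF that]] by blast
  have S: "c ` {1..n} \<subseteq> wreath_perms d" using c(1) by blast
  have hull: "add_subgroup hull (?c ` {1..n}) = tree_bij d ` generate (iter_wreath d) (c ` {1..n})"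
    using hull_tree_bij[OF d S] by (simp add: image_image)
  note gen = generate_wreath_perms[OF d S]
  have agree: "agree l g h \<longleftrightarrow> eqm l (tree_bij d g) (tree_bij d h)" if "g \<in> wreath_perms d" "h \<in> wreath_perms d" for g h
    using tree_bij_mod[OF d that] by (simp add: agree_def)
  obtain w u where w: "w \<in> tree_W d" and u: "\<forall>i\<in>{1..n}. u i \<in> add_subgroup hull (?c ` {1..n}) \<and> eqm l (w + ?c' i - w) (u i + ?c i - u i)"
    using rigid_tuples(1)[OF rigid 2 1] by blast
  obtain w' where w': "w = tree_bij d w'" "w' \<in> wreath_perms d" using w by (auto simp: tree_W_def)
  have "\<forall>i\<in>{1..n}. \<exists>v. v \<in> generate (iter_wreath d) (c ` {1..n}) \<and> u i = tree_bij d v" using u unfolding hull by blast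
  from bchoice[OF this] obtain v where v: "\<forall>i\<in>{1..n}. v i \<in> generate (iter_wreath d) (c ` {1..n}) \<and> u i = tree_bij d (v i)" ..
  have "agree l (conj_by w' (c' i)) (conj_by (v i) (c i))" if i: "i \<in> {1..n}" for i
  proof -
    have vW: "v i \<in> wreath_perms d" using v i gen by blast
    show ?thesis
      using u v i w' vW c'W[OF i] c(1)[OF i]
      by (simp add: agree conj_by_wreath_perms[OF d] tree_bij_conj_by[OF d] del: comp_apply)
  qed
  then show "\<exists>w\<in>wreath_perms d. \<exists>u. \<forall>i\<in>{1..n}. u i \<in> generate (iter_wreath d) (c ` {1..n}) \<and>
      agree l (conj_by w (c' i)) (conj_by (u i) (c i))" using v w'(2) by blast
  fix u Z x
  assume u: "\<And>i. i \<in> {1..n} \<Longrightarrow> u i \<in> generate (iter_wreath d) (c ` {1..n})" and Z: "Z \<subseteq> wreath_perms d"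
    and uZ: "\<And>i. i \<in> {1..n} \<Longrightarrow> \<exists>h\<in>generate (iter_wreath d) Z. agree l (conj_by (u i) (c i)) h"
    and x: "x \<in> generate (iter_wreath d) (c ` {1..n})"
  note genZ = generate_wreath_perms[OF d Z]
  define H where "H = tree_bij d ` generate (iter_wreath d) Z"
  have H: "add_subgroup H" unfolding H_def by (rule add_subgroup_tree_bij_generate[OF d Z])
  have HW: "H \<subseteq> tree_W d" unfolding H_def using genZ bW by blast
  define Y where "Y = {g \<in> tree_W d. \<exists>v\<in>H. eqm l g v}"
  have Y: "add_subgroup Y" unfolding Y_def by (rule mod_subgroup[OF H HW])
  have "add_subgroup hull (?c ` {1..n}) \<subseteq> Y"
  proof (rule rigid_tuples(2)[OF rigid 2 1, of "\<lambda>i. tree_bij d (u i)"])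
    show "add_subgroup Y" by (rule Y)
    show "Y \<subseteq> tree_W d" by (auto simp: Y_def)
    show "tree_K d l \<subseteq> Y" unfolding Y_def using K_W add_subgroup_zero[OF H] W_zero by (auto simp: cong_mod_def intro!: bexI[of _ 0])
    show "tree_bij d (u i) \<in> add_subgroup hull (?c ` {1..n})" if "i \<in> {1..n}" for i unfolding hull using u[OF that] by blast
    show "tree_bij d (u i) + ?c i - tree_bij d (u i) \<in> Y" if i: "i \<in> {1..n}" for i
    proof -
      obtain h where h: "h \<in> generate (iter_wreath d) Z" "agree l (conj_by (u i) (c i)) h" using uZ[OF i] by blast
      have uW: "u i \<in> wreath_perms d" "h \<in> wreath_perms d" using u[OF i] gen h genZ by auto
      have "eqm l (tree_bij d (conj_by (u i) (c i))) (tree_bij d h)"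
        using h(2) agree conj_by_wreath_perms[OF d uW(1) c(1)[OF i]] uW(2) by blast
      then show ?thesis unfolding tree_bij_conj_by[OF d uW(1) c(1)[OF i]] Y_def H_def using h(1) by (auto simp: cong_mod_def)
    qed
  qed auto
  then have "tree_bij d x \<in> Y" unfolding hull using x by blast
  then obtain h where h: "h \<in> generate (iter_wreath d) Z" "eqm l (tree_bij d x) (tree_bij d h)" unfolding Y_def H_def by blast
  then show "\<exists>h\<in>generate (iter_wreath d) Z. agree l x h" using agree[of x h] x gen genZ by blast
qed

section \<open>Subfields and adjunction\<close>

lemma is_subfieldD:
  assumes "is_subfield F"
  shows is_subfield_1: "1 \<in> F" and is_subfield_0: "0 \<in> F"
    and is_subfield_diff: "x \<in> F \<Longrightarrow> y \<in> F \<Longrightarrow> x - y \<in> F"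
    and is_subfield_mult: "x \<in> F \<Longrightarrow> y \<in> F \<Longrightarrow> x * y \<in> F"
    and is_subfield_inverse: "x \<in> F \<Longrightarrow> inverse x \<in> F"
    and is_subfield_minus: "x \<in> F \<Longrightarrow> - x \<in> F"
    and is_subfield_add: "x \<in> F \<Longrightarrow> y \<in> F \<Longrightarrow> x + y \<in> F"
    and is_subfield_divide: "x \<in> F \<Longrightarrow> y \<in> F \<Longrightarrow> x / y \<in> F"
    and is_subfield_power: "x \<in> F \<Longrightarrow> x ^ m \<in> F"
proof -
  show 1: "1 \<in> F" and diff: "\<And>x y. x \<in> F \<Longrightarrow> y \<in> F \<Longrightarrow> x - y \<in> F"
    and mult: "\<And>x y. x \<in> F \<Longrightarrow> y \<in> F \<Longrightarrow> x * y \<in> F" and inv: "\<And>x. x \<in> F \<Longrightarrow> inverse x \<in> F"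
    using assms by (auto simp: is_subfield_def)
  show 0: "0 \<in> F" using diff[OF 1 1] by simp
  show minus: "- x \<in> F" if "x \<in> F" for x using diff[OF 0 that] by simp
  show add: "x + y \<in> F" if "x \<in> F" "y \<in> F" for x y using diff[OF that(1) minus[OF that(2)]] by simp
  show "x / y \<in> F" if "x \<in> F" "y \<in> F" for x y using mult[OF that(1) inv[OF that(2)]] by (simp add: divide_inverse)
  show "x ^ m \<in> F" if "x \<in> F" for x by (induction m) (simp_all add: 1 mult that)
qed

lemma is_subfield_hull: "is_subfield (is_subfield hull S)"
  by (rule hull_in) (auto simp: is_subfield_def)

lemma is_subfield_adjoin: "is_subfield (adjoin F S)"
  unfolding adjoin_def by (rule is_subfield_hull)

lemma adjoin_base: "x \<in> F \<Longrightarrow> x \<in> adjoin F S" unfolding adjoin_def by (simp add: hull_inc)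
lemma adjoin_gen: "x \<in> S \<Longrightarrow> x \<in> adjoin F S" unfolding adjoin_def by (simp add: hull_inc)

lemma adjoin_minimal: "is_subfield E \<Longrightarrow> F \<subseteq> E \<Longrightarrow> S \<subseteq> E \<Longrightarrow> adjoin F S \<subseteq> E"
  unfolding adjoin_def by (rule hull_minimal) auto

text \<open>Values lie in the ambient field without a prescribed codomain, so that Galois elements,
  their sections and the paths are all instances.\<close>

locale subfield_hom =
  fixes E :: "'l::field set" and h :: "'l \<Rightarrow> 'l"
  assumes E: "is_subfield E"
    and hom_add: "x \<in> E \<Longrightarrow> y \<in> E \<Longrightarrow> h (x + y) = h x + h y"
    and hom_mult: "x \<in> E \<Longrightarrow> y \<in> E \<Longrightarrow> h (x * y) = h x * h y"
    and hom_inj: "inj_on h E"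
begin

lemma hom_0: "h 0 = 0" using hom_add[of 0 0] is_subfield_0[OF E] by (metis add_0_right add_left_cancel)

lemma hom_1: "h 1 = 1"
proof -
  have "h 1 \<noteq> h 0" using inj_onD[OF hom_inj, of 1 0] is_subfield_0[OF E] is_subfield_1[OF E] by auto
  moreover have "h 1 * h 1 = h 1" using hom_mult[of 1 1] is_subfield_1[OF E] by simp
  ultimately show ?thesis by (simp add: hom_0)
qed

lemma hom_minus: "x \<in> E \<Longrightarrow> h (- x) = - h x"
  using hom_add[of x "- x"] is_subfield_minus[OF E] by (simp add: hom_0 eq_neg_iff_add_eq_0 add.commute)

lemma hom_diff: "x \<in> E \<Longrightarrow> y \<in> E \<Longrightarrow> h (x - y) = h x - h y"
  using hom_add[of x "- y"] is_subfield_minus[OF E] by (simp add: hom_minus)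

lemma hom_eq_0: "x \<in> E \<Longrightarrow> h x = 0 \<longleftrightarrow> x = 0"
  using hom_inj is_subfield_0[OF E] by (metis hom_0 inj_on_eq_iff)

lemma hom_inverse: "x \<in> E \<Longrightarrow> h (inverse x) = inverse (h x)"
proof (cases "x = 0")
  case False
  assume x: "x \<in> E"
  have "h x * h (inverse x) = 1" using hom_mult[OF x is_subfield_inverse[OF E x]] False by (simp add: hom_1)
  then show ?thesis by (metis inverse_unique)
qed (simp add: hom_0)

lemma hom_divide: "x \<in> E \<Longrightarrow> y \<in> E \<Longrightarrow> h (x / y) = h x / h y"
  by (simp add: divide_inverse hom_mult hom_inverse is_subfield_inverse[OF E])

lemma hom_power: "x \<in> E \<Longrightarrow> h (x ^ m) = h x ^ m"
  by (induction m) (simp_all add: hom_1 hom_mult is_subfield_power[OF E])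

lemma hom_prod: "(\<And>i. i \<in> I \<Longrightarrow> g i \<in> E) \<Longrightarrow> h (prod g I) = (\<Prod>i\<in>I. h (g i)) \<and> prod g I \<in> E"
  by (induction I rule: infinite_finite_induct) (auto simp: hom_1 hom_mult is_subfield_1[OF E] is_subfield_mult[OF E])

lemma preimage_subfield: "is_subfield E' \<Longrightarrow> is_subfield {x \<in> E. h x \<in> E'}"
  using E unfolding is_subfield_def by (auto simp: hom_1 hom_diff hom_mult hom_inverse is_subfield_def)

lemma fixed_subfield: "is_subfield {x \<in> E. h x = x}"
  using E unfolding is_subfield_def by (auto simp: hom_1 hom_diff hom_mult hom_inverse is_subfield_def)

end

lemma subfield_hom_comp:
  assumes "subfield_hom E g" "subfield_hom E' h" "g ` E \<subseteq> E'"
  shows "subfield_hom E (h \<circ> g)"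
proof -
  interpret g: subfield_hom E g by (rule assms)
  interpret h: subfield_hom E' h by (rule assms)
  have E': "g x \<in> E'" if "x \<in> E" for x using that assms by auto
  show ?thesis
    by unfold_locales
      (auto simp: g.E g.hom_add g.hom_mult h.hom_add h.hom_mult E' intro!: comp_inj_on g.hom_inj inj_on_subset[OF h.hom_inj] assms(3))
qed

lemma field_iso_hom: "is_subfield E \<Longrightarrow> field_iso E E' h \<Longrightarrow> subfield_hom E h"
  unfolding field_iso_def by unfold_locales (auto simp: bij_betw_def)

section \<open>Separable elements given by roots\<close>

lemma poly_over_mult:
  assumes F: "is_subfield F" and "poly_over F p" "poly_over F q" shows "poly_over F (p * q)"
proof -
  have "(\<Sum>i\<in>I. coeff p i * coeff q (m - i)) \<in> F" for I m
    using assms by (induction I rule: infinite_finite_induct)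
      (auto simp: poly_over_def is_subfield_0[OF F] intro!: is_subfield_add[OF F] is_subfield_mult[OF F])
  then show ?thesis by (simp add: poly_over_def coeff_mult)
qed

lemma poly_over_power: "is_subfield F \<Longrightarrow> poly_over F p \<Longrightarrow> poly_over F (p ^ m)"
proof (induction m)
  case 0
  then show ?case by (simp add: poly_over_def coeff_1 is_subfield_0 is_subfield_1)
next
  case (Suc m)
  then show ?case using poly_over_mult[of F p "p ^ m"] by simp
qed

text \<open>With q = X + e and p = q^d - u, the combination q p' - d p is the non-zero constant d u,
  so p and p' are coprime. The shift by \<open>e\<close> lets the lemma apply to \<zeta> - 1, for a
  \<open>d\<close>-th root of unity \<zeta>, as well as to \<zeta>.\<close>

lemma separable_overI_power:
  fixes x e u :: "'l::field"
  assumes F: "is_subfield F" and "e \<in> F" "u \<in> F" "u \<noteq> 0" "of_nat d \<noteq> (0 :: 'l)" and x: "(x + e) ^ d = u"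
  shows "separable_over F x"
proof -
  let ?q = "[:e, 1:]" and ?p = "[:e, 1:] ^ d - [:u:]"
  have d: "d \<noteq> 0" using assms(5) by (cases d) auto
  have "poly_over F ?q" using assms(2) by (auto simp: poly_over_def coeff_pCons is_subfield_1[OF F] is_subfield_0[OF F] split: nat.split)
  then have "poly_over F (?q ^ d)" by (rule poly_over_power[OF F])
  then have p: "poly_over F ?p" using assms(3)
    by (auto simp: poly_over_def coeff_pCons is_subfield_0[OF F] intro!: is_subfield_diff[OF F] split: nat.split)
  have pd: "pderiv ?p = smult (of_nat d) (?q ^ (d - 1))"
    using d by (simp add: pderiv_diff pderiv_pCons pderiv_power)
  have "?q * pderiv ?p - smult (of_nat d) ?p = [:of_nat d * u:]"
  proof -
    have "?q * ?q ^ (d - 1) = ?q ^ d" using d by (metis power_eq_if)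
    then have "?q * pderiv ?p = smult (of_nat d) (?q ^ d)" unfolding pd by (metis mult_smult_right)
    then show ?thesis by (simp add: smult_diff_right)
  qed
  then have "coprime ?p (pderiv ?p)"
  proof (intro coprimeI)
    fix c assume "c dvd ?p" "c dvd pderiv ?p" and eq: "?q * pderiv ?p - smult (of_nat d) ?p = [:of_nat d * u:]"
    then have "c dvd [:of_nat d * u:]" using dvd_diff dvd_mult dvd_smult by metis
    then show "is_unit c" using assms(4,5) by (metis dvd_trans is_unit_const_poly_iff mult_eq_0_iff dvd_field_iff)
  qed
  moreover have "poly ?p x = 0" using x by (simp add: poly_power add.commute)
  ultimately show ?thesis using p unfolding separable_over_def separable_poly_def by blast
qed

lemma separable_over_base: "is_subfield F \<Longrightarrow> (x::'l::field) \<in> F \<Longrightarrow> separable_over F x"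
proof -
  assume F: "is_subfield F" and x: "x \<in> F"
  have "poly_over F [:- x, 1:]"
    using x by (auto simp: poly_over_def coeff_pCons is_subfield_1[OF F] is_subfield_0[OF F] is_subfield_minus[OF F] split: nat.split)
  moreover have "separable_poly [:- x, 1:]" by (simp add: separable_poly_def pderiv_pCons flip: one_pCons)
  ultimately show ?thesis unfolding separable_over_def by (intro exI[of _ "[:- x, 1:]"]) simp
qed

section \<open>The tree of iterated preimages\<close>

locale unicritical =
  fixes K :: "'l::field set" and a b t :: 'l and f :: "'l poly" and d n :: nat
    and \<gamma> :: "nat \<Rightarrow> 'l \<Rightarrow> 'l" and \<gamma>_inf :: "'l \<Rightarrow> 'l"
    and tt :: "nat \<Rightarrow> 'l" and \<Lambda> :: "nat \<Rightarrow> 'l \<Rightarrow> 'l"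
  assumes K: "is_subfield K"
    and t: "transcendental_over K t"
    and Omega: "UNIV_is_separable_closure_of (adjoin K {t})"
    and f: "a \<in> K" "b \<in> K" "a \<noteq> 0" "f = monom a d + [:b:]"
    and d: "d \<ge> 2" "CHAR('l) = 0 \<or> coprime d CHAR('l)"
    and pcf: "finite {(poly f ^^ i) 0 | i. i \<ge> 1}" "card {(poly f ^^ i) 0 | i. i \<ge> 1} = n"
    and gamma: "\<forall>i\<in>{1..n}. \<gamma> i \<in> carrier (geom_group K f t) \<and>
          is_inertia_over_point K f t ((poly f ^^ i) 0) (top_generate (geom_group K f t) {\<gamma> i})"
    and gamma_inf: "\<gamma>_inf \<in> carrier (geom_group K f t)"
    and gamma_gen: "carrier (geom_group K f t) = top_generate (geom_group K f t) (\<gamma> ` {1..n})"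
    and gamma_prod: "\<gamma>_inf = foldr (\<otimes>\<^bsub>geom_group K f t\<^esub>) (map \<gamma> [1..<Suc n]) \<one>\<^bsub>geom_group K f t\<^esub>"
    and labeling: "preimage_labeling d f t tt"
    and paths: "choice_of_paths d K t tt \<Lambda>"
    and rho_inf: "arboreal_rep d K f t tt \<Lambda> \<gamma>_inf = odometer d"
begin

lemma d1: "d \<ge> 1" using d by simp
lemma d_ne: "of_nat d \<noteq> (0 :: 'l)"
proof
  assume "of_nat d = (0 :: 'l)"
  then have "CHAR('l) dvd d" by (simp add: of_nat_eq_0_iff_char_dvd)
  then have "CHAR('l) = 1" using d by (auto dest: coprime_absorb_right)
  then have "of_nat 1 = (0 :: 'l)" by (metis of_nat_CHAR)
  then show False by simp
qed

lemma poly_f: "poly f x = a * x ^ d + b" by (simp add: f poly_monom)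

abbreviation k where "k \<equiv> sep_closure K"

lemma K_k: "x \<in> K \<Longrightarrow> x \<in> k" using separable_over_base[OF K] by (simp add: sep_closure_def)
lemma ab_k: "a \<in> k" "b \<in> k" using f K_k by auto

lemma root_of_unity_k: "x ^ d = 1 \<Longrightarrow> x \<in> k"
  using separable_overI_power[OF K is_subfield_0[OF K] is_subfield_1[OF K] _ d_ne, of x] by (simp add: sep_closure_def)

lemma root_of_unity_minus_1_k: "x ^ d = 1 \<Longrightarrow> x - 1 \<in> k"
  using separable_overI_power[OF K is_subfield_1[OF K] is_subfield_1[OF K] _ d_ne, of "x - 1"] by (simp add: sep_closure_def)

lemma tt_inj: "inj_on tt {1..d}" and tt_image: "tt ` {1..d} = {x. poly f x = t}"
  using labeling by (auto simp: preimage_labeling_def bij_betw_def)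

lemma f_tt: "i \<in> {1..d} \<Longrightarrow> poly f (tt i) = t" using tt_image by blast

text \<open>As t is f of \<open>tt i\<close>, it lies in K(\<open>tt i\<close>), and separability
  over K(t) implies separability over the larger field. Hence the paths are bijections of the whole
  ambient field.\<close>

lemma sep_closure_UNIV: "i \<in> {1..d} \<Longrightarrow> sep_closure (adjoin K {tt i}) = UNIV" "sep_closure (adjoin K {t}) = UNIV"
proof -
  show U: "sep_closure (adjoin K {t}) = UNIV" using Omega by (simp add: UNIV_is_separable_closure_of_def)
  assume i: "i \<in> {1..d}"
  have E: "is_subfield (adjoin K {tt i})" by (rule is_subfield_adjoin)
  have "a * tt i ^ d + b \<in> adjoin K {tt i}"
    by (intro is_subfield_add[OF E] is_subfield_mult[OF E] is_subfield_power[OF E] adjoin_base f adjoin_gen) simp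
  then have "t \<in> adjoin K {tt i}" using f_tt[OF i] by (simp add: poly_f)
  then have "adjoin K {t} \<subseteq> adjoin K {tt i}" by (intro adjoin_minimal E) (auto intro: adjoin_base)
  then show "sep_closure (adjoin K {tt i}) = UNIV"
    using U unfolding sep_closure_def separable_over_def poly_over_def by blast
qed

lemma path: assumes "i \<in> {1..d}"
  shows path_bij: "bij (\<Lambda> i)" and path_add: "\<Lambda> i (x + y) = \<Lambda> i x + \<Lambda> i y" and path_mult: "\<Lambda> i (x * y) = \<Lambda> i x * \<Lambda> i y"
    and path_k: "x \<in> k \<Longrightarrow> \<Lambda> i x = x" and path_t: "\<Lambda> i t = tt i"
  using paths assms sep_closure_UNIV unfolding choice_of_paths_def is_path_def field_iso_def by auto

lemma UNIV_subfield: "is_subfield (UNIV :: 'l set)" by (simp add: is_subfield_def)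

lemma path_hom: "i \<in> {1..d} \<Longrightarrow> subfield_hom UNIV (\<Lambda> i)"
  using path by unfold_locales (auto simp: UNIV_subfield bij_is_inj)

lemma path_f: "i \<in> {1..d} \<Longrightarrow> \<Lambda> i (poly f x) = poly f (\<Lambda> i x)"
  using subfield_hom.hom_power[OF path_hom, of i x d] by (simp add: poly_f path_add path_mult path_k ab_k)

lemma path_f_iter: "i \<in> {1..d} \<Longrightarrow> \<Lambda> i ((poly f ^^ l) x) = (poly f ^^ l) (\<Lambda> i x)"
  by (induction l) (simp_all add: path_f)

text \<open>Names the nodes of the preimage tree by words. The first letter is the outermost path,
  in accordance with the recursion of the arboreal representation.\<close>

primrec T :: "nat list \<Rightarrow> 'l" where
  "T [] = t"
| "T (i # w) = \<Lambda> i (T w)"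

lemma f_iter_T: "w \<in> lists {1..d} \<Longrightarrow> (poly f ^^ length w) (T w) = t"
proof (induction w)
  case (Cons i w)
  then have i: "i \<in> {1..d}" by auto
  have "(poly f ^^ length (i # w)) (T (i # w)) = poly f (\<Lambda> i ((poly f ^^ length w) (T w)))" using i by (simp add: path_f_iter)
  also have "\<dots> = t" using Cons i by (simp add: path_t f_tt)
  finally show ?case .
qed simp

lemma f_iter_T_Cons: "i # w \<in> lists {1..d} \<Longrightarrow> (poly f ^^ length w) (T (i # w)) = tt i"
  using f_iter_T[of w] path_f_iter[of i "length w" "T w"] path_t[of i] by simp

lemma T_inj: "v \<in> lists {1..d} \<Longrightarrow> w \<in> lists {1..d} \<Longrightarrow> length v = length w \<Longrightarrow> T v = T w \<Longrightarrow> v = w"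
proof (induction v arbitrary: w)
  case (Cons i v)
  then obtain j u where w: "w = j # u" by (cases w) auto
  have "tt i = tt j" using f_iter_T_Cons[of i v] f_iter_T_Cons[of j u] Cons.prems w by simp
  then have ij: "i = j" using tt_inj Cons.prems w by (auto dest: inj_onD)
  moreover have "T v = T u" using Cons.prems(4) path_bij[of i] Cons.prems(1) by (auto simp: w ij dest: bij_is_inj injD)
  ultimately show ?case using Cons w by auto
qed simp

lemma T_surj: "(poly f ^^ l) x = t \<Longrightarrow> \<exists>w\<in>lists {1..d}. length w = l \<and> T w = x"
proof (induction l arbitrary: x)
  case 0
  then show ?case by (intro bexI[of _ "[]"]) auto
next
  case (Suc l)
  then have "(poly f ^^ l) x \<in> {x. poly f x = t}" by simp
  then have "(poly f ^^ l) x \<in> tt ` {1..d}" by (simp only: tt_image)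
  then obtain i where i: "i \<in> {1..d}" "(poly f ^^ l) x = tt i" by blast
  obtain y where y: "x = \<Lambda> i y" using path_bij[OF i(1)] by (metis bij_pointE)
  have "\<Lambda> i ((poly f ^^ l) y) = \<Lambda> i t" using i y by (simp add: path_f_iter path_t)
  then have "(poly f ^^ l) y = t" using path_bij[OF i(1)] by (auto dest: bij_is_inj injD)
  then obtain w where "w \<in> lists {1..d}" "length w = l" "T w = y" using Suc.IH by blast
  then show ?case using i y by (intro bexI[of _ "i # w"]) auto
qed

text \<open>The recursion of \<open>T\<close> adds letters in front, whereas the children of a node
  arise by appending a letter.\<close>

lemma T_snoc: "w \<in> lists {1..d} \<Longrightarrow> i \<in> {1..d} \<Longrightarrow> poly f (T (w @ [i])) = T w"
  by (induction w) (auto simp: path_t f_tt simp flip: path_f)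

text \<open>
  The paths fix the coefficients, so a polynomial vanishing at \<open>t\<close> vanishes at the infinitely many
  points \<open>T w\<close>.
\<close>

lemma no_root_t:
  assumes fixed: "\<And>i j. i \<in> {1..d} \<Longrightarrow> \<Lambda> i (coeff p j) = coeff p j" and "p \<noteq> 0"
  shows "poly p t \<noteq> 0"
proof
  assume 0: "poly p t = 0"
  have step: "\<Lambda> i (poly p x) = poly p (\<Lambda> i x)" if "i \<in> {1..d}" for i x
  proof -
    interpret h: subfield_hom UNIV "\<Lambda> i" by (rule path_hom[OF that])
    have "\<Lambda> i (\<Sum>j\<in>J. coeff p j * x ^ j) = (\<Sum>j\<in>J. coeff p j * \<Lambda> i x ^ j)" if "finite J" for J
      using that by (induction J rule: finite_induct)
        (simp_all add: h.hom_0 h.hom_add h.hom_mult h.hom_power fixed[OF \<open>i \<in> {1..d}\<close>])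
    then show ?thesis by (simp add: poly_altdef)
  qed
  have root: "poly p (T w) = 0" if "w \<in> lists {1..d}" for w
    using that
  proof (induction w)
    case (Cons i w)
    interpret h: subfield_hom UNIV "\<Lambda> i" using Cons.hyps by (intro path_hom) auto
    show ?case using Cons step[of i "T w"] by (simp add: h.hom_0)
  qed (simp add: 0)
  define l where "l = Suc (degree p)"
  let ?L = "{w \<in> lists {1..d}. length w = l}"
  have L: "?L = {w. set w \<subseteq> {1..d} \<and> length w = l}" by auto
  have "inj_on T ?L" by (rule inj_onI) (use T_inj in auto)
  moreover have "T ` ?L \<subseteq> {x. poly p x = 0}" using root by auto
  ultimately have "card ?L \<le> card {x. poly p x = 0}"
    by (rule card_inj_on_le[OF _ _ poly_roots_finite[OF assms(2)]])
  also have "\<dots> \<le> degree p" by (rule card_poly_roots_bound[OF assms(2)])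
  finally have "d ^ l \<le> degree p" unfolding L by (simp add: card_lists_length_eq)
  moreover have "l < d ^ l" using d(1) by (intro power_gt_expt) simp
  ultimately show False by (simp add: l_def)
qed

end

context unicritical
begin

definition level_field :: "nat \<Rightarrow> 'l set" where
  "level_field l = adjoin k {x. (poly f ^^ l) x = t}"

abbreviation M where "M \<equiv> preimage_field K f t"
abbreviation F where "F \<equiv> adjoin k {t}"
abbreviation \<Gamma> where "\<Gamma> \<equiv> carrier (geom_group K f t)"

lemma M_eq: "M = (\<Union>l. level_field l)" by (simp add: preimage_field_def level_field_def)

lemma level_field: "is_subfield (level_field l)" unfolding level_field_def by (rule is_subfield_adjoin)

lemma f_closed: "is_subfield E \<Longrightarrow> a \<in> E \<Longrightarrow> b \<in> E \<Longrightarrow> x \<in> E \<Longrightarrow> poly f x \<in> E"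
  unfolding poly_f by (intro is_subfield_add is_subfield_mult is_subfield_power)

lemma preimage_M: "(poly f ^^ l) x = t \<Longrightarrow> x \<in> M"
  unfolding M_eq level_field_def by (rule UN_I[of l]) (auto intro: adjoin_gen)

lemma level_field_Suc: "level_field l \<subseteq> level_field (Suc l)"
  unfolding level_field_def
proof (rule adjoin_minimal)
  let ?E = "adjoin k {x. (poly f ^^ Suc l) x = t}"
  show E: "is_subfield ?E" by (rule is_subfield_adjoin)
  show "{x. (poly f ^^ l) x = t} \<subseteq> ?E"
  proof
    fix x assume "x \<in> {x. (poly f ^^ l) x = t}"
    then obtain w where w: "w \<in> lists {1..d}" "length w = l" "T w = x" using T_surj by blast
    have "T (w @ [1]) \<in> ?E" using f_iter_T[of "w @ [1]"] w d1 by (intro adjoin_gen) auto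
    then have "poly f (T (w @ [1])) \<in> ?E"
      by (rule f_closed[OF E adjoin_base[OF ab_k(1)] adjoin_base[OF ab_k(2)]])
    then show "x \<in> ?E" using T_snoc[OF w(1), of 1] d1 w by simp
  qed
qed (auto intro: adjoin_base)

lemma level_field_mono: "l \<le> l' \<Longrightarrow> level_field l \<subseteq> level_field l'"
  by (rule lift_Suc_mono_le[of level_field l l', OF level_field_Suc])

lemma level_field_2: "x \<in> M \<Longrightarrow> y \<in> M \<Longrightarrow> \<exists>l. x \<in> level_field l \<and> y \<in> level_field l"
proof -
  assume "x \<in> M" "y \<in> M"
  then obtain l l' where "x \<in> level_field l" "y \<in> level_field l'" unfolding M_eq by blast
  then have "x \<in> level_field (max l l')" "y \<in> level_field (max l l')"
    using level_field_mono[of l "max l l'"] level_field_mono[of l' "max l l'"] by auto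
  then show ?thesis by blast
qed

lemma M: "is_subfield M"
proof -
  have "x - y \<in> M \<and> x * y \<in> M" if "x \<in> M" "y \<in> M" for x y
  proof -
    obtain l where "x \<in> level_field l" "y \<in> level_field l" using level_field_2[OF \<open>x \<in> M\<close> \<open>y \<in> M\<close>] by blast
    then have "x - y \<in> level_field l" "x * y \<in> level_field l"
      using is_subfield_diff[OF level_field] is_subfield_mult[OF level_field] by auto
    then show ?thesis unfolding M_eq by blast
  qed
  moreover have "inverse x \<in> M" if "x \<in> M" for x using that is_subfield_inverse[OF level_field] unfolding M_eq by blast
  moreover have "1 \<in> M" using is_subfield_1[OF level_field] unfolding M_eq by blast
  ultimately show ?thesis by (simp add: is_subfield_def)
qed

lemma k_M: "x \<in> k \<Longrightarrow> x \<in> M" unfolding M_eq level_field_def by (auto intro: adjoin_base)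

lemma T_M: "w \<in> lists {1..d} \<Longrightarrow> T w \<in> M"
  by (rule preimage_M[OF f_iter_T])

lemma t_M: "t \<in> M" using T_M[of "[]"] by simp
lemma tt_M: "i \<in> {1..d} \<Longrightarrow> tt i \<in> M" using T_M[of "[i]"] by (simp add: path_t)

lemma f_M: "x \<in> M \<Longrightarrow> poly f x \<in> M"
  by (rule f_closed[OF M k_M[OF ab_k(1)] k_M[OF ab_k(2)]])

lemma f_iter_M: "x \<in> M \<Longrightarrow> (poly f ^^ l) x \<in> M" by (induction l) (auto intro: f_M)

lemma hom_f:
  assumes h: "subfield_hom M h" and hk: "\<And>x. x \<in> k \<Longrightarrow> h x = x" and x: "x \<in> M"
  shows "h ((poly f ^^ l) x) = (poly f ^^ l) (h x)"
proof (induction l)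
  case (Suc l)
  interpret h: subfield_hom M h by (rule h)
  define y where "y = (poly f ^^ l) x"
  have y: "y \<in> M" unfolding y_def by (rule f_iter_M[OF x])
  have "h (poly f y) = poly f (h y)"
    unfolding poly_f using y ab_k
    by (simp add: h.hom_add h.hom_mult h.hom_power hk k_M is_subfield_mult[OF M] is_subfield_power[OF M])
  then show ?case using Suc by (simp add: y_def)
qed simp

lemma hom_M:
  assumes h: "subfield_hom M h" and hk: "\<And>x. x \<in> k \<Longrightarrow> h x = x" and ht: "h t = t" and x: "x \<in> M"
  shows "h x \<in> M"
proof -
  interpret h: subfield_hom M h by (rule h)
  have "level_field l \<subseteq> {x \<in> M. h x \<in> M}" for l
    unfolding level_field_def
  proof (rule adjoin_minimal)
    show "is_subfield {x \<in> M. h x \<in> M}" by (rule h.preimage_subfield[OF M])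
    show "k \<subseteq> {x \<in> M. h x \<in> M}" using k_M by (auto simp: hk)
    show "{x. (poly f ^^ l) x = t} \<subseteq> {x \<in> M. h x \<in> M}"
    proof
      fix x assume x: "x \<in> {x. (poly f ^^ l) x = t}"
      then have xM: "x \<in> M" using preimage_M by blast
      have "(poly f ^^ l) (h x) = t" using hom_f[OF h hk xM, of l] x ht by simp
      then have "h x \<in> M" by (rule preimage_M)
      then show "x \<in> {x \<in> M. h x \<in> M}" using xM by simp
    qed
  qed
  then show ?thesis using x unfolding M_eq by blast
qed

lemma path_M: "i \<in> {1..d} \<Longrightarrow> x \<in> M \<Longrightarrow> \<Lambda> i x \<in> M"
proof -
  assume i: "i \<in> {1..d}" and "x \<in> M"
  interpret h: subfield_hom UNIV "\<Lambda> i" by (rule path_hom[OF i])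
  have "level_field l \<subseteq> {x \<in> UNIV. \<Lambda> i x \<in> M}" for l
    unfolding level_field_def
  proof (rule adjoin_minimal)
    show "is_subfield {x \<in> UNIV. \<Lambda> i x \<in> M}" by (rule h.preimage_subfield[OF M])
    show "k \<subseteq> {x \<in> UNIV. \<Lambda> i x \<in> M}" using path_k[OF i] k_M by auto
    show "{x. (poly f ^^ l) x = t} \<subseteq> {x \<in> UNIV. \<Lambda> i x \<in> M}"
    proof
      fix x assume "x \<in> {x. (poly f ^^ l) x = t}"
      then have "(poly f ^^ l) (\<Lambda> i x) = tt i" using path_f_iter[OF i, of l x] path_t[OF i] by simp
      then have "(poly f ^^ Suc l) (\<Lambda> i x) = t" using f_tt[OF i] by simp
      then have "\<Lambda> i x \<in> M" by (rule preimage_M)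
      then show "x \<in> {x \<in> UNIV. \<Lambda> i x \<in> M}" by simp
    qed
  qed
  then show "\<Lambda> i x \<in> M" using \<open>x \<in> M\<close> unfolding M_eq by blast
qed

lemma \<Gamma>_iff: "g \<in> \<Gamma> \<longleftrightarrow> g permutes M \<and> subfield_hom M g \<and> (\<forall>x\<in>k. g x = x) \<and> g t = t"
proof
  assume g: "g \<in> \<Gamma>"
  then have "g permutes M" "field_iso M M g" "\<forall>x\<in>F. g x = x" by (auto simp: geom_group_def gal_group_def)
  then show "g permutes M \<and> subfield_hom M g \<and> (\<forall>x\<in>k. g x = x) \<and> g t = t"
    using field_iso_hom[OF M] by (auto intro: adjoin_base adjoin_gen)
next
  assume g: "g permutes M \<and> subfield_hom M g \<and> (\<forall>x\<in>k. g x = x) \<and> g t = t"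
  then interpret h: subfield_hom M g by simp
  have "F \<subseteq> {x \<in> M. g x = x}" using g t_M k_M by (intro adjoin_minimal h.fixed_subfield) auto
  then show "g \<in> \<Gamma>" using g by (auto simp: geom_group_def gal_group_def field_iso_def h.hom_add h.hom_mult permutes_imp_bij)
qed

lemma \<Gamma>D: assumes "g \<in> \<Gamma>"
  shows \<Gamma>_permutes: "g permutes M" and \<Gamma>_hom: "subfield_hom M g" and \<Gamma>_k: "x \<in> k \<Longrightarrow> g x = x" and \<Gamma>_t: "g t = t"
    and \<Gamma>_M: "x \<in> M \<Longrightarrow> g x \<in> M" and \<Gamma>_bij: "bij g"
  using assms by (auto simp: \<Gamma>_iff permutes_in_image permutes_bij)

lemma \<Gamma>_ops [simp]: "g \<otimes>\<^bsub>geom_group K f t\<^esub> h = g \<circ> h" "\<one>\<^bsub>geom_group K f t\<^esub> = id"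
  by (simp_all add: geom_group_def gal_group_def)

lemma id_\<Gamma>: "id \<in> \<Gamma>"
  unfolding \<Gamma>_iff by (auto intro!: permutes_id simp: subfield_hom_def M)

lemma comp_\<Gamma>: assumes "g \<in> \<Gamma>" "h \<in> \<Gamma>" shows "g \<circ> h \<in> \<Gamma>"
proof -
  have "(g \<circ> h) permutes M" by (rule permutes_compose[OF \<Gamma>_permutes[OF assms(2)] \<Gamma>_permutes[OF assms(1)]])
  moreover have "subfield_hom M (g \<circ> h)"
    by (rule subfield_hom_comp[OF \<Gamma>_hom[OF assms(2)] \<Gamma>_hom[OF assms(1)]]) (use \<Gamma>_M[OF assms(2)] in blast)
  ultimately show ?thesis unfolding \<Gamma>_iff using assms by (simp add: \<Gamma>_k \<Gamma>_t)
qed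

lemma inv_\<Gamma>: assumes g: "g \<in> \<Gamma>" shows "inv' g \<in> \<Gamma>"
proof -
  interpret h: subfield_hom M g by (rule \<Gamma>_hom[OF g])
  have p: "inv' g permutes M" by (rule permutes_inv[OF \<Gamma>_permutes[OF g]])
  have gi: "g (inv' g x) = x" "inv' g (g x) = x" for x using permutes_inverses[OF \<Gamma>_permutes[OF g]] by auto
  have iM: "inv' g x \<in> M" if "x \<in> M" for x using that p by (simp add: permutes_in_image)
  have "subfield_hom M (inv' g)"
  proof
    show "is_subfield M" by (rule M)
    show "inv' g (x + y) = inv' g x + inv' g y" if "x \<in> M" "y \<in> M" for x y
      using h.hom_add[OF iM[OF that(1)] iM[OF that(2)]] gi by metis
    show "inv' g (x * y) = inv' g x * inv' g y" if "x \<in> M" "y \<in> M" for x y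
      using h.hom_mult[OF iM[OF that(1)] iM[OF that(2)]] gi by metis
    show "inj_on (inv' g) M" using permutes_inj[OF p] by (auto intro: inj_on_subset)
  qed
  moreover have "inv' g x = x" if "x \<in> k" for x using gi(2)[of x] \<Gamma>_k[OF g that] by simp
  moreover have "inv' g t = t" using gi(2)[of t] \<Gamma>_t[OF g] by simp
  ultimately show ?thesis unfolding \<Gamma>_iff using p by blast
qed

lemma \<Gamma>_group: "group (geom_group K f t)"
proof (rule groupI)
  fix x assume "x \<in> \<Gamma>"
  then show "\<exists>y\<in>\<Gamma>. y \<otimes>\<^bsub>geom_group K f t\<^esub> x = \<one>\<^bsub>geom_group K f t\<^esub>"
    using inv_\<Gamma> \<Gamma>_bij by (intro bexI[of _ "inv' x"]) (auto simp: bij_is_inj)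
qed (auto simp: id_\<Gamma> comp_\<Gamma> comp_assoc intro: comp_\<Gamma>)

lemma \<Gamma>_inv: "g \<in> \<Gamma> \<Longrightarrow> inv\<^bsub>geom_group K f t\<^esub> g = inv' g"
  by (rule group.inv_equality[OF \<Gamma>_group]) (auto simp: inv_\<Gamma> bij_is_inj \<Gamma>_bij)

lemma \<Gamma>_f: "g \<in> \<Gamma> \<Longrightarrow> x \<in> M \<Longrightarrow> g ((poly f ^^ l) x) = (poly f ^^ l) (g x)"
  by (rule hom_f[OF \<Gamma>_hom \<Gamma>_k])

section \<open>Sections of Galois elements\<close>

abbreviation sec :: "('l \<Rightarrow> 'l) \<Rightarrow> nat \<Rightarrow> 'l \<Rightarrow> 'l" where
  "sec \<equiv> section_at d K f t tt \<Lambda>"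

abbreviation root :: "('l \<Rightarrow> 'l) \<Rightarrow> nat \<Rightarrow> nat" where
  "root \<equiv> root_perm d tt"

abbreviation \<rho> :: "('l \<Rightarrow> 'l) \<Rightarrow> nat list \<Rightarrow> nat list" where
  "\<rho> \<equiv> arboreal_rep d K f t tt \<Lambda>"

lemma root: assumes "g \<in> \<Gamma>" "i \<in> {1..d}" shows "root g i \<in> {1..d} \<and> g (tt i) = tt (root g i)"
proof -
  have "poly f (g (tt i)) = t" using \<Gamma>_f[OF assms(1) tt_M[OF assms(2)], of 1] \<Gamma>_t[OF assms(1)] f_tt[OF assms(2)] by simp
  then obtain j where j: "j \<in> {1..d}" "g (tt i) = tt j" using tt_image by force
  show ?thesis unfolding root_perm_def
    by (rule theI2[of _ j]) (use j tt_inj in \<open>auto dest: inj_onD\<close>)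
qed

lemma root_eqI: "i \<in> {1..d} \<Longrightarrow> j \<in> {1..d} \<Longrightarrow> g (tt i) = tt j \<Longrightarrow> root g i = j"
  unfolding root_perm_def by (rule the_equality) (use tt_inj in \<open>auto dest: inj_onD\<close>)

lemma sec_eq: "g \<in> \<Gamma> \<Longrightarrow> i \<in> {1..d} \<Longrightarrow> x \<in> M \<Longrightarrow> sec g i x = inv' (\<Lambda> (root g i)) (g (\<Lambda> i x))"
  by (simp add: section_at_def sep_closure_UNIV(2))

lemma path_sec: assumes "g \<in> \<Gamma>" "i \<in> {1..d}" "x \<in> M" shows "\<Lambda> (root g i) (sec g i x) = g (\<Lambda> i x)"
  unfolding sec_eq[OF assms] using root[OF assms(1,2)] by (simp add: surj_f_inv_f bij_is_surj path_bij)

lemma sec_hom: assumes g: "g \<in> \<Gamma>" and i: "i \<in> {1..d}" shows "subfield_hom M (sec g i)"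
proof -
  interpret h: subfield_hom M g by (rule \<Gamma>_hom[OF g])
  let ?j = "root g i"
  have j: "?j \<in> {1..d}" using root[OF g i] by blast
  have inj: "\<Lambda> ?j x = \<Lambda> ?j y \<longleftrightarrow> x = y" for x y using path_bij[OF j] by (auto dest: bij_is_inj injD)
  show ?thesis
  proof
    show "is_subfield M" by (rule M)
    fix x y assume xy: "x \<in> M" "y \<in> M"
    have pM: "\<Lambda> i x \<in> M" "\<Lambda> i y \<in> M" using path_M[OF i] xy by auto
    have "\<Lambda> ?j (sec g i (x + y)) = \<Lambda> ?j (sec g i x + sec g i y)"
      using xy pM by (simp add: path_sec[OF g i] path_add[OF j] path_add[OF i] h.hom_add is_subfield_add[OF M])
    then show "sec g i (x + y) = sec g i x + sec g i y" by (simp add: inj)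
    have "\<Lambda> ?j (sec g i (x * y)) = \<Lambda> ?j (sec g i x * sec g i y)"
      using xy pM by (simp add: path_sec[OF g i] path_mult[OF j] path_mult[OF i] h.hom_mult is_subfield_mult[OF M])
    then show "sec g i (x * y) = sec g i x * sec g i y" by (simp add: inj)
  next
    show "inj_on (sec g i) M"
    proof (rule inj_onI)
      fix x y assume xy: "x \<in> M" "y \<in> M" "sec g i x = sec g i y"
      then have "g (\<Lambda> i x) = g (\<Lambda> i y)" using path_sec[OF g i] by metis
      then have "\<Lambda> i x = \<Lambda> i y" using h.hom_inj path_M[OF i] xy by (auto dest: inj_onD)
      then show "x = y" using path_bij[OF i] by (auto dest: bij_is_inj injD)
    qed
  qed
qed

lemma sec_k: assumes "g \<in> \<Gamma>" "i \<in> {1..d}" "x \<in> k" shows "sec g i x = x"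
proof -
  have j: "root g i \<in> {1..d}" using root[OF assms(1,2)] by blast
  have "\<Lambda> (root g i) (sec g i x) = \<Lambda> (root g i) x"
    using assms by (simp add: path_sec k_M path_k \<Gamma>_k path_k[OF j])
  then show ?thesis using path_bij[OF j] by (auto dest: bij_is_inj injD)
qed

lemma sec_t: assumes "g \<in> \<Gamma>" "i \<in> {1..d}" shows "sec g i t = t"
proof -
  have j: "root g i \<in> {1..d}" "g (tt i) = tt (root g i)" using root[OF assms] by blast+
  have "\<Lambda> (root g i) (sec g i t) = \<Lambda> (root g i) t"
    using assms j by (simp add: path_sec t_M path_t)
  then show ?thesis using path_bij[OF j(1)] by (auto dest: bij_is_inj injD)
qed

lemma sec_M: "g \<in> \<Gamma> \<Longrightarrow> i \<in> {1..d} \<Longrightarrow> x \<in> M \<Longrightarrow> sec g i x \<in> M"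
  by (rule hom_M[OF sec_hom sec_k sec_t])

lemma root_inv: assumes "g \<in> \<Gamma>" "i \<in> {1..d}" shows "root (inv' g) (root g i) = i"
proof (rule root_eqI)
  have "inv' g (g (tt i)) = tt i" using \<Gamma>_bij[OF assms(1)] by (simp add: bij_is_inj inv_f_f)
  then show "inv' g (tt (root g i)) = tt i" using root[OF assms] by simp
qed (use root[OF assms] assms in auto)

lemma sec_inv: assumes g: "g \<in> \<Gamma>" and i: "i \<in> {1..d}" and x: "x \<in> M"
  shows "sec (inv' g) (root g i) (sec g i x) = x"
proof -
  let ?j = "root g i"
  have j: "?j \<in> {1..d}" using root[OF g i] by blast
  have "\<Lambda> i (sec (inv' g) ?j (sec g i x)) = inv' g (\<Lambda> ?j (sec g i x))"
    using path_sec[OF inv_\<Gamma>[OF g] j sec_M[OF g i x]] root_inv[OF g i] by simp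
  also have "\<dots> = \<Lambda> i x" using \<Gamma>_bij[OF g] by (simp add: path_sec[OF g i x] bij_is_inj inv_f_f)
  finally show ?thesis using path_bij[OF i] by (auto dest: bij_is_inj injD)
qed

lemma sec_\<Gamma>: assumes g: "g \<in> \<Gamma>" and i: "i \<in> {1..d}" shows "sec g i \<in> \<Gamma>"
proof -
  let ?j = "root g i"
  have j: "?j \<in> {1..d}" using root[OF g i] by blast
  have "bij_betw (sec g i) M M"
  proof (rule bij_betwI[where g = "sec (inv' g) ?j"])
    show "sec g i \<in> M \<rightarrow> M" using sec_M[OF g i] by auto
    show "sec (inv' g) ?j \<in> M \<rightarrow> M" using sec_M[OF inv_\<Gamma>[OF g] j] by auto
    show "sec (inv' g) ?j (sec g i x) = x" if "x \<in> M" for x by (rule sec_inv[OF g i that])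
    show "sec g i (sec (inv' g) ?j x) = x" if "x \<in> M" for x
    proof -
      have "sec (inv' (inv' g)) (root (inv' g) ?j) (sec (inv' g) ?j x) = x" by (rule sec_inv[OF inv_\<Gamma>[OF g] j that])
      then show ?thesis using \<Gamma>_bij[OF g] by (simp add: inv_inv_eq root_inv[OF g i])
    qed
  qed
  then have "sec g i permutes M" by (rule bij_imp_permutes) (simp add: section_at_def)
  then show ?thesis unfolding \<Gamma>_iff using sec_hom[OF g i] sec_k[OF g i] sec_t[OF g i] by blast
qed

text \<open>Words move under \<rho> as the nodes \<open>T w\<close> move under the automorphism.
  Since \<open>T\<close> is injective on each level, this determines \<rho> and yields its
  multiplicativity.\<close>

lemma \<rho>_lists: "g \<in> \<Gamma> \<Longrightarrow> w \<in> lists {1..d} \<Longrightarrow> \<rho> g w \<in> lists {1..d} \<and> length (\<rho> g w) = length w \<and> T (\<rho> g w) = g (T w)"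
proof (induction w arbitrary: g)
  case Nil
  then show ?case by (simp add: \<Gamma>_t)
next
  case (Cons i w)
  then have i: "i \<in> {1..d}" and w: "w \<in> lists {1..d}" by auto
  note IH = Cons.IH[OF sec_\<Gamma>[OF Cons.prems(1) i] w]
  have "T (\<rho> g (i # w)) = \<Lambda> (root g i) (sec g i (T w))" using Cons.prems IH by simp
  also have "\<dots> = g (T (i # w))" using path_sec[OF Cons.prems(1) i T_M[OF w]] by simp
  finally show ?case using Cons.prems IH root[OF Cons.prems(1) i] by auto
qed

lemma \<rho>_outside: "w \<notin> lists {1..d} \<Longrightarrow> \<rho> g w = w" by (cases w) auto

lemma \<rho>_eqI: "g \<in> \<Gamma> \<Longrightarrow> v \<in> lists {1..d} \<Longrightarrow> w \<in> lists {1..d} \<Longrightarrow> length v = length w \<Longrightarrow> T v = g (T w) \<Longrightarrow> \<rho> g w = v"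
  using \<rho>_lists[of g w] by (intro T_inj) auto

lemma \<rho>_comp: assumes "g \<in> \<Gamma>" "h \<in> \<Gamma>" shows "\<rho> (g \<circ> h) = \<rho> g \<circ> \<rho> h"
proof
  fix w
  show "\<rho> (g \<circ> h) w = (\<rho> g \<circ> \<rho> h) w"
  proof (cases "w \<in> lists {1..d}")
    case True
    note h = \<rho>_lists[OF assms(2) True]
    note g = \<rho>_lists[OF assms(1) conjunct1[OF h]]
    show ?thesis by (rule \<rho>_eqI[OF comp_\<Gamma>[OF assms]]) (use g h True in auto)
  qed (simp add: \<rho>_outside)
qed

lemma \<rho>_id: "\<rho> id = id"
proof
  show "\<rho> id w = id w" for w
    by (cases "w \<in> lists {1..d}") (use \<rho>_eqI[OF id_\<Gamma>, of w w] \<rho>_outside in auto)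
qed

lemma tt_ne_0: "i \<in> {1..d} \<Longrightarrow> tt i \<noteq> 0"
proof
  assume i: "i \<in> {1..d}" and "tt i = 0"
  then have "poly [:- b, 1:] t = 0" using f_tt[OF i] d by (simp add: poly_f power_0_left)
  moreover have "poly_over K [:- b, 1:]"
    using f(2) by (auto simp: poly_over_def coeff_pCons is_subfield_1[OF K] is_subfield_0[OF K] is_subfield_minus[OF K] split: nat.split)
  ultimately show False using t unfolding transcendental_over_def by auto
qed

lemma tt_power: "i \<in> {1..d} \<Longrightarrow> tt i ^ d = (t - b) / a"
  using f_tt[of i] f(3) by (simp add: poly_f field_simps)

lemma tt_ratio: "i \<in> {1..d} \<Longrightarrow> j \<in> {1..d} \<Longrightarrow> (tt i / tt j) ^ d = 1"
proof -
  assume i: "i \<in> {1..d}" and j: "j \<in> {1..d}"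
  have "tt j ^ d \<noteq> 0" using tt_ne_0[OF j] by simp
  moreover have "tt i ^ d = tt j ^ d" using tt_power[OF i] tt_power[OF j] by simp
  ultimately show ?thesis by (simp add: power_divide)
qed

text \<open>The labelling fixes this root of unity: \<open>\<gamma>_inf\<close> shifts the labels of
  the first level by the cycle, and this shift is multiplication by \<xi>.\<close>

definition \<xi> :: 'l where "\<xi> = tt (std_cycle d 1) / tt 1"

lemma \<xi>_power: "\<xi> ^ d = 1"
  unfolding \<xi>_def by (rule tt_ratio) (use d1 in \<open>auto simp: std_cycle_eq\<close>)

lemma \<xi>_k: "\<xi> \<in> k" by (rule root_of_unity_k[OF \<xi>_power])
lemma \<xi>_ne_0: "\<xi> \<noteq> 0" using \<xi>_power d1 by (auto simp: power_0_left)

lemma \<Gamma>_tt: assumes g: "g \<in> \<Gamma>" and ij: "i \<in> {1..d}" "j \<in> {1..d}" shows "g (tt i) = tt i / tt j * g (tt j)"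
proof -
  interpret h: subfield_hom M g by (rule \<Gamma>_hom[OF g])
  have "tt i / tt j \<in> k" by (rule root_of_unity_k[OF tt_ratio[OF ij]])
  then have "g (tt i / tt j * tt j) = tt i / tt j * g (tt j)" using tt_M[OF ij(2)] k_M \<Gamma>_k[OF g] by (simp only: h.hom_mult)
  then show ?thesis using tt_ne_0[OF ij(2)] by simp
qed

lemma root_inf: "i \<in> {1..d} \<Longrightarrow> root \<gamma>_inf i = std_cycle d i"
  using fun_cong[OF rho_inf, of "[i]"] by simp

lemma \<gamma>_inf_tt: assumes i: "i \<in> {1..d}" shows "\<gamma>_inf (tt i) = \<xi> * tt i"
proof -
  have 1: "1 \<in> {1..d}" using d1 by simp
  have "\<gamma>_inf (tt i) = tt i / tt 1 * \<gamma>_inf (tt 1)" by (rule \<Gamma>_tt[OF gamma_inf i 1])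
  also have "\<gamma>_inf (tt 1) = \<xi> * tt 1" using root[OF gamma_inf 1] root_inf[OF 1] tt_ne_0[OF 1] by (simp add: \<xi>_def)
  finally show ?thesis using tt_ne_0[OF 1] by simp
qed

lemma tt_rotl_1: assumes "i \<in> {1..d}" shows "tt (rotl d 1 i) = \<xi> * tt i"
  using root[OF gamma_inf assms] root_inf[OF assms] \<gamma>_inf_tt[OF assms] by (simp add: std_cycle_rotl)

lemma tt_rotl: assumes i: "i \<in> {1..d}" shows "tt (rotl d (int j) i) = \<xi> ^ j * tt i"
proof (induction j)
  case (Suc j)
  have "rotl d (int (Suc j)) i = rotl d 1 (rotl d (int j) i)" using rotl_add[of d 1 "int j" i] by simp
  then show ?case using tt_rotl_1[OF rotl_range[OF i]] Suc by simp
qed (simp add: rotl_0)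

text \<open>Ratios of first-level roots are \<open>d\<close>-th roots of unity, hence constants. So
  an automorphism multiplies all these roots by one common factor, which is a power of
  \<xi>.\<close>

lemma root_rotl:
  assumes g: "g \<in> \<Gamma>"
  shows "\<exists>j. j < d \<and> (\<forall>i\<in>{1..d}. root g i = rotl d (int j) i \<and> g (tt i) = \<xi> ^ j * tt i)"
proof -
  have 1: "1 \<in> {1..d}" using d1 by simp
  define j where "j = root g 1 - 1"
  have r1: "root g 1 \<in> {1..d}" "g (tt 1) = tt (root g 1)" using root[OF g 1] by auto
  then have "rotl d (int j) 1 = root g 1" by (auto simp: j_def rotl_def)
  then have g1: "g (tt 1) = \<xi> ^ j * tt 1" using tt_rotl[OF 1, of j] r1 by simp
  have gi: "g (tt i) = \<xi> ^ j * tt i" if "i \<in> {1..d}" for i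
    using \<Gamma>_tt[OF g that 1] g1 tt_ne_0[OF 1] by simp
  moreover have "root g i = rotl d (int j) i" if "i \<in> {1..d}" for i
    by (rule root_eqI[OF that rotl_range[OF that]]) (simp add: tt_rotl[OF that] gi[OF that])
  moreover have "j < d" using r1 by (auto simp: j_def)
  ultimately show ?thesis by blast
qed

lemma \<rho>_node:
  assumes "\<And>i. i \<in> {1..d} \<Longrightarrow> root g i = rotl d j i"
  shows "\<rho> g = node d (rotl d j) (\<lambda>i. \<rho> (sec g i))"
proof
  fix w show "\<rho> g w = node d (rotl d j) (\<lambda>i. \<rho> (sec g i)) w"
    by (cases w) (use assms in auto)
qed

lemma \<rho>_wreath_perms: "g \<in> \<Gamma> \<Longrightarrow> \<rho> g \<in> wreath_perms d"
proof (rule wreath_perms_coinduct[OF d1, where X = "\<lambda>h. \<exists>g\<in>\<Gamma>. h = \<rho> g"])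
  fix h assume "\<exists>g\<in>\<Gamma>. h = \<rho> g"
  then obtain g where g: "g \<in> \<Gamma>" "h = \<rho> g" by blast
  obtain j where "\<forall>i\<in>{1..d}. root g i = rotl d (int j) i" using root_rotl[OF g(1)] by blast
  then have "h = node d (rotl d (int j)) (\<lambda>i. \<rho> (sec g i))" unfolding g(2) by (intro \<rho>_node) blast
  then show "\<exists>k gs. h = node d (rotl d k) gs \<and> (\<forall>i\<in>{1..d}. (\<exists>g\<in>\<Gamma>. gs i = \<rho> g) \<or> gs i \<in> wreath_perms d)"
    using sec_\<Gamma>[OF g(1)] by blast
qed blast

lemma \<rho>_inv: "g \<in> \<Gamma> \<Longrightarrow> \<rho> (inv' g) = inv' (\<rho> g)"
proof -
  assume g: "g \<in> \<Gamma>"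
  have "inv' g \<circ> g = id" "g \<circ> inv' g = id" using \<Gamma>_bij[OF g] by (simp_all add: bij_is_inj bij_is_surj flip: surj_iff)
  then have "\<rho> (inv' g) \<circ> \<rho> g = id" "\<rho> g \<circ> \<rho> (inv' g) = id"
    using \<rho>_comp[OF inv_\<Gamma>[OF g] g] \<rho>_comp[OF g inv_\<Gamma>[OF g]] by (simp_all add: \<rho>_id)
  then show ?thesis using inv_unique_comp by metis
qed

end

section \<open>Closures in the topology of pointwise convergence\<close>

lemma pointwise_closure_iff:
  assumes "S \<subseteq> C"
  shows "x \<in> Abstract_Topology.closure_of (subtopology pointwise_topology C) S \<longleftrightarrow>
    x \<in> C \<and> (\<forall>X. finite X \<longrightarrow> (\<exists>h\<in>S. \<forall>z\<in>X. h z = x z))"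
proof
  assume x: "x \<in> Abstract_Topology.closure_of (subtopology pointwise_topology C) S"
  have xC: "x \<in> C" using x by (auto simp: in_closure_of)
  have "\<exists>h\<in>S. \<forall>z\<in>X. h z = x z" if X: "finite X" for X
  proof -
    let ?U = "\<lambda>z. if z \<in> X then {x z} else UNIV"
    have "openin pointwise_topology (PiE UNIV ?U)"
      unfolding pointwise_topology_def
      by (rule product_topology_basis) (auto intro: finite_subset[OF _ X])
    then have "openin (subtopology pointwise_topology C) (PiE UNIV ?U \<inter> C)" by (auto simp: openin_subtopology)
    moreover have "x \<in> PiE UNIV ?U \<inter> C" using xC by auto
    ultimately obtain h where h: "h \<in> S" "h \<in> PiE UNIV ?U \<inter> C" using x unfolding in_closure_of by blast
    have "h z = x z" if "z \<in> X" for z using PiE_mem[of h UNIV ?U z] h(2) that by auto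
    then show ?thesis using h(1) by blast
  qed
  then show "x \<in> C \<and> (\<forall>X. finite X \<longrightarrow> (\<exists>h\<in>S. \<forall>z\<in>X. h z = x z))" using xC by blast
next
  assume x: "x \<in> C \<and> (\<forall>X. finite X \<longrightarrow> (\<exists>h\<in>S. \<forall>z\<in>X. h z = x z))"
  show "x \<in> Abstract_Topology.closure_of (subtopology pointwise_topology C) S"
    unfolding in_closure_of
  proof (intro conjI allI impI)
    show "x \<in> topspace (subtopology pointwise_topology C)" using x by (simp add: pointwise_topology_def)
    fix U assume U: "x \<in> U \<and> openin (subtopology pointwise_topology C) U"
    then obtain U' where U': "openin pointwise_topology U'" "U = U' \<inter> C" by (auto simp: openin_subtopology)
    then obtain V where V: "finite {i. V i \<noteq> UNIV}" "x \<in> PiE UNIV V" "PiE UNIV V \<subseteq> U'"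
      using U unfolding pointwise_topology_def openin_product_topology_alt by auto
    obtain h where h: "h \<in> S" "\<forall>z\<in>{i. V i \<noteq> UNIV}. h z = x z" using x V(1) by blast
    have "h z \<in> V z" for z using h(2) V(2) by (cases "V z = UNIV") auto
    then have "h \<in> U'" using V(3) by auto
    then show "\<exists>y. y \<in> S \<and> y \<in> U" using h(1) assms U' by blast
  qed
qed

lemma agree_refl: "agree l g g" by (simp add: agree_def)
lemma agree_trans: "agree l g h \<Longrightarrow> agree l h k \<Longrightarrow> agree l g k" by (simp add: agree_def)
lemma agree_sym: "agree l g h \<Longrightarrow> agree l h g" by (simp add: agree_def)
lemma agree_mono: "agree l g h \<Longrightarrow> l' \<le> l \<Longrightarrow> agree l' g h" by (simp add: agree_def)

text \<open>Only finitely many words over \<open>{1..d}\<close> have length at most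
  \<open>l\<close>, and all other words are fixed; so testing on finite sets and testing on levels
  amount to the same.\<close>

lemma top_generate_iter_wreath:
  assumes d: "d \<ge> 1" and Z: "Z \<subseteq> wreath_perms d"
  shows "g \<in> top_generate (iter_wreath d) Z \<longleftrightarrow>
    g \<in> wreath_perms d \<and> (\<forall>l. \<exists>h\<in>generate (iter_wreath d) Z. agree l g h)"
proof -
  note gen = generate_wreath_perms[OF d Z]
  have "g \<in> top_generate (iter_wreath d) Z \<longleftrightarrow>
      g \<in> wreath_perms d \<and> (\<forall>X. finite X \<longrightarrow> (\<exists>h\<in>generate (iter_wreath d) Z. \<forall>z\<in>X. h z = g z))"
    unfolding top_generate_def using pointwise_closure_iff[OF gen] by (simp add: iter_wreath_def)
  also have "\<dots> \<longleftrightarrow> g \<in> wreath_perms d \<and> (\<forall>l. \<exists>h\<in>generate (iter_wreath d) Z. agree l g h)"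
  proof (intro conj_cong refl iffI allI impI)
    fix l assume g: "g \<in> wreath_perms d" and *: "\<forall>X. finite X \<longrightarrow> (\<exists>h\<in>generate (iter_wreath d) Z. \<forall>z\<in>X. h z = g z)"
    have "finite {w. set w \<subseteq> {1..d} \<and> length w \<le> l}" by (rule finite_lists_length_le) simp
    then obtain h where h: "h \<in> generate (iter_wreath d) Z" "\<forall>z\<in>{w. set w \<subseteq> {1..d} \<and> length w \<le> l}. h z = g z" using * by blast
    have "g w = h w" if "length w \<le> l" for w
    proof (cases "w \<in> lists {1..d}")
      case True
      then have "set w \<subseteq> {1..d}" by auto
      then show ?thesis using h(2) that by auto
    next
      case False
      have "h \<in> wreath_perms d" using h(1) gen by blast
      then show ?thesis using wreath_perms_outside[OF d g False] wreath_perms_outside[OF d _ False, of h] by simp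
    qed
    then show "\<exists>h\<in>generate (iter_wreath d) Z. agree l g h" using h(1) unfolding agree_def by blast
  next
    fix X :: "nat list set" assume *: "\<forall>l. \<exists>h\<in>generate (iter_wreath d) Z. agree l g h" and X: "finite X"
    have "length z \<le> Max (length ` X)" if "z \<in> X" for z using X that by (intro Max_ge) auto
    then show "\<exists>h\<in>generate (iter_wreath d) Z. \<forall>z\<in>X. h z = g z"
      using *[rule_format, of "Max (length ` X)"] unfolding agree_def by metis
  qed
  finally show ?thesis .
qed

text \<open>The rotation at the root is read off from one-letter words. The sections are again
  approximated at every level, so coinduction applies.\<close>

lemma wreath_perms_closed:
  assumes d: "d \<ge> 1" and g: "\<And>l. \<exists>h\<in>wreath_perms d. agree l g h"
  shows "g \<in> wreath_perms d"
proof (rule wreath_perms_coinduct[OF d, where X = "\<lambda>g. \<forall>l. \<exists>h\<in>wreath_perms d. agree l g h"])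
  fix g assume g: "\<forall>l. \<exists>h\<in>wreath_perms d. agree l g h"
  have "\<exists>h k gs. h \<in> wreath_perms d \<and> agree l g h \<and> h = node d (rotl d k) gs \<and> (\<forall>i\<in>{1..d}. gs i \<in> wreath_perms d)" for l
  proof -
    obtain h where h: "h \<in> wreath_perms d" "agree l g h" using g by blast
    then show ?thesis using wreath_perms_cases[OF d h(1)] by metis
  qed
  then obtain h k gs where h: "\<And>l. h l \<in> wreath_perms d" "\<And>l. agree l g (h l)"
    "\<And>l. h l = node d (rotl d (k l)) (gs l)" "\<And>l i. i \<in> {1..d} \<Longrightarrow> gs l i \<in> wreath_perms d" by metis
  define s where "s = rotl d (k 1)"
  have s: "rotl d (k (Suc l)) i = s i" if "i \<in> {1..d}" for i l
  proof -
    have "h (Suc l) [i] = h 1 [i]" using h(2)[of "Suc l"] h(2)[of 1] by (simp add: agree_def)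
    moreover have "h (Suc l) [i] = rotl d (k (Suc l)) i # gs (Suc l) i []" "h 1 [i] = s i # gs 1 i []"
      unfolding h(3)[of "Suc l"] h(3)[of 1] s_def using that by auto
    ultimately show ?thesis by simp
  qed
  define gs' where "gs' i w = tl (g (i # w))" for i w
  have node: "g (i # w) = s i # gs (Suc l) i w" if "i \<in> {1..d}" "w \<in> lists {1..d}" "length w \<le> l" for i w l
  proof -
    have "g (i # w) = h (Suc l) (i # w)" using h(2)[of "Suc l"] that by (simp add: agree_def)
    also have "\<dots> = s i # gs (Suc l) i w" using that s[OF that(1), of l] by (subst h(3)) auto
    finally show ?thesis .
  qed
  have out: "g w = w" if "w \<notin> lists {1..d}" for w
    using h(2)[of "length w"] wreath_perms_outside[OF d h(1) that] by (simp add: agree_def)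
  have "g w = node d s gs' w" for w
  proof (cases w)
    case Nil
    then show ?thesis using h(2)[of 0] wreath_perms_length[OF d h(1)[of 0], of "[]"] by (simp add: agree_def)
  next
    case (Cons i v)
    then show ?thesis using out[of w] node[of i v "length v"] by (cases "w \<in> lists {1..d}") (auto simp: gs'_def)
  qed
  then have "g = node d (rotl d (k 1)) gs'" by (auto simp: s_def)
  moreover have "\<exists>h\<in>wreath_perms d. agree l (gs' i) h" if i: "i \<in> {1..d}" for i l
  proof (intro bexI)
    show "gs (Suc l) i \<in> wreath_perms d" by (rule h(4)[OF i])
    have "gs' i w = gs (Suc l) i w" if "length w \<le> l" for w
    proof (cases "w \<in> lists {1..d}")
      case True
      then show ?thesis using node[OF i True that] by (simp add: gs'_def)
    next
      case False
      then have "i # w \<notin> lists {1..d}" by auto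
      then show ?thesis using out[of "i # w"] wreath_perms_outside[OF d h(4)[OF i] False] by (simp add: gs'_def)
    qed
    then show "agree l (gs' i) (gs (Suc l) i)" by (simp add: agree_def)
  qed
  ultimately show "\<exists>k gs. g = node d (rotl d k) gs \<and> (\<forall>i\<in>{1..d}. (\<forall>l. \<exists>h\<in>wreath_perms d. agree l (gs i) h) \<or> gs i \<in> wreath_perms d)"
    by blast
qed (use g in blast)

section \<open>The image of the Galois group is closed and topologically generated\<close>

context unicritical
begin

lemma \<Gamma>_level_field: assumes g: "g \<in> \<Gamma>" and "x \<in> level_field l" shows "g x \<in> level_field l"
proof -
  interpret h: subfield_hom M g by (rule \<Gamma>_hom[OF g])
  have "level_field l \<subseteq> {x \<in> M. g x \<in> level_field l}"
    unfolding level_field_def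
  proof (rule adjoin_minimal)
    show "is_subfield {x \<in> M. g x \<in> adjoin k {x. (poly f ^^ l) x = t}}" by (rule h.preimage_subfield[OF is_subfield_adjoin])
    show "k \<subseteq> {x \<in> M. g x \<in> adjoin k {x. (poly f ^^ l) x = t}}" using k_M by (auto simp: \<Gamma>_k[OF g] adjoin_base)
    show "{x. (poly f ^^ l) x = t} \<subseteq> {x \<in> M. g x \<in> adjoin k {x. (poly f ^^ l) x = t}}"
      using preimage_M \<Gamma>_f[OF g, of _ l] \<Gamma>_t[OF g] by (fastforce intro!: adjoin_gen)
  qed
  then show ?thesis using assms by blast
qed

lemma agree_level_field:
  assumes g: "g \<in> \<Gamma>" and h: "h \<in> \<Gamma>" and "agree l (\<rho> g) (\<rho> h)" and "x \<in> level_field l"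
  shows "g x = h x"
proof -
  interpret g: subfield_hom M g by (rule \<Gamma>_hom[OF g])
  interpret h: subfield_hom M h by (rule \<Gamma>_hom[OF h])
  have "is_subfield {x \<in> M. g x = h x}"
    using M unfolding is_subfield_def
    by (auto simp: g.hom_1 h.hom_1 g.hom_diff h.hom_diff g.hom_mult h.hom_mult g.hom_inverse h.hom_inverse)
  moreover have "k \<subseteq> {x \<in> M. g x = h x}" using k_M by (auto simp: \<Gamma>_k[OF g] \<Gamma>_k[OF h])
  moreover have "{x. (poly f ^^ l) x = t} \<subseteq> {x \<in> M. g x = h x}"
  proof
    fix x assume "x \<in> {x. (poly f ^^ l) x = t}"
    then obtain w where w: "w \<in> lists {1..d}" "length w = l" "T w = x" using T_surj by blast
    have "g x = T (\<rho> g w)" "h x = T (\<rho> h w)" using \<rho>_lists[OF g w(1)] \<rho>_lists[OF h w(1)] w(3) by auto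
    then show "x \<in> {x \<in> M. g x = h x}" using assms(3) w T_M[OF w(1)] by (simp add: agree_def)
  qed
  ultimately have "level_field l \<subseteq> {x \<in> M. g x = h x}" unfolding level_field_def by (rule adjoin_minimal)
  then show ?thesis using assms(4) by blast
qed

text \<open>The approximating automorphisms for levels l and above coincide on
  \<open>level_field l\<close>. They glue to an automorphism of the union \<open>M\<close>, each
  element being treated at its least level.\<close>

lemma \<rho>_image_closed:
  assumes g: "g \<in> wreath_perms d" and approx: "\<And>l. \<exists>h\<in>\<Gamma>. agree l g (\<rho> h)"
  shows "g \<in> \<rho> ` \<Gamma>"
proof -
  have "\<forall>l. \<exists>h. h \<in> \<Gamma> \<and> agree l g (\<rho> h)" using approx by blast
  from choice[OF this] obtain D where D: "\<And>l. D l \<in> \<Gamma>" "\<And>l. agree l g (\<rho> (D l))" by blast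
  have D_mono: "D l' x = D l x" if "l \<le> l'" "x \<in> level_field l" for l l' x
    by (rule agree_level_field[OF D(1) D(1) agree_trans[OF agree_sym[OF agree_mono[OF D(2) that(1)]] D(2)] that(2)])
  define lev where "lev x = (LEAST l. x \<in> level_field l)" for x
  have lev: "x \<in> level_field (lev x)" if "x \<in> M" for x
    using that LeastI_ex[of "\<lambda>l. x \<in> level_field l"] unfolding M_eq lev_def by blast
  have lev_le: "lev x \<le> l" if "x \<in> level_field l" for x l unfolding lev_def by (rule Least_le[of "\<lambda>l. x \<in> level_field l", OF that])
  have lf_M: "x \<in> M" if "x \<in> level_field l" for x l using that unfolding M_eq by blast
  define \<delta> where "\<delta> x = (if x \<in> M then D (lev x) x else x)" for x
  define \<delta>' where "\<delta>' x = (if x \<in> M then inv' (D (lev x)) x else x)" for x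
  have \<delta>: "\<delta> x = D l x" if "x \<in> level_field l" for x l
    using that D_mono[OF lev_le[OF that] lev] lf_M[OF that] by (simp add: \<delta>_def)
  have \<delta>': "\<delta>' x = inv' (D l) x" if x: "x \<in> level_field l" for x l
  proof -
    let ?y = "inv' (D (lev x)) x"
    have "?y \<in> level_field (lev x)" by (rule \<Gamma>_level_field[OF inv_\<Gamma>[OF D(1)] lev[OF lf_M[OF x]]])
    then have "D l ?y = D (lev x) ?y" by (rule D_mono[OF lev_le[OF x]])
    also have "\<dots> = x" using \<Gamma>_bij[OF D(1)] by (simp add: bij_is_surj surj_f_inv_f)
    finally have "inv' (D l) x = ?y" using \<Gamma>_bij[OF D(1)] by (metis bij_inv_eq_iff)
    then show ?thesis using lf_M[OF x] by (simp add: \<delta>'_def)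
  qed
  have "\<delta> permutes M"
  proof (rule bij_imp_permutes[OF bij_betwI[where g = \<delta>']])
    show "\<delta> \<in> M \<rightarrow> M" "\<delta>' \<in> M \<rightarrow> M" using \<Gamma>_M D(1) inv_\<Gamma> by (auto simp: \<delta>_def \<delta>'_def)
    fix x assume x: "x \<in> M"
    have "\<delta>' (\<delta> x) = inv' (D (lev x)) (D (lev x) x)"
      using \<delta>[OF lev[OF x]] \<delta>'[OF \<Gamma>_level_field[OF D(1) lev[OF x]]] by simp
    then show "\<delta>' (\<delta> x) = x" using \<Gamma>_bij[OF D(1)] by (simp add: bij_is_inj inv_f_f)
    have "\<delta> (\<delta>' x) = D (lev x) (inv' (D (lev x)) x)"
      using \<delta>'[OF lev[OF x]] \<delta>[OF \<Gamma>_level_field[OF inv_\<Gamma>[OF D(1)] lev[OF x]]] by simp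
    then show "\<delta> (\<delta>' x) = x" using \<Gamma>_bij[OF D(1)] by (simp add: bij_is_surj surj_f_inv_f)
  qed (simp add: \<delta>_def)
  moreover have "subfield_hom M \<delta>"
  proof
    show "is_subfield M" by (rule M)
    fix x y assume "x \<in> M" "y \<in> M"
    then obtain l where l: "x \<in> level_field l" "y \<in> level_field l" using level_field_2 by blast
    interpret h: subfield_hom M "D l" by (rule \<Gamma>_hom[OF D(1)])
    show "\<delta> (x + y) = \<delta> x + \<delta> y"
      using \<delta>[OF l(1)] \<delta>[OF l(2)] \<delta>[OF is_subfield_add[OF level_field l]] h.hom_add lf_M l by simp
    show "\<delta> (x * y) = \<delta> x * \<delta> y"
      using \<delta>[OF l(1)] \<delta>[OF l(2)] \<delta>[OF is_subfield_mult[OF level_field l]] h.hom_mult lf_M l by simp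
  next
    show "inj_on \<delta> M" using \<open>\<delta> permutes M\<close> by (rule permutes_inj_on)
  qed
  moreover have "\<delta> x = x" if "x \<in> k" for x using k_M[OF that] \<Gamma>_k[OF D(1) that] by (simp add: \<delta>_def)
  moreover have "\<delta> t = t" using t_M \<Gamma>_t[OF D(1)] by (simp add: \<delta>_def)
  ultimately have \<delta>\<Gamma>: "\<delta> \<in> \<Gamma>" unfolding \<Gamma>_iff by blast
  have "\<rho> \<delta> w = g w" for w
  proof (cases "w \<in> lists {1..d}")
    case True
    have "T w \<in> level_field (length w)" unfolding level_field_def using f_iter_T[OF True] by (intro adjoin_gen) simp
    then have "\<delta> (T w) = D (length w) (T w)" by (rule \<delta>)
    then have "\<rho> \<delta> w = \<rho> (D (length w)) w"
      using \<rho>_lists[OF D(1)[of "length w"] True] by (intro \<rho>_eqI[OF \<delta>\<Gamma>]) (use True in auto)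
    then show ?thesis using D(2)[of "length w"] by (simp add: agree_def)
  next
    case False
    then show ?thesis using wreath_perms_outside[OF d1 g False] \<rho>_outside by simp
  qed
  then show ?thesis using \<delta>\<Gamma> by (metis ext image_eqI)
qed

lemma \<rho>_generate:
  assumes S: "S \<subseteq> \<Gamma>" and g: "g \<in> generate (geom_group K f t) S"
  shows "\<rho> g \<in> generate (iter_wreath d) (\<rho> ` S)"
proof -
  from g have "g \<in> \<Gamma> \<and> \<rho> g \<in> generate (iter_wreath d) (\<rho> ` S)"
  proof (induction rule: generate.induct)
    case one
    have "\<one>\<^bsub>iter_wreath d\<^esub> = id" by (simp add: iter_wreath_def)
    then show ?case using generate.one[of "iter_wreath d" "\<rho> ` S"] id_\<Gamma> by (simp only: \<Gamma>_ops \<rho>_id)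
  next
    case (incl h)
    then show ?case using S by (auto intro: generate.incl)
  next
    case (inv h)
    then have h: "h \<in> \<Gamma>" using S by blast
    have "inv\<^bsub>iter_wreath d\<^esub> (\<rho> h) \<in> generate (iter_wreath d) (\<rho> ` S)" using inv by (auto intro: generate.inv)
    then show ?case using h inv_\<Gamma>[OF h] by (simp add: \<Gamma>_inv \<rho>_inv iter_wreath_inv[OF d1 \<rho>_wreath_perms])
  next
    case (eng h1 h2)
    then have "\<rho> h1 \<circ> \<rho> h2 \<in> generate (iter_wreath d) (\<rho> ` S)"
      using generate.eng[of "\<rho> h1" "iter_wreath d" "\<rho> ` S" "\<rho> h2"] by (simp add: iter_wreath_def)
    then have "\<rho> (h1 \<circ> h2) \<in> generate (iter_wreath d) (\<rho> ` S)" using eng \<rho>_comp by metis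
    moreover have "h1 \<circ> h2 \<in> \<Gamma>" using eng comp_\<Gamma> by blast
    ultimately show ?case unfolding \<Gamma>_ops by blast
  qed
  then show ?thesis by blast
qed

lemma \<gamma>_\<Gamma>: "i \<in> {1..n} \<Longrightarrow> \<gamma> i \<in> \<Gamma>" using gamma by blast

lemma \<Gamma>_generate: "S \<subseteq> \<Gamma> \<Longrightarrow> generate (geom_group K f t) S \<subseteq> \<Gamma>"
  by (rule group.generate_incl[OF \<Gamma>_group])

text \<open>One inclusion approximates an automorphism on the finitely many nodes up to each level;
  the other one rests on the closedness of the image.\<close>

lemma \<rho>_image: "\<rho> ` \<Gamma> = top_generate (iter_wreath d) ((\<lambda>i. \<rho> (\<gamma> i)) ` {1..n})"
proof -
  have S: "\<gamma> ` {1..n} \<subseteq> \<Gamma>" using \<gamma>_\<Gamma> by blast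
  have Z: "(\<lambda>i. \<rho> (\<gamma> i)) ` {1..n} \<subseteq> wreath_perms d" using \<gamma>_\<Gamma> \<rho>_wreath_perms by blast
  have "\<rho> ` \<gamma> ` {1..n} = (\<lambda>i. \<rho> (\<gamma> i)) ` {1..n}" by (simp add: image_image)
  show ?thesis
  proof (intro equalityI subsetI)
    fix g assume "g \<in> \<rho> ` \<Gamma>"
    then obtain \<delta> where \<delta>: "\<delta> \<in> \<Gamma>" "g = \<rho> \<delta>" by blast
    have "\<exists>h\<in>generate (iter_wreath d) ((\<lambda>i. \<rho> (\<gamma> i)) ` {1..n}). agree l g h" for l
    proof -
      have "\<delta> \<in> top_generate (geom_group K f t) (\<gamma> ` {1..n})" using \<delta>(1) gamma_gen by simp
      then have *: "\<forall>X. finite X \<longrightarrow> (\<exists>h\<in>generate (geom_group K f t) (\<gamma> ` {1..n}). \<forall>z\<in>X. h z = \<delta> z)"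
        unfolding top_generate_def pointwise_closure_iff[OF \<Gamma>_generate[OF S]] by blast
      have "finite (T ` {w. set w \<subseteq> {1..d} \<and> length w \<le> l})" by (intro finite_imageI finite_lists_length_le) simp
      then obtain h where h: "h \<in> generate (geom_group K f t) (\<gamma> ` {1..n})" "\<forall>z\<in>T ` {w. set w \<subseteq> {1..d} \<and> length w \<le> l}. h z = \<delta> z"
        using * by blast
      have h\<Gamma>: "h \<in> \<Gamma>" using h(1) \<Gamma>_generate[OF S] by blast
      have "g w = \<rho> h w" if "length w \<le> l" for w
      proof (cases "w \<in> lists {1..d}")
        case True
        then have "h (T w) = \<delta> (T w)" using h(2) that by auto
        then show ?thesis unfolding \<delta>(2)
          using \<rho>_lists[OF h\<Gamma> True] by (intro \<rho>_eqI[OF \<delta>(1)]) (use True in auto)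
      qed (simp add: \<delta>(2) \<rho>_outside)
      moreover have "\<rho> h \<in> generate (iter_wreath d) ((\<lambda>i. \<rho> (\<gamma> i)) ` {1..n})"
        using \<rho>_generate[OF S h(1)] by (simp add: image_image)
      ultimately show ?thesis unfolding agree_def by blast
    qed
    then show "g \<in> top_generate (iter_wreath d) ((\<lambda>i. \<rho> (\<gamma> i)) ` {1..n})"
      unfolding top_generate_iter_wreath[OF d1 Z] using \<delta> \<rho>_wreath_perms by blast
  next
    fix g assume "g \<in> top_generate (iter_wreath d) ((\<lambda>i. \<rho> (\<gamma> i)) ` {1..n})"
    then have g: "g \<in> wreath_perms d" "\<And>l. \<exists>h\<in>generate (iter_wreath d) ((\<lambda>i. \<rho> (\<gamma> i)) ` {1..n}). agree l g h"
      unfolding top_generate_iter_wreath[OF d1 Z] by blast+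
    have "generate (iter_wreath d) ((\<lambda>i. \<rho> (\<gamma> i)) ` {1..n}) \<subseteq> \<rho> ` \<Gamma>"
    proof
      fix h assume "h \<in> generate (iter_wreath d) ((\<lambda>i. \<rho> (\<gamma> i)) ` {1..n})"
      then show "h \<in> \<rho> ` \<Gamma>"
      proof (induction rule: generate.induct)
        case one
        have "\<one>\<^bsub>iter_wreath d\<^esub> = \<rho> id" unfolding \<rho>_id by (simp add: iter_wreath_def)
        then show ?case using id_\<Gamma> by blast
      next
        case (incl h)
        then show ?case using \<gamma>_\<Gamma> by blast
      next
        case (inv h)
        then obtain i where i: "i \<in> {1..n}" "h = \<rho> (\<gamma> i)" by blast
        have "inv\<^bsub>iter_wreath d\<^esub> h = \<rho> (inv' (\<gamma> i))"
          unfolding i(2) using \<gamma>_\<Gamma>[OF i(1)] by (simp add: \<rho>_inv iter_wreath_inv[OF d1 \<rho>_wreath_perms])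
        then show ?case using inv_\<Gamma>[OF \<gamma>_\<Gamma>[OF i(1)]] by blast
      next
        case (eng h1 h2)
        then obtain g1 g2 where "g1 \<in> \<Gamma>" "g2 \<in> \<Gamma>" "h1 = \<rho> g1" "h2 = \<rho> g2" by blast
        then have "g1 \<circ> g2 \<in> \<Gamma>" "h1 \<otimes>\<^bsub>iter_wreath d\<^esub> h2 = \<rho> (g1 \<circ> g2)"
          using comp_\<Gamma> \<rho>_comp by (auto simp: iter_wreath_def)
        then show ?case by blast
      qed
    qed
    then show "g \<in> \<rho> ` \<Gamma>" using g(2) by (intro \<rho>_image_closed[OF g(1)]) blast
  qed
qed

end

section \<open>Valuation rings\<close>

locale valuation =
  fixes M V :: "'l::field set"
  assumes M: "is_subfield M" and V: "valuation_ring_of M V"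
begin

lemma V_M: "x \<in> V \<Longrightarrow> x \<in> M" and V_1: "1 \<in> V" and V_diff: "x \<in> V \<Longrightarrow> y \<in> V \<Longrightarrow> x - y \<in> V"
  and V_mult: "x \<in> V \<Longrightarrow> y \<in> V \<Longrightarrow> x * y \<in> V" and V_cases: "x \<in> M \<Longrightarrow> x \<in> V \<or> inverse x \<in> V"
  using V by (auto simp: valuation_ring_of_def)

lemma V_0: "0 \<in> V" using V_diff[OF V_1 V_1] by simp
lemma V_minus: "x \<in> V \<Longrightarrow> - x \<in> V" using V_diff[OF V_0] by simp
lemma V_add: "x \<in> V \<Longrightarrow> y \<in> V \<Longrightarrow> x + y \<in> V" using V_diff[OF _ V_minus] by fastforce
lemma V_power: "x \<in> V \<Longrightarrow> x ^ j \<in> V" by (induction j) (auto intro: V_1 V_mult)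

abbreviation \<mm> where "\<mm> \<equiv> valuation_ideal V"

lemma mm_iff: "x \<in> \<mm> \<longleftrightarrow> x \<in> V \<and> (x = 0 \<or> inverse x \<notin> V)" by (simp add: valuation_ideal_def)

lemma mm_V: "x \<in> \<mm> \<Longrightarrow> x \<in> V" by (simp add: mm_iff)
lemma mm_0: "0 \<in> \<mm>" by (simp add: mm_iff V_0)

lemma mm_mult: "x \<in> \<mm> \<Longrightarrow> y \<in> V \<Longrightarrow> x * y \<in> \<mm>"
proof -
  assume x: "x \<in> \<mm>" and y: "y \<in> V"
  have "inverse (x * y) \<notin> V" if nz: "x * y \<noteq> 0"
  proof
    assume "inverse (x * y) \<in> V"
    then have "y * inverse (x * y) \<in> V" using V_mult y by blast
    moreover have "y * inverse (x * y) = inverse x" using nz by (simp add: field_simps)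
    ultimately have "inverse x \<in> V" by (simp only:)
    then show False using x nz by (auto simp: mm_iff)
  qed
  then show ?thesis using x y V_mult by (auto simp: mm_iff)
qed

lemma mm_mult': "y \<in> V \<Longrightarrow> x \<in> \<mm> \<Longrightarrow> y * x \<in> \<mm>" using mm_mult[of x y] by (simp add: mult.commute)

lemma mm_minus: "x \<in> \<mm> \<Longrightarrow> - x \<in> \<mm>" using mm_mult[OF _ V_minus[OF V_1], of x] by simp

lemma mm_add: "x \<in> \<mm> \<Longrightarrow> y \<in> \<mm> \<Longrightarrow> x + y \<in> \<mm>"
proof -
  have *: "x + y \<in> \<mm>" if "x \<in> \<mm>" "y \<in> \<mm>" "y \<noteq> 0" "x / y \<in> V" for x y
  proof -
    have "y * (x / y + 1) \<in> \<mm>" by (intro mm_mult that V_add V_1)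
    moreover have "y * (x / y + 1) = x + y" using that(3) by (simp add: distrib_left)
    ultimately show ?thesis by (simp only:)
  qed
  assume xy: "x \<in> \<mm>" "y \<in> \<mm>"
  show ?thesis
  proof (cases "x = 0 \<or> y = 0")
    case False
    have "x / y \<in> M" by (rule is_subfield_divide[OF M]) (use xy mm_V V_M in auto)
    then have "x / y \<in> V \<or> y / x \<in> V" using V_cases[of "x / y"] by simp
    then show ?thesis using *[of x y] *[of y x] xy False by (auto simp: add.commute)
  qed (use xy in auto)
qed

lemma mm_diff: "x \<in> \<mm> \<Longrightarrow> y \<in> \<mm> \<Longrightarrow> x - y \<in> \<mm>" using mm_add[OF _ mm_minus] by fastforce

lemma unitD: "x \<in> V \<Longrightarrow> x \<notin> \<mm> \<Longrightarrow> x \<noteq> 0 \<and> inverse x \<in> V" by (auto simp: mm_iff)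

lemma mm_prime: "x \<in> V \<Longrightarrow> y \<in> V \<Longrightarrow> x * y \<in> \<mm> \<Longrightarrow> x \<in> \<mm> \<or> y \<in> \<mm>"
proof (rule ccontr)
  assume x: "x \<in> V" and y: "y \<in> V" and xy: "x * y \<in> \<mm>" and "\<not> (x \<in> \<mm> \<or> y \<in> \<mm>)"
  then have "inverse y * inverse x \<in> V" "x * y \<noteq> 0" using unitD V_mult by auto
  moreover have "inverse (x * y) = inverse y * inverse x" by simp
  ultimately show False using xy unfolding mm_iff by metis
qed

lemma mm_1: "1 \<notin> \<mm>" by (simp add: mm_iff V_1)

lemma mm_power: "x \<in> V \<Longrightarrow> x ^ j \<in> \<mm> \<Longrightarrow> x \<in> \<mm>"
  by (induction j) (auto simp: mm_1 dest: mm_prime intro: V_power)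

lemma mm_prod: "finite I \<Longrightarrow> (\<And>i. i \<in> I \<Longrightarrow> g i \<in> V) \<Longrightarrow> prod g I \<in> \<mm> \<Longrightarrow> \<exists>i\<in>I. g i \<in> \<mm>"
proof (induction I rule: finite_induct)
  case (insert i I)
  have "prod g I \<in> V" using insert.hyps(1) insert.prems(1)
    by (induction I rule: finite_induct) (auto intro: V_1 V_mult)
  then show ?case using insert mm_prime[of "g i" "prod g I"] by auto
qed (simp add: mm_1)

lemma V_root: "x \<in> M \<Longrightarrow> j \<ge> 1 \<Longrightarrow> x ^ j \<in> V \<Longrightarrow> x \<in> V"
proof (rule ccontr)
  assume x: "x \<in> M" "j \<ge> 1" "x ^ j \<in> V" "x \<notin> V"
  then have "x \<noteq> 0" "inverse x \<in> V" using V_cases V_0 by auto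
  then have "x ^ j * inverse x ^ (j - 1) \<in> V" using x V_mult V_power by blast
  also have "x ^ j * inverse x ^ (j - 1) = x"
    using x(2) \<open>x \<noteq> 0\<close> by (cases j) (simp_all add: field_simps)
  finally show False using x by simp
qed

text \<open>Meant for the product of the successive images of one element under an inertial
  automorphism, all of them congruent to that element.\<close>

lemma power_cong:
  assumes "x \<in> V" "\<And>i. i < j \<Longrightarrow> y i \<in> V" "\<And>i. i < j \<Longrightarrow> y i - x \<in> \<mm>"
  shows "(\<Prod>i<j. y i) - x ^ j \<in> \<mm> \<and> (\<Prod>i<j. y i) \<in> V"
  using assms(2,3)
proof (induction j)
  case (Suc j)
  then have IH: "(\<Prod>i<j. y i) - x ^ j \<in> \<mm>" "(\<Prod>i<j. y i) \<in> V" by auto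
  have yj: "y j \<in> V" "y j - x \<in> \<mm>" using Suc.prems by auto
  have "((\<Prod>i<j. y i) - x ^ j) * y j + x ^ j * (y j - x) \<in> \<mm>"
    by (intro mm_add mm_mult mm_mult' IH yj V_power assms(1))
  also have "((\<Prod>i<j. y i) - x ^ j) * y j + x ^ j * (y j - x) = (\<Prod>i<Suc j. y i) - x ^ Suc j"
    by (simp add: algebra_simps)
  finally show ?case using IH yj V_mult by simp
qed (simp add: mm_0 V_1)

end

section \<open>Inertial elements\<close>

context unicritical
begin

definition post :: "nat \<Rightarrow> 'l" where "post i = (poly f ^^ i) 0"

lemma post_Suc: "post (Suc i) = a * post i ^ d + b" by (simp add: post_def poly_f)
lemma post_1: "post 1 = b" using d1 by (simp add: post_def poly_f)
lemma post_K: "post i \<in> K"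
proof (induction i)
  case (Suc i)
  then show ?case unfolding post_Suc by (intro is_subfield_add[OF K] is_subfield_mult[OF K] is_subfield_power[OF K] f)
qed (simp add: post_def is_subfield_0[OF K])

text \<open>Records those properties of an inertia group that pass to sections: the constants and
  their inverses as well as \<open>t\<close> are integral, and the element acts trivially on the
  residue field.\<close>

definition inert :: "'l set \<Rightarrow> ('l \<Rightarrow> 'l) \<Rightarrow> bool" where
  "inert V \<delta> \<longleftrightarrow> valuation_ring_of M V \<and> (\<forall>c\<in>k. c \<in> V \<and> inverse c \<in> V) \<and> t \<in> V \<and>
     \<delta> \<in> \<Gamma> \<and> \<delta> ` V = V \<and> (\<forall>x\<in>V. \<delta> x - x \<in> valuation_ideal V)"

lemma inertD: assumes "inert V \<delta>"
  shows inert_val: "valuation M V" and inert_k: "c \<in> k \<Longrightarrow> c \<in> V" "c \<in> k \<Longrightarrow> inverse c \<in> V" and inert_t: "t \<in> V"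
    and inert_\<Gamma>: "\<delta> \<in> \<Gamma>" and inert_V: "x \<in> V \<Longrightarrow> \<delta> x \<in> V" and inert_mm: "x \<in> V \<Longrightarrow> \<delta> x - x \<in> valuation_ideal V"
  using assms by (auto simp: inert_def valuation_def M)

lemma const_mm: assumes "inert V \<delta>" "c \<in> k" "c \<in> valuation_ideal V" shows "c = 0"
  using assms by (auto simp: inert_def valuation_ideal_def)

text \<open>The difference \<zeta> - 1 is a constant, and the only constant in the maximal ideal is
  0; so \<open>d\<close>-th roots of unity stay distinct in the residue field.\<close>

lemma root_of_unity_mm: assumes "inert V \<delta>" "\<zeta> ^ d = 1" "\<zeta> - 1 \<in> valuation_ideal V" shows "\<zeta> = 1"
  using const_mm[OF assms(1) root_of_unity_minus_1_k[OF assms(2)] assms(3)] by simp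

lemma inert_comp: assumes "inert V g" "inert V h" shows "inert V (g \<circ> h)"
proof -
  interpret valuation M V by (rule inert_val[OF assms(1)])
  have "(g \<circ> h) x - x \<in> valuation_ideal V" if "x \<in> V" for x
  proof -
    have "(g (h x) - h x) + (h x - x) \<in> valuation_ideal V"
      by (intro mm_add inert_mm[OF assms(1)] inert_mm[OF assms(2)] inert_V[OF assms(2)] that)
    then show ?thesis by simp
  qed
  moreover have "(g \<circ> h) ` V = V" using assms unfolding inert_def by (metis image_comp)
  ultimately show ?thesis using assms comp_\<Gamma> unfolding inert_def by blast
qed

lemma inert_id: "inert V \<delta> \<Longrightarrow> inert V id"
  using valuation.mm_0[OF inert_val, of V \<delta>] id_\<Gamma> by (simp add: inert_def)

lemma inert_funpow: "inert V \<delta> \<Longrightarrow> inert V (\<delta> ^^ j)"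
  by (induction j) (auto intro: inert_id inert_comp)

lemma inert_root_of_unity:
  assumes \<delta>: "inert V \<delta>" and y: "y \<in> V" "y \<notin> valuation_ideal V" and "\<delta> y = \<zeta> * y" "\<zeta> ^ d = 1"
  shows "\<zeta> = 1"
proof -
  interpret valuation M V by (rule inert_val[OF \<delta>])
  have y0: "y \<noteq> 0" "inverse y \<in> V" using unitD[OF y] by auto
  have "(\<delta> y - y) * inverse y \<in> \<mm>" by (intro mm_mult inert_mm[OF \<delta> y(1)] y0)
  also have "(\<delta> y - y) * inverse y = \<zeta> - 1" using assms(4) y0 by (simp add: field_simps)
  finally show ?thesis using root_of_unity_mm[OF \<delta> assms(5)] by blast
qed

text \<open>The place that belongs to a section at \<open>i\<close>: pulled back along the path,
  \<open>t\<close> acquires the residue of \<open>tt i\<close>.\<close>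

definition pull :: "nat \<Rightarrow> 'l set \<Rightarrow> 'l set" where
  "pull i V = {x \<in> M. \<Lambda> i x \<in> V}"

lemma pull_mm: assumes "inert V \<delta>" "i \<in> {1..d}" shows "x \<in> valuation_ideal (pull i V) \<longleftrightarrow> x \<in> M \<and> \<Lambda> i x \<in> valuation_ideal V"
proof -
  interpret h: subfield_hom UNIV "\<Lambda> i" by (rule path_hom[OF assms(2)])
  show ?thesis by (auto simp: valuation_ideal_def pull_def h.hom_eq_0 h.hom_inverse is_subfield_inverse[OF M])
qed

lemma inert_sec:
  assumes \<delta>: "inert V \<delta>" and i: "i \<in> {1..d}" and fix_i: "root \<delta> i = i" and tV: "tt i \<in> V"
  shows "inert (pull i V) (sec \<delta> i)"
proof -
  interpret h: subfield_hom UNIV "\<Lambda> i" by (rule path_hom[OF i])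
  interpret valuation M V by (rule inert_val[OF \<delta>])
  note \<delta>\<Gamma> = inert_\<Gamma>[OF \<delta>]
  have sec: "\<Lambda> i (sec \<delta> i x) = \<delta> (\<Lambda> i x)" if "x \<in> M" for x using path_sec[OF \<delta>\<Gamma> i that] fix_i by simp
  have "valuation_ring_of M (pull i V)"
    unfolding valuation_ring_of_def pull_def
    using V_1 V_diff V_mult V_cases path_M[OF i] M
    by (auto simp: h.hom_1 h.hom_diff h.hom_mult h.hom_inverse is_subfield_1[OF M] is_subfield_diff[OF M] is_subfield_mult[OF M] is_subfield_inverse[OF M])
  moreover have "c \<in> pull i V \<and> inverse c \<in> pull i V" if "c \<in> k" for c
    using inert_k[OF \<delta> that] k_M[OF that] is_subfield_inverse[OF M k_M[OF that]] path_k[OF i that] by (simp add: pull_def h.hom_inverse)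
  moreover have "t \<in> pull i V" using t_M tV path_t[OF i] by (simp add: pull_def)
  moreover have "sec \<delta> i ` pull i V = pull i V"
  proof
    show "sec \<delta> i ` pull i V \<subseteq> pull i V" using sec inert_V[OF \<delta>] sec_M[OF \<delta>\<Gamma> i] by (auto simp: pull_def)
    show "pull i V \<subseteq> sec \<delta> i ` pull i V"
    proof
      fix y assume y: "y \<in> pull i V"
      then have "\<Lambda> i y \<in> \<delta> ` V" using \<delta> by (auto simp: pull_def inert_def)
      then obtain v where v: "v \<in> V" "\<Lambda> i y = \<delta> v" by blast
      have yM: "y \<in> M" using y by (simp add: pull_def)
      have "y \<in> sec \<delta> i ` M" using permutes_image[OF \<Gamma>_permutes[OF sec_\<Gamma>[OF \<delta>\<Gamma> i]]] yM by simp
      then obtain x where x: "x \<in> M" "y = sec \<delta> i x" by blast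
      have "\<delta> (\<Lambda> i x) = \<delta> v" using sec[OF x(1)] x(2) v(2) by simp
      then have "\<Lambda> i x = v" using \<Gamma>_bij[OF \<delta>\<Gamma>] by (auto dest: bij_is_inj injD)
      then show "y \<in> sec \<delta> i ` pull i V" using x v by (auto simp: pull_def)
    qed
  qed
  moreover have "sec \<delta> i x - x \<in> valuation_ideal (pull i V)" if "x \<in> pull i V" for x
  proof -
    have x: "x \<in> M" "\<Lambda> i x \<in> V" using that by (auto simp: pull_def)
    have "\<Lambda> i (sec \<delta> i x - x) = \<delta> (\<Lambda> i x) - \<Lambda> i x" using sec[OF x(1)] by (simp add: h.hom_diff)
    then show ?thesis unfolding pull_mm[OF \<delta> i] using inert_mm[OF \<delta> x(2)] x sec_M[OF \<delta>\<Gamma> i] is_subfield_diff[OF M] by simp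
  qed
  ultimately show ?thesis using sec_\<Gamma>[OF \<delta>\<Gamma> i] unfolding inert_def by blast
qed

lemma tt_V: assumes "inert V \<delta>" "i \<in> {1..d}" shows "tt i \<in> V"
proof -
  interpret valuation M V by (rule inert_val[OF assms(1)])
  have "(t - b) * inverse a \<in> V" by (intro V_mult V_diff inert_t[OF assms(1)] inert_k[OF assms(1)] ab_k)
  then show ?thesis using tt_power[OF assms(2)] d1 by (intro V_root[OF tt_M[OF assms(2)]]) (auto simp: divide_inverse)
qed

lemma f_cong:
  assumes \<delta>: "inert V \<delta>" and i: "i \<in> {1..d}" and tq: "tt i - post j \<in> valuation_ideal V"
  shows "t - post (Suc j) \<in> valuation_ideal V"
proof -
  interpret valuation M V by (rule inert_val[OF \<delta>])
  have q: "post j \<in> V" "a \<in> V" using inert_k(1)[OF \<delta>] K_k post_K ab_k by auto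
  have "t - post (Suc j) = (a * tt i ^ d + b) - (a * post j ^ d + b)"
    using f_tt[OF i] by (simp add: poly_f post_Suc)
  also have "\<dots> = a * (tt i ^ d - post j ^ d)" by (simp add: algebra_simps)
  also have "\<dots> = (tt i - post j) * (a * (\<Sum>l<d. post j ^ (d - Suc l) * tt i ^ l))"
    unfolding power_diff_sumr2 by (simp only: mult.left_commute)
  finally have "t - post (Suc j) = (tt i - post j) * (a * (\<Sum>l<d. post j ^ (d - Suc l) * tt i ^ l))" .
  moreover have "(\<Sum>l\<in>L. post j ^ (d - Suc l) * tt i ^ l) \<in> V" for L
    by (induction L rule: infinite_finite_induct) (auto intro: V_0 V_add V_mult V_power q tt_V[OF \<delta> i])
  ultimately show ?thesis using tq q V_mult by (simp add: mm_mult)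
qed

text \<open>From a * \<open>tt i\<close>^d = t - b it follows that \<open>tt i\<close> is a unit. An
  inertial element multiplies it by a root of unity congruent to 1, hence by 1.\<close>

lemma root_trivial:
  assumes \<delta>: "inert V \<delta>" and "t - b \<notin> valuation_ideal V" and i: "i \<in> {1..d}"
  shows "root \<delta> i = i" "\<delta> (tt i) = tt i"
proof -
  interpret valuation M V by (rule inert_val[OF \<delta>])
  obtain j where j: "\<forall>i\<in>{1..d}. root \<delta> i = rotl d (int j) i \<and> \<delta> (tt i) = \<xi> ^ j * tt i" using root_rotl[OF inert_\<Gamma>[OF \<delta>]] by blast
  have tb: "t - b \<in> V" by (intro V_diff inert_t[OF \<delta>] inert_k(1)[OF \<delta>] ab_k)
  have "tt i \<notin> \<mm>"
  proof
    assume "tt i \<in> \<mm>"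
    then have "tt i * (a * tt i ^ (d - 1)) \<in> \<mm>" by (intro mm_mult V_mult V_power inert_k(1)[OF \<delta>] ab_k tt_V[OF \<delta> i])
    also have "tt i * (a * tt i ^ (d - 1)) = a * tt i ^ d" using d1 by (cases d) auto
    also have "a * tt i ^ d = t - b" using f_tt[OF i] unfolding poly_f by (metis add_diff_cancel_right')
    finally show False using assms(2) by blast
  qed
  moreover have "(\<xi> ^ j) ^ d = 1" using \<xi>_power by (metis power_mult power_one mult.commute)
  moreover have ji: "\<delta> (tt i) = \<xi> ^ j * tt i" using j i by blast
  ultimately have "\<xi> ^ j = 1" using inert_root_of_unity[OF \<delta> tt_V[OF \<delta> i]] by blast
  then show "\<delta> (tt i) = tt i" unfolding ji by simp
  then show "root \<delta> i = i" by (intro root_eqI i)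
qed

text \<open>The hypothesis is inherited by the sections: if \<open>tt i\<close> were congruent to a
  post-critical point, its image t would be congruent to the next one. So the root permutation is
  trivial at every node.\<close>

lemma unramified:
  assumes "inert V \<delta>" "\<And>j. t - post (Suc j) \<notin> valuation_ideal V"
  shows "\<rho> \<delta> = id"
proof
  fix w
  show "\<rho> \<delta> w = id w"
    using assms
  proof (induction w arbitrary: V \<delta>)
    case (Cons i w)
    show ?case
    proof (cases "i # w \<in> lists {1..d}")
      case True
      then have i: "i \<in> {1..d}" by auto
      have "t - b \<notin> valuation_ideal V" using Cons.prems(2)[of 0] post_1 by simp
      then have r: "root \<delta> i = i" using root_trivial[OF Cons.prems(1) _ i] by blast
      have s: "inert (pull i V) (sec \<delta> i)" by (rule inert_sec[OF Cons.prems(1) i r tt_V[OF Cons.prems(1) i]])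
      have "t - post (Suc j) \<notin> valuation_ideal (pull i V)" for j
      proof
        assume "t - post (Suc j) \<in> valuation_ideal (pull i V)"
        then have "\<Lambda> i (t - post (Suc j)) \<in> valuation_ideal V" using pull_mm[OF Cons.prems(1) i] by blast
        then have "tt i - post (Suc j) \<in> valuation_ideal V"
          using subfield_hom.hom_diff[OF path_hom[OF i], of t "post (Suc j)"] path_t[OF i] path_k[OF i K_k[OF post_K]] by simp
        then show False using f_cong[OF Cons.prems(1) i] Cons.prems(2) by blast
      qed
      then show ?thesis using Cons.IH[OF s] r True by simp
    next
      case False
      then show ?thesis using \<rho>_outside[OF False, of \<delta>] by (simp only: id_apply)
    qed
  qed simp
qed

section \<open>Kummer generators over the post-critical points\<close>

text \<open>
  An inertial element over \<open>p\<close> multiplies a \<open>d\<close>-th root of a local parameter by a scalar that modulo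
  the maximal ideal does not depend on the root. It is normalised to the scalar by which \<open>\<gamma>_inf\<close>
  moves the first-level preimages of \<open>t\<close>.
\<close>

definition tame :: "'l set \<Rightarrow> 'l \<Rightarrow> ('l \<Rightarrow> 'l) \<Rightarrow> bool" where
  "tame V p \<delta> \<longleftrightarrow> (\<exists>y\<in>M. \<exists>u\<in>V. inverse u \<in> V \<and> u \<noteq> 0 \<and> y \<noteq> 0 \<and> y ^ d = u * (t - p) \<and> \<delta> y / y - \<xi> \<in> valuation_ideal V)"

text \<open>Two \<open>d\<close>-th roots of unit multiples of t - p differ by a unit, and an
  inertial element multiplies a unit by a factor congruent to 1.\<close>

lemma tame_all:
  assumes \<delta>: "inert V \<delta>" and "tame V p \<delta>"
    and y': "y' \<in> M" "y' \<noteq> 0" "u' \<in> V" "inverse u' \<in> V" "u' \<noteq> 0" "y' ^ d = u' * (t - p)"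
  shows "\<delta> y' / y' - \<xi> \<in> valuation_ideal V"
proof -
  interpret valuation M V by (rule inert_val[OF \<delta>])
  interpret h: subfield_hom M \<delta> by (rule \<Gamma>_hom[OF inert_\<Gamma>[OF \<delta>]])
  obtain y u where y: "y \<in> M" "y \<noteq> 0" and u: "u \<in> V" "inverse u \<in> V" "u \<noteq> 0" and yu: "y ^ d = u * (t - p)"
    and tame: "\<delta> y / y - \<xi> \<in> \<mm>" using assms(2) unfolding tame_def by blast
  define \<eta> where "\<eta> = y' / y"
  have \<eta>: "\<eta> \<in> M" "\<eta> \<noteq> 0" unfolding \<eta>_def using y y' is_subfield_divide[OF M] by auto
  have tp: "t - p \<noteq> 0" using yu y d1 by auto
  have "\<eta> ^ d = u' * inverse u" unfolding \<eta>_def power_divide yu y'(6) using tp by (simp add: divide_inverse)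
  then have \<eta>V: "\<eta> \<in> V" using V_mult[OF y'(3) u(2)] d1 by (intro V_root[OF \<eta>(1)]) auto
  have "inverse \<eta> ^ d = u * inverse u'" using \<open>\<eta> ^ d = u' * inverse u\<close> by (simp add: power_inverse field_simps)
  then have \<eta>'V: "inverse \<eta> \<in> V"
    using V_mult[OF u(1) y'(4)] d1 by (intro V_root[OF is_subfield_inverse[OF M \<eta>(1)]]) auto
  have "(\<delta> \<eta> - \<eta>) * inverse \<eta> \<in> \<mm>" by (intro mm_mult inert_mm[OF \<delta>] \<eta>V \<eta>'V)
  then have 1: "\<delta> \<eta> / \<eta> - 1 \<in> \<mm>" using \<eta>(2) by (simp add: field_simps)
  have \<xi>V: "\<xi> \<in> V" by (rule inert_k(1)[OF \<delta> \<xi>_k])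
  have "\<delta> y / y = (\<delta> y / y - \<xi>) + \<xi>" by simp
  then have yV: "\<delta> y / y \<in> V" using V_add[OF mm_V[OF tame] \<xi>V] by simp
  have "(\<delta> \<eta> / \<eta> - 1) * (\<delta> y / y) + (\<delta> y / y - \<xi>) \<in> \<mm>" by (intro mm_add mm_mult 1 yV tame)
  moreover have "(\<delta> \<eta> / \<eta> - 1) * (\<delta> y / y) + (\<delta> y / y - \<xi>) = \<delta> \<eta> / \<eta> * (\<delta> y / y) - \<xi>" by (simp add: algebra_simps)
  moreover have "\<delta> \<eta> / \<eta> * (\<delta> y / y) = \<delta> y' / y'"
  proof -
    have "y' = \<eta> * y" using y by (simp add: \<eta>_def)
    then have "\<delta> y' = \<delta> \<eta> * \<delta> y" using h.hom_mult \<eta> y by simp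
    then show ?thesis using \<open>y' = \<eta> * y\<close> by simp
  qed
  ultimately show ?thesis by (simp only:)
qed

lemma \<xi>_int: assumes "i \<in> {1..d}" shows "tt i = \<xi> ^ (i - 1) * tt 1"
proof -
  have 1: "1 \<in> {1..d}" using d1 by simp
  have "rotl d (int (i - 1)) 1 = i" using assms by (auto simp: rotl_def)
  then show ?thesis using tt_rotl[OF 1, of "i - 1"] by simp
qed

lemma \<xi>_distinct: "inj_on (\<lambda>i. \<xi> ^ i) {..<d}"
proof (rule inj_onI)
  fix i j assume "i \<in> {..<d}" "j \<in> {..<d}" "\<xi> ^ i = \<xi> ^ j"
  then have "tt (Suc i) = tt (Suc j)" using \<xi>_int[of "Suc i"] \<xi>_int[of "Suc j"] by simp
  then show "i = j" using tt_inj \<open>i \<in> {..<d}\<close> \<open>j \<in> {..<d}\<close> by (auto dest: inj_onD)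
qed

text \<open>The \<open>d\<close> distinct powers of \<xi> are all the roots of X^d - 1; homogenising
  gives the formula, with \<open>y = 0\<close> apart.\<close>

lemma prod_roots: "(\<Prod>i<d. x - \<xi> ^ i * y) = x ^ d - y ^ d"
proof -
  let ?p = "\<Prod>i<d. [:- (\<xi> ^ i), 1:]" and ?q = "monom (1 :: 'l) d - 1"
  have "?p = ?q"
  proof (rule poly_eqI_degree_lead_coeff[where A = "(\<lambda>i. \<xi> ^ i) ` {..<d}" and n = d])
    show "degree ?p \<le> d" by (rule order_trans[OF degree_prod_sum_le]) auto
    show "degree ?q \<le> d" by (rule order_trans[OF degree_diff_le_max]) (simp add: degree_monom_eq)
    show "d \<le> card ((\<lambda>i. \<xi> ^ i) ` {..<d})" by (simp add: card_image[OF \<xi>_distinct])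
    have "degree ?p = d" by (subst degree_prod_eq_sum_degree) auto
    moreover have "lead_coeff ?p = 1" by (simp add: lead_coeff_prod)
    ultimately show "coeff ?p d = coeff ?q d" using d1 by (simp add: coeff_1)
    fix z assume "z \<in> (\<lambda>i. \<xi> ^ i) ` {..<d}"
    then obtain i where i: "i < d" "z = \<xi> ^ i" by blast
    have "poly ?p z = 0" using i by (auto simp: poly_prod)
    moreover have "z ^ d = 1" unfolding i(2) using \<xi>_power by (metis power_mult power_one mult.commute)
    ultimately show "poly ?p z = poly ?q z" by (simp add: poly_monom)
  qed
  then have e: "(\<Prod>i<d. x - \<xi> ^ i) = x ^ d - 1" for x
  proof -
    have "poly ?p x = poly ?q x" by (simp only: \<open>?p = ?q\<close>)
    then show ?thesis by (simp add: poly_prod poly_monom)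
  qed
  show ?thesis
  proof (cases "y = 0")
    case False
    have "x - \<xi> ^ i * y = y * (x / y - \<xi> ^ i)" for i using False by (simp add: right_diff_distrib)
    then have "(\<Prod>i<d. x - \<xi> ^ i * y) = (\<Prod>i<d. y * (x / y - \<xi> ^ i))" by simp
    also have "\<dots> = y ^ d * ((x / y) ^ d - 1)" by (simp add: prod.distrib e)
    also have "\<dots> = x ^ d - y ^ d" using False by (simp add: right_diff_distrib power_divide)
    finally show ?thesis .
  qed (use d1 in \<open>simp add: power_0_left\<close>)
qed

lemma prod_tt: "(\<Prod>i\<in>{1..d}. x - tt i) = (poly f x - t) / a"
proof -
  have "(\<Prod>i\<in>{1..d}. x - tt i) = (\<Prod>i<d. x - \<xi> ^ i * tt 1)"
  proof -
    have "{1..d} = Suc ` {..<d}" by (simp add: image_Suc_lessThan)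
    then have "(\<Prod>i\<in>{1..d}. x - tt i) = (\<Prod>i<d. x - tt (Suc i))" by (simp add: prod.reindex)
    also have "\<dots> = (\<Prod>i<d. x - \<xi> ^ i * tt 1)"
    proof (rule prod.cong[OF refl])
      show "x - tt (Suc i) = x - \<xi> ^ i * tt 1" if "i \<in> {..<d}" for i using \<xi>_int[of "Suc i"] that by simp
    qed
    finally show ?thesis .
  qed
  also have "\<dots> = x ^ d - (t - b) / a" using prod_roots tt_power[of 1] d1 by simp
  finally show ?thesis using f(3) by (simp add: poly_f field_simps)
qed

end

section \<open>Products over the nodes of a level\<close>

context unicritical
begin

lemma M_prod: "(\<And>i. i \<in> I \<Longrightarrow> g i \<in> M) \<Longrightarrow> prod g I \<in> M"
  by (induction I rule: infinite_finite_induct) (auto intro: is_subfield_1[OF M] is_subfield_mult[OF M])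

lemma t_ne_0: "t \<noteq> 0"
proof
  assume "t = 0"
  then have "poly [:0, 1:] t = 0" by simp
  moreover have "poly_over K [:0, 1:]"
    by (auto simp: poly_over_def coeff_pCons is_subfield_1[OF K] is_subfield_0[OF K] split: nat.split)
  ultimately show False using t unfolding transcendental_over_def by fastforce
qed

lemma T_ne_0: "w \<in> lists {1..d} \<Longrightarrow> T w \<noteq> 0"
  by (induction w) (auto simp: t_ne_0 subfield_hom.hom_eq_0[OF path_hom])

definition words :: "nat \<Rightarrow> nat list set" where
  "words r = {w \<in> lists {1..d}. length w = r}"

lemma words_0: "words 0 = {[]}" by (auto simp: words_def)

lemma words_Suc: "words (Suc r) = (\<lambda>(w, i). w @ [i]) ` (words r \<times> {1..d})"
proof
  show "words (Suc r) \<subseteq> (\<lambda>(w, i). w @ [i]) ` (words r \<times> {1..d})"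
  proof
    fix w assume w: "w \<in> words (Suc r)"
    then have ne: "w \<noteq> []" by (auto simp: words_def)
    have "w = butlast w @ [last w]" using append_butlast_last_id[OF ne] by simp
    moreover have "butlast w \<in> words r" "last w \<in> {1..d}"
      using w last_in_set[OF ne] by (auto simp: words_def dest: in_set_butlastD)
    ultimately show "w \<in> (\<lambda>(w, i). w @ [i]) ` (words r \<times> {1..d})" by force
  qed
qed (auto simp: words_def)

lemma finite_words: "finite (words r)"
  by (induction r) (simp_all add: words_0 words_Suc)

lemma prod_T_snoc: "w \<in> lists {1..d} \<Longrightarrow> (\<Prod>i\<in>{1..d}. x - T (w @ [i])) = (poly f x - T w) / a"
proof (induction w arbitrary: x)
  case Nil
  have "(\<Prod>i\<in>{1..d}. x - T ([] @ [i])) = (\<Prod>i\<in>{1..d}. x - tt i)"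
    by (rule prod.cong[OF refl]) (simp only: append_Nil T.simps path_t)
  then show ?case using prod_tt[of x] by simp
next
  case (Cons j w)
  then have j: "j \<in> {1..d}" and w: "w \<in> lists {1..d}" by auto
  interpret h: subfield_hom UNIV "\<Lambda> j" by (rule path_hom[OF j])
  obtain x' where x': "x = \<Lambda> j x'" using path_bij[OF j] by (metis bij_pointE)
  have "(\<Prod>i\<in>{1..d}. x - T ((j # w) @ [i])) = \<Lambda> j (\<Prod>i\<in>{1..d}. x' - T (w @ [i]))"
    using h.hom_prod[of "{1..d}" "\<lambda>i. x' - T (w @ [i])"] by (simp add: x' h.hom_diff)
  also have "\<dots> = (poly f x - T (j # w)) / a"
    using Cons.IH[OF w] path_f[OF j] path_k[OF j ab_k(1)] by (simp add: x' h.hom_diff h.hom_divide)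
  finally show ?case .
qed

text \<open>Splitting off the last letter turns the factors below a node \<open>w\<close> into (f(x)
  - \<open>T w\<close>) / a, so the formula for level r is used at the point f(x).\<close>

lemma prod_T: "\<exists>c\<in>K. c \<noteq> 0 \<and> (\<forall>x. (\<Prod>w\<in>words r. x - T w) = c * ((poly f ^^ r) x - t))"
proof (induction r)
  case 0
  show ?case by (rule bexI[of _ 1]) (simp_all add: words_0 is_subfield_1[OF K])
next
  case (Suc r)
  then obtain c where c: "c \<in> K" "c \<noteq> 0" "\<And>x. (\<Prod>w\<in>words r. x - T w) = c * ((poly f ^^ r) x - t)" by blast
  let ?c = "c / a ^ card (words r)"
  have "(\<Prod>w\<in>words (Suc r). x - T w) = ?c * ((poly f ^^ Suc r) x - t)" for x
  proof -
    have inj: "inj_on (\<lambda>(w, i). w @ [i]) (words r \<times> {1..d})" by (auto simp: inj_on_def)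
    have "(\<Prod>w\<in>words (Suc r). x - T w) = (\<Prod>(w, i)\<in>words r \<times> {1..d}. x - T (w @ [i]))"
      unfolding words_Suc by (subst prod.reindex[OF inj]) (simp add: case_prod_unfold)
    also have "\<dots> = (\<Prod>w\<in>words r. \<Prod>i\<in>{1..d}. x - T (w @ [i]))" by (simp add: prod.cartesian_product)
    also have "\<dots> = (\<Prod>w\<in>words r. (poly f x - T w) / a)"
      by (rule prod.cong[OF refl], rule prod_T_snoc) (simp add: words_def)
    also have "\<dots> = c * ((poly f ^^ r) (poly f x) - t) / a ^ card (words r)" by (simp add: prod_dividef c(3))
    finally show ?thesis by (simp add: funpow_swap1)
  qed
  moreover have "?c \<in> K" "?c \<noteq> 0" using c f is_subfield_divide[OF K] is_subfield_power[OF K] by auto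
  ultimately show ?case by blast
qed

definition Y :: "nat \<Rightarrow> 'l" where "Y r = (\<Prod>w\<in>words r. T (w @ [1]))"

lemma one_letter: "1 \<in> {1..d}" using d1 by simp

lemma snoc_lists: "w \<in> words r \<Longrightarrow> i \<in> {1..d} \<Longrightarrow> w @ [i] \<in> lists {1..d}" by (auto simp: words_def)

lemma Y_M: "Y r \<in> M"
  unfolding Y_def by (rule M_prod) (rule T_M[OF snoc_lists[OF _ one_letter]])

lemma Y_ne_0: "Y r \<noteq> 0"
  unfolding Y_def using T_ne_0[OF snoc_lists[OF _ one_letter]] finite_words by (simp add: prod_zero_iff)

text \<open>Each factor has \<open>d\<close>-th power (\<open>T w\<close> - b) / a, and
  \<open>prod_T\<close> at x = b evaluates the product. As b is already the first post-critical
  point, \<open>Y r\<close> belongs to the point with index r + 1.\<close>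

lemma Y_power: "\<exists>c\<in>K. c \<noteq> 0 \<and> Y r ^ d = c * (t - post (Suc r))"
proof -
  obtain c where c: "c \<in> K" "c \<noteq> 0" "\<And>x. (\<Prod>w\<in>words r. x - T w) = c * ((poly f ^^ r) x - t)" using prod_T by blast
  have "Y r ^ d = (\<Prod>w\<in>words r. T (w @ [1]) ^ d)" by (simp add: Y_def prod_power_distrib)
  also have "\<dots> = (\<Prod>w\<in>words r. (b - T w) * (- 1 / a))"
  proof (rule prod.cong[OF refl])
    fix w assume "w \<in> words r"
    then have "a * T (w @ [1]) ^ d + b = T w" using T_snoc[OF _ one_letter, of w] by (simp add: words_def poly_f)
    then show "T (w @ [1]) ^ d = (b - T w) * (- 1 / a)" using f(3) by (simp add: field_simps)
  qed
  also have "\<dots> = c * ((poly f ^^ r) b - t) * (- 1 / a) ^ card (words r)" by (simp only: prod.distrib c(3) prod_constant)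
  also have "(poly f ^^ r) b = post (Suc r)"
  proof -
    have "poly f 0 = b" using d1 by (simp add: poly_f power_0_left)
    then show ?thesis by (simp add: post_def funpow_swap1)
  qed
  finally have "Y r ^ d = (- c * (- 1 / a) ^ card (words r)) * (t - post (Suc r))" by (simp add: algebra_simps)
  moreover have "- c * (- 1 / a) ^ card (words r) \<in> K"
    by (intro is_subfield_mult[OF K] is_subfield_minus[OF K] is_subfield_power[OF K] is_subfield_divide[OF K] is_subfield_1[OF K] c(1) f(1))
  moreover have "- c * (- 1 / a) ^ card (words r) \<noteq> 0" using c(2) f(3) by simp
  ultimately show ?thesis by blast
qed

lemma \<Gamma>_Y: assumes \<delta>: "\<delta> \<in> \<Gamma>" shows "\<exists>\<zeta>. \<zeta> ^ d = 1 \<and> \<delta> (Y r) = \<zeta> * Y r"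
proof -
  interpret h: subfield_hom M \<delta> by (rule \<Gamma>_hom[OF \<delta>])
  obtain c where c: "c \<in> K" "Y r ^ d = c * (t - post (Suc r))" using Y_power by blast
  have ck: "c \<in> M" "post (Suc r) \<in> M" using k_M K_k c post_K by auto
  have "\<delta> (Y r) ^ d = \<delta> (c * (t - post (Suc r)))" using h.hom_power[OF Y_M, of r d] by (simp add: c(2))
  also have "\<dots> = Y r ^ d"
    using ck t_M \<Gamma>_k[OF \<delta> K_k] c post_K \<Gamma>_t[OF \<delta>] by (simp add: h.hom_mult h.hom_diff is_subfield_diff[OF M])
  finally have "(\<delta> (Y r) / Y r) ^ d = 1" using Y_ne_0 by (simp add: power_divide)
  then show ?thesis using Y_ne_0 by (intro exI[of _ "\<delta> (Y r) / Y r"]) simp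
qed

lemma root_of_unity_\<Gamma>: "\<delta> \<in> \<Gamma> \<Longrightarrow> \<zeta> ^ d = 1 \<Longrightarrow> x \<in> M \<Longrightarrow> \<delta> (\<zeta> * x) = \<zeta> * \<delta> x"
  using subfield_hom.hom_mult[OF \<Gamma>_hom, of \<delta> \<zeta> x] k_M[OF root_of_unity_k] \<Gamma>_k[OF _ root_of_unity_k] by simp

lemma T_std_cycle: "w \<in> lists {1..d} \<Longrightarrow> i \<in> {1..d} \<Longrightarrow> T (w @ [std_cycle d i]) = \<xi> * T (w @ [i])"
proof (induction w)
  case Nil
  have "std_cycle d i \<in> {1..d}" unfolding std_cycle_rotl by (rule rotl_range[OF Nil(2)])
  then show ?case using Nil tt_rotl_1[of i] by (simp add: path_t std_cycle_rotl)
next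
  case (Cons j w)
  then have j: "j \<in> {1..d}" by auto
  then show ?case using Cons path_mult[OF j] path_k[OF j \<xi>_k] by simp
qed

lemma odometer_snoc:
  "w \<in> lists {1..d} \<Longrightarrow> i \<in> {1..d} \<Longrightarrow>
   odometer d (w @ [i]) = odometer d w @ [if w = replicate (length w) d then std_cycle d i else i]"
  by (induction w) auto

text \<open>Appending a letter to a word of length r, the odometer changes this letter only below
  the word that consists of \<open>d\<close> alone. So exactly one factor \<xi> appears, while the
  other effect is a permutation of the words.\<close>

lemma \<gamma>_inf_Y: "\<gamma>_inf (Y r) = \<xi> * Y r"
proof -
  interpret h: subfield_hom M \<gamma>_inf by (rule \<Gamma>_hom[OF gamma_inf])
  let ?e = "\<lambda>w. if w = replicate r d then \<xi> else 1"
  let ?o = "odometer d"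
  have o: "\<rho> \<gamma>_inf = ?o" by (rule rho_inf)
  have "\<gamma>_inf (Y r) = (\<Prod>w\<in>words r. \<gamma>_inf (T (w @ [1])))"
    unfolding Y_def using h.hom_prod[of "words r" "\<lambda>w. T (w @ [1])"] T_M[OF snoc_lists[OF _ one_letter]] by blast
  also have "\<dots> = (\<Prod>w\<in>words r. ?e w * T (?o w @ [1]))"
  proof (rule prod.cong[OF refl])
    fix w assume w: "w \<in> words r"
    then have wl: "w \<in> lists {1..d}" and len: "length w = r" by (auto simp: words_def)
    have ol: "?o w \<in> lists {1..d}" using \<rho>_lists[OF gamma_inf wl] by (simp add: o)
    have "\<gamma>_inf (T (w @ [1])) = T (?o (w @ [1]))" using \<rho>_lists[OF gamma_inf snoc_lists[OF w one_letter]] by (simp add: o)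
    then show "\<gamma>_inf (T (w @ [1])) = ?e w * T (?o w @ [1])"
      unfolding odometer_snoc[OF wl one_letter] len using T_std_cycle[OF ol one_letter] by (cases "w = replicate r d") simp_all
  qed
  also have "\<dots> = (\<Prod>w\<in>words r. ?e w) * (\<Prod>w\<in>words r. T (?o w @ [1]))" by (rule prod.distrib)
  also have "(\<Prod>w\<in>words r. ?e w) = \<xi>"
  proof -
    have "replicate r d \<in> words r" using d1 by (auto simp: words_def)
    then show ?thesis using finite_words by (simp add: prod.delta')
  qed
  also have "(\<Prod>w\<in>words r. T (?o w @ [1])) = Y r"
  proof -
    have W: "?o \<in> wreath_perms d" using \<rho>_wreath_perms[OF gamma_inf] by (simp add: o)
    have inj: "inj_on ?o (words r)" using wreath_perms_inj[OF d1 W] by (auto simp: inj_on_def)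
    have "?o ` words r \<subseteq> words r" using wreath_perms_lists[OF d1 W] by (auto simp: words_def)
    then have "?o ` words r = words r" using inj finite_words by (metis endo_inj_surj)
    then show ?thesis unfolding Y_def using prod.reindex[OF inj, of "\<lambda>w. T (w @ [1])"] by simp
  qed
  finally show ?thesis .
qed

section \<open>The given inertia generators\<close>

lemma fixed_no_root: assumes "poly_over k p" "p \<noteq> 0" shows "poly p t \<noteq> 0"
  by (rule no_root_t) (use assms path_k in \<open>auto simp: poly_over_def\<close>)

lemma k_0: "0 \<in> k" and k_1: "1 \<in> k" using K_k is_subfield_0[OF K] is_subfield_1[OF K] by auto

lemma gamma_inert:
  assumes s: "s \<in> {1..n}"
  shows "\<exists>V. inert V (\<gamma> s) \<and> t - post s \<in> valuation_ideal V"
proof -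
  let ?P = "post s"
  have \<gamma>: "\<gamma> s \<in> \<Gamma>" by (rule \<gamma>_\<Gamma>[OF s])
  obtain V where Vr: "valuation_ring_of M V" "V \<inter> F = local_ring_at k t ?P"
    and I: "top_generate (geom_group K f t) {\<gamma> s} = inertia_group M F V"
    using gamma s unfolding is_inertia_over_point_def is_inertia_group_over_def post_def by metis
  have "\<gamma> s \<in> generate (geom_group K f t) {\<gamma> s}" by (rule generate.incl) simp
  then have "\<gamma> s \<in> top_generate (geom_group K f t) {\<gamma> s}"
    using \<gamma> \<Gamma>_generate[of "{\<gamma> s}"] unfolding top_generate_def by (subst pointwise_closure_iff) auto
  then have \<gamma>V: "\<gamma> s ` V = V" "\<forall>x\<in>V. \<gamma> s x - x \<in> valuation_ideal V" unfolding I inertia_group_def by auto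
  interpret valuation M V using M Vr(1) by unfold_locales
  have F: "is_subfield F" by (rule is_subfield_adjoin)
  have loc: "poly p t / poly q t \<in> V" if "poly_over k p" "poly_over k q" "poly q ?P \<noteq> 0" for p q
    using that Vr(2) unfolding local_ring_at_def by blast
  have const: "poly_over k [:c:]" if "c \<in> k" for c using that k_0 by (auto simp: poly_over_def coeff_pCons split: nat.split)
  have one: "poly_over k 1" using const[OF k_1] by (simp add: one_pCons)
  have kV: "c \<in> V \<and> inverse c \<in> V" if c: "c \<in> k" for c
  proof
    show "c \<in> V" using loc[OF const[OF c] one] by simp
    show "inverse c \<in> V"
    proof (cases "c = 0")
      case False
      then show ?thesis using loc[OF one const[OF c]] by (simp add: divide_inverse)
    qed (simp add: V_0)
  qed
  have tV: "t \<in> V"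
  proof -
    have "poly_over k [:0, 1:]" using k_0 k_1 by (auto simp: poly_over_def coeff_pCons split: nat.split)
    then show ?thesis using loc[OF _ one, of "[:0, 1:]"] by simp
  qed
  have Pk: "?P \<in> k" by (rule K_k[OF post_K])
  \<comment> \<open>Otherwise 1 / (t - P) lies in the local ring. Clearing denominators gives a
    polynomial that vanishes at t although its value at P is that of the denominator, which is not
    0.\<close>
  have "t - ?P \<in> \<mm>"
  proof (rule ccontr)
    assume "t - ?P \<notin> \<mm>"
    then have u: "inverse (t - ?P) \<in> V" "t - ?P \<noteq> 0" 
      using unitD[OF V_diff[OF tV conjunct1[OF kV[OF Pk]]]] by auto
    have "inverse (t - ?P) \<in> F"
      by (intro is_subfield_inverse[OF F] is_subfield_diff[OF F] adjoin_gen adjoin_base Pk) simp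
    then obtain p q where pq: "poly_over k p" "poly_over k q" "poly q ?P \<noteq> 0" "inverse (t - ?P) = poly p t / poly q t"
      using u(1) Vr(2) unfolding local_ring_at_def by blast
    have "q \<noteq> 0" using pq(3) by auto
    then have "poly q t \<noteq> 0" by (rule fixed_no_root[OF pq(2)])
    then have "poly q t = poly p t * (t - ?P)" using pq(4) u(2) by (simp add: field_simps)
    then have "poly (q - p * [:- ?P, 1:]) t = 0" by (simp add: algebra_simps)
    moreover have "q - p * [:- ?P, 1:] \<noteq> 0"
    proof
      assume "q - p * [:- ?P, 1:] = 0"
      then have "poly (q - p * [:- ?P, 1:]) ?P = 0" by simp
      then show False using pq(3) by simp
    qed
    \<comment> \<open>The coefficients are combinations of constants, and the paths fix them because
      they are ring homomorphisms fixing the constants.\<close>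
    moreover have "\<Lambda> i (coeff (q - p * [:- ?P, 1:]) j) = coeff (q - p * [:- ?P, 1:]) j" if i: "i \<in> {1..d}" for i j
    proof -
      interpret h: subfield_hom UNIV "\<Lambda> i" by (rule path_hom[OF i])
      have "\<Lambda> i (coeff p j) = coeff p j" "\<Lambda> i (coeff q j) = coeff q j" "\<Lambda> i ?P = ?P" for j
        using pq path_k[OF i] Pk by (auto simp: poly_over_def)
      then show ?thesis by (simp add: h.hom_diff h.hom_mult h.hom_add h.hom_0 h.hom_minus coeff_pCons split: nat.split)
    qed
    ultimately show False using no_root_t by blast
  qed
  then show ?thesis using Vr(1) \<gamma>V kV tV \<gamma> unfolding inert_def by blast
qed

lemma post_set: "{(poly f ^^ i) 0 | i. i \<ge> 1} = {post i | i. i \<ge> 1}" by (simp add: post_def)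

lemma post_cycle: assumes "1 \<le> i" "i < j" "post i = post j" "q \<ge> 1" shows "\<exists>l\<in>{1..<j}. post q = post l"
  using assms(4)
proof (induction q rule: dec_induct)
  case base
  then show ?case using assms by (intro bexI[of _ 1]) auto
next
  case (step q)
  then obtain l where l: "l \<in> {1..<j}" "post q = post l" by blast
  then have "post (Suc q) = post (Suc l)" by (simp add: post_Suc)
  show ?case
  proof (cases "Suc l = j")
    case True
    then show ?thesis using \<open>post (Suc q) = post (Suc l)\<close> assms(1-3) by (intro bexI[of _ i]) auto
  next
    case False
    then show ?thesis using \<open>post (Suc q) = post (Suc l)\<close> l by (intro bexI[of _ "Suc l"]) auto
  qed
qed

text \<open>A repetition before index n would confine the orbit to fewer than n points.\<close>

lemma post_inj: assumes "i \<in> {1..n}" "j \<in> {1..n}" "post i = post j" shows "i = j"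
proof -
  have *: False if ij: "1 \<le> i" "i < j" "j \<le> n" "post i = post j" for i j
  proof -
    have "{post i | i. i \<ge> 1} \<subseteq> post ` {1..<j}"
    proof
      fix z assume "z \<in> {post i | i. i \<ge> 1}"
      then obtain q where q: "q \<ge> 1" "z = post q" by blast
      obtain l where "l \<in> {1..<j}" "post q = post l" using post_cycle[OF ij(1,2,4) q(1)] ..
      then show "z \<in> post ` {1..<j}" unfolding q(2) by (metis imageI)
    qed
    then have "n \<le> card (post ` {1..<j})" 
      using card_mono[of "post ` {1..<j}" "{post i | i. i \<ge> 1}"] pcf(2)[unfolded post_set] by simp
    also have "\<dots> \<le> card {1..<j}" by (rule card_image_le) simp
    finally show False using ij by simp
  qed
  show ?thesis using *[of i j] *[of j i] assms by (cases i j rule: linorder_cases) auto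
qed

lemma post_cover: assumes "q \<ge> 1" shows "\<exists>l\<in>{1..n}. post q = post l"
proof -
  have "inj_on post {1..n}" using post_inj by (auto simp: inj_on_def)
  then have "card (post ` {1..n}) = n" by (simp add: card_image)
  moreover have "post ` {1..n} \<subseteq> {post i | i. i \<ge> 1}" by auto
  ultimately have "post ` {1..n} = {post i | i. i \<ge> 1}"
    using card_subset_eq[OF pcf(1)[unfolded post_set]] pcf(2)[unfolded post_set] by simp
  moreover have "post q \<in> {post i | i. i \<ge> 1}" using assms by blast
  ultimately have "post q \<in> post ` {1..n}" by (simp only:)
  then show ?thesis by (simp only: image_iff)
qed

lemma n_pos: "n \<ge> 1" using post_cover[of 1] by auto

lemma post_mm: assumes "inert V \<delta>" "t - post i \<in> valuation_ideal V" "t - post j \<in> valuation_ideal V" shows "post i = post j"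
proof -
  interpret valuation M V by (rule inert_val[OF assms(1)])
  have "(t - post i) - (t - post j) \<in> \<mm>" by (intro mm_diff assms)
  then have e: "post j - post i \<in> \<mm>" by simp
  have "post j - post i \<in> k" by (intro K_k is_subfield_diff[OF K] post_K)
  then show ?thesis using const_mm[OF assms(1) _ e] by simp
qed

text \<open>At a place over a different post-critical point, t - f^(r+1)(0) is a unit, hence so is
  \<open>Y r\<close>, and inertia can multiply it only by 1.\<close>

lemma gamma_Y_other:
  assumes i: "i \<in> {1..n}" and s: "Suc r \<in> {1..n}" "i \<noteq> Suc r"
  shows "\<gamma> i (Y r) = Y r"
proof -
  obtain V where W: "inert V (\<gamma> i)" "t - post i \<in> valuation_ideal V" using gamma_inert[OF i] by blast
  interpret valuation M V by (rule inert_val[OF W(1)])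
  obtain \<zeta> where \<zeta>: "\<zeta> ^ d = 1" "\<gamma> i (Y r) = \<zeta> * Y r" using \<Gamma>_Y[OF \<gamma>_\<Gamma>[OF i]] by blast
  obtain c where c: "c \<in> K" "c \<noteq> 0" "Y r ^ d = c * (t - post (Suc r))" using Y_power by blast
  have cV: "c \<in> V" "inverse c \<in> V" using inert_k[OF W(1)] K_k c by auto
  have tp: "t - post (Suc r) \<in> V" by (intro V_diff inert_t[OF W(1)] inert_k(1)[OF W(1)] K_k post_K)
  have "t - post (Suc r) \<notin> \<mm>" using post_mm[OF W, of "Suc r"] post_inj[OF i s(1)] s(2) by blast
  moreover have "Y r \<in> V" using V_root[OF Y_M d1, of r] V_mult[OF cV(1) tp] c(3) by simp
  moreover have "Y r \<in> \<mm> \<Longrightarrow> t - post (Suc r) \<in> \<mm>"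
  proof -
    assume Y: "Y r \<in> \<mm>"
    have "Y r * (Y r ^ (d - 1) * inverse c) \<in> \<mm>" by (intro mm_mult Y V_mult V_power mm_V[OF Y] cV)
    also have "Y r * (Y r ^ (d - 1) * inverse c) = Y r ^ d * inverse c" using d1 by (cases d) auto
    also have "\<dots> = t - post (Suc r)" using c(2) by (simp add: c(3))
    finally show ?thesis .
  qed
  ultimately have "\<zeta> = 1" using inert_root_of_unity[OF W(1) _ _ \<zeta>(2,1)] by blast
  then show ?thesis using \<zeta>(2) by simp
qed

lemma gamma_Y_same:
  assumes s: "Suc r \<in> {1..n}" shows "\<gamma> (Suc r) (Y r) = \<xi> * Y r"
proof -
  obtain \<zeta> where \<zeta>: "\<zeta> ^ d = 1" "\<gamma> (Suc r) (Y r) = \<zeta> * Y r" using \<Gamma>_Y[OF \<gamma>_\<Gamma>[OF s]] by blast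
  let ?e = "\<lambda>i. if i = Suc r then \<zeta> else 1"
  have e1: "?e i ^ d = 1" for i using \<zeta>(1) by simp
  \<comment> \<open>The induction also records that the accumulated factor is a \<open>d\<close>-th
    root of unity, since then the next automorphism fixes it.\<close>
  have step: "foldr (\<otimes>\<^bsub>geom_group K f t\<^esub>) (map \<gamma> is) \<one>\<^bsub>geom_group K f t\<^esub> (Y r) = prod_list (map ?e is) * Y r \<and>
      prod_list (map ?e is) ^ d = 1" if "set is \<subseteq> {1..n}" for "is"
    using that
  proof (induction "is")
    case (Cons i "is")
    have "i \<in> {1..n} \<and> set is \<subseteq> {1..n}" using Cons.prems by (simp only: list.set insert_subset)
    then have i: "i \<in> {1..n}" and IH: "foldr (\<otimes>\<^bsub>geom_group K f t\<^esub>) (map \<gamma> is) \<one>\<^bsub>geom_group K f t\<^esub> (Y r) = prod_list (map ?e is) * Y r"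
        "prod_list (map ?e is) ^ d = 1"
      using Cons.IH by (simp_all only: list.set insert_subset)
    have "\<gamma> i (Y r) = ?e i * Y r" using \<zeta>(2) gamma_Y_other[OF i s] by simp
    then have "\<gamma> i (prod_list (map ?e is) * Y r) = prod_list (map ?e is) * (?e i * Y r)"
      using root_of_unity_\<Gamma>[OF \<gamma>_\<Gamma>[OF i] IH(2) Y_M] by simp
    moreover have "(?e i * prod_list (map ?e is)) ^ d = 1" unfolding power_mult_distrib IH(2) e1 by simp
    moreover have "foldr (\<otimes>\<^bsub>geom_group K f t\<^esub>) (map \<gamma> (i # is)) \<one>\<^bsub>geom_group K f t\<^esub> (Y r)
        = \<gamma> i (foldr (\<otimes>\<^bsub>geom_group K f t\<^esub>) (map \<gamma> is) \<one>\<^bsub>geom_group K f t\<^esub> (Y r))"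
      by (simp only: list.map foldr.simps(2) comp_apply[of "(\<otimes>\<^bsub>geom_group K f t\<^esub>) _"]) (simp only: \<Gamma>_ops(1) comp_apply)
    ultimately show ?case unfolding IH(1) by (simp only: list.map prod_list.Cons mult_ac)
  qed simp
  have "\<gamma>_inf (Y r) = prod_list (map ?e [1..<Suc n]) * Y r"
    unfolding gamma_prod by (rule conjunct1[OF step]) auto
  also have "prod_list (map ?e [1..<Suc n]) = prod ?e {1..<Suc n}"
    using prod.distinct_set_conv_list[of "[1..<Suc n]" ?e] by (simp only: set_upt distinct_upt)
  also have "\<dots> = \<zeta>" using s by (simp add: prod.delta)
  finally have "\<zeta> * Y r = \<xi> * Y r" unfolding \<gamma>_inf_Y by (rule sym)
  then show ?thesis using \<zeta>(2) by (simp only:)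
qed

text \<open>The place is quantified inside, because the sections of an element are inertial at
  places other than its own.\<close>

definition inertia_class :: "nat \<Rightarrow> ('l \<Rightarrow> 'l) set" where
  "inertia_class s = {\<delta>. \<exists>V. inert V \<delta> \<and> t - post s \<in> valuation_ideal V \<and> tame V (post s) \<delta>}"

lemma tame_Y:
  assumes \<delta>: "inert V \<delta>" and "\<delta> (Y r) / Y r - \<xi> \<in> valuation_ideal V" shows "tame V (post (Suc r)) \<delta>"
proof -
  obtain c where c: "c \<in> K" "c \<noteq> 0" "Y r ^ d = c * (t - post (Suc r))" using Y_power by blast
  then show ?thesis unfolding tame_def using assms(2) inert_k[OF \<delta> K_k[OF c(1)]] Y_M Y_ne_0 by blast
qed

lemma gamma_class: assumes s: "s \<in> {1..n}" shows "\<gamma> s \<in> inertia_class s"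
proof -
  obtain r where r: "s = Suc r" using s by (cases s) auto
  obtain V where V: "inert V (\<gamma> s)" "t - post s \<in> valuation_ideal V" using gamma_inert[OF s] by blast
  have "\<gamma> s (Y r) / Y r - \<xi> = 0" using gamma_Y_same s Y_ne_0 r by simp
  then have "tame V (post (Suc r)) (\<gamma> s)" using valuation.mm_0[OF inert_val[OF V(1)]] by (intro tame_Y[OF V(1)]) simp
  then show ?thesis using V unfolding inertia_class_def r by blast
qed

end

section \<open>Wreath recursion of the inertia classes\<close>

context unicritical
begin

sublocale wt: wreath_tower d "tree_W d" "tree_rot d" "tree_tup d" "tree_K d"
  by (rule tree_tower[OF d(1)])

abbreviation \<beta> :: "('l \<Rightarrow> 'l) \<Rightarrow> nat list bijection" where "\<beta> \<delta> \<equiv> tree_bij d (\<rho> \<delta>)"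

abbreviation secs :: "('l \<Rightarrow> 'l) \<Rightarrow> int \<Rightarrow> nat list bijection" where "secs \<delta> j \<equiv> \<beta> (sec \<delta> (letter d j))"

lemma \<beta>_W: "\<delta> \<in> \<Gamma> \<Longrightarrow> \<beta> \<delta> \<in> tree_W d"
  unfolding tree_W_def by (intro imageI \<rho>_wreath_perms)

lemma secs_W: "\<delta> \<in> \<Gamma> \<Longrightarrow> secs \<delta> j \<in> tree_W d"
  by (intro \<beta>_W sec_\<Gamma> letter_range d1)

lemma \<beta>_decomp:
  assumes \<delta>: "\<delta> \<in> \<Gamma>" and r: "\<And>i. i \<in> {1..d} \<Longrightarrow> root \<delta> i = rotl d j i"
  shows "\<beta> \<delta> = tree_rot d j + tree_tup d (secs \<delta>)"
proof -
  have "\<rho> \<delta> = node d (rotl d j) (\<lambda>i. \<rho> (sec \<delta> i))" by (rule \<rho>_node[OF r])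
  then show ?thesis using tree_bij_node[OF d1, of "\<lambda>i. \<rho> (sec \<delta> i)" j] \<rho>_wreath_perms[OF sec_\<Gamma>[OF \<delta>]] by (simp only:)
qed

lemma sec_comp:
  assumes g: "g \<in> \<Gamma>" and h: "h \<in> \<Gamma>" and i: "i \<in> {1..d}"
  shows "root (g \<circ> h) i = root g (root h i)" "sec (g \<circ> h) i = sec g (root h i) \<circ> sec h i"
proof -
  have hi: "root h i \<in> {1..d}" "h (tt i) = tt (root h i)" using root[OF h i] by auto
  have ghi: "root g (root h i) \<in> {1..d}" "g (tt (root h i)) = tt (root g (root h i))" using root[OF g hi(1)] by auto
  show r: "root (g \<circ> h) i = root g (root h i)" by (rule root_eqI[OF i ghi(1)]) (simp add: hi ghi)
  have inj: "inj (\<Lambda> (root g (root h i)))" by (rule bij_is_inj[OF path_bij[OF ghi(1)]])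
  show "sec (g \<circ> h) i = sec g (root h i) \<circ> sec h i"
  proof
    fix x
    show "sec (g \<circ> h) i x = (sec g (root h i) \<circ> sec h i) x"
    proof (cases "x \<in> M")
      case True
      have "\<Lambda> (root g (root h i)) (sec (g \<circ> h) i x) = g (h (\<Lambda> i x))"
        using path_sec[OF comp_\<Gamma>[OF g h] i True] unfolding r by simp
      also have "\<dots> = \<Lambda> (root g (root h i)) (sec g (root h i) (sec h i x))"
        unfolding path_sec[OF g hi(1) sec_M[OF h i True]] path_sec[OF h i True] by (rule refl)
      finally show ?thesis using inj by (simp only: inj_eq comp_apply)
    next
      case False
      have "sec g' j x = x" if "g' \<in> \<Gamma>" "j \<in> {1..d}" for g' j
        by (rule permutes_not_in[OF \<Gamma>_permutes[OF sec_\<Gamma>[OF that]] False])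
      then show ?thesis using comp_\<Gamma>[OF g h] g h i hi(1) by (simp only: comp_apply)
    qed
  qed
qed

lemma funpow_\<Gamma>: "\<delta> \<in> \<Gamma> \<Longrightarrow> \<delta> ^^ j \<in> \<Gamma>"
  by (induction j) (simp_all only: funpow.simps id_\<Gamma> comp_\<Gamma>)

text \<open>After j steps the letter 1 has moved to the residue j + 1, where the next factor of
  \<open>partial_product\<close> is taken. So the partial product is the section at 1 of a
  power.\<close>

lemma partial_product_sec:
  assumes \<delta>: "\<delta> \<in> \<Gamma>" and r: "\<And>i. i \<in> {1..d} \<Longrightarrow> root \<delta> i = rotl d 1 i"
  shows "root (\<delta> ^^ j) 1 = rotl d (int j) 1 \<and> wt.partial_product (secs \<delta>) j = \<beta> (sec (\<delta> ^^ j) 1)"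
proof (induction j)
  case 0
  have "sec id 1 = id"
  proof
    fix x
    have "root id 1 = 1" by (rule root_eqI) (use one_letter in simp_all)
    then show "sec id 1 x = id x"
      using path_sec[OF id_\<Gamma> one_letter, of x] bij_is_inj[OF path_bij[OF one_letter]]
        permutes_not_in[OF \<Gamma>_permutes[OF sec_\<Gamma>[OF id_\<Gamma> one_letter]], of x]
      by (cases "x \<in> M") (simp_all only: id_apply inj_eq not_False_eq_True True_implies_equals)
  qed
  moreover have "root id 1 = 1" by (rule root_eqI) (use one_letter in simp_all)
  ultimately show ?case using \<rho>_id tree_bij_id[OF d1] rotl_0[of d]
    unfolding funpow.simps wt.partial_product.simps of_nat_0 using id_apply[of "1 :: nat"] by (simp only: simp_thms)
next
  case (Suc j)
  have dj: "\<delta> ^^ j \<in> \<Gamma>" by (rule funpow_\<Gamma>[OF \<delta>])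
  have rj: "root (\<delta> ^^ j) 1 \<in> {1..d}" "root (\<delta> ^^ j) 1 = rotl d (int j) 1" using root[OF dj one_letter] Suc by auto
  have "rotl d (int (Suc j)) 1 = rotl d 1 (rotl d (int j) 1)" using rotl_add[of d 1 "int j" 1] by simp
  then have rS: "root (\<delta> ^^ Suc j) 1 = rotl d (int (Suc j)) 1"
    using sec_comp(1)[OF \<delta> dj one_letter] r[OF rj(1)] rj(2) by (simp only: funpow.simps)
  have "letter d (int (Suc j) mod int d) = root (\<delta> ^^ j) 1"
  proof -
    have "int (root (\<delta> ^^ j) 1) mod int d = int (Suc j) mod int d"
      using residue_rotl[OF one_letter, of "int j"] unfolding rj(2) by simp
    then show ?thesis using letter_residue[OF rj(1)] by (simp only:)
  qed
  then have "wt.partial_product (secs \<delta>) (Suc j) = \<beta> (sec \<delta> (root (\<delta> ^^ j) 1)) + \<beta> (sec (\<delta> ^^ j) 1)"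
    unfolding wt.partial_product.simps conjunct2[OF Suc] by (simp only:)
  also have "\<dots> = \<beta> (sec (\<delta> ^^ Suc j) 1)"
    unfolding funpow.simps sec_comp(2)[OF \<delta> dj one_letter] \<rho>_comp[OF sec_\<Gamma>[OF \<delta> rj(1)] sec_\<Gamma>[OF dj one_letter]]
    by (rule tree_bij_comp[OF d1 \<rho>_wreath_perms[OF sec_\<Gamma>[OF \<delta> rj(1)]] \<rho>_wreath_perms[OF sec_\<Gamma>[OF dj one_letter]], symmetric])
  finally have pp: "wt.partial_product (secs \<delta>) (Suc j) = \<beta> (sec (\<delta> ^^ Suc j) 1)" .
  show ?case by (rule conjI[OF rS pp])
qed

lemma inertia_class_\<Gamma>: "\<delta> \<in> inertia_class s \<Longrightarrow> \<delta> \<in> \<Gamma>"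
  unfolding inertia_class_def using inert_\<Gamma> by blast

lemma pull_diff:
  assumes "inert V \<delta>" "i \<in> {1..d}" shows "t - post j \<in> valuation_ideal (pull i V) \<longleftrightarrow> tt i - post j \<in> valuation_ideal V"
proof -
  interpret h: subfield_hom UNIV "\<Lambda> i" by (rule path_hom[OF assms(2)])
  have "t - post j \<in> M" by (intro is_subfield_diff[OF M] t_M k_M K_k post_K)
  moreover have "\<Lambda> i (t - post j) = tt i - post j"
    using path_t[OF assms(2)] path_k[OF assms(2) K_k[OF post_K]] by (simp add: h.hom_diff)
  ultimately show ?thesis unfolding pull_mm[OF assms] by simp
qed

text \<open>The roots \<open>tt i\<close> are themselves \<open>d\<close>-th roots of a unit
  multiple of t - b, so tameness gives a factor congruent to \<xi>; being a root of unity, it equals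
  \<xi>.\<close>

lemma class_1_root:
  assumes \<delta>: "inert V \<delta>" "tame V (post 1) \<delta>" and i: "i \<in> {1..d}"
  shows "\<delta> (tt i) = \<xi> * tt i" "root \<delta> i = rotl d 1 i"
proof -
  interpret valuation M V by (rule inert_val[OF \<delta>(1)])
  have "\<delta> (tt i) / tt i - \<xi> \<in> \<mm>"
  proof (rule tame_all[OF \<delta> tt_M[OF i] tt_ne_0[OF i]])
    show "inverse a \<in> V" "inverse (inverse a) \<in> V" using inert_k[OF \<delta>(1) ab_k(1)] by simp_all
    show "inverse a \<noteq> 0" using f(3) by simp
    show "tt i ^ d = inverse a * (t - post 1)" unfolding tt_power[OF i] post_1 by (simp add: field_simps)
  qed
  moreover obtain j where j: "\<delta> (tt i) = \<xi> ^ j * tt i" using root_rotl[OF inert_\<Gamma>[OF \<delta>(1)]] i by blast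
  moreover have "\<delta> (tt i) / tt i = \<xi> ^ j" using j tt_ne_0[OF i] by simp
  ultimately have m: "\<xi> ^ j - \<xi> \<in> \<mm>" by (simp only:)
  have "(\<xi> ^ j - \<xi>) * inverse \<xi> \<in> \<mm>" by (intro mm_mult m inert_k(2)[OF \<delta>(1) \<xi>_k])
  then have "\<xi> ^ j / \<xi> - 1 \<in> \<mm>" using \<xi>_ne_0 by (simp add: field_simps)
  moreover have "(\<xi> ^ j / \<xi>) ^ d = 1"
    unfolding power_divide power_mult[symmetric] mult.commute[of j d] unfolding power_mult \<xi>_power by simp
  ultimately have "\<xi> ^ j / \<xi> = 1" using root_of_unity_mm[OF \<delta>(1)] by (simp only:)
  then have "\<xi> ^ j = \<xi>" using \<xi>_ne_0 by simp
  then show e: "\<delta> (tt i) = \<xi> * tt i" using j by simp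
  show "root \<delta> i = rotl d 1 i" by (rule root_eqI[OF i rotl_range[OF i]]) (simp add: e tt_rotl_1[OF i])
qed

lemma tt_class_1: assumes "inert V \<delta>" "t - post 1 \<in> valuation_ideal V" "i \<in> {1..d}" shows "tt i \<in> valuation_ideal V"
proof -
  interpret valuation M V by (rule inert_val[OF assms(1)])
  have "(t - post 1) * inverse a \<in> \<mm>" by (intro mm_mult assms(2) inert_k(2)[OF assms(1)] ab_k)
  then have "tt i ^ d \<in> \<mm>" unfolding tt_power[OF assms(3)] post_1 by (simp add: divide_inverse)
  then show ?thesis by (rule mm_power[OF tt_V[OF assms(1,3)]])
qed

text \<open>Transporting \<open>Y r\<close> along the path gives y with y^d a constant times
  \<open>tt 1\<close>. For \<eta> = \<delta>(y) / y this yields \<eta>^d = \<xi>, and \<delta>^d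
  multiplies y by the product of \<open>d\<close> images of \<eta>, all congruent to \<eta>. So the
  factor is again congruent to \<xi>.\<close>

lemma class_1_periodic:
  assumes W: "inert V \<delta>" "t - post 1 \<in> valuation_ideal V" "tame V (post 1) \<delta>" and n0: "post n = 0"
  shows "sec (\<delta> ^^ d) 1 \<in> inertia_class n"
proof -
  interpret valuation M V by (rule inert_val[OF W(1)])
  interpret h: subfield_hom M \<delta> by (rule \<Gamma>_hom[OF inert_\<Gamma>[OF W(1)]])
  interpret p: subfield_hom UNIV "\<Lambda> 1" by (rule path_hom[OF one_letter])
  have dj: "inert V (\<delta> ^^ j)" for j by (rule inert_funpow[OF W(1)])
  have r1: "root (\<delta> ^^ d) 1 = 1"
    using partial_product_sec[OF inert_\<Gamma>[OF W(1)] class_1_root(2)[OF W(1,3)], of d] rotl_d[of d] by (simp only: id_apply)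
  have s: "inert (pull 1 V) (sec (\<delta> ^^ d) 1)" by (rule inert_sec[OF dj one_letter r1 tt_V[OF W(1) one_letter]])
  have t1: "t - post n \<in> valuation_ideal (pull 1 V)"
    using pull_diff[OF W(1) one_letter, of n] tt_class_1[OF W(1,2) one_letter] by (simp only: n0 diff_zero)
  obtain r where r: "n = Suc r" using n_pos by (cases n) auto
  obtain c where c: "c \<in> K" "c \<noteq> 0" "Y r ^ d = c * (t - post (Suc r))" using Y_power by blast
  define y where "y = \<Lambda> 1 (Y r)"
  have ck: "c \<in> k" by (rule K_k[OF c(1)])
  have y: "y \<in> M" "y \<noteq> 0" using path_M[OF one_letter Y_M] Y_ne_0 by (simp_all add: y_def p.hom_eq_0 del: One_nat_def)
  have yd: "y ^ d = c * tt 1"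
    using path_t[OF one_letter] path_k[OF one_letter ck] n0
    by (simp add: y_def p.hom_mult c(3) r del: One_nat_def flip: p.hom_power)
  define \<eta> where "\<eta> = \<delta> y / y"
  have \<eta>M: "\<eta> \<in> M" using y h.E unfolding \<eta>_def by (intro is_subfield_divide[OF M] hom_M[OF h.subfield_hom_axioms] \<Gamma>_k \<Gamma>_t inert_\<Gamma>[OF W(1)])
  have "\<delta> y ^ d = \<delta> (c * tt 1)" using y by (simp add: yd flip: h.hom_power)
  also have "\<dots> = c * (\<xi> * tt 1)"
    using class_1_root(1)[OF W(1,3) one_letter] \<Gamma>_k[OF inert_\<Gamma>[OF W(1)] ck] k_M[OF ck] tt_M[OF one_letter] by (simp add: h.hom_mult)
  finally have "\<delta> y ^ d = c * (\<xi> * tt 1)" .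
  then have \<eta>d: "\<eta> ^ d = \<xi>" using tt_ne_0[OF one_letter] c(2) by (simp add: \<eta>_def power_divide yd)
  have \<eta>V: "\<eta> \<in> V" by (rule V_root[OF \<eta>M d1]) (simp add: \<eta>d inert_k(1)[OF W(1) \<xi>_k])
  have tel: "(\<delta> ^^ j) y = (\<Prod>i<j. (\<delta> ^^ i) \<eta>) * y" for j
  proof (induction j)
    case (Suc j)
    interpret hj: subfield_hom M "\<delta> ^^ j" by (rule \<Gamma>_hom[OF inert_\<Gamma>[OF dj]])
    have "(\<delta> ^^ Suc j) y = (\<delta> ^^ j) (\<eta> * y)" using y by (simp add: funpow_swap1 \<eta>_def)
    then show ?case using hj.hom_mult[OF \<eta>M y(1)] Suc by (simp add: mult_ac)
  qed simp
  have "(\<Prod>i<d. (\<delta> ^^ i) \<eta>) - \<eta> ^ d \<in> \<mm>"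
    using power_cong[OF \<eta>V, of d "\<lambda>i. (\<delta> ^^ i) \<eta>"] inert_V[OF dj \<eta>V] inert_mm[OF dj \<eta>V] by blast
  then have fin: "(\<delta> ^^ d) y / y - \<xi> \<in> \<mm>" using y by (simp add: tel \<eta>d)
  have "sec (\<delta> ^^ d) 1 (Y r) / Y r - \<xi> \<in> valuation_ideal (pull 1 V)"
    unfolding pull_mm[OF W(1) one_letter]
  proof
    show "sec (\<delta> ^^ d) 1 (Y r) / Y r - \<xi> \<in> M"
      by (intro is_subfield_diff[OF M] is_subfield_divide[OF M] sec_M[OF inert_\<Gamma>[OF dj] one_letter] Y_M k_M[OF \<xi>_k])
    have "\<Lambda> 1 (sec (\<delta> ^^ d) 1 (Y r)) = (\<delta> ^^ d) y" 
      using path_sec[OF inert_\<Gamma>[OF dj[of d]] one_letter Y_M, of r] unfolding r1 y_def .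
    then show "\<Lambda> 1 (sec (\<delta> ^^ d) 1 (Y r) / Y r - \<xi>) \<in> \<mm>"
      using fin path_k[OF one_letter \<xi>_k] by (simp add: p.hom_diff p.hom_divide y_def del: One_nat_def)
  qed
  from tame_Y[OF s this] show ?thesis using s t1 r unfolding inertia_class_def by blast
qed

lemma sec_trivial:
  assumes \<delta>: "inert V \<delta>" and i: "i \<in> {1..d}" "root \<delta> i = i" and no: "\<And>j. tt i - post (Suc j) \<notin> valuation_ideal V"
  shows "\<beta> (sec \<delta> i) = 0"
proof -
  have s: "inert (pull i V) (sec \<delta> i)" by (rule inert_sec[OF \<delta> i tt_V[OF \<delta> i(1)]])
  have "\<rho> (sec \<delta> i) = id" by (rule unramified[OF s]) (use no in \<open>simp only: pull_diff[OF \<delta> i(1)] not_False_eq_True\<close>)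
  then show ?thesis by (simp only: tree_bij_id[OF d1])
qed

lemma class_1_preperiodic:
  assumes W: "inert V \<delta>" "t - post 1 \<in> valuation_ideal V" "tame V (post 1) \<delta>" and no: "\<And>j. post (Suc j) \<noteq> 0"
  shows "\<beta> (sec (\<delta> ^^ d) 1) = 0"
proof (rule sec_trivial[OF inert_funpow[OF W(1)] one_letter])
  interpret valuation M V by (rule inert_val[OF W(1)])
  show "root (\<delta> ^^ d) 1 = 1"
    using partial_product_sec[OF inert_\<Gamma>[OF W(1)] class_1_root(2)[OF W(1,3)], of d] rotl_d[of d] by (simp only: id_apply)
  fix j
  show "tt 1 - post (Suc j) \<notin> \<mm>"
  proof
    assume "tt 1 - post (Suc j) \<in> \<mm>"
    then have "tt 1 - (tt 1 - post (Suc j)) \<in> \<mm>" by (rule mm_diff[OF tt_class_1[OF W(1,2) one_letter]])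
    then show False using const_mm[OF W(1) K_k[OF post_K], of "Suc j"] no[of j] by simp
  qed
qed

text \<open>If two roots are congruent, then (\<zeta> - 1) times a root lies in the maximal ideal
  for some \<zeta> \<noteq> 1; so the root itself does, and its residue would be 0.\<close>

lemma tt_mm_unique:
  assumes \<delta>: "inert V \<delta>" and i: "i \<in> {1..d}" "i' \<in> {1..d}" "i \<noteq> i'" and nz: "post j \<noteq> 0"
    and m: "tt i - post j \<in> valuation_ideal V" shows "tt i' - post j \<notin> valuation_ideal V"
proof
  interpret valuation M V by (rule inert_val[OF \<delta>])
  assume m': "tt i' - post j \<in> \<mm>"
  define \<zeta> where "\<zeta> = tt i' / tt i"
  have \<zeta>: "\<zeta> - 1 \<in> k" unfolding \<zeta>_def by (rule root_of_unity_minus_1_k[OF tt_ratio[OF i(2,1)]])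
  have tV: "tt i \<in> V" by (rule tt_V[OF \<delta> i(1)])
  have "(tt i' - post j) - (tt i - post j) \<in> \<mm>" by (rule mm_diff[OF m' m])
  also have "(tt i' - post j) - (tt i - post j) = (\<zeta> - 1) * tt i" using tt_ne_0[OF i(1)] by (simp add: \<zeta>_def field_simps)
  finally have "\<zeta> - 1 \<in> \<mm> \<or> tt i \<in> \<mm>" by (rule mm_prime[OF inert_k(1)[OF \<delta> \<zeta>] tV])
  then show False
  proof
    assume "\<zeta> - 1 \<in> \<mm>"
    then have "tt i' = tt i" using const_mm[OF \<delta> \<zeta>] tt_ne_0[OF i(1)] by (simp add: \<zeta>_def)
    then show False using inj_onD[OF tt_inj] i by metis
  next
    assume "tt i \<in> \<mm>"
    then have "tt i - (tt i - post j) \<in> \<mm>" using m by (rule mm_diff)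
    then show False using const_mm[OF \<delta> K_k[OF post_K]] nz by simp
  qed
qed

text \<open>By \<open>prod_tt\<close> the product of the differences lies in the maximal ideal,
  which is prime.\<close>

lemma tt_mm_exists:
  assumes \<delta>: "inert V \<delta>" and "t - post (Suc j) \<in> valuation_ideal V" shows "\<exists>i\<in>{1..d}. tt i - post j \<in> valuation_ideal V"
proof -
  interpret valuation M V by (rule inert_val[OF \<delta>])
  have "(t - post (Suc j)) * (- inverse a) \<in> \<mm>" by (intro mm_mult assms(2) V_minus inert_k(2)[OF \<delta> ab_k(1)])
  also have "(t - post (Suc j)) * (- inverse a) = (poly f (post j) - t) / a"
    by (simp add: post_Suc poly_f divide_inverse algebra_simps)
  also have "\<dots> = (\<Prod>i\<in>{1..d}. post j - tt i)" by (rule prod_tt[symmetric])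
  finally have "\<exists>i\<in>{1..d}. post j - tt i \<in> \<mm>"
    using mm_prod[of "{1..d}" "\<lambda>i. post j - tt i"] V_diff[OF inert_k(1)[OF \<delta> K_k[OF post_K]] tt_V[OF \<delta>]] by blast
  then obtain i where i: "i \<in> {1..d}" "post j - tt i \<in> \<mm>" ..
  then show ?thesis using mm_minus[OF i(2)] by (intro bexI[of _ i]) simp_all
qed

text \<open>The other factors in \<open>prod_tt\<close> form a unit \<open>G\<close>, so t -
  f^(j+1)(0) and \<open>tt i\<close> - f^j(0) differ by a unit. A \<open>d\<close>-th root adapted
  to the section therefore serves for the element itself, and \<open>tame_all\<close> gives the
  factor \<xi>.\<close>

lemma class_sec:
  assumes W: "inert V \<delta>" "tame V (post (Suc j)) \<delta>" and i: "i \<in> {1..d}" "root \<delta> i = i"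
    and j: "j \<ge> 1" "post j \<noteq> 0" and m: "tt i - post j \<in> valuation_ideal V"
  shows "sec \<delta> i \<in> inertia_class j"
proof -
  interpret valuation M V by (rule inert_val[OF W(1)])
  interpret p: subfield_hom UNIV "\<Lambda> i" by (rule path_hom[OF i(1)])
  have s: "inert (pull i V) (sec \<delta> i)" by (rule inert_sec[OF W(1) i tt_V[OF W(1) i(1)]])
  have t1: "t - post j \<in> valuation_ideal (pull i V)" unfolding pull_diff[OF W(1) i(1)] by (rule m)
  obtain r where r: "j = Suc r" using j by (cases j) auto
  obtain c where c: "c \<in> K" "c \<noteq> 0" "Y r ^ d = c * (t - post (Suc r))" using Y_power by blast
  have ck: "c \<in> k" by (rule K_k[OF c(1)])
  define y where "y = \<Lambda> i (Y r)"
  have y: "y \<in> M" "y \<noteq> 0" using path_M[OF i(1) Y_M] Y_ne_0 by (simp_all add: y_def p.hom_eq_0)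
  have yd: "y ^ d = c * (tt i - post j)"
    using path_t[OF i(1)] path_k[OF i(1)] ck K_k[OF post_K]
    by (simp add: y_def p.hom_mult p.hom_diff c(3) r flip: p.hom_power)
  define G where "G = (\<Prod>i'\<in>{1..d} - {i}. post j - tt i')"
  have dV: "post j - tt i' \<in> V" if "i' \<in> {1..d}" for i'
    by (rule V_diff[OF inert_k(1)[OF W(1) K_k[OF post_K]] tt_V[OF W(1) that]])
  have GV: "G \<in> V"
  proof -
    have "prod g I \<in> V" if "\<And>i'. i' \<in> I \<Longrightarrow> g i' \<in> V" for g :: "nat \<Rightarrow> 'l" and I
      using that by (induction I rule: infinite_finite_induct) (auto intro: V_1 V_mult)
    then show ?thesis unfolding G_def using dV by (metis DiffD1)
  qed
  have "G \<notin> \<mm>"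
  proof
    assume G: "G \<in> \<mm>"
    have "\<exists>i'\<in>{1..d} - {i}. post j - tt i' \<in> \<mm>"
      by (rule mm_prod[OF _ _ G[unfolded G_def]]) (use dV in auto)
    then obtain i' where i': "i' \<in> {1..d}" "i \<noteq> i'" "post j - tt i' \<in> \<mm>" by blast
    have "tt i' - post j \<in> \<mm>" using mm_minus[OF i'(3)] by simp
    then show False using tt_mm_unique[OF W(1) i(1) i'(1,2) j(2) m] by contradiction
  qed
  then have G: "G \<noteq> 0" "inverse G \<in> V" using unitD[OF GV] by auto
  have "(poly f (post j) - t) / a = (post j - tt i) * G"
    unfolding prod_tt[symmetric] G_def by (rule prod.remove) (use i(1) in simp_all)
  then have "poly f (post j) - t = a * ((post j - tt i) * G)" using f(3) by (simp add: field_simps)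
  moreover have "poly f (post j) = post (Suc j)" by (simp add: poly_f post_Suc)
  ultimately have e: "t - post (Suc j) = a * (tt i - post j) * G" by (simp add: algebra_simps)
  have fin: "\<delta> y / y - \<xi> \<in> \<mm>"
  proof (rule tame_all[OF W y])
    show "c * (inverse a * inverse G) \<in> V" by (intro V_mult G inert_k[OF W(1)] ab_k ck)
    have "inverse c * (a * G) \<in> V" by (intro V_mult GV inert_k[OF W(1)] ab_k ck)
    then show "inverse (c * (inverse a * inverse G)) \<in> V" by (simp add: inverse_mult_distrib)
    show "c * (inverse a * inverse G) \<noteq> 0" using c(2) G f(3) by simp
    show "y ^ d = c * (inverse a * inverse G) * (t - post (Suc j))" unfolding e yd using G f(3) by (simp add: field_simps)
  qed
  have "sec \<delta> i (Y r) / Y r - \<xi> \<in> valuation_ideal (pull i V)"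
    unfolding pull_mm[OF W(1) i(1)]
  proof
    show "sec \<delta> i (Y r) / Y r - \<xi> \<in> M"
      by (intro is_subfield_diff[OF M] is_subfield_divide[OF M] sec_M[OF inert_\<Gamma>[OF W(1)] i(1)] Y_M k_M[OF \<xi>_k])
    have "\<Lambda> i (sec \<delta> i (Y r)) = \<delta> y" using path_sec[OF inert_\<Gamma>[OF W(1)] i(1) Y_M] i(2) by (simp add: y_def)
    then show "\<Lambda> i (sec \<delta> i (Y r) / Y r - \<xi>) \<in> \<mm>"
      using fin path_k[OF i(1) \<xi>_k] by (simp add: p.hom_diff p.hom_divide y_def)
  qed
  from tame_Y[OF s this] show ?thesis using s t1 r unfolding inertia_class_def by blast
qed

end

section \<open>Recursion of each inertia class and comparison with the model\<close>

context unicritical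
begin

lemma class_1_decomp:
  assumes "\<delta> \<in> inertia_class 1"
  shows "(\<forall>i. secs \<delta> i \<in> tree_W d) \<and> \<beta> \<delta> = tree_rot d 1 + tree_tup d (secs \<delta>) \<and>
    wt.partial_product (secs \<delta>) d = \<beta> (sec (\<delta> ^^ d) 1)"
proof -
  obtain W where W: "inert W \<delta>" "tame W (post 1) \<delta>" using assms unfolding inertia_class_def by blast
  note \<delta> = inert_\<Gamma>[OF W(1)] and r = class_1_root(2)[OF W]
  show ?thesis using secs_W[OF \<delta>] \<beta>_decomp[OF \<delta> r] conjunct2[OF partial_product_sec[OF \<delta> r]] by blast
qed

lemma class_1_product_periodic:
  assumes "post n = 0" "\<delta> \<in> inertia_class 1" shows "sec (\<delta> ^^ d) 1 \<in> inertia_class n"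
proof -
  obtain W where "inert W \<delta>" "t - post 1 \<in> valuation_ideal W" "tame W (post 1) \<delta>" using assms unfolding inertia_class_def by blast
  then show ?thesis using class_1_periodic assms(1) by blast
qed

lemma class_1_product_preperiodic:
  assumes "\<And>j. post (Suc j) \<noteq> 0" "\<delta> \<in> inertia_class 1" shows "\<beta> (sec (\<delta> ^^ d) 1) = 0"
proof -
  obtain W where W: "inert W \<delta>" "t - post 1 \<in> valuation_ideal W" "tame W (post 1) \<delta>" using assms unfolding inertia_class_def by blast
  show ?thesis by (rule class_1_preperiodic[OF W assms(1)])
qed

lemma f_eq_b: "post (Suc j) = b \<longleftrightarrow> post j = 0"
  using f(3) d1 by (simp add: post_Suc)

lemma class_step:
  assumes s: "s \<in> {2..n}" and \<delta>: "\<delta> \<in> inertia_class s"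
  obtains i W where "inert W \<delta>" "i \<in> {1..d}" "tt i - post (s - 1) \<in> valuation_ideal W" "sec \<delta> i \<in> inertia_class (s - 1)"
    "\<beta> \<delta> = tree_tup d (secs \<delta>)" "post (s - 1) \<noteq> 0" "\<And>i. i \<in> {1..d} \<Longrightarrow> root \<delta> i = i" "tame W (post s) \<delta>"
proof -
  obtain W where W: "inert W \<delta>" "t - post s \<in> valuation_ideal W" "tame W (post s) \<delta>" using \<delta> unfolding inertia_class_def by blast
  have s1: "Suc (s - 1) = s" "s - 1 \<ge> 1" using s by auto
  have "post s \<noteq> post 1"
  proof
    assume "post s = post 1"
    then have "s = 1" by (intro post_inj) (use s in auto)
    then show False using s by simp
  qed
  then have "post (s - 1) \<noteq> 0" using f_eq_b[of "s - 1"] post_1 unfolding s1 by simp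
  have "t - b \<notin> valuation_ideal W" using post_mm[OF W(1,2), of 1] \<open>post s \<noteq> post 1\<close> unfolding post_1 by blast
  then have r: "root \<delta> i = i" if "i \<in> {1..d}" for i using root_trivial(1)[OF W(1) _ that] by blast
  have "\<beta> \<delta> = tree_rot d 0 + tree_tup d (secs \<delta>)"
    by (rule \<beta>_decomp[OF inert_\<Gamma>[OF W(1)]]) (simp only: r rotl_0 id_apply)
  then have dec: "\<beta> \<delta> = tree_tup d (secs \<delta>)" by (simp only: tree_rot_0 add_0)
  obtain i where i: "i \<in> {1..d}" "tt i - post (s - 1) \<in> valuation_ideal W"
    using tt_mm_exists[OF W(1), of "s - 1"] W(2) unfolding s1 by blast
  have "sec \<delta> i \<in> inertia_class (s - 1)"
    using class_sec[OF W(1) _ i(1) r[OF i(1)] s1(2) \<open>post (s - 1) \<noteq> 0\<close> i(2)] W(3) unfolding s1 by blast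
  then show ?thesis using that W(1,3) i dec \<open>post (s - 1) \<noteq> 0\<close> r by blast
qed

text \<open>After \<open>q\<close> is replaced by its representative l in 1, ..., n, the index l + 1
  is again in that range unless l = n, and there the points are distinct.\<close>

lemma preimage_index:
  assumes s: "s \<in> {2..n}" and q: "q \<ge> 1" "post (Suc q) = post s"
  shows "post q = post (s - 1) \<or> (post q = post n \<and> post (Suc n) = post s)"
proof -
  obtain l where l: "l \<in> {1..n}" "post q = post l" using post_cover[OF q(1)] by blast
  then have e: "post (Suc l) = post s" using q(2) by (simp add: post_Suc)
  show ?thesis
  proof (cases "l = n")
    case False
    then have "Suc l = s" by (intro post_inj[OF _ _ e]) (use s l in auto)
    then show ?thesis using l(2) by auto
  qed (use e l in auto)
qed

lemma secs_eq: "i \<in> {1..d} \<Longrightarrow> secs \<delta> (int i mod int d) = \<beta> (sec \<delta> i)"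
  by (simp only: letter_residue)

lemma residue_mem: "int i mod int d \<in> {0..<int d}" using d1 by simp

lemma letter_residue_eq: "j \<in> {0..<int d} \<Longrightarrow> int (letter d j) mod int d = j"
  using residue_letter[OF d1, of j] by simp

lemma class_step_simple:
  assumes s: "s \<in> {2..n}" "post (Suc n) \<noteq> post s" and \<delta>: "\<delta> \<in> inertia_class s"
  shows "\<exists>j\<in>{0..<int d}. \<beta> \<delta> = tree_tup d (secs \<delta>) \<and> secs \<delta> j \<in> \<beta> ` inertia_class (s - 1) \<and>
    (\<forall>k\<in>{0..<int d} - {j}. secs \<delta> k = 0)"
proof -
  obtain i W where W: "inert W \<delta>" "i \<in> {1..d}" "tt i - post (s - 1) \<in> valuation_ideal W" "sec \<delta> i \<in> inertia_class (s - 1)"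
    "\<beta> \<delta> = tree_tup d (secs \<delta>)" "post (s - 1) \<noteq> 0" "\<And>i. i \<in> {1..d} \<Longrightarrow> root \<delta> i = i"
    by (rule class_step[OF s(1) \<delta>]) (rule that)
  interpret valuation M W by (rule inert_val[OF W(1)])
  have s1: "Suc (s - 1) = s" using s by auto
  have ts: "t - post s \<in> valuation_ideal W" using f_cong[OF W(1-3)] unfolding s1 .
  have "secs \<delta> k = 0" if k: "k \<in> {0..<int d} - {int i mod int d}" for k
  proof (rule sec_trivial[OF W(1) letter_range[OF d1] W(7)[OF letter_range[OF d1]]])
    fix q
    have ne: "i \<noteq> letter d k" using k letter_residue_eq[of k] by auto
    show "tt (letter d k) - post (Suc q) \<notin> valuation_ideal W"
    proof
      assume m: "tt (letter d k) - post (Suc q) \<in> valuation_ideal W"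
      have "t - post (Suc (Suc q)) \<in> valuation_ideal W" by (rule f_cong[OF W(1) letter_range[OF d1] m])
      then have e: "post (Suc (Suc q)) = post s" using post_mm[OF W(1) _ ts] by blast
      have "post (Suc q) = post (s - 1)" using preimage_index[OF s(1) _ e] s(2) by simp
      then show False using m tt_mm_unique[OF W(1,2) letter_range[OF d1] ne W(6,3)] by simp
    qed
  qed
  then show ?thesis using W(4,5) secs_eq[OF W(2)] residue_mem by (intro bexI[of _ "int i mod int d"]) auto
qed

text \<open>If \<open>tt i\<close> is congruent to \<open>post m\<close>, then the root rotated by
  \<open>r\<close> is \<xi>^r times \<open>tt i\<close>, hence congruent to \<open>post n\<close>.
  Since \<open>post n\<close> and \<open>post m\<close> have the same image under f, both sections
  are ramified, and no further root meets the orbit.\<close>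

lemma class_step_branch:
  assumes m: "1 \<le> m" "m < n" and r: "0 < r" "r < d" "post n = \<xi> ^ r * post m"
    and \<delta>: "\<delta> \<in> inertia_class (Suc m)"
  shows "\<exists>j\<in>{0..<int d}. \<beta> \<delta> = tree_tup d (secs \<delta>) \<and> secs \<delta> j \<in> \<beta> ` inertia_class m \<and>
    secs \<delta> ((j + int r) mod int d) \<in> \<beta> ` inertia_class n \<and>
    (\<forall>k\<in>{0..<int d} - {j, (j + int r) mod int d}. secs \<delta> k = 0)"
proof -
  have s: "Suc m \<in> {2..n}" using m by auto
  obtain i W where W: "inert W \<delta>" "i \<in> {1..d}" "tt i - post m \<in> valuation_ideal W" "sec \<delta> i \<in> inertia_class m"
    "\<beta> \<delta> = tree_tup d (secs \<delta>)" "post m \<noteq> 0" "\<And>i. i \<in> {1..d} \<Longrightarrow> root \<delta> i = i" "tame W (post (Suc m)) \<delta>"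
    by (rule class_step[OF s \<delta>, unfolded diff_Suc_1]) (rule that)
  interpret valuation M W by (rule inert_val[OF W(1)])
  have ts: "t - post (Suc m) \<in> valuation_ideal W" by (rule f_cong[OF W(1-3)])
  define i' where "i' = rotl d (int r) i"
  have i': "i' \<in> {1..d}" unfolding i'_def by (rule rotl_range[OF W(2)])
  have n1: "n \<ge> 1" using m by simp
  have nz: "post n \<noteq> 0" using W(6) \<xi>_ne_0 r(3) by simp
  have pn: "post (Suc n) = post (Suc m)"
  proof -
    have "(\<xi> ^ r) ^ d = 1" unfolding power_mult[symmetric] mult.commute[of r d] unfolding power_mult \<xi>_power by simp
    then show ?thesis by (simp add: post_Suc r(3) power_mult_distrib)
  qed
  have "\<xi> ^ r * (tt i - post m) \<in> \<mm>" by (intro mm_mult' W(3) V_power inert_k(1)[OF W(1) \<xi>_k])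
  also have "\<xi> ^ r * (tt i - post m) = tt i' - post n" unfolding i'_def tt_rotl[OF W(2)] r(3) by (simp add: right_diff_distrib)
  finally have m': "tt i' - post n \<in> \<mm>" .
  have i'n: "sec \<delta> i' \<in> inertia_class n"
    by (rule class_sec[OF W(1) _ i' W(7)[OF i'] n1 nz m']) (use W(8) in \<open>simp only: pn\<close>)
  have res: "int i' mod int d = (int i mod int d + int r) mod int d"
    unfolding i'_def residue_rotl[OF W(2)] by (simp add: mod_add_left_eq)
  have "secs \<delta> k = 0" if k: "k \<in> {0..<int d} - {int i mod int d, int i' mod int d}" for k
  proof (rule sec_trivial[OF W(1) letter_range[OF d1] W(7)[OF letter_range[OF d1]]])
    fix q
    have ne: "i \<noteq> letter d k" "i' \<noteq> letter d k" using k letter_residue_eq[of k] by auto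
    show "tt (letter d k) - post (Suc q) \<notin> valuation_ideal W"
    proof
      assume c: "tt (letter d k) - post (Suc q) \<in> valuation_ideal W"
      have "t - post (Suc (Suc q)) \<in> valuation_ideal W" by (rule f_cong[OF W(1) letter_range[OF d1] c])
      then have e: "post (Suc (Suc q)) = post (Suc m)" using post_mm[OF W(1) _ ts] by blast
      have "post (Suc q) = post m \<or> post (Suc q) = post n" using preimage_index[OF s _ e] by auto
      then show False using c tt_mm_unique[OF W(1,2) letter_range[OF d1] ne(1) W(6,3)]
          tt_mm_unique[OF W(1) i' letter_range[OF d1] ne(2) nz m'] by auto
    qed
  qed
  then show ?thesis using W(4,5) i'n secs_eq[OF W(2)] secs_eq[OF i'] residue_mem unfolding res
    by (intro bexI[of _ "int i mod int d"]) auto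
qed

lemma rigid_model:
  "\<exists>a. wreath_model d (tree_W d) (tree_rot d) (tree_tup d) (tree_K d) n a \<and>
    (\<forall>l. wreath_model.conjugates_inner (tree_W d) (tree_K d) n a l \<and> wreath_model.conjugates_generate (tree_W d) (tree_K d) n a l) \<and>
    (\<forall>l. \<forall>i\<in>{1..n}. \<exists>g\<in>tree_W d. cong_mod (tree_W d) (tree_K d l) (\<beta> (\<gamma> i)) (g + a i - g))"
proof -
  define D where "D s = \<beta> ` inertia_class s" for s
  have DW: "x \<in> tree_W d" if "x \<in> D s" for s x using that \<beta>_W inertia_class_\<Gamma> unfolding D_def by blast
  have \<gamma>D: "\<beta> (\<gamma> i) \<in> D i" if "i \<in> {1..n}" for i unfolding D_def by (rule imageI[OF gamma_class[OF that]])
  have simple: "\<exists>h. \<exists>j\<in>{0..<int d}. x = tree_tup d h \<and> h j \<in> D (s - 1) \<and> (\<forall>k\<in>{0..<int d} - {j}. h k = 0)"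
    if s: "s \<in> {2..n}" "post (Suc n) \<noteq> post s" and x: "x \<in> D s" for s x
  proof -
    obtain \<delta> where \<delta>: "\<delta> \<in> inertia_class s" "x = \<beta> \<delta>" using x unfolding D_def by (elim imageE)
    show ?thesis unfolding \<delta>(2) D_def by (rule exI[of _ "secs \<delta>"]) (rule class_step_simple[OF s \<delta>(1)])
  qed
  \<comment> \<open>The image of the last orbit point decides the model: \<open>l = 1\<close> means
    a periodic orbit, and otherwise the orbit closes up at \<open>l = Suc m\<close>.\<close>
  obtain l where l: "l \<in> {1..n}" "post (Suc n) = post l" using post_cover[of "Suc n"] by auto
  show ?thesis
  proof (cases "l = 1")
    case True
    then have n0: "post n = 0" using l(2) f_eq_b[of n] post_1 by simp
    obtain a where a: "periodic_model d (tree_W d) (tree_rot d) (tree_tup d) (tree_K d) n a"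
      using periodic_tree_model[OF d(1) n_pos] ..
    interpret pm: periodic_model d "tree_W d" "tree_rot d" "tree_tup d" "tree_K d" n a by (rule a)
    have "\<exists>g\<in>tree_W d. cong_mod (tree_W d) (tree_K d l) (\<beta> (\<gamma> i)) (g + a i - g)" if i: "i \<in> {1..n}" for l i
    proof (rule pm.classes_conj[of D, OF _ _ DW i \<gamma>D[OF i]])
      fix x assume "x \<in> D 1"
      then obtain \<delta> where \<delta>: "\<delta> \<in> inertia_class 1" "x = \<beta> \<delta>" unfolding D_def by (elim imageE)
      have "wt.partial_product (secs \<delta>) d \<in> D n"
        using class_1_decomp[OF \<delta>(1)] imageI[OF class_1_product_periodic[OF n0 \<delta>(1)], of \<beta>] unfolding D_def by (simp only:)
      then show "\<exists>h. (\<forall>i. h i \<in> tree_W d) \<and> x = tree_rot d 1 + tree_tup d h \<and> wt.partial_product h d \<in> D n"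
        using class_1_decomp[OF \<delta>(1)] unfolding \<delta>(2) by (intro exI[of _ "secs \<delta>"]) (simp only: simp_thms)
    next
      fix s x assume s: "s \<in> {2..n}" and x: "x \<in> D s"
      have "post (Suc n) \<noteq> post s"
      proof
        assume "post (Suc n) = post s"
        then have "post 1 = post s" using l(2) True by simp
        then have "1 = s" by (intro post_inj) (use s in auto)
        then show False using s by simp
      qed
      then show "\<exists>h. \<exists>j\<in>{0..<int d}. x = tree_tup d h \<and> h j \<in> D (s - 1) \<and> (\<forall>k\<in>{0..<int d} - {j}. h k = 0)"
        by (rule simple[OF s _ x])
    qed
    then show ?thesis using pm.rigid pm.wreath_model_axioms by (intro exI[of _ a] conjI allI ballI) simp_all
  next
    case False
    define m where "m = l - 1"
    have m: "1 \<le> m" "m < n" and lm: "l = Suc m" using False l(1) by (auto simp: m_def)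
    have pm': "post (Suc n) = post (Suc m)" using l(2) lm by simp
    then have "post n ^ d = post m ^ d" using f(3) by (simp add: post_Suc)
    \<comment> \<open>Elements with equal \<open>d\<close>-th powers differ by a power of \<xi>; its
      exponent becomes the distance between the branch positions.\<close>
    then have "(\<Prod>i<d. post n - \<xi> ^ i * post m) = 0" by (simp add: prod_roots)
    then obtain r where r: "r < d" "post n = \<xi> ^ r * post m" by (auto simp: prod_zero_iff)
    have "r \<noteq> 0"
    proof
      assume "r = 0"
      then have "n = m" using r m by (intro post_inj) auto
      then show False using m by simp
    qed
    then have r0: "0 < r" by simp
    have nz: "post (Suc j) \<noteq> 0" for j
    proof
      assume z: "post (Suc j) = 0"
      obtain q where q: "q \<in> {1..n}" "post (Suc j) = post q" using post_cover[of "Suc j"] by auto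
      then have e: "post (Suc q) = post 1" using z f_eq_b[of q] post_1 by simp
      show False
      proof (cases "q = n")
        case True
        then have "post (Suc m) = post 1" using e pm' by simp
        then have "Suc m = 1" by (intro post_inj) (use m in auto)
        then show False using m by simp
      next
        case False
        then have "Suc q = 1" by (intro post_inj[OF _ _ e]) (use q in auto)
        then show False using q by simp
      qed
    qed
    obtain a where a: "preperiodic_model d (tree_W d) (tree_rot d) (tree_tup d) (tree_K d) n a m (int r)"
      using preperiodic_tree_model[OF d(1) m, of "int r"] r0 r(1) by auto
    interpret pm: preperiodic_model d "tree_W d" "tree_rot d" "tree_tup d" "tree_K d" n a m "int r" by (rule a)
    have "\<exists>g\<in>tree_W d. cong_mod (tree_W d) (tree_K d l) (\<beta> (\<gamma> i)) (g + a i - g)" if i: "i \<in> {1..n}" for l i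
    proof (rule pm.classes_conj[of D, OF _ _ _ DW i \<gamma>D[OF i]])
      fix x assume "x \<in> D 1"
      then obtain \<delta> where \<delta>: "\<delta> \<in> inertia_class 1" "x = \<beta> \<delta>" unfolding D_def by (elim imageE)
      have "wt.partial_product (secs \<delta>) d = 0"
        using class_1_decomp[OF \<delta>(1)] class_1_product_preperiodic[OF nz \<delta>(1)] by (simp only:)
      then show "\<exists>h. (\<forall>i. h i \<in> tree_W d) \<and> x = tree_rot d 1 + tree_tup d h \<and> wt.partial_product h d = 0"
        using class_1_decomp[OF \<delta>(1)] unfolding \<delta>(2) by (intro exI[of _ "secs \<delta>"]) (simp only: simp_thms)
    next
      fix s x assume s: "s \<in> {2..n}" "s \<noteq> Suc m" and x: "x \<in> D s"
      have "post (Suc n) \<noteq> post s"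
      proof
        assume "post (Suc n) = post s"
        then have "post s = post (Suc m)" using pm' by simp
        then have "s = Suc m" by (intro post_inj) (use s m in auto)
        then show False using s by simp
      qed
      then show "\<exists>h. \<exists>j\<in>{0..<int d}. x = tree_tup d h \<and> h j \<in> D (s - 1) \<and> (\<forall>k\<in>{0..<int d} - {j}. h k = 0)"
        by (rule simple[OF s(1) _ x])
    next
      fix x assume "x \<in> D (Suc m)"
      then obtain \<delta> where \<delta>: "\<delta> \<in> inertia_class (Suc m)" "x = \<beta> \<delta>" unfolding D_def by (elim imageE)
      show "\<exists>h. \<exists>j\<in>{0..<int d}. x = tree_tup d h \<and> h j \<in> D m \<and> h ((j + int r) mod int d) \<in> D n \<and>
          (\<forall>k\<in>{0..<int d} - {j, (j + int r) mod int d}. h k = 0)"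
        unfolding \<delta>(2) D_def by (rule exI[of _ "secs \<delta>"]) (rule class_step_branch[OF m r0 r \<delta>(1)])
    qed
    then show ?thesis using pm.rigid pm.wreath_model_axioms by (intro exI[of _ a] conjI allI ballI) simp_all
  qed
qed

end

section \<open>Passing to the limit\<close>

lemma agree_all: "(\<And>l. agree l g h) \<Longrightarrow> g = h"
  by (rule ext) (auto simp: agree_def)

context
  fixes d :: nat
  assumes d1: "d \<ge> 1"
begin

lemma agree_comp:
  assumes "agree l g g'" "agree l h h'" "h \<in> wreath_perms d"
  shows "agree l (g \<circ> h) (g' \<circ> h')"
  unfolding agree_def
proof (intro allI impI)
  fix w :: "nat list" assume w: "length w \<le> l"
  have "length (h w) \<le> l" using wreath_perms_length[OF d1 assms(3), of w] w by simp
  then have "g (h w) = g' (h w)" using assms(1) unfolding agree_def by blast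
  moreover have "h w = h' w" using assms(2) w unfolding agree_def by blast
  ultimately show "(g \<circ> h) w = (g' \<circ> h') w" by simp
qed

lemma agree_inv:
  assumes "agree l g h" and g: "g \<in> wreath_perms d" and h: "h \<in> wreath_perms d"
  shows "agree l (inv' g) (inv' h)"
  unfolding agree_def
proof (intro allI impI)
  fix w :: "nat list" assume w: "length w \<le> l"
  define v where "v = inv' h w"
  have hv: "h v = w" unfolding v_def by (rule surj_f_inv_f[OF bij_is_surj[OF wreath_perms_bij[OF d1 h]]])
  have "length v \<le> l" using wreath_perms_length[OF d1 h, of v] hv w by simp
  then have "g v = w" using assms(1) hv unfolding agree_def by simp
  then show "inv' g w = inv' h w" using inv_f_f[OF bij_is_inj[OF wreath_perms_bij[OF d1 g]], of v] by (simp add: v_def)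
qed

lemma agree_conj_by:
  assumes "agree l g g'" "agree l x x'" "g \<in> wreath_perms d" "g' \<in> wreath_perms d" "x \<in> wreath_perms d"
  shows "agree l (conj_by g x) (conj_by g' x')"
  by (intro agree_comp agree_inv assms inv_wreath_perms[OF d1])

text \<open>On words of bounded length there are only finitely many possible restrictions, so nested
  infinite index sets can be chosen on which all members of the family agree up to a given level.
  One diagonal sequence then serves for all \<open>i\<close> at once.\<close>

lemma wreath_perms_compact:
  fixes g :: "nat \<Rightarrow> 'i \<Rightarrow> nat list \<Rightarrow> nat list"
  assumes I: "finite I" and g: "\<And>l i. i \<in> I \<Longrightarrow> g l i \<in> wreath_perms d"
  shows "\<exists>G. \<forall>l. \<exists>l'\<ge>l. \<forall>i\<in>I. agree l (G i) (g l' i)"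
proof -
  let ?P = "\<lambda>n S. infinite (S :: nat set) \<and> (\<forall>x\<in>S. \<forall>y\<in>S. \<forall>i\<in>I. agree n (g x i) (g y i))"
  have step: "\<exists>S'. ?P n S' \<and> S' \<subseteq> S" if S: "infinite S" for n and S :: "nat set"
  proof -
    let ?L = "{w. set w \<subseteq> {1..d} \<and> length w \<le> n}"
    define F where "F x = restrict (\<lambda>(i, w). g x i w) (I \<times> ?L)" for x
    have "F x \<in> (I \<times> ?L) \<rightarrow>\<^sub>E ?L" for x
    proof (rule PiE_I)
      fix p assume "p \<in> I \<times> ?L"
      then obtain i w where p: "p = (i, w)" "i \<in> I" "w \<in> ?L" by blast
      have "w \<in> lists {1..d}" using p(3) by auto
      then have "g x i w \<in> lists {1..d}" "length (g x i w) \<le> n"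
        using wreath_perms_lists[OF d1 g[OF p(2)]] wreath_perms_length[OF d1 g[OF p(2)]] p(3) by auto
      then show "F x p \<in> ?L" using p by (auto simp: F_def)
    qed (simp add: F_def)
    then have "F ` S \<subseteq> (I \<times> ?L) \<rightarrow>\<^sub>E ?L" by blast
    moreover have "finite ((I \<times> ?L) \<rightarrow>\<^sub>E ?L)" by (intro finite_PiE finite_cartesian_product I finite_lists_length_le) simp_all
    ultimately have "finite (F ` S)" by (rule finite_subset)
    then obtain x0 where x0: "infinite {x \<in> S. F x = F x0}" using pigeonhole_infinite[OF S] by blast
    have "agree n (g x i) (g y i)" if xy: "F x = F x0" "F y = F x0" and i: "i \<in> I" for x y i
      unfolding agree_def
    proof (intro allI impI)
      fix w :: "nat list" assume w: "length w \<le> n"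
      show "g x i w = g y i w"
      proof (cases "w \<in> lists {1..d}")
        case True
        then have "(i, w) \<in> I \<times> ?L" using w i by auto
        moreover have "F x (i, w) = F y (i, w)" using xy by simp
        ultimately show ?thesis by (simp only: F_def restrict_apply' prod.case)
      next
        case False
        then show ?thesis using wreath_perms_outside[OF d1 g[OF i]] by simp
      qed
    qed
    then show ?thesis using x0 by (intro exI[of _ "{x \<in> S. F x = F x0}"]) auto
  qed
  have "\<exists>S. \<forall>n. ?P n (S n) \<and> S (Suc n) \<subseteq> S n"
  proof (rule dependent_nat_choice)
    show "\<exists>S. ?P 0 S" using step[of UNIV 0] by auto
    show "\<exists>S'. ?P (Suc n) S' \<and> S' \<subseteq> S" if "?P n S" for S n by (rule step) (use that in blast)
  qed
  then obtain S where S0: "\<forall>n. ?P n (S n) \<and> S (Suc n) \<subseteq> S n" ..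
  have S: "infinite (S n)" "S (Suc n) \<subseteq> S n" for n using spec[OF S0, of n] by auto
  have S_agree: "agree n (g x i) (g y i)" if "x \<in> S n" "y \<in> S n" "i \<in> I" for n x y i
    using spec[OF S0, of n] that by simp
  have mono: "S m \<subseteq> S n" if "n \<le> m" for n m using lift_Suc_antimono_le[of S, OF S(2) that] .
  have "\<exists>x. x \<in> S l \<and> x \<ge> l" for l using S(1)[of l] unfolding infinite_nat_iff_unbounded_le by blast
  then have "\<exists>x. \<forall>l. x l \<in> S l \<and> x l \<ge> l" by (intro choice allI)
  then obtain x where x: "\<And>l. x l \<in> S l" "\<And>l. x l \<ge> l" by auto
  \<comment> \<open>The value at \<open>w\<close> is read off at level \<open>length w\<close>, from
    which on the chosen sequence is constant at \<open>w\<close>.\<close>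
  let ?G = "\<lambda>i w. g (x (length w)) i w"
  have "agree l (?G i) (g (x l) i)" if i: "i \<in> I" for l i
    unfolding agree_def
  proof (intro allI impI)
    fix w :: "nat list" assume "length w \<le> l"
    then have "x l \<in> S (length w)" using mono x(1) by blast
    then show "?G i w = g (x l) i w" using S_agree[OF x(1) _ i] unfolding agree_def by blast
  qed
  then show ?thesis using x(2) by (intro exI[of _ ?G] allI) blast
qed

end

context unicritical
begin

text \<open>Convergence of the finite-level conjugators along one subsequence gives exact equations.
  The two groups are closed, so they are compared level by level.\<close>

lemma conjugate_generators:
  assumes c': "\<And>i. i \<in> {1..n} \<Longrightarrow> \<exists>g\<in>wreath_perms d. c' i = conj_by g (\<rho> (\<gamma> i))"
  shows "\<exists>w\<in>wreath_perms d. \<exists>u. (\<forall>i\<in>{1..n}. u i \<in> \<rho> ` \<Gamma> \<and> conj_by w (c' i) = conj_by (u i) (\<rho> (\<gamma> i))) \<and>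
    conj_by w ` top_generate (iter_wreath d) (c' ` {1..n}) = \<rho> ` \<Gamma>"
proof -
  define c where "c i = \<rho> (\<gamma> i)" for i
  let ?C = "c ` {1..n}" and ?G = "iter_wreath d"
  have cW: "c i \<in> wreath_perms d" if "i \<in> {1..n}" for i unfolding c_def by (rule \<rho>_wreath_perms[OF \<gamma>_\<Gamma>[OF that]])
  have CW: "?C \<subseteq> wreath_perms d" using cW by blast
  have c'g: "\<exists>g\<in>wreath_perms d. c' i = conj_by g (c i)" if "i \<in> {1..n}" for i using c'[OF that] unfolding c_def .
  have c'W: "c' i \<in> wreath_perms d" if i: "i \<in> {1..n}" for i
  proof -
    obtain g where g: "g \<in> wreath_perms d" "c' i = conj_by g (c i)" using c'g[OF i] ..
    show ?thesis unfolding g(2) by (rule conj_by_wreath_perms[OF d1 g(1) cW[OF i]])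
  qed
  have C'W: "c' ` {1..n} \<subseteq> wreath_perms d" using c'W by blast
  have \<rho>\<Gamma>: "\<rho> ` \<Gamma> = top_generate ?G ?C" using \<rho>_image unfolding c_def .
  have \<rho>\<Gamma>W: "\<rho> ` \<Gamma> \<subseteq> wreath_perms d" using \<rho>_wreath_perms by blast
  note mem = top_generate_iter_wreath[OF d1]
  note gW = generate_wreath_perms[OF d1 CW]
  obtain a where a: "wreath_model d (tree_W d) (tree_rot d) (tree_tup d) (tree_K d) n a"
    and rig: "\<And>l. wreath_model.conjugates_inner (tree_W d) (tree_K d) n a l"
      "\<And>l. wreath_model.conjugates_generate (tree_W d) (tree_K d) n a l"
    and ca: "\<And>l i. i \<in> {1..n} \<Longrightarrow> \<exists>g\<in>tree_W d. cong_mod (tree_W d) (tree_K d l) (tree_bij d (c i)) (g + a i - g)"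
    using rigid_model unfolding c_def by blast
  note level = rigid_level[OF a rig cW ca c'g]
  \<comment> \<open>Index 0 holds the common conjugator, so that it and the \<open>u i\<close>
    converge along the same subsequence.\<close>
  define P where "P l g \<longleftrightarrow> g 0 \<in> wreath_perms d \<and> (\<forall>i\<in>{1..n}. g i \<in> generate ?G ?C \<and>
      agree l (conj_by (g 0) (c' i)) (conj_by (g i) (c i)))" for l and g :: "nat \<Rightarrow> nat list \<Rightarrow> nat list"
  have "\<exists>g. P l g" for l
  proof -
    obtain w u where wu: "w \<in> wreath_perms d" "\<forall>i\<in>{1..n}. u i \<in> generate ?G ?C \<and> agree l (conj_by w (c' i)) (conj_by (u i) (c i))"
      using level(1)[of l] by blast
    have "P l (\<lambda>i. if i = 0 then w else u i)" using wu unfolding P_def by auto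
    then show ?thesis by (rule exI[of "P l"])
  qed
  then obtain g where g: "\<And>l. P l (g l)" by metis
  have gWi: "g l i \<in> wreath_perms d" if "i \<in> {0..n}" for l i
    using g[of l] gW that unfolding P_def by (cases "i = 0") auto
  obtain G where G: "\<And>l. \<exists>l'\<ge>l. \<forall>i\<in>{0..n}. agree l (G i) (g l' i)"
    using wreath_perms_compact[OF d1, of "{0..n}" g] gWi by auto
  have GW: "G i \<in> wreath_perms d" if i: "i \<in> {0..n}" for i
    by (rule wreath_perms_closed[OF d1]) (use G gWi[OF i] i in blast)
  define w where "w = G 0"
  have w: "w \<in> wreath_perms d" unfolding w_def by (rule GW) simp
  have G\<Gamma>: "G i \<in> \<rho> ` \<Gamma>" if i: "i \<in> {1..n}" for i
  proof -
    have i0: "i \<in> {0..n}" using i by auto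
    have "\<exists>h\<in>generate ?G ?C. agree l (G i) h" for l using G[of l] g i i0 unfolding P_def by blast
    then show ?thesis unfolding \<rho>\<Gamma> mem[OF CW] using GW[OF i0] by blast
  qed
  have conj: "conj_by w (c' i) = conj_by (G i) (c i)" if i: "i \<in> {1..n}" for i
  proof (rule agree_all)
    fix l
    have i0: "i \<in> {0..n}" "0 \<in> {0..n}" using i by auto
    obtain l' where l': "l' \<ge> l" "\<And>i. i \<in> {0..n} \<Longrightarrow> agree l (G i) (g l' i)" using G[of l] by blast
    have "agree l (conj_by w (c' i)) (conj_by (g l' 0) (c' i))"
      unfolding w_def by (rule agree_conj_by[OF d1 l'(2)[OF i0(2)] agree_refl GW[OF i0(2)] gWi[OF i0(2)] c'W[OF i]])
    also have "agree l (conj_by (g l' 0) (c' i)) (conj_by (g l' i) (c i))"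
      using agree_mono[OF _ l'(1)] g[of l'] i unfolding P_def by blast
    also (agree_trans) have "agree l (conj_by (g l' i) (c i)) (conj_by (G i) (c i))"
      by (rule agree_conj_by[OF d1 agree_sym[OF l'(2)[OF i0(1)]] agree_refl gWi[OF i0(1)] GW[OF i0(1)] cW[OF i]])
    finally (agree_trans) show "agree l (conj_by w (c' i)) (conj_by (G i) (c i))" .
  qed
  interpret G: group ?G by (rule iter_wreath_group[OF d1])
  have carr: "carrier ?G = wreath_perms d" and mult: "x \<otimes>\<^bsub>?G\<^esub> y = x \<circ> y" and one: "\<one>\<^bsub>?G\<^esub> = id" for x y
    by (simp_all add: iter_wreath_def)
  have bw: "bij w" by (rule wreath_perms_bij[OF d1 w])
  have w': "inv' w \<in> wreath_perms d" by (rule inv_wreath_perms[OF d1 w])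
  have ww': "inv' w \<circ> w = id" "w \<circ> inv' w = id" "inv' (inv' w) = w"
    using bw by (simp_all add: bij_is_inj bij_is_surj surj_iff[symmetric] inv_inv_eq)
  have "group_hom ?G ?G (conj_by w)"
  proof (unfold_locales, rule homI)
    show "conj_by w x \<in> carrier ?G" if "x \<in> carrier ?G" for x using that conj_by_wreath_perms[OF d1 w] unfolding carr by blast
    show "conj_by w (x \<otimes>\<^bsub>?G\<^esub> y) = conj_by w x \<otimes>\<^bsub>?G\<^esub> conj_by w y" for x y
      unfolding mult using ww'(1) by (metis comp_assoc comp_id)
  qed
  then interpret h: group_hom ?G ?G "conj_by w" .
  let ?Z = "conj_by w ` c' ` {1..n}"
  have Z: "conj_by w ` generate ?G (c' ` {1..n}) = generate ?G ?Z"
    using h.generate_img[of "c' ` {1..n}"] C'W unfolding carr by simp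
  have ZW: "?Z \<subseteq> wreath_perms d" using conj_by_wreath_perms[OF d1 w c'W] by blast
  have sub: "subgroup (\<rho> ` \<Gamma>) ?G"
  proof (rule G.subgroupI)
    show "\<rho> ` \<Gamma> \<subseteq> carrier ?G" unfolding carr by (rule \<rho>\<Gamma>W)
    show "\<rho> ` \<Gamma> \<noteq> {}" using id_\<Gamma> by blast
    show "inv\<^bsub>?G\<^esub> x \<in> \<rho> ` \<Gamma>" if "x \<in> \<rho> ` \<Gamma>" for x
    proof -
      obtain \<delta> where \<delta>: "\<delta> \<in> \<Gamma>" "x = \<rho> \<delta>" using \<open>x \<in> \<rho> ` \<Gamma>\<close> by (elim imageE)
      show ?thesis unfolding \<delta>(2) iter_wreath_inv[OF d1 \<rho>_wreath_perms[OF \<delta>(1)]] \<rho>_inv[OF \<delta>(1), symmetric]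
        by (rule imageI[OF inv_\<Gamma>[OF \<delta>(1)]])
    qed
    show "x \<otimes>\<^bsub>?G\<^esub> y \<in> \<rho> ` \<Gamma>" if "x \<in> \<rho> ` \<Gamma>" "y \<in> \<rho> ` \<Gamma>" for x y
    proof -
      obtain \<delta> \<epsilon> where \<delta>: "\<delta> \<in> \<Gamma>" "x = \<rho> \<delta>" "\<epsilon> \<in> \<Gamma>" "y = \<rho> \<epsilon>"
        using \<open>x \<in> \<rho> ` \<Gamma>\<close> \<open>y \<in> \<rho> ` \<Gamma>\<close> by fast
      show ?thesis unfolding \<delta>(2,4) mult \<rho>_comp[OF \<delta>(1,3), symmetric] by (rule imageI[OF comp_\<Gamma>[OF \<delta>(1,3)]])
    qed
  qed
  have "?Z \<subseteq> \<rho> ` \<Gamma>"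
  proof
    fix z assume "z \<in> ?Z"
    then obtain i where i: "i \<in> {1..n}" "z = conj_by w (c' i)" by blast
    have ci: "c i \<in> \<rho> ` \<Gamma>" unfolding c_def by (rule imageI[OF \<gamma>_\<Gamma>[OF i(1)]])
    have "G i \<otimes>\<^bsub>?G\<^esub> c i \<otimes>\<^bsub>?G\<^esub> inv\<^bsub>?G\<^esub> (G i) \<in> \<rho> ` \<Gamma>"
      by (intro subgroup.m_closed[OF sub] subgroup.m_inv_closed[OF sub] G\<Gamma>[OF i(1)] ci)
    moreover have "inv\<^bsub>?G\<^esub> (G i) = inv' (G i)" by (rule iter_wreath_inv[OF d1 GW]) (use i(1) in auto)
    ultimately show "z \<in> \<rho> ` \<Gamma>" unfolding i(2) conj[OF i(1)] mult by (simp only:)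
  qed
  then have gZ: "generate ?G ?Z \<subseteq> \<rho> ` \<Gamma>" by (rule G.generate_subgroup_incl[OF _ sub])
  have "conj_by w ` top_generate ?G (c' ` {1..n}) = \<rho> ` \<Gamma>"
  proof
    show "conj_by w ` top_generate ?G (c' ` {1..n}) \<subseteq> \<rho> ` \<Gamma>"
    proof
      fix y assume "y \<in> conj_by w ` top_generate ?G (c' ` {1..n})"
      then obtain x where x: "y = conj_by w x" "x \<in> top_generate ?G (c' ` {1..n})" by (elim imageE)
      then have xW: "x \<in> wreath_perms d" and xg: "\<exists>h\<in>generate ?G (c' ` {1..n}). agree l x h" for l
        using mem[OF C'W, of x] by simp_all
      show "y \<in> \<rho> ` \<Gamma>"
      proof (rule \<rho>_image_closed)
        show "y \<in> wreath_perms d" unfolding x(1) by (rule conj_by_wreath_perms[OF d1 w xW])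
        fix l
        obtain h where h: "h \<in> generate ?G (c' ` {1..n})" "agree l x h" using xg[of l] ..
        have "conj_by w h \<in> \<rho> ` \<Gamma>" using gZ imageI[OF h(1), of "conj_by w"] unfolding Z by blast
        then obtain \<delta> where \<delta>: "conj_by w h = \<rho> \<delta>" "\<delta> \<in> \<Gamma>" by (elim imageE)
        have "agree l y (\<rho> \<delta>)" unfolding x(1) \<delta>(1)[symmetric] by (rule agree_conj_by[OF d1 agree_refl h(2) w w xW])
        then show "\<exists>\<delta>\<in>\<Gamma>. agree l y (\<rho> \<delta>)" using \<delta>(2) ..
      qed
    qed
    show "\<rho> ` \<Gamma> \<subseteq> conj_by w ` top_generate ?G (c' ` {1..n})"
    proof
      fix y assume y: "y \<in> \<rho> ` \<Gamma>"
      define x where "x = conj_by (inv' w) y"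
      have yW: "y \<in> wreath_perms d" using \<rho>\<Gamma>W y by blast
      have xW: "x \<in> wreath_perms d" unfolding x_def by (rule conj_by_wreath_perms[OF d1 w' yW])
      have undo: "conj_by (inv' w) (conj_by w h) = h" for h unfolding ww'(3) using ww'(1) by (metis comp_assoc comp_id id_comp)
      have "\<exists>h\<in>generate ?G (c' ` {1..n}). agree l x h" for l
      proof -
        \<comment> \<open>Generation at level \<open>l\<close> is stated for conjugators in the
          abstract group generated by the \<open>c i\<close>, whereas \<open>G i\<close> lies only
          in its closure; so \<open>G i\<close> is replaced by an element agreeing with it up to
          level \<open>l\<close>.\<close>
        have "\<exists>v. \<forall>i\<in>{1..n}. v i \<in> generate ?G ?C \<and> agree l (G i) (v i)"
          using G\<Gamma> unfolding \<rho>\<Gamma> mem[OF CW] by (intro bchoice) blast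
        then obtain v where v: "\<And>i. i \<in> {1..n} \<Longrightarrow> v i \<in> generate ?G ?C" "\<And>i. i \<in> {1..n} \<Longrightarrow> agree l (G i) (v i)" by blast
        obtain y' where y': "y' \<in> generate ?G ?C" "agree l y y'" using y unfolding \<rho>\<Gamma> mem[OF CW] by blast
        have near: "\<exists>h\<in>generate ?G ?Z. agree l (conj_by (v i) (c i)) h" if i: "i \<in> {1..n}" for i
        proof (rule bexI[of _ "conj_by w (c' i)"])
          show "conj_by w (c' i) \<in> generate ?G ?Z" using i by (intro generate.incl imageI)
          have "G i \<in> wreath_perms d" "v i \<in> wreath_perms d" using GW gW v(1)[OF i] i by auto
          then show "agree l (conj_by (v i) (c i)) (conj_by w (c' i))"
            unfolding conj[OF i] by (intro agree_conj_by[OF d1 agree_sym[OF v(2)[OF i]] agree_refl] cW[OF i])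
        qed
        obtain h where h: "h \<in> generate ?G ?Z" "agree l y' h" using level(2)[of v ?Z l y', OF _ _ _ v(1) ZW near y'(1)] by blast
        obtain h' where h': "h' \<in> generate ?G (c' ` {1..n})" "h = conj_by w h'" using h(1) unfolding Z[symmetric] by (elim imageE)
        have "agree l x h'"
          unfolding x_def using agree_conj_by[OF d1 agree_refl agree_trans[OF y'(2) h(2)] w' w' yW] unfolding h'(2) undo .
        then show ?thesis using h'(1) ..
      qed
      then have "x \<in> top_generate ?G (c' ` {1..n})" unfolding mem[OF C'W] using xW by blast
      moreover have "conj_by w x = y" unfolding x_def ww'(3) using ww'(2) by (metis comp_assoc comp_id id_comp)
      ultimately show "y \<in> conj_by w ` top_generate ?G (c' ` {1..n})" by (metis imageI)
    qed
  qed
  then show ?thesis using w G\<Gamma> conj unfolding c_def by (intro bexI[of _ w] exI[of _ G] conjI ballI) auto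
qed

end

theorem theorem1p2:
  fixes K :: "'l::field set" and a b t :: 'l and f :: "'l poly" and d n :: nat
    and \<gamma> :: "nat \<Rightarrow> 'l \<Rightarrow> 'l" and \<gamma>_inf :: "'l \<Rightarrow> 'l"
    and tt :: "nat \<Rightarrow> 'l" and \<Lambda> :: "nat \<Rightarrow> 'l \<Rightarrow> 'l"
    and c c' :: "nat \<Rightarrow> nat list \<Rightarrow> nat list"
  assumes K: "is_subfield K"
    and t: "transcendental_over K t"
    and Omega: "UNIV_is_separable_closure_of (adjoin K {t})"
    and f: "a \<in> K" "b \<in> K" "a \<noteq> 0" "f = monom a d + [:b:]"
    and d: "d \<ge> 2" "CHAR('l) = 0 \<or> coprime d CHAR('l)"
    and pcf: "finite {(poly f ^^ i) 0 | i. i \<ge> 1}" "card {(poly f ^^ i) 0 | i. i \<ge> 1} = n"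
    and gamma: "\<forall>i\<in>{1..n}. \<gamma> i \<in> carrier (geom_group K f t) \<and>
          is_inertia_over_point K f t ((poly f ^^ i) 0) (top_generate (geom_group K f t) {\<gamma> i})"
    and gamma_inf: "\<gamma>_inf \<in> carrier (geom_group K f t)"
          "is_inertia_over_infinity K f t (top_generate (geom_group K f t) {\<gamma>_inf})"
    and gamma_gen: "carrier (geom_group K f t) = top_generate (geom_group K f t) (\<gamma> ` {1..n})"
    and gamma_prod: "\<gamma>_inf = foldr (\<otimes>\<^bsub>geom_group K f t\<^esub>) (map \<gamma> [1..<Suc n]) \<one>\<^bsub>geom_group K f t\<^esub>"
    and labeling: "preimage_labeling d f t tt"
    and paths: "choice_of_paths d K t tt \<Lambda>"
    and rho_inf: "arboreal_rep d K f t tt \<Lambda> \<gamma>_inf = odometer d"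
    and c: "\<forall>i\<in>{1..n}. c i = arboreal_rep d K f t tt \<Lambda> (\<gamma> i)"
    and c': "\<forall>i\<in>{1..n}. c' i \<in> carrier (iter_wreath d) \<and>
          (\<exists>g\<in>carrier (iter_wreath d).
             c' i = g \<otimes>\<^bsub>iter_wreath d\<^esub> c i \<otimes>\<^bsub>iter_wreath d\<^esub> inv\<^bsub>iter_wreath d\<^esub> g)"
  shows "\<exists>w\<in>carrier (iter_wreath d). \<exists>u :: nat \<Rightarrow> nat list \<Rightarrow> nat list.
      (\<forall>i\<in>{1..n}. u i \<in> arb_image d K f t tt \<Lambda> \<and>
         w \<otimes>\<^bsub>iter_wreath d\<^esub> c' i \<otimes>\<^bsub>iter_wreath d\<^esub> inv\<^bsub>iter_wreath d\<^esub> w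
           = u i \<otimes>\<^bsub>iter_wreath d\<^esub> c i \<otimes>\<^bsub>iter_wreath d\<^esub> inv\<^bsub>iter_wreath d\<^esub> (u i)) \<and>
      (\<lambda>g. w \<otimes>\<^bsub>iter_wreath d\<^esub> g \<otimes>\<^bsub>iter_wreath d\<^esub> inv\<^bsub>iter_wreath d\<^esub> w)
         ` top_generate (iter_wreath d) (c' ` {1..n}) = arb_image d K f t tt \<Lambda>"
  proof -
  interpret unicritical K a b t f d n \<gamma> \<gamma>_inf tt \<Lambda>
    using assms by unfold_locales blast+
  have carr: "carrier (iter_wreath d) = wreath_perms d" and mult: "x \<otimes>\<^bsub>iter_wreath d\<^esub> y = x \<circ> y" for x y
    by (simp_all add: iter_wreath_def)
  note ginv = iter_wreath_inv[OF d1]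
  have "\<exists>g\<in>wreath_perms d. c' i = conj_by g (\<rho> (\<gamma> i))" if i: "i \<in> {1..n}" for i
  proof -
    obtain g where g: "g \<in> wreath_perms d" "c' i = g \<otimes>\<^bsub>iter_wreath d\<^esub> c i \<otimes>\<^bsub>iter_wreath d\<^esub> inv\<^bsub>iter_wreath d\<^esub> g"
      using bspec[OF c' i] unfolding carr by blast
    show ?thesis using g(2) unfolding mult ginv[OF g(1)] bspec[OF c i] by (rule bexI[OF _ g(1)])
  qed
  from conjugate_generators[of c', OF this] obtain w u where w: "w \<in> wreath_perms d"
    and u: "\<forall>i\<in>{1..n}. u i \<in> \<rho> ` \<Gamma> \<and> conj_by w (c' i) = conj_by (u i) (\<rho> (\<gamma> i))"
    and img: "conj_by w ` top_generate (iter_wreath d) (c' ` {1..n}) = \<rho> ` \<Gamma>" by blast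
  have arb: "arb_image d K f t tt \<Lambda> = \<rho> ` \<Gamma>" by (rule arb_image_def)
  show ?thesis
    unfolding carr arb
  proof (rule bexI[OF exI[of _ u] w], intro conjI ballI)
    fix i assume i: "i \<in> {1..n}"
    show ui: "u i \<in> \<rho> ` \<Gamma>" using bspec[OF u i] ..
    then have "u i \<in> wreath_perms d" using \<rho>_wreath_perms by (elim imageE) (simp only:)
    then show "w \<otimes>\<^bsub>iter_wreath d\<^esub> c' i \<otimes>\<^bsub>iter_wreath d\<^esub> inv\<^bsub>iter_wreath d\<^esub> w
        = u i \<otimes>\<^bsub>iter_wreath d\<^esub> c i \<otimes>\<^bsub>iter_wreath d\<^esub> inv\<^bsub>iter_wreath d\<^esub> (u i)"
      using conjunct2[OF bspec[OF u i]] bspec[OF c i] w by (simp only: mult ginv)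
  next
    show "(\<lambda>g. w \<otimes>\<^bsub>iter_wreath d\<^esub> g \<otimes>\<^bsub>iter_wreath d\<^esub> inv\<^bsub>iter_wreath d\<^esub> w) `
        top_generate (iter_wreath d) (c' ` {1..n}) = \<rho> ` \<Gamma>"
      using img unfolding mult ginv[OF w] .
  qed
qed

end
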